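(* Let $d\ge2$ be an integer, let $\mathscr{M}=\bigotimes_{k=1}^\infty\mathbb{M}_d$, let $0<p<\infty$, and let $b=(b_k)_{k\ge1}$ be a noncommutative martingale with respect to the filtration $(\mathscr{M}_k)_{k\ge1}$. Then $\pi_b\in S_p(L_2(\mathscr{M}))$ if and only if $b\in\boldsymbol{B}_p(\mathscr{M})$. Moreover, $$\|\pi_b\|_{S_p(L_2(\mathscr{M}))}\approx_{d,p}\|b\|_{\boldsymbol{B}_p(\mathscr{M})}.$$
   Context: $\mathbb{M}_d$ is the algebra of $d\times d$ complex matrices with normalized trace $\mathrm{tr}_d=\frac1d\mathrm{Tr}$; $\mathscr{M}=\bigotimes_{k=1}^\infty(\mathbb{M}_d,\mathrm{tr}_d)$ is the infinite von Neumann algebra tensor product (the inductive limit of the algebras $(\mathbb{M}_d^{\otimes k},\mathrm{tr}_d^{\otimes k})$), equipped with the product tracial state $\tau$, and $L_p(\mathscr{M})$ is the associated noncommutative $L_p$-space, with $\|x\|_{L_p(\mathscr{M})}=\tau(|x|^p)^{1/p}$. For $n\ge1$, $\mathscr{M}_n=\mathbb{M}_d^{\otimes n}$ is embedded in $\mathscr{M}$ via $x\mapsto x\otimes1\otimes1\otimes\cdots$, and $\mathcal{E}_n$ is the trace-preserving conditional expectation of $\mathscr{M}$ onto $\mathscr{M}_n$. A martingale is a sequence $x=(x_n)_{n\ge1}\subset L_1(\mathscr{M})$ with $\mathcal{E}_n(x_{n+1})=x_n$ for every $n\ge1$; its martingale differences are $d_nx=x_n-x_{n-1}$ for $n\ge1$,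 with the convention $x_0=0$. An element $x\in L_q(\mathscr{M})$, $1\le q\le\infty$, is identified with the martingale $x_n=\mathcal{E}_n(x)$. The martingale paraproduct with symbol $b$ is $\pi_b(f)=\sum_{k=1}^\infty d_kb\cdot f_{k-1}$ for $f=(f_k)_{k\ge1}\in L_2(\mathscr{M})$. $S_p(\mathcal{H})$ denotes the Schatten $p$-class of operators on a Hilbert space $\mathcal{H}$. The martingale Besov space $\boldsymbol{B}_p(\mathscr{M})$ is the completion, with respect to $\|\cdot\|_{\boldsymbol{B}_p(\mathscr{M})}$, of the set of all $b\in\mathcal{S}(\mathscr{M})$ such that $$\|b\|_{\boldsymbol{B}_p(\mathscr{M})}=\Big(\sum_{k=1}^\infty d^{2k}\|d_kb\|_{L_p(\mathscr{M})}^p\Big)^{1/p}<\infty,$$ where $\mathcal{S}(\mathscr{M})$ is the linear span of the positive elements of $\mathscr{M}$ whose support projection has finite trace (so $\mathcal{S}(\mathscr{M})=\mathscr{M}$, as $\tau$ is finite). $A\approx_{d,p}B$ means that $A\le C_{d,p}B$ and $B\le C_{d,p}'A$ with positive constants depending only on $d$ and $p$.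
   Formalization: With f_0=0 the bound of the Besov norm by the Schatten norm fails (b_n=1 for all n gives π_b=0), so it is stated for b_1=0 only; the equivalence and the other bound hold for all b. With f_0=τ(f) instead, the full claim is proved for every b. *)

theory Defs
  imports "Jordan_Normal_Form.Schur_Decomposition" "HOL-Analysis.Analysis"
begin

section \<open>The tower of matrix algebras\<close>

text \<open>
  The n-th tensor power of the d x d matrices is \<open>carrier_mat (d ^ n) (d ^ n)\<close>; a multi-index
  is written as a number in base d, the last tensor factor being the least significant digit.
  Hence \<open>tensor_one r x\<close> is the Kronecker product of x with the r x r identity, and
  \<open>partial_trace r\<close> is the identity tensored with the normalized trace of the r x r matrices.
  The latter is the trace-preserving conditional expectation (lemmas \<open>ntr_partial_trace\<close> and
  \<open>partial_trace_bimodule\<close>).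
\<close>

definition ntr :: "complex mat \<Rightarrow> complex" where
  "ntr x = (\<Sum>i<dim_row x. x $$ (i, i)) / of_nat (dim_row x)"

definition tensor_one :: "nat \<Rightarrow> complex mat \<Rightarrow> complex mat" where
  "tensor_one r x = Matrix.mat (dim_row x * r) (dim_col x * r)
     (\<lambda>(i, j). if i mod r = j mod r then x $$ (i div r, j div r) else 0)"

definition partial_trace :: "nat \<Rightarrow> complex mat \<Rightarrow> complex mat" where
  "partial_trace r x = Matrix.mat (dim_row x div r) (dim_col x div r)
     (\<lambda>(i, j). (\<Sum>a<r. x $$ (i * r + a, j * r + a)) / of_nat r)"

text \<open>
  \<open>pos_powr A s\<close> is the power A^s of a positive semidefinite matrix, by functional calculus:
  unitary diagonalization, then the power of the eigenvalues.
\<close>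

definition pos_powr :: "complex mat \<Rightarrow> real \<Rightarrow> complex mat" where
  "pos_powr A s = (THE B. \<exists>U l. U \<in> carrier_mat (dim_row A) (dim_row A) \<and>
     mat_adjoint U * U = 1\<^sub>m (dim_row A) \<and> (\<forall>i<dim_row A. 0 \<le> l i) \<and>
     A = U * mat_diag (dim_row A) (\<lambda>i. complex_of_real (l i)) * mat_adjoint U \<and>
     B = U * mat_diag (dim_row A) (\<lambda>i. complex_of_real (l i powr s)) * mat_adjoint U)"

definition Lp_norm :: "real \<Rightarrow> complex mat \<Rightarrow> real" where
  "Lp_norm p x = Re (ntr (pos_powr (mat_adjoint x * x) (p / 2))) powr (1 / p)"

definition hs_inner :: "complex mat \<Rightarrow> complex mat \<Rightarrow> complex" where
  "hs_inner x y = ntr (mat_adjoint y * x)"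

definition L2_norm :: "complex mat \<Rightarrow> real" where
  "L2_norm x = sqrt (Re (hs_inner x x))"

text \<open>
  A martingale is given by its members for n \<open>\<ge>\<close> 1, each of them in the n-th matrix algebra (the
  range of the n-th conditional expectation); the value at 0 records the convention x_0 = 0.
\<close>

definition martingales :: "nat \<Rightarrow> (nat \<Rightarrow> complex mat) set" where
  "martingales d = {x. x 0 = 0\<^sub>m 1 1 \<and>
     (\<forall>n\<ge>1. x n \<in> carrier_mat (d ^ n) (d ^ n) \<and> partial_trace d (x (Suc n)) = x n)}"

definition mdiff :: "nat \<Rightarrow> (nat \<Rightarrow> complex mat) \<Rightarrow> nat \<Rightarrow> complex mat" where
  "mdiff d x n = x n - tensor_one d (x (n - 1))"

definition L2_Cauchy :: "nat \<Rightarrow> (nat \<Rightarrow> complex mat) \<Rightarrow> bool" where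
  "L2_Cauchy d x \<longleftrightarrow>
     (\<forall>e>0. \<exists>N\<ge>1. \<forall>n\<ge>N. \<forall>m\<ge>n. L2_norm (x m - tensor_one (d ^ (m - n)) (x n)) < e)"


section \<open>Elementary facts about the tower\<close>

lemma sum_nat_prod:
  fixes h :: "nat \<Rightarrow> 'a::comm_monoid_add"
  shows "(\<Sum>i<N * r. h i) = (\<Sum>p<N. \<Sum>a<r. h (p * r + a))"
proof -
  have "(\<Sum>i<N * r. h i) = (\<Sum>p<N. sum h {p * r..<p * r + r})"
    by (simp add: sum.nat_group)
  also have "\<dots> = (\<Sum>p<N. \<Sum>a<r. h (p * r + a))"
  proof (rule sum.cong, rule refl)
    fix p
    have "sum h {0 + p * r..<r + p * r} = (\<Sum>a = 0..<r. h (a + p * r))"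
      by (rule sum.shift_bounds_nat_ivl)
    then show "sum h {p * r..<p * r + r} = (\<Sum>a<r. h (p * r + a))"
      by (simp add: add.commute atLeast0LessThan)
  qed
  finally show ?thesis .
qed

lemma less_prod_index: "p < N \<Longrightarrow> a < r \<Longrightarrow> p * r + a < N * (r::nat)"
proof -
  assume "p < N" "a < r"
  then have "p * r + a < Suc p * r" by simp
  also have "\<dots> \<le> N * r" using \<open>p < N\<close> by (intro mult_le_mono1) simp
  finally show ?thesis .
qed

lemma div_prod_index: "i < N * r \<Longrightarrow> i div r < (N::nat)"
  by (simp add: less_mult_imp_div_less)

lemma mat_adjoint_carrier [simp]:
  "x \<in> carrier_mat n m \<Longrightarrow> mat_adjoint x \<in> carrier_mat m n"
  by (auto simp: mat_adjoint_def)

lemma mat_adjoint_index: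
  "x \<in> carrier_mat n m \<Longrightarrow> i < m \<Longrightarrow> j < n \<Longrightarrow> mat_adjoint x $$ (i, j) = cnj (x $$ (j, i))"
  by (auto simp: mat_adjoint_def mat_of_rows_def)

lemma tensor_one_carrier [simp]:
  "x \<in> carrier_mat N N \<Longrightarrow> tensor_one r x \<in> carrier_mat (N * r) (N * r)"
  by (auto simp: tensor_one_def)

lemma partial_trace_carrier [simp]:
  "r > 0 \<Longrightarrow> x \<in> carrier_mat (N * r) (N * r) \<Longrightarrow> partial_trace r x \<in> carrier_mat N N"
  by (auto simp: partial_trace_def)

lemma partial_trace_index:
  "r > 0 \<Longrightarrow> x \<in> carrier_mat (N * r) (N * r) \<Longrightarrow> i < N \<Longrightarrow> j < N \<Longrightarrow>
   partial_trace r x $$ (i, j) = (\<Sum>a<r. x $$ (i * r + a, j * r + a)) / of_nat r"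
  by (auto simp: partial_trace_def)

lemma tensor_one_index:
  "x \<in> carrier_mat N N \<Longrightarrow> p < N \<Longrightarrow> q < N \<Longrightarrow> a < r \<Longrightarrow> b < r \<Longrightarrow>
   tensor_one r x $$ (p * r + a, q * r + b) = (if a = b then x $$ (p, q) else 0)"
  by (auto simp: tensor_one_def less_prod_index)

lemma tensor_one_1 [simp]: "x \<in> carrier_mat N N \<Longrightarrow> tensor_one 1 x = x"
  by (auto simp: tensor_one_def intro!: eq_matI)

lemma partial_trace_1 [simp]: "x \<in> carrier_mat N N \<Longrightarrow> partial_trace 1 x = x"
  by (auto simp: partial_trace_def intro!: eq_matI)

lemma eq_mat_prodI:
  assumes "x \<in> carrier_mat (N * r) (N * r)" "y \<in> carrier_mat (N * r) (N * r)" "r > 0"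
    and "\<And>p q a b. p < N \<Longrightarrow> q < N \<Longrightarrow> a < r \<Longrightarrow> b < r \<Longrightarrow>
      x $$ (p * r + a, q * r + b) = y $$ (p * r + a, q * r + b)"
  shows "x = y"
proof (rule eq_matI)
  fix i j assume "i < dim_row y" "j < dim_col y"
  then have ij: "i < N * r" "j < N * r" using assms by auto
  have "x $$ (i div r * r + i mod r, j div r * r + j mod r)
      = y $$ (i div r * r + i mod r, j div r * r + j mod r)"
    by (rule assms(4)) (use ij assms(3) in \<open>auto intro: div_prod_index\<close>)
  then show "x $$ (i, j) = y $$ (i, j)" by simp
qed (use assms in auto)

lemma tensor_one_tensor_one:
  assumes "x \<in> carrier_mat N N" "r > 0" "s > 0"
  shows "tensor_one r (tensor_one s x) = tensor_one (s * r) x"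
proof (rule eq_mat_prodI[where N = "N * s" and r = r])
  fix p q a b assume pq: "p < N * s" "q < N * s" "a < r" "b < r"
  have eq: "p * r + a = (p div s) * (s * r) + (p mod s * r + a)" for p a
    using div_mult_mod_eq[of p s] by (metis add.assoc add_mult_distrib mult.assoc)
  have lt: "p mod s * r + a < s * r" if "a < r" for p a
    using that assms(3) by (auto intro: less_prod_index)
  have inj: "(p mod s * r + a = q mod s * r + b) \<longleftrightarrow> (p mod s = q mod s \<and> a = b)"
  proof
    assume "p mod s * r + a = q mod s * r + b"
    then have "(p mod s * r + a) div r = (q mod s * r + b) div r"
      "(p mod s * r + a) mod r = (q mod s * r + b) mod r" by auto
    then show "p mod s = q mod s \<and> a = b" using pq by simp
  qed auto
  have "tensor_one (s * r) x $$ (p * r + a, q * r + b) =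
    (if p mod s * r + a = q mod s * r + b then x $$ (p div s, q div s) else 0)"
    by (subst (1 2) eq, rule tensor_one_index) (use assms pq lt in \<open>auto intro: div_prod_index\<close>)
  moreover have "tensor_one r (tensor_one s x) $$ (p * r + a, q * r + b) =
     (if a = b then tensor_one s x $$ (p, q) else 0)"
    by (rule tensor_one_index) (use assms pq in auto)
  moreover have "tensor_one s x $$ (p, q) = (if p mod s = q mod s then x $$ (p div s, q div s) else 0)"
    using assms pq by (auto simp: tensor_one_def)
  ultimately show "tensor_one r (tensor_one s x) $$ (p * r + a, q * r + b) =
     tensor_one (s * r) x $$ (p * r + a, q * r + b)"
    unfolding inj by auto
qed (use assms tensor_one_carrier[OF tensor_one_carrier[OF assms(1), of s], of r]
      tensor_one_carrier[OF assms(1), of "s * r"] in \<open>auto simp: mult.assoc\<close>)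

lemma partial_trace_tensor_one:
  assumes "x \<in> carrier_mat N N" "r > 0"
  shows "partial_trace r (tensor_one r x) = x"
proof (rule eq_matI)
  fix i j assume "i < dim_row x" "j < dim_col x"
  then have "i < N" "j < N" using assms by auto
  then show "partial_trace r (tensor_one r x) $$ (i, j) = x $$ (i, j)"
    using assms by (simp add: partial_trace_index[where N = N] tensor_one_index[where N = N])
qed (use assms carrier_matD[OF partial_trace_carrier[OF assms(2) tensor_one_carrier[OF assms(1), of r]]] in simp_all)

lemma partial_trace_partial_trace:
  assumes "x \<in> carrier_mat (N * s * r) (N * s * r)" "r > 0" "s > 0"
  shows "partial_trace s (partial_trace r x) = partial_trace (s * r) x"
proof (rule eq_matI)
  have x': "x \<in> carrier_mat (N * (s * r)) (N * (s * r))" using assms by (simp add: mult.assoc)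
  have c: "partial_trace r x \<in> carrier_mat (N * s) (N * s)" using assms by simp
  have c2: "partial_trace s (partial_trace r x) \<in> carrier_mat N N"
    using assms c by (intro partial_trace_carrier)
  have c3: "partial_trace (s * r) x \<in> carrier_mat N N"
    using assms x' by (intro partial_trace_carrier) auto
  show "dim_row (partial_trace s (partial_trace r x)) = dim_row (partial_trace (s * r) x)"
    "dim_col (partial_trace s (partial_trace r x)) = dim_col (partial_trace (s * r) x)"
    using c2 c3 by auto
  fix i j assume "i < dim_row (partial_trace (s * r) x)" "j < dim_col (partial_trace (s * r) x)"
  then have ij: "i < N" "j < N" using c3 by auto
  have "partial_trace s (partial_trace r x) $$ (i, j)
     = (\<Sum>b<s. partial_trace r x $$ (i * s + b, j * s + b)) / of_nat s"
    using ij c assms by (intro partial_trace_index)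
  also have "\<dots> = (\<Sum>b<s. (\<Sum>a<r. x $$ ((i * s + b) * r + a, (j * s + b) * r + a)) / of_nat r) / of_nat s"
    using ij assms less_prod_index
    by (intro arg_cong2[where f = "(/)"] sum.cong refl partial_trace_index[where N = "N * s"]) auto
  also have "\<dots> = (\<Sum>b<s. \<Sum>a<r. x $$ (i * (s * r) + (b * r + a), j * (s * r) + (b * r + a))) / of_nat (s * r)"
    by (simp add: sum_divide_distrib algebra_simps)
  also have "\<dots> = partial_trace (s * r) x $$ (i, j)"
    using ij x' assms by (subst partial_trace_index[where N = N]) (auto simp: sum_nat_prod)
  finally show "partial_trace s (partial_trace r x) $$ (i, j) = partial_trace (s * r) x $$ (i, j)" .
qed

lemma ntr_partial_trace:
  assumes "x \<in> carrier_mat (N * r) (N * r)" "r > 0"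
  shows "ntr (partial_trace r x) = ntr x"
proof -
  have "ntr (partial_trace r x) = (\<Sum>i<N. (\<Sum>a<r. x $$ (i * r + a, i * r + a)) / of_nat r) / of_nat N"
    unfolding ntr_def carrier_matD[OF partial_trace_carrier[OF assms(2,1)]]
    using assms by (auto intro!: arg_cong2[where f = "(/)"] sum.cong partial_trace_index)
  also have "\<dots> = ntr x"
    using assms by (auto simp: ntr_def sum_nat_prod sum_divide_distrib mult.commute)
  finally show ?thesis .
qed

lemma mat_mult_index:
  "x \<in> carrier_mat n k \<Longrightarrow> y \<in> carrier_mat k m \<Longrightarrow> i < n \<Longrightarrow> j < m \<Longrightarrow>
   (x * y) $$ (i, j) = (\<Sum>l<k. x $$ (i, l) * y $$ (l, j))"
  by (auto simp: scalar_prod_def atLeast0LessThan)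

lemma partial_trace_bimodule:
  assumes "x \<in> carrier_mat (N * r) (N * r)" "y \<in> carrier_mat N N" "z \<in> carrier_mat N N" "r > 0"
  shows "partial_trace r (tensor_one r y * x * tensor_one r z) = y * partial_trace r x * z"
proof -
  have ty: "tensor_one r y \<in> carrier_mat (N * r) (N * r)"
    and tz: "tensor_one r z \<in> carrier_mat (N * r) (N * r)" using assms by auto
  have px: "partial_trace r x \<in> carrier_mat N N" using assms by auto
  have tyx: "tensor_one r y * x \<in> carrier_mat (N * r) (N * r)" by (rule mult_carrier_mat[OF ty assms(1)])
  have l: "partial_trace r (tensor_one r y * x) = y * partial_trace r x"
    if x: "x \<in> carrier_mat (N * r) (N * r)" for x
  proof (rule eq_matI)
    have c: "tensor_one r y * x \<in> carrier_mat (N * r) (N * r)" by (rule mult_carrier_mat[OF ty x])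
    have px: "partial_trace r x \<in> carrier_mat N N" using x assms by simp
    fix i j assume "i < dim_row (y * partial_trace r x)" "j < dim_col (y * partial_trace r x)"
    then have ij: "i < N" "j < N" using assms px by auto
    have ent: "(tensor_one r y * x) $$ (i * r + a, j * r + a) =
      (\<Sum>p<N. y $$ (i, p) * x $$ (p * r + a, j * r + a))" if "a < r" for a
    proof -
      have "(tensor_one r y * x) $$ (i * r + a, j * r + a) =
        (\<Sum>l<N * r. tensor_one r y $$ (i * r + a, l) * x $$ (l, j * r + a))"
        by (rule mat_mult_index[OF ty x]) (use ij that less_prod_index in auto)
      also have "\<dots> = (\<Sum>p<N. \<Sum>b<r. (if a = b then y $$ (i, p) else 0) * x $$ (p * r + b, j * r + a))"
        unfolding sum_nat_prod
        by (intro sum.cong refl) (use ij that assms in \<open>auto simp: tensor_one_index[where N = N]\<close>)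
      also have "\<dots> = (\<Sum>p<N. y $$ (i, p) * x $$ (p * r + a, j * r + a))"
        using that by (simp add: if_distrib[of "\<lambda>c. c * _"] sum.delta cong: if_cong)
      finally show ?thesis .
    qed
    have "partial_trace r (tensor_one r y * x) $$ (i, j) =
      (\<Sum>a<r. \<Sum>p<N. y $$ (i, p) * x $$ (p * r + a, j * r + a)) / of_nat r"
      by (subst partial_trace_index[OF assms(4) c ij]) (simp add: ent)
    also have "\<dots> = (\<Sum>p<N. y $$ (i, p) * ((\<Sum>a<r. x $$ (p * r + a, j * r + a)) / of_nat r))"
      by (subst sum.swap) (simp add: sum_divide_distrib sum_distrib_left)
    also have "\<dots> = (\<Sum>p<N. y $$ (i, p) * partial_trace r x $$ (p, j))"
      using ij x assms by (auto intro!: sum.cong simp: partial_trace_index[where N = N])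
    also have "\<dots> = (y * partial_trace r x) $$ (i, j)"
      by (rule mat_mult_index[OF assms(2) px ij, symmetric])
    finally show "partial_trace r (tensor_one r y * x) $$ (i, j) = (y * partial_trace r x) $$ (i, j)" .
  qed (use carrier_matD[OF partial_trace_carrier[OF assms(4) mult_carrier_mat[OF ty x]]]
      carrier_matD[OF mult_carrier_mat[OF assms(2) partial_trace_carrier[OF assms(4) x]]] in simp_all)
  have rr: "partial_trace r (x * tensor_one r z) = partial_trace r x * z"
    if x: "x \<in> carrier_mat (N * r) (N * r)" for x
  proof (rule eq_matI)
    have c: "x * tensor_one r z \<in> carrier_mat (N * r) (N * r)" by (rule mult_carrier_mat[OF x tz])
    have px: "partial_trace r x \<in> carrier_mat N N" using x assms by simp
    fix i j assume "i < dim_row (partial_trace r x * z)" "j < dim_col (partial_trace r x * z)"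
    then have ij: "i < N" "j < N" using assms px by auto
    have ent: "(x * tensor_one r z) $$ (i * r + a, j * r + a) =
      (\<Sum>p<N. x $$ (i * r + a, p * r + a) * z $$ (p, j))" if "a < r" for a
    proof -
      have "(x * tensor_one r z) $$ (i * r + a, j * r + a) =
        (\<Sum>l<N * r. x $$ (i * r + a, l) * tensor_one r z $$ (l, j * r + a))"
        by (rule mat_mult_index[OF x tz]) (use ij that less_prod_index in auto)
      also have "\<dots> = (\<Sum>p<N. \<Sum>b<r. x $$ (i * r + a, p * r + b) * (if b = a then z $$ (p, j) else 0))"
        unfolding sum_nat_prod
        by (intro sum.cong refl) (use ij that assms in \<open>auto simp: tensor_one_index[where N = N]\<close>)
      also have "\<dots> = (\<Sum>p<N. x $$ (i * r + a, p * r + a) * z $$ (p, j))"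
        using that by (simp add: if_distrib[of "\<lambda>c. _ * c"] sum.delta cong: if_cong)
      finally show ?thesis .
    qed
    have "partial_trace r (x * tensor_one r z) $$ (i, j) =
      (\<Sum>a<r. \<Sum>p<N. x $$ (i * r + a, p * r + a) * z $$ (p, j)) / of_nat r"
      by (subst partial_trace_index[OF assms(4) c ij]) (simp add: ent)
    also have "\<dots> = (\<Sum>p<N. ((\<Sum>a<r. x $$ (i * r + a, p * r + a)) / of_nat r) * z $$ (p, j))"
      by (subst sum.swap) (simp add: sum_divide_distrib sum_distrib_right)
    also have "\<dots> = (\<Sum>p<N. partial_trace r x $$ (i, p) * z $$ (p, j))"
      using ij x assms by (auto intro!: sum.cong simp: partial_trace_index[where N = N])
    also have "\<dots> = (partial_trace r x * z) $$ (i, j)"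
      by (rule mat_mult_index[OF px assms(3) ij, symmetric])
    finally show "partial_trace r (x * tensor_one r z) $$ (i, j) = (partial_trace r x * z) $$ (i, j)" .
  qed (use carrier_matD[OF partial_trace_carrier[OF assms(4) mult_carrier_mat[OF x tz]]]
      carrier_matD[OF mult_carrier_mat[OF partial_trace_carrier[OF assms(4) x] assms(3)]] in simp_all)
  show ?thesis using rr[OF tyx] l[OF assms(1)] by simp
qed

lemma hs_inner_sum:
  assumes "x \<in> carrier_mat N N" "y \<in> carrier_mat N N"
  shows "hs_inner x y = (\<Sum>i<N. \<Sum>j<N. x $$ (i, j) * cnj (y $$ (i, j))) / of_nat N"
proof -
  have c: "mat_adjoint y * x \<in> carrier_mat N N" using assms by (intro mult_carrier_mat mat_adjoint_carrier)
  have "hs_inner x y = (\<Sum>i<N. \<Sum>j<N. cnj (y $$ (j, i)) * x $$ (j, i)) / of_nat N"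
    unfolding hs_inner_def ntr_def carrier_matD(1)[OF c]
  proof (intro arg_cong2[where f = "(/)"] sum.cong refl)
    fix i assume "i \<in> {..<N}"
    then have i: "i < N" by simp
    show "(mat_adjoint y * x) $$ (i, i) = (\<Sum>j<N. cnj (y $$ (j, i)) * x $$ (j, i))"
      unfolding mat_mult_index[OF mat_adjoint_carrier[OF assms(2)] assms(1) i i]
      using i by (intro sum.cong refl) (simp add: mat_adjoint_index[OF assms(2)])
  qed
  also have "(\<Sum>i<N. \<Sum>j<N. cnj (y $$ (j, i)) * x $$ (j, i)) = (\<Sum>i<N. \<Sum>j<N. x $$ (i, j) * cnj (y $$ (i, j)))"
    by (subst sum.swap) (simp add: mult.commute)
  finally show ?thesis .
qed

lemma hs_inner_tensor_one:
  assumes "z \<in> carrier_mat (N * r) (N * r)" "x \<in> carrier_mat N N" "r > 0"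
  shows "hs_inner z (tensor_one r x) = hs_inner (partial_trace r z) x"
proof -
  have "(\<Sum>i<N * r. \<Sum>j<N * r. z $$ (i, j) * cnj (tensor_one r x $$ (i, j)))
    = (\<Sum>p<N. \<Sum>a<r. \<Sum>q<N. \<Sum>b<r. z $$ (p * r + a, q * r + b) * (if a = b then cnj (x $$ (p, q)) else 0))"
    unfolding sum_nat_prod by (intro sum.cong refl) (use assms in \<open>auto simp: tensor_one_index[where N = N]\<close>)
  also have "\<dots> = (\<Sum>p<N. \<Sum>a<r. \<Sum>q<N. z $$ (p * r + a, q * r + a) * cnj (x $$ (p, q)))"
    by (simp add: if_distrib[of "\<lambda>c. _ * c"] sum.delta cong: if_cong)
  also have "\<dots> = (\<Sum>p<N. \<Sum>q<N. (\<Sum>a<r. z $$ (p * r + a, q * r + a)) * cnj (x $$ (p, q)))"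
    by (subst sum.swap) (simp add: sum_distrib_right)
  also have "\<dots> = (\<Sum>p<N. \<Sum>q<N. of_nat r * (partial_trace r z $$ (p, q) * cnj (x $$ (p, q))))"
    using assms by (auto intro!: sum.cong simp: partial_trace_index[where N = N])
  finally show ?thesis
    using assms hs_inner_sum[OF assms(1) tensor_one_carrier[OF assms(2), of r]]
      hs_inner_sum[OF partial_trace_carrier[OF assms(3,1)] assms(2)]
    by (simp add: sum_distrib_left[symmetric])
qed

abbreviation sqn :: "complex mat \<Rightarrow> real" where
  "sqn x \<equiv> Re (hs_inner x x)"

lemma sqn_sum:
  assumes "x \<in> carrier_mat N N"
  shows "sqn x = (\<Sum>i<N. \<Sum>j<N. (cmod (x $$ (i, j)))\<^sup>2) / real N"
proof -
  have "(\<Sum>i<N. \<Sum>j<N. x $$ (i, j) * cnj (x $$ (i, j)))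
      = complex_of_real (\<Sum>i<N. \<Sum>j<N. (cmod (x $$ (i, j)))\<^sup>2)"
    by (simp only: of_real_sum complex_norm_square)
  then have "hs_inner x x = complex_of_real ((\<Sum>i<N. \<Sum>j<N. (cmod (x $$ (i, j)))\<^sup>2) / real N)"
    using hs_inner_sum[OF assms assms] by simp
  then show ?thesis by (simp only: Re_complex_of_real)
qed

lemma sqn_nonneg: "x \<in> carrier_mat N N \<Longrightarrow> 0 \<le> sqn x"
  by (subst sqn_sum, assumption) (intro divide_nonneg_nonneg sum_nonneg, auto)

lemma Re_hs_inner_sum:
  assumes "x \<in> carrier_mat N N" "y \<in> carrier_mat N N"
  shows "Re (hs_inner x y) = (\<Sum>i<N. \<Sum>j<N. inner (x $$ (i, j)) (y $$ (i, j))) / real N"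
proof -
  have "Re (hs_inner x y) = Re (\<Sum>i<N. \<Sum>j<N. x $$ (i, j) * cnj (y $$ (i, j))) / real N"
    by (simp only: hs_inner_sum[OF assms] Re_divide_of_nat)
  then show ?thesis by (simp add: inner_complex_def)
qed

lemma entry_le_sqn:
  assumes "x \<in> carrier_mat N N" "i < N" "j < N"
  shows "(cmod (x $$ (i, j)))\<^sup>2 \<le> real N * sqn x"
proof -
  have "(cmod (x $$ (i, j)))\<^sup>2 \<le> (\<Sum>j<N. (cmod (x $$ (i, j)))\<^sup>2)"
    using assms by (intro member_le_sum[of j "{..<N}" "\<lambda>j. (cmod (x $$ (i, j)))\<^sup>2"]) auto
  also have "\<dots> \<le> (\<Sum>i<N. \<Sum>j<N. (cmod (x $$ (i, j)))\<^sup>2)"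
    using assms by (intro member_le_sum[of i "{..<N}" "\<lambda>i. \<Sum>j<N. (cmod (x $$ (i, j)))\<^sup>2"])
      (auto intro: sum_nonneg)
  also have "\<dots> = real N * sqn x" using assms sqn_sum[OF assms(1)] by simp
  finally show ?thesis .
qed

lemma Re_hs_inner_polar:
  assumes "x \<in> carrier_mat N N" "y \<in> carrier_mat N N"
  shows "sqn (x + y) = sqn x + sqn y + 2 * Re (hs_inner x y)"
    "sqn (x - y) = sqn x + sqn y - 2 * Re (hs_inner x y)"
proof -
  have e: "(cmod (a + b))\<^sup>2 = (cmod a)\<^sup>2 + (cmod b)\<^sup>2 + 2 * inner a b"
    "(cmod (a - b))\<^sup>2 = (cmod a)\<^sup>2 + (cmod b)\<^sup>2 - 2 * inner a b" for a b
    by (simp_all add: power2_norm_eq_inner inner_add inner_diff inner_commute)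
  have "sqn (x + y) = (\<Sum>i<N. \<Sum>j<N. (cmod (x $$ (i, j) + y $$ (i, j)))\<^sup>2) / real N"
    using assms by (subst sqn_sum[where N = N]) auto
  then show "sqn (x + y) = sqn x + sqn y + 2 * Re (hs_inner x y)"
    by (simp add: e sqn_sum[OF assms(1)] sqn_sum[OF assms(2)] Re_hs_inner_sum[OF assms]
       sum.distrib sum_distrib_left add_divide_distrib)
  have "sqn (x - y) = (\<Sum>i<N. \<Sum>j<N. (cmod (x $$ (i, j) - y $$ (i, j)))\<^sup>2) / real N"
    using assms by (subst sqn_sum[where N = N]) auto
  then show "sqn (x - y) = sqn x + sqn y - 2 * Re (hs_inner x y)"
    by (simp add: e sqn_sum[OF assms(1)] sqn_sum[OF assms(2)] Re_hs_inner_sum[OF assms]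
       sum.distrib sum_subtractf sum_distrib_left add_divide_distrib diff_divide_distrib)
qed

lemma sqn_add_le:
  assumes "x \<in> carrier_mat N N" "y \<in> carrier_mat N N"
  shows "sqn (x + y) \<le> 2 * sqn x + 2 * sqn y"
proof -
  have "0 \<le> sqn (x - y)" using assms by (intro sqn_nonneg[of _ N]) auto
  then show ?thesis using Re_hs_inner_polar[OF assms] by simp
qed

lemma sqn_smult:
  assumes "x \<in> carrier_mat N N"
  shows "sqn (c \<cdot>\<^sub>m x) = (cmod c)\<^sup>2 * sqn x"
proof -
  have "sqn (c \<cdot>\<^sub>m x) = (\<Sum>i<N. \<Sum>j<N. (cmod (c * x $$ (i, j)))\<^sup>2) / real N"
    using assms by (subst sqn_sum[where N = N]) auto
  then show ?thesis
    by (simp add: sqn_sum[OF assms] norm_mult power_mult_distrib sum_distrib_left[symmetric])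
qed

lemma sqn_tensor_one:
  assumes "x \<in> carrier_mat N N" "r > 0"
  shows "sqn (tensor_one r x) = sqn x"
  using hs_inner_tensor_one[OF tensor_one_carrier[OF assms(1)] assms]
  by (simp add: partial_trace_tensor_one[OF assms])


section \<open>Square-integrable martingales\<close>

lemma martingales_carrier:
  "x \<in> martingales d \<Longrightarrow> x n \<in> carrier_mat (d ^ n) (d ^ n)"
  by (cases "n = 0") (auto simp: martingales_def)

lemma martingale_steps:
  assumes "x \<in> martingales d" "d > 0" "n \<ge> 1"
  shows "partial_trace (d ^ k) (x (n + k)) = x n"
proof (induction k)
  case 0
  then show ?case using partial_trace_1[OF martingales_carrier[OF assms(1), of n]] by simp
next
  case (Suc k)
  have c: "x (n + Suc k) \<in> carrier_mat (d ^ n * d ^ k * d) (d ^ n * d ^ k * d)"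
    using martingales_carrier[OF assms(1), of "n + Suc k"] by (simp add: power_add mult.commute mult.left_commute)
  have "partial_trace (d ^ Suc k) (x (n + Suc k)) = partial_trace (d ^ k) (partial_trace d (x (n + Suc k)))"
    using partial_trace_partial_trace[OF c] assms(2) by (simp add: mult.commute)
  also have "partial_trace d (x (n + Suc k)) = x (n + k)"
    using assms by (auto simp: martingales_def)
  finally show ?case using Suc by simp
qed

lemma martingale_steps':
  assumes "x \<in> martingales d" "d > 0" "n \<ge> 1" "n \<le> m"
  shows "partial_trace (d ^ (m - n)) (x m) = x n"
  using martingale_steps[OF assms(1-3), of "m - n"] assms(4) by simp

lemma martingale_increment:
  assumes "x \<in> martingales d" "d > 0" "n \<ge> 1" "n \<le> m"
  shows "sqn (x m - tensor_one (d ^ (m - n)) (x n)) = sqn (x m) - sqn (x n)"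
proof -
  have e: "d ^ m = d ^ n * d ^ (m - n)" using assms by (simp flip: power_add)
  have cm: "x m \<in> carrier_mat (d ^ n * d ^ (m - n)) (d ^ n * d ^ (m - n))"
    using martingales_carrier[OF assms(1), of m] e by simp
  note cn = martingales_carrier[OF assms(1), of n]
  have t: "tensor_one (d ^ (m - n)) (x n) \<in> carrier_mat (d ^ n * d ^ (m - n)) (d ^ n * d ^ (m - n))"
    using cn by simp
  have "hs_inner (x m) (tensor_one (d ^ (m - n)) (x n)) = hs_inner (x n) (x n)"
    using hs_inner_tensor_one[OF cm cn] assms martingale_steps'[OF assms] by simp
  then show ?thesis
    using Re_hs_inner_polar(2)[OF cm t] sqn_tensor_one[OF cn, of "d ^ (m - n)"] assms by simp
qed

lemma martingale_sqn_mono: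
  assumes "x \<in> martingales d" "d > 0" "n \<ge> 1" "n \<le> m"
  shows "sqn (x n) \<le> sqn (x m)"
proof -
  have e: "d ^ m = d ^ n * d ^ (m - n)" using assms by (simp flip: power_add)
  have "tensor_one (d ^ (m - n)) (x n) \<in> carrier_mat (d ^ m) (d ^ m)"
    unfolding e using martingales_carrier[OF assms(1), of n] by simp
  then have "x m - tensor_one (d ^ (m - n)) (x n) \<in> carrier_mat (d ^ m) (d ^ m)"
    using martingales_carrier[OF assms(1), of m] by auto
  from sqn_nonneg[OF this] show ?thesis using martingale_increment[OF assms] by simp
qed

lemma martingale_sqn_convergent:
  assumes "x \<in> martingales d" "d > 0" "\<And>n. n \<ge> 1 \<Longrightarrow> sqn (x n) \<le> B"
  shows "convergent (\<lambda>n. sqn (x n))"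
proof -
  have "incseq (\<lambda>n. sqn (x (Suc n)))"
    using martingale_sqn_mono[OF assms(1,2)] by (auto simp: incseq_def)
  moreover have "\<forall>n. sqn (x (Suc n)) \<le> B" using assms(3) by simp
  ultimately obtain L where "(\<lambda>n. sqn (x (Suc n))) \<longlonglongrightarrow> L"
    by (rule incseq_convergent)
  then have "(\<lambda>n. sqn (x n)) \<longlonglongrightarrow> L" by (rule LIMSEQ_imp_Suc)
  then show ?thesis by (rule convergentI)
qed

lemma L2_Cauchy_iff_bounded:
  assumes "x \<in> martingales d" "d > 0"
  shows "L2_Cauchy d x \<longleftrightarrow> (\<exists>B. \<forall>n\<ge>1. sqn (x n) \<le> B)"
proof
  assume "L2_Cauchy d x"
  then have "\<exists>N\<ge>1. \<forall>n\<ge>N. \<forall>m\<ge>n. L2_norm (x m - tensor_one (d ^ (m - n)) (x n)) < 1"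
    unfolding L2_Cauchy_def by (elim allE[of _ 1] impE) simp_all
  then obtain N where N: "N \<ge> 1" "\<And>n m. n \<ge> N \<Longrightarrow> m \<ge> n \<Longrightarrow>
      L2_norm (x m - tensor_one (d ^ (m - n)) (x n)) < 1"
    by auto
  have "sqn (x n) \<le> sqn (x N) + 1" if "n \<ge> 1" for n
  proof (cases "n \<ge> N")
    case True
    have "sqrt (sqn (x n) - sqn (x N)) < 1"
      using N(2)[OF le_refl True] martingale_increment[OF assms N(1) True] by (simp add: L2_norm_def)
    then show ?thesis by simp
  next
    case False
    then show ?thesis using martingale_sqn_mono[OF assms that, of N] by simp
  qed
  then show "\<exists>B. \<forall>n\<ge>1. sqn (x n) \<le> B" by blast
next
  assume "\<exists>B. \<forall>n\<ge>1. sqn (x n) \<le> B"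
  then obtain B where "\<And>n. n \<ge> 1 \<Longrightarrow> sqn (x n) \<le> B" by auto
  then have "convergent (\<lambda>n. sqn (x n))" by (rule martingale_sqn_convergent[OF assms])
  then have C: "Cauchy (\<lambda>n. sqn (x n))" by (rule convergent_Cauchy)
  show "L2_Cauchy d x" unfolding L2_Cauchy_def
  proof (intro allI impI)
    fix e :: real assume e: "e > 0"
    then obtain N where N: "\<And>m n. m \<ge> N \<Longrightarrow> n \<ge> N \<Longrightarrow> dist (sqn (x m)) (sqn (x n)) < e\<^sup>2"
      using metric_CauchyD[OF C, of "e\<^sup>2"] by auto
    show "\<exists>N\<ge>1. \<forall>n\<ge>N. \<forall>m\<ge>n. L2_norm (x m - tensor_one (d ^ (m - n)) (x n)) < e"
    proof (intro exI[of _ "max 1 N"] conjI allI impI)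
      fix n m assume nm: "n \<ge> max 1 N" "m \<ge> n"
      then have "sqn (x m) - sqn (x n) < e\<^sup>2" using N[of m n] by (auto simp: dist_real_def)
      then have "sqrt (sqn (x m) - sqn (x n)) < e" using e by (simp add: real_less_lsqrt)
      then show "L2_norm (x m - tensor_one (d ^ (m - n)) (x n)) < e"
        using martingale_increment[OF assms, of n m] nm by (simp add: L2_norm_def)
    qed auto
  qed
qed

lemma partial_trace_add:
  assumes "x \<in> carrier_mat (N * r) (N * r)" "y \<in> carrier_mat (N * r) (N * r)" "r > 0"
  shows "partial_trace r (x + y) = partial_trace r x + partial_trace r y"
  using assms less_prod_index[of _ N _ r]
  by (intro eq_matI) (auto simp: partial_trace_def sum.distrib add_divide_distrib)

lemma partial_trace_smult:
  assumes "x \<in> carrier_mat (N * r) (N * r)" "r > 0"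
  shows "partial_trace r (c \<cdot>\<^sub>m x) = c \<cdot>\<^sub>m partial_trace r x"
  using assms less_prod_index[of _ N _ r]
  by (intro eq_matI) (auto simp: partial_trace_def sum_distrib_left)

lemma martingales_add:
  assumes "x \<in> martingales d" "y \<in> martingales d" "d > 0"
  shows "(\<lambda>n. x n + y n) \<in> martingales d"
proof -
  have "partial_trace d (x (Suc n) + y (Suc n)) = x n + y n" if "n \<ge> 1" for n
    using partial_trace_add[of "x (Suc n)" "d ^ n" d "y (Suc n)"]
      martingales_carrier[OF assms(1), of "Suc n"] martingales_carrier[OF assms(2), of "Suc n"] assms that
    by (auto simp: martingales_def mult.commute)
  moreover have "x n + y n \<in> carrier_mat (d ^ n) (d ^ n)" for n
    using martingales_carrier[OF assms(1), of n] martingales_carrier[OF assms(2), of n] by simp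
  moreover have "x 0 + y 0 = 0\<^sub>m 1 1" using assms by (simp add: martingales_def)
  ultimately show ?thesis by (auto simp: martingales_def)
qed

lemma martingales_smult:
  assumes "x \<in> martingales d" "d > 0"
  shows "(\<lambda>n. c \<cdot>\<^sub>m x n) \<in> martingales d"
proof -
  have "partial_trace d (c \<cdot>\<^sub>m x (Suc n)) = c \<cdot>\<^sub>m x n" if "n \<ge> 1" for n
    using partial_trace_smult[of "x (Suc n)" "d ^ n" d c]
      martingales_carrier[OF assms(1), of "Suc n"] assms that
    by (auto simp: martingales_def mult.commute)
  moreover have "c \<cdot>\<^sub>m x n \<in> carrier_mat (d ^ n) (d ^ n)" for n
    using martingales_carrier assms by auto
  moreover have "c \<cdot>\<^sub>m x 0 = 0\<^sub>m 1 1" using assms by (auto simp: martingales_def)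
  ultimately show ?thesis by (auto simp: martingales_def)
qed

lemma L2_Cauchy_add:
  assumes "x \<in> martingales d" "y \<in> martingales d" "d > 0" "L2_Cauchy d x" "L2_Cauchy d y"
  shows "L2_Cauchy d (\<lambda>n. x n + y n)"
proof -
  obtain B B' where B: "\<forall>n\<ge>1. sqn (x n) \<le> B" and B': "\<forall>n\<ge>1. sqn (y n) \<le> B'"
    using assms(4,5) L2_Cauchy_iff_bounded[OF assms(1,3)] L2_Cauchy_iff_bounded[OF assms(2,3)] by auto
  have "sqn (x n + y n) \<le> 2 * B + 2 * B'" if "n \<ge> 1" for n
    using sqn_add_le[OF martingales_carrier[OF assms(1), of n] martingales_carrier[OF assms(2), of n]]
      B[rule_format, OF that] B'[rule_format, OF that] by linarith
  then show ?thesis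
    using L2_Cauchy_iff_bounded[OF martingales_add[OF assms(1-3)] assms(3)] by blast
qed

lemma L2_Cauchy_smult:
  assumes "x \<in> martingales d" "d > 0" "L2_Cauchy d x"
  shows "L2_Cauchy d (\<lambda>n. c \<cdot>\<^sub>m x n)"
proof -
  obtain B where B: "\<forall>n\<ge>1. sqn (x n) \<le> B"
    using assms(3) L2_Cauchy_iff_bounded[OF assms(1,2)] by auto
  have "sqn (c \<cdot>\<^sub>m x n) \<le> (cmod c)\<^sup>2 * B" if "n \<ge> 1" for n
    unfolding sqn_smult[OF martingales_carrier[OF assms(1), of n]] using B that
    by (intro mult_left_mono) auto
  then show ?thesis
    using L2_Cauchy_iff_bounded[OF martingales_smult[OF assms(1-2)] assms(2)] by blast
qed

lemma zero_martingale:
  "d > 0 \<Longrightarrow> (\<lambda>n. 0\<^sub>m (d ^ n) (d ^ n)) \<in> martingales d"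
  by (auto simp: martingales_def partial_trace_def less_prod_index mult.commute[of d] intro!: eq_matI)

lemma L2_Cauchy_zero:
  assumes "d > 0"
  shows "L2_Cauchy d (\<lambda>n. 0\<^sub>m (d ^ n) (d ^ n))"
proof -
  have "sqn (0\<^sub>m (d ^ n) (d ^ n)) \<le> 0" for n by (subst sqn_sum[of _ "d ^ n"]) auto
  then show ?thesis using L2_Cauchy_iff_bounded[OF zero_martingale[OF assms] assms] by blast
qed

section \<open>The Hilbert space of the infinite tensor product\<close>

text \<open>
  With d the cardinality of the index type, \<open>'d l2M\<close> is the completion of the union of the
  matrix algebras (modulo \<open>x \<mapsto> x \<otimes> 1\<close>) for the 2-norm of the normalized trace. An
  element f of the completion is represented by the martingale of its conditional expectations
  \<open>f\<^sub>n\<close>, which is a 2-norm Cauchy sequence with limit f. Completeness, isometry of the embeddings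
  and density of their ranges are proved below (the \<open>complete_space\<close> instance, \<open>inner_l2_embed\<close>,
  \<open>l2_embed_tendsto\<close>). The real inner product is the real part of \<open>\<tau>(g\<^sup>* f)\<close>.
\<close>

typedef 'd l2M = "{f \<in> martingales CARD('d::finite). L2_Cauchy CARD('d) f}"
  using zero_martingale[of "CARD('d)"] L2_Cauchy_zero[of "CARD('d)"] by auto

setup_lifting type_definition_l2M

lemma Rep_l2M_martingale: "Rep_l2M (f :: 'd::finite l2M) \<in> martingales CARD('d)"
  and Rep_l2M_Cauchy: "L2_Cauchy CARD('d) (Rep_l2M (f :: 'd::finite l2M))"
  using Rep_l2M[of f] by auto

lemma Rep_l2M_carrier:
  "Rep_l2M (f :: 'd::finite l2M) n \<in> carrier_mat (CARD('d) ^ n) (CARD('d) ^ n)"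
  by (rule martingales_carrier[OF Rep_l2M_martingale])

lift_definition scaleC :: "complex \<Rightarrow> 'd::finite l2M \<Rightarrow> 'd l2M" is "\<lambda>c f n. c \<cdot>\<^sub>m f n"
  by (auto intro: martingales_smult L2_Cauchy_smult)

instantiation l2M :: (finite) real_vector
begin

lift_definition zero_l2M :: "'a l2M" is "\<lambda>n. 0\<^sub>m (CARD('a) ^ n) (CARD('a) ^ n)"
  by (auto intro: zero_martingale L2_Cauchy_zero)

lift_definition plus_l2M :: "'a l2M \<Rightarrow> 'a l2M \<Rightarrow> 'a l2M" is "\<lambda>f g n. f n + g n"
  by (auto intro: martingales_add L2_Cauchy_add)

definition uminus_l2M :: "'a l2M \<Rightarrow> 'a l2M" where "uminus_l2M f = scaleC (-1) f"

definition minus_l2M :: "'a l2M \<Rightarrow> 'a l2M \<Rightarrow> 'a l2M" where "minus_l2M f g = f + (- g)"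

definition scaleR_l2M :: "real \<Rightarrow> 'a l2M \<Rightarrow> 'a l2M" where
  "scaleR_l2M r f = scaleC (complex_of_real r) f"

lemma l2M_eqI:
  fixes f g :: "'a l2M"
  assumes "\<And>n i j. i < CARD('a) ^ n \<Longrightarrow> j < CARD('a) ^ n \<Longrightarrow> Rep_l2M f n $$ (i, j) = Rep_l2M g n $$ (i, j)"
  shows "f = g"
proof -
  have "Rep_l2M f n = Rep_l2M g n" for n
    using assms Rep_l2M_carrier[of f n] Rep_l2M_carrier[of g n] by (intro eq_matI) auto
  then show ?thesis by (simp add: Rep_l2M_inject[symmetric] ext)
qed

lemma Rep_l2M_index:
  fixes f g :: "'a l2M"
  assumes "i < CARD('a) ^ n" "j < CARD('a) ^ n"
  shows "Rep_l2M (f + g) n $$ (i, j) = Rep_l2M f n $$ (i, j) + Rep_l2M g n $$ (i, j)"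
    and "Rep_l2M (0 :: 'a l2M) n $$ (i, j) = 0"
    and "Rep_l2M (scaleC c f) n $$ (i, j) = c * Rep_l2M f n $$ (i, j)"
  using assms Rep_l2M_carrier[of f n] Rep_l2M_carrier[of g n]
  by (auto simp: plus_l2M.rep_eq zero_l2M.rep_eq scaleC.rep_eq)

instance
  by standard
    (auto intro!: l2M_eqI simp: Rep_l2M_index uminus_l2M_def minus_l2M_def scaleR_l2M_def algebra_simps)

end

lemma Rep_l2M_add: "Rep_l2M (f + g) n = Rep_l2M f n + Rep_l2M g n"
  by (simp add: plus_l2M.rep_eq)

lemma Rep_l2M_scaleR: "Rep_l2M (r *\<^sub>R f) n = complex_of_real r \<cdot>\<^sub>m Rep_l2M f n"
  by (simp add: scaleR_l2M_def scaleC.rep_eq)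

lemma Rep_l2M_diff: "Rep_l2M (f - g) n = Rep_l2M f n - Rep_l2M (g :: 'd::finite l2M) n"
  using Rep_l2M_carrier[of f n] Rep_l2M_carrier[of g n]
  by (intro eq_matI) (auto simp: minus_l2M_def uminus_l2M_def plus_l2M.rep_eq scaleC.rep_eq)

lemma sqn_Rep_convergent: "convergent (\<lambda>n. sqn (Rep_l2M (f :: 'd::finite l2M) n))"
proof -
  obtain B where "\<forall>n\<ge>1. sqn (Rep_l2M f n) \<le> B"
    using L2_Cauchy_iff_bounded[OF Rep_l2M_martingale[of f]] Rep_l2M_Cauchy[of f] by auto
  then show ?thesis by (intro martingale_sqn_convergent[OF Rep_l2M_martingale[of f]]) auto
qed

lemma inner_Rep_convergent:
  "convergent (\<lambda>n. Re (hs_inner (Rep_l2M (f :: 'd::finite l2M) n) (Rep_l2M (g :: 'd l2M) n)))"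
proof -
  have "convergent (\<lambda>n. 1 / 2 * (sqn (Rep_l2M (f + g) n) - sqn (Rep_l2M f n) - sqn (Rep_l2M g n)))"
    by (intro convergent_mult convergent_diff convergent_const sqn_Rep_convergent)
  moreover have "1 / 2 * (sqn (Rep_l2M (f + g) n) - sqn (Rep_l2M f n) - sqn (Rep_l2M g n))
      = Re (hs_inner (Rep_l2M f n) (Rep_l2M g n))" for n
    using Re_hs_inner_polar(1)[OF Rep_l2M_carrier[of f n] Rep_l2M_carrier[of g n]]
    by (simp add: Rep_l2M_add)
  ultimately show ?thesis by simp
qed

instantiation l2M :: (finite) real_inner
begin

definition inner_l2M :: "'a l2M \<Rightarrow> 'a l2M \<Rightarrow> real" where
  "inner_l2M f g = lim (\<lambda>n. Re (hs_inner (Rep_l2M f n) (Rep_l2M g n)))"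

definition norm_l2M :: "'a l2M \<Rightarrow> real" where "norm_l2M f = sqrt (inner f f)"

definition dist_l2M :: "'a l2M \<Rightarrow> 'a l2M \<Rightarrow> real" where "dist_l2M f g = norm (f - g)"

definition sgn_l2M :: "'a l2M \<Rightarrow> 'a l2M" where "sgn_l2M f = inverse (norm f) *\<^sub>R f"

definition uniformity_l2M :: "('a l2M \<times> 'a l2M) filter" where
  "uniformity_l2M = (INF e\<in>{0<..}. principal {(x, y). dist x y < e})"

definition open_l2M :: "'a l2M set \<Rightarrow> bool" where
  "open_l2M U = (\<forall>x\<in>U. eventually (\<lambda>(x', y). x' = x \<longrightarrow> y \<in> U) uniformity)"

lemma inner_l2M_LIMSEQ:
  "(\<lambda>n. Re (hs_inner (Rep_l2M f n) (Rep_l2M (g :: 'a l2M) n))) \<longlonglongrightarrow> inner f g"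
  unfolding inner_l2M_def using inner_Rep_convergent convergent_LIMSEQ_iff by blast

lemma sqn_le_inner:
  assumes "n \<ge> 1"
  shows "sqn (Rep_l2M (f :: 'a l2M) n) \<le> inner f f"
proof (rule LIMSEQ_le_const[OF inner_l2M_LIMSEQ])
  show "\<exists>N. \<forall>m\<ge>N. sqn (Rep_l2M f n) \<le> sqn (Rep_l2M f m)"
    using martingale_sqn_mono[OF Rep_l2M_martingale[of f] _ assms] by auto
qed

instance
proof
  fix x y z :: "'a l2M" and r :: real and U :: "'a l2M set"
  show "dist x y = norm (x - y)" "sgn x = inverse (norm x) *\<^sub>R x" "norm x = sqrt (inner x x)"
    "(uniformity :: ('a l2M \<times> 'a l2M) filter) = (INF e\<in>{0<..}. principal {(x, y). dist x y < e})"
    "open U = (\<forall>x\<in>U. eventually (\<lambda>(x', y). x' = x \<longrightarrow> y \<in> U) uniformity)"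
    by (simp_all add: dist_l2M_def sgn_l2M_def norm_l2M_def uniformity_l2M_def open_l2M_def)
  note R = Re_hs_inner_sum[where N = "CARD('a) ^ n" for n, OF Rep_l2M_carrier Rep_l2M_carrier]
  show "inner x y = inner y x"
    unfolding inner_l2M_def R by (simp add: inner_commute)
  have "Re (hs_inner (Rep_l2M (x + y) n) (Rep_l2M z n)) =
     Re (hs_inner (Rep_l2M x n) (Rep_l2M z n)) + Re (hs_inner (Rep_l2M y n) (Rep_l2M z n))" for n
    unfolding R by (simp add: Rep_l2M_index inner_add_left sum.distrib add_divide_distrib)
  then show "inner (x + y) z = inner x z + inner y z"
    using LIMSEQ_unique[OF inner_l2M_LIMSEQ[of "x + y" z]]
      tendsto_add[OF inner_l2M_LIMSEQ[of x z] inner_l2M_LIMSEQ[of y z]] by simp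
  have "Re (hs_inner (Rep_l2M (r *\<^sub>R x) n) (Rep_l2M y n)) = r * Re (hs_inner (Rep_l2M x n) (Rep_l2M y n))" for n
    unfolding R
    by (simp add: Rep_l2M_index scaleR_l2M_def inner_complex_def sum_distrib_left algebra_simps)
  then show "inner (r *\<^sub>R x) y = r * inner x y"
    using LIMSEQ_unique[OF inner_l2M_LIMSEQ[of "r *\<^sub>R x" y]]
      tendsto_mult_left[OF inner_l2M_LIMSEQ[of x y], of r] by simp
  show nn: "0 \<le> inner x x"
    using sqn_le_inner[of 1 x] sqn_nonneg[OF Rep_l2M_carrier[of x 1]] by simp
  show "(inner x x = 0) = (x = 0)"
  proof
    assume "inner x x = 0"
    show "x = 0"
    proof (rule l2M_eqI)
      fix n i j assume ij: "i < CARD('a) ^ n" "j < CARD('a) ^ n"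
      show "Rep_l2M x n $$ (i, j) = Rep_l2M (0 :: 'a l2M) n $$ (i, j)"
      proof (cases "n = 0")
        case True
        then show ?thesis using Rep_l2M_martingale[of x] ij
          by (auto simp: martingales_def zero_l2M.rep_eq)
      next
        case False
        then have "sqn (Rep_l2M x n) \<le> 0" using sqn_le_inner[of n x] \<open>inner x x = 0\<close> by simp
        then have "real (CARD('a) ^ n) * sqn (Rep_l2M x n) \<le> 0"
          by (intro mult_nonneg_nonpos) auto
        with entry_le_sqn[OF Rep_l2M_carrier[of x n] ij]
        have "(cmod (Rep_l2M x n $$ (i, j)))\<^sup>2 \<le> 0" by linarith
        then show ?thesis using ij by (simp add: zero_l2M.rep_eq)
      qed
    qed
  next
    assume "x = 0"
    have "sqn (Rep_l2M (0 :: 'a l2M) n) = 0" for n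
      by (subst sqn_sum[OF Rep_l2M_carrier]) (simp add: Rep_l2M_index)
    then show "inner x x = 0" using \<open>x = 0\<close> inner_l2M_LIMSEQ[of "0 :: 'a l2M" 0]
      LIMSEQ_unique[OF _ tendsto_const] by auto
  qed
qed

end

lemma l2M_entry_le:
  fixes f :: "'d::finite l2M"
  assumes "i < CARD('d) ^ n" "j < CARD('d) ^ n"
  shows "cmod (Rep_l2M f n $$ (i, j)) \<le> sqrt (CARD('d) ^ n) * norm f"
proof (cases "n = 0")
  case True
  then show ?thesis using Rep_l2M_martingale[of f] assms by (auto simp: martingales_def)
next
  case False
  have "(cmod (Rep_l2M f n $$ (i, j)))\<^sup>2 \<le> real (CARD('d) ^ n) * inner f f"
    using entry_le_sqn[OF Rep_l2M_carrier[of f n] assms] sqn_le_inner[of n f] False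
    by (smt (verit) mult_left_mono of_nat_0_le_iff One_nat_def Suc_leI neq0_conv)
  then have "cmod (Rep_l2M f n $$ (i, j)) \<le> sqrt (real (CARD('d) ^ n) * inner f f)"
    by (rule real_le_rsqrt)
  then show ?thesis by (simp add: real_sqrt_mult norm_eq_sqrt_inner)
qed

lemma sqn_LIMSEQ:
  assumes "\<And>k. X k \<in> carrier_mat N N" "Y \<in> carrier_mat N N"
    and "\<And>i j. i < N \<Longrightarrow> j < N \<Longrightarrow> (\<lambda>k. X k $$ (i, j)) \<longlonglongrightarrow> Y $$ (i, j)"
  shows "(\<lambda>k. sqn (X k)) \<longlonglongrightarrow> sqn Y"
  unfolding sqn_sum[OF assms(1)] sqn_sum[OF assms(2)] divide_inverse
  by (intro tendsto_intros tendsto_sum) (use assms(3) in auto)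

instance l2M :: (finite) complete_space
proof
  fix F :: "nat \<Rightarrow> 'a l2M" assume F: "Cauchy F"
  let ?d = "CARD('a)"
  have d: "?d > 0" by simp
  have "Cauchy (\<lambda>k. Rep_l2M (F k) n $$ (i, j))" if ij: "i < ?d ^ n" "j < ?d ^ n" for n i j
  proof (rule metric_CauchyI)
    fix e :: real assume "e > 0"
    have s: "sqrt (?d ^ n) > 0" by simp
    obtain M where M: "\<And>k l. k \<ge> M \<Longrightarrow> l \<ge> M \<Longrightarrow> dist (F k) (F l) < e / sqrt (?d ^ n)"
      using F \<open>e > 0\<close> s metric_CauchyD[of F "e / sqrt (?d ^ n)"] by (auto simp del: s)
    have "dist (Rep_l2M (F k) n $$ (i, j)) (Rep_l2M (F l) n $$ (i, j)) < e" if "k \<ge> M" "l \<ge> M" for k l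
    proof -
      have "dist (Rep_l2M (F k) n $$ (i, j)) (Rep_l2M (F l) n $$ (i, j))
        = cmod (Rep_l2M (F k - F l) n $$ (i, j))"
        using ij Rep_l2M_carrier[of "F k" n] Rep_l2M_carrier[of "F l" n]
        by (simp add: Rep_l2M_diff dist_norm)
      also have "\<dots> \<le> sqrt (?d ^ n) * dist (F k) (F l)"
        using l2M_entry_le[OF ij, of "F k - F l"] by (simp add: dist_norm)
      also have "\<dots> < sqrt (?d ^ n) * (e / sqrt (?d ^ n))"
        using M[OF that] s by (intro mult_strict_left_mono) auto
      also have "\<dots> = e" using s by simp
      finally show ?thesis .
    qed
    then show "\<exists>M. \<forall>k\<ge>M. \<forall>l\<ge>M. dist (Rep_l2M (F k) n $$ (i, j)) (Rep_l2M (F l) n $$ (i, j)) < e"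
      by blast
  qed
  then have conv: "convergent (\<lambda>k. Rep_l2M (F k) n $$ (i, j))" if "i < ?d ^ n" "j < ?d ^ n" for n i j
    using that Cauchy_convergent by blast
  define G where "G n = Matrix.mat (?d ^ n) (?d ^ n) (\<lambda>(i, j). lim (\<lambda>k. Rep_l2M (F k) n $$ (i, j)))" for n
  have Gc: "G n \<in> carrier_mat (?d ^ n) (?d ^ n)" for n by (simp add: G_def)
  have lim: "(\<lambda>k. Rep_l2M (F k) n $$ (i, j)) \<longlonglongrightarrow> G n $$ (i, j)" if "i < ?d ^ n" "j < ?d ^ n" for n i j
    using conv[OF that] that by (simp add: G_def convergent_LIMSEQ_iff)
  have Gm: "G \<in> martingales ?d"
  proof -
    have "partial_trace ?d (G (Suc n)) = G n" if n: "n \<ge> 1" for n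
    proof (rule eq_matI)
      have c: "G (Suc n) \<in> carrier_mat (?d ^ n * ?d) (?d ^ n * ?d)"
        using Gc[of "Suc n"] by (simp add: mult.commute)
      have c': "Rep_l2M (F k) (Suc n) \<in> carrier_mat (?d ^ n * ?d) (?d ^ n * ?d)" for k
        using Rep_l2M_carrier[of "F k" "Suc n"] by (simp add: mult.commute)
      show "dim_row (partial_trace ?d (G (Suc n))) = dim_row (G n)"
        "dim_col (partial_trace ?d (G (Suc n))) = dim_col (G n)"
        using partial_trace_carrier[OF d c] Gc[of n] by auto
      fix i j assume "i < dim_row (G n)" "j < dim_col (G n)"
      then have ij: "i < ?d ^ n" "j < ?d ^ n" using Gc[of n] by auto
      have lt: "i * ?d + a < ?d ^ Suc n" "j * ?d + a < ?d ^ Suc n" if "a < ?d" for a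
        using less_prod_index[OF ij(1) that] less_prod_index[OF ij(2) that] by (simp_all add: mult.commute)
      have "(\<lambda>k. (\<Sum>a<?d. Rep_l2M (F k) (Suc n) $$ (i * ?d + a, j * ?d + a)) / of_nat ?d)
        \<longlonglongrightarrow> (\<Sum>a<?d. G (Suc n) $$ (i * ?d + a, j * ?d + a)) / of_nat ?d"
        using lt lim by (intro tendsto_intros tendsto_sum) auto
      moreover have "(\<Sum>a<?d. Rep_l2M (F k) (Suc n) $$ (i * ?d + a, j * ?d + a)) / of_nat ?d
          = Rep_l2M (F k) n $$ (i, j)" for k
      proof -
        have "partial_trace ?d (Rep_l2M (F k) (Suc n)) = Rep_l2M (F k) n"
          using Rep_l2M_martingale[of "F k"] n by (auto simp: martingales_def)
        then show ?thesis using partial_trace_index[OF d c'[of k] ij] by simp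
      qed
      ultimately show "partial_trace ?d (G (Suc n)) $$ (i, j) = G n $$ (i, j)"
        using lim[OF ij] LIMSEQ_unique partial_trace_index[OF d c ij] by auto
    qed
    moreover have "G 0 = 0\<^sub>m 1 1"
    proof (rule eq_matI)
      fix i j assume "i < dim_row (0\<^sub>m 1 1 :: complex mat)" "j < dim_col (0\<^sub>m 1 1 :: complex mat)"
      then have ij: "i < ?d ^ 0" "j < ?d ^ 0" by auto
      have "Rep_l2M (F k) 0 $$ (i, j) = 0" for k
        using Rep_l2M_martingale[of "F k"] ij by (auto simp: martingales_def)
      then show "G 0 $$ (i, j) = 0\<^sub>m 1 1 $$ (i, j)"
        using lim[OF ij] ij LIMSEQ_unique[OF _ tendsto_const] by auto
    qed (use Gc[of 0] in auto)
    ultimately show ?thesis using Gc by (auto simp: martingales_def)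
  qed
  have "Bseq F" using F by (rule Cauchy_Bseq)
  then obtain K where K: "\<And>k. norm (F k) \<le> K" by (auto simp: Bseq_def)
  have "sqn (G n) \<le> K\<^sup>2" if "n \<ge> 1" for n
  proof (rule LIMSEQ_le_const2[OF sqn_LIMSEQ[OF Rep_l2M_carrier Gc lim]])
    have "sqn (Rep_l2M (F k) n) \<le> K\<^sup>2" for k
      using sqn_le_inner[OF that, of "F k"] power_mono[OF K[of k] norm_ge_zero, of 2]
      by (simp add: power2_norm_eq_inner)
    then show "\<exists>N. \<forall>k\<ge>N. sqn (Rep_l2M (F k) n) \<le> K\<^sup>2" by blast
  qed
  then have GC: "L2_Cauchy ?d G" using L2_Cauchy_iff_bounded[OF Gm d] by blast
  define g where "g = (Abs_l2M G :: 'a l2M)"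
  have Rg: "Rep_l2M g = G" unfolding g_def using Gm GC by (intro Abs_l2M_inverse) auto
  have "F \<longlonglongrightarrow> g"
  proof (rule metric_LIMSEQ_I)
    fix e :: real assume e: "e > 0"
    then obtain M where M: "\<And>k l. k \<ge> M \<Longrightarrow> l \<ge> M \<Longrightarrow> dist (F k) (F l) < e / 2"
      using metric_CauchyD[OF F, of "e / 2"] by auto
    have "dist (F k) g < e" if k: "k \<ge> M" for k
    proof -
      have "sqn (Rep_l2M (F k - g) n) \<le> (e / 2)\<^sup>2" if n: "n \<ge> 1" for n
      proof (rule LIMSEQ_le_const2[where X = "\<lambda>l. sqn (Rep_l2M (F k - F l) n)"])
        show "(\<lambda>l. sqn (Rep_l2M (F k - F l) n)) \<longlonglongrightarrow> sqn (Rep_l2M (F k - g) n)"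
        proof (rule sqn_LIMSEQ[OF Rep_l2M_carrier Rep_l2M_carrier])
          fix i j assume ij: "i < ?d ^ n" "j < ?d ^ n"
          have e: "Rep_l2M (F k - h) n $$ (i, j) = Rep_l2M (F k) n $$ (i, j) - Rep_l2M h n $$ (i, j)" for h
            using ij Rep_l2M_carrier[of h n] Rep_l2M_carrier[of "F k" n] by (simp add: Rep_l2M_diff)
          show "(\<lambda>l. Rep_l2M (F k - F l) n $$ (i, j)) \<longlonglongrightarrow> Rep_l2M (F k - g) n $$ (i, j)"
            unfolding e Rg by (intro tendsto_intros lim ij)
        qed
        have "sqn (Rep_l2M (F k - F l) n) \<le> (e / 2)\<^sup>2" if "l \<ge> M" for l
        proof -
          have "sqn (Rep_l2M (F k - F l) n) \<le> (norm (F k - F l))\<^sup>2"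
            using sqn_le_inner[OF n] by (simp add: power2_norm_eq_inner)
          also have "\<dots> \<le> (e / 2)\<^sup>2"
            using M[OF k that] by (intro power_mono) (auto simp: dist_norm)
          finally show ?thesis .
        qed
        then show "\<exists>N. \<forall>l\<ge>N. sqn (Rep_l2M (F k - F l) n) \<le> (e / 2)\<^sup>2" by blast
      qed
      then have "inner (F k - g) (F k - g) \<le> (e / 2)\<^sup>2"
        by (intro LIMSEQ_le_const2[OF inner_l2M_LIMSEQ]) blast
      then have "norm (F k - g) \<le> e / 2"
        using e unfolding norm_eq_sqrt_inner by (intro real_le_lsqrt) auto
      then show ?thesis using e by (simp add: dist_norm)
    qed
    then show "\<exists>M. \<forall>k\<ge>M. dist (F k) g < e" by blast
  qed
  then show "convergent F" by (rule convergentI)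
qed

global_interpretation l2M: vector_space "scaleC :: complex \<Rightarrow> 'd::finite l2M \<Rightarrow> 'd l2M"
  by standard (auto intro!: l2M_eqI simp: Rep_l2M_index algebra_simps)

text \<open>The element of \<open>'d l2M\<close> given by a matrix x of the n-th algebra, i.e. its sequence of
  conditional expectations.\<close>

definition embed_seq :: "nat \<Rightarrow> nat \<Rightarrow> complex mat \<Rightarrow> nat \<Rightarrow> complex mat" where
  "embed_seq d n x k = (if k = 0 then 0\<^sub>m 1 1
     else if k \<le> n then partial_trace (d ^ (n - k)) x else tensor_one (d ^ (k - n)) x)"

lemma embed_seq_ge:
  "k \<ge> 1 \<Longrightarrow> n \<le> k \<Longrightarrow> x \<in> carrier_mat (d ^ n) (d ^ n) \<Longrightarrow>
   embed_seq d n x k = tensor_one (d ^ (k - n)) x"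
  using partial_trace_1[of x "d ^ n"] tensor_one_1[of x "d ^ n"] by (auto simp: embed_seq_def)

lemma embed_seq_martingale:
  assumes "x \<in> carrier_mat (d ^ n) (d ^ n)" "d > 0"
  shows "embed_seq d n x \<in> martingales d"
proof -
  have c: "embed_seq d n x k \<in> carrier_mat (d ^ k) (d ^ k)" if "k \<ge> 1" for k
  proof (cases "k \<le> n")
    case True
    then have e: "d ^ n = d ^ k * d ^ (n - k)" by (simp flip: power_add)
    show ?thesis using that True assms(2) partial_trace_carrier[of "d ^ (n - k)" x "d ^ k"] assms(1)
      unfolding e by (simp add: embed_seq_def)
  next
    case False
    then have e: "d ^ k = d ^ n * d ^ (k - n)" by (simp flip: power_add)
    show ?thesis using that False tensor_one_carrier[OF assms(1), of "d ^ (k - n)"]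
      by (simp add: embed_seq_def e)
  qed
  have "partial_trace d (embed_seq d n x (Suc k)) = embed_seq d n x k" if k: "k \<ge> 1" for k
  proof (cases "k < n")
    case True
    then obtain l where l: "n = Suc (k + l)" using less_iff_Suc_add by blast
    have "x \<in> carrier_mat (d ^ k * d * d ^ l) (d ^ k * d * d ^ l)"
      using assms(1) l by (simp add: power_add mult_ac)
    from partial_trace_partial_trace[OF this] show ?thesis
      using assms(2) k l by (simp add: embed_seq_def mult.commute)
  next
    case False
    then obtain l where l: "k = n + l" using le_Suc_ex[of n k] by auto
    have t: "tensor_one (d ^ l) x \<in> carrier_mat (d ^ n * d ^ l) (d ^ n * d ^ l)" using assms by simp
    have "embed_seq d n x (Suc k) = tensor_one d (tensor_one (d ^ l) x)"
      using embed_seq_ge[of "Suc k" n x d] tensor_one_tensor_one[OF assms(1), of d "d ^ l"] assms l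
      by (simp add: mult.commute)
    then show ?thesis
      using partial_trace_tensor_one[OF t assms(2)] embed_seq_ge[of k n x d] k l assms by simp
  qed
  then show ?thesis using c by (auto simp: martingales_def embed_seq_def)
qed

lemma embed_seq_L2:
  assumes "x \<in> carrier_mat (d ^ n) (d ^ n)" "d > 0"
  shows "L2_Cauchy d (embed_seq d n x)"
proof -
  have "sqn (embed_seq d n x k) \<le> sqn (embed_seq d n x (Suc n + k))" if "k \<ge> 1" for k
    using martingale_sqn_mono[OF embed_seq_martingale[OF assms] assms(2) that] by simp
  moreover have "sqn (embed_seq d n x (Suc n + k)) = sqn x" for k
    using embed_seq_ge[of "Suc n + k" n x d] sqn_tensor_one[OF assms(1)] assms by simp
  ultimately show ?thesis
    using L2_Cauchy_iff_bounded[OF embed_seq_martingale[OF assms] assms(2)] by auto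
qed

definition l2_embed :: "nat \<Rightarrow> complex mat \<Rightarrow> 'd::finite l2M" where
  "l2_embed n x = Abs_l2M (embed_seq CARD('d) n x)"

lemma Rep_l2_embed:
  "x \<in> carrier_mat (CARD('d) ^ n) (CARD('d) ^ n) \<Longrightarrow>
   Rep_l2M (l2_embed n x :: 'd::finite l2M) = embed_seq CARD('d) n x"
  unfolding l2_embed_def by (rule Abs_l2M_inverse) (auto intro: embed_seq_martingale embed_seq_L2)

lemma inner_l2_embed:
  assumes "x \<in> carrier_mat (CARD('d) ^ n) (CARD('d) ^ n)" "y \<in> carrier_mat (CARD('d) ^ n) (CARD('d) ^ n)"
  shows "inner (l2_embed n x :: 'd::finite l2M) (l2_embed n y) = Re (hs_inner x y)"
proof -
  have "\<forall>\<^sub>F k in sequentially. Re (hs_inner (embed_seq CARD('d) n x k) (embed_seq CARD('d) n y k))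
     = Re (hs_inner x y)"
    using eventually_ge_at_top[of "Suc n"]
  proof eventually_elim
    case (elim k)
    then have "embed_seq CARD('d) n x k = tensor_one (CARD('d) ^ (k - n)) x"
      "embed_seq CARD('d) n y k = tensor_one (CARD('d) ^ (k - n)) y"
      using assms by (auto intro: embed_seq_ge)
    then show ?case
      using hs_inner_tensor_one[OF tensor_one_carrier[OF assms(1)] assms(2), of "CARD('d) ^ (k - n)"]
        partial_trace_tensor_one[OF assms(1), of "CARD('d) ^ (k - n)"] by simp
  qed
  then have "(\<lambda>k. Re (hs_inner (embed_seq CARD('d) n x k) (embed_seq CARD('d) n y k)))
     \<longlonglongrightarrow> Re (hs_inner x y)" by (rule tendsto_eventually)
  then show ?thesis
    using inner_l2M_LIMSEQ[of "l2_embed n x :: 'd l2M" "l2_embed n y"] LIMSEQ_unique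
    unfolding Rep_l2_embed[OF assms(1)] Rep_l2_embed[OF assms(2)] by blast
qed

lemma l2_embed_tendsto:
  fixes f :: "'d::finite l2M"
  shows "(\<lambda>n. l2_embed n (Rep_l2M f n)) \<longlonglongrightarrow> f"
proof (rule metric_LIMSEQ_I)
  fix e :: real assume e: "e > 0"
  let ?d = "CARD('d)"
  have "\<exists>N\<ge>1. \<forall>n\<ge>N. \<forall>m\<ge>n.
      L2_norm (Rep_l2M f m - tensor_one (?d ^ (m - n)) (Rep_l2M f n)) < e / 2"
    using Rep_l2M_Cauchy[of f] e unfolding L2_Cauchy_def by (elim allE[of _ "e / 2"] impE) simp_all
  then obtain N where N: "N \<ge> 1" "\<And>n m. n \<ge> N \<Longrightarrow> m \<ge> n \<Longrightarrow>
      L2_norm (Rep_l2M f m - tensor_one (?d ^ (m - n)) (Rep_l2M f n)) < e / 2"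
    by auto
  have "dist (l2_embed n (Rep_l2M f n)) f < e" if n: "n \<ge> N" for n
  proof -
    let ?g = "f - l2_embed n (Rep_l2M f n)"
    have "sqn (Rep_l2M ?g m) \<le> (e / 2)\<^sup>2" if m: "m \<ge> n" for m
    proof -
      have "Rep_l2M ?g m = Rep_l2M f m - tensor_one (?d ^ (m - n)) (Rep_l2M f n)"
        using embed_seq_ge[of m n "Rep_l2M f n" ?d] m n N(1) Rep_l2M_carrier[of f n]
        by (simp add: Rep_l2M_diff Rep_l2_embed)
      then have "sqrt (sqn (Rep_l2M ?g m)) < e / 2" using N(2)[OF n m] by (simp add: L2_norm_def)
      then have "sqrt (sqn (Rep_l2M ?g m)) ^ 2 \<le> (e / 2)\<^sup>2"
        using sqn_nonneg[OF Rep_l2M_carrier] by (intro power_mono) auto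
      then show ?thesis using sqn_nonneg[OF Rep_l2M_carrier[of ?g m]] by simp
    qed
    then have "inner ?g ?g \<le> (e / 2)\<^sup>2"
      by (intro LIMSEQ_le_const2[OF inner_l2M_LIMSEQ]) blast
    then have "norm ?g \<le> e / 2" using e unfolding norm_eq_sqrt_inner by (intro real_le_lsqrt) auto
    then show ?thesis using e by (simp add: dist_norm norm_minus_commute)
  qed
  then show "\<exists>N. \<forall>n\<ge>N. dist (l2_embed n (Rep_l2M f n)) f < e" by blast
qed


section \<open>The von Neumann algebra and its martingales\<close>

definition bounded_ops :: "('d::finite l2M \<Rightarrow> 'd l2M) set" where
  "bounded_ops = {T. bounded_linear T \<and> (\<forall>c f. T (scaleC c f) = scaleC c (T f))}"

definition commutant :: "('d::finite l2M \<Rightarrow> 'd l2M) set \<Rightarrow> ('d l2M \<Rightarrow> 'd l2M) set" where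
  "commutant S = {T \<in> bounded_ops. \<forall>A\<in>S. T \<circ> A = A \<circ> T}"

text \<open>Left multiplications by the elements of the matrix algebras, determined by their action on
  the dense subspace of matrices.\<close>

definition left_mults :: "('d::finite l2M \<Rightarrow> 'd l2M) set" where
  "left_mults = {T \<in> bounded_ops. \<exists>n. \<exists>x\<in>carrier_mat (CARD('d) ^ n) (CARD('d) ^ n).
     \<forall>m\<ge>n. \<forall>y\<in>carrier_mat (CARD('d) ^ m) (CARD('d) ^ m).
       T (l2_embed m y) = l2_embed m (tensor_one (CARD('d) ^ (m - n)) x * y)}"

definition vN_tensor :: "('d::finite l2M \<Rightarrow> 'd l2M) set" where
  "vN_tensor = commutant (commutant left_mults)"

text \<open>
  An element T of the algebra is identified with the martingale of its conditional expectations.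
  As T is identified in L_2 with the vector \<open>T 1\<close>, and the n-th conditional expectation is the
  orthogonal projection onto the n-th matrix algebra, these are the members of \<open>T 1\<close>.
\<close>

definition vN_martingales :: "'d::finite itself \<Rightarrow> (nat \<Rightarrow> complex mat) set" where
  "vN_martingales _ =
     {Rep_l2M (T (l2_embed 1 (1\<^sub>m CARD('d)))) | T :: 'd l2M \<Rightarrow> 'd l2M. T \<in> vN_tensor}"


section \<open>Schatten classes\<close>

text \<open>
  \<open>singular_space T s\<close> is the kernel of \<open>T\<^sup>* T - s\<^sup>2\<close>, written with the form
  \<open>\<langle>T\<^sup>* T f, g\<rangle> = \<langle>T f, T g\<rangle>\<close>; for s > 0 it is the eigenspace of |T| at s, and its complex
  dimension is the multiplicity of the singular value s. Hence the sum below is \<open>Tr |T|\<^sup>p\<close>.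
  Compactness makes all these dimensions finite; it is required separately because \<open>dim\<close> is 0
  for infinite-dimensional spaces.
\<close>

definition singular_space :: "('d::finite l2M \<Rightarrow> 'd l2M) \<Rightarrow> real \<Rightarrow> 'd l2M set" where
  "singular_space T s = {f. \<forall>g. inner (T f) (T g) = s\<^sup>2 * inner f g}"

definition singular_mult :: "('d::finite l2M \<Rightarrow> 'd l2M) \<Rightarrow> real \<Rightarrow> nat" where
  "singular_mult T s = l2M.dim (singular_space T s)"

definition schatten_class :: "real \<Rightarrow> ('d::finite l2M \<Rightarrow> 'd l2M) set" where
  "schatten_class p = {T \<in> bounded_ops. compact (closure (T ` cball 0 1)) \<and>
     (\<lambda>s. real (singular_mult T s) * s powr p) summable_on {0<..}}"

definition schatten_norm :: "real \<Rightarrow> ('d::finite l2M \<Rightarrow> 'd l2M) \<Rightarrow> real" where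
  "schatten_norm p T = (\<Sum>\<^sub>\<infinity>s\<in>{0<..}. real (singular_mult T s) * s powr p) powr (1 / p)"


section \<open>Paraproducts and Besov spaces\<close>

text \<open>
  The argument F assigns to f in L_2 the sequence \<open>f\<^sub>0, f\<^sub>1, f\<^sub>2, \<dots>\<close>; only \<open>f\<^sub>0\<close> is a matter of
  convention. For \<open>F = Rep_l2M\<close> it is 0, while \<open>scalar_start\<close> takes \<open>f\<^sub>0 = \<tau>(f)\<close>, the expectation
  onto the scalars, seen as a 1 x 1 matrix. With \<open>f\<^sub>0 = 0\<close> the paraproduct does not depend
  on \<open>b\<^sub>1\<close>.
\<close>

definition scalar_start :: "'d::finite l2M \<Rightarrow> nat \<Rightarrow> complex mat" where
  "scalar_start f k = (if k = 0 then partial_trace CARD('d) (Rep_l2M f 1) else Rep_l2M f k)"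

definition paraproduct_term ::
    "('d::finite l2M \<Rightarrow> nat \<Rightarrow> complex mat) \<Rightarrow> (nat \<Rightarrow> complex mat) \<Rightarrow> 'd l2M \<Rightarrow> nat \<Rightarrow> 'd l2M" where
  "paraproduct_term F b f k = l2_embed k (mdiff CARD('d) b k * tensor_one CARD('d) (F f (k - 1)))"

definition paraproduct ::
    "('d::finite l2M \<Rightarrow> nat \<Rightarrow> complex mat) \<Rightarrow> (nat \<Rightarrow> complex mat) \<Rightarrow> 'd l2M \<Rightarrow> 'd l2M" where
  "paraproduct F b f = (\<Sum>k. paraproduct_term F b f (Suc k))"

definition paraproduct_in_schatten ::
    "real \<Rightarrow> ('d::finite l2M \<Rightarrow> nat \<Rightarrow> complex mat) \<Rightarrow> (nat \<Rightarrow> complex mat) \<Rightarrow> bool" where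
  "paraproduct_in_schatten p F b \<longleftrightarrow>
     (\<forall>f. summable (\<lambda>k. paraproduct_term F b f (Suc k))) \<and> paraproduct F b \<in> schatten_class p"

definition besov_term :: "nat \<Rightarrow> real \<Rightarrow> (nat \<Rightarrow> complex mat) \<Rightarrow> nat \<Rightarrow> real" where
  "besov_term d p b k = real d ^ (2 * k) * Lp_norm p (mdiff d b k) powr p"

definition besov_norm :: "nat \<Rightarrow> real \<Rightarrow> (nat \<Rightarrow> complex mat) \<Rightarrow> real" where
  "besov_norm d p b = (\<Sum>k. besov_term d p b (Suc k)) powr (1 / p)"

text \<open>
  The completion of the elements of the von Neumann algebra with finite Besov norm, as a space of
  martingales: the class of a Cauchy sequence is the martingale whose differences are the limits
  of the differences. The norm of the completion is again given by \<open>besov_norm\<close>.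
\<close>

definition besov_space :: "'d::finite itself \<Rightarrow> real \<Rightarrow> (nat \<Rightarrow> complex mat) set" where
  "besov_space _ p = {b \<in> martingales CARD('d). \<exists>X.
     (\<forall>j. X j \<in> vN_martingales TYPE('d) \<and> summable (\<lambda>k. besov_term CARD('d) p (X j) (Suc k))) \<and>
     (\<forall>e>0. \<exists>N. \<forall>i\<ge>N. \<forall>j\<ge>N. besov_norm CARD('d) p (\<lambda>n. X i n - X j n) < e) \<and>
     (\<forall>k\<ge>1. (\<lambda>j. Lp_norm p (mdiff CARD('d) (X j) k - mdiff CARD('d) b k)) \<longlonglongrightarrow> 0)}"

end

theory Submission
  imports Defs
begin

section \<open>Overview\<close>

text \<open>
  Put \<open>q = p / 2\<close> and write \<open>d\<^sub>k\<close> for the k-th difference of b. For \<open>k \<ge> 2\<close> the conditional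
  expectation onto level k - 1 kills \<open>d\<^sub>k\<close>, so the terms \<open>d\<^sub>k f\<^bsub>k-1\<^esub>\<close> are orthogonal and \<open>\<parallel>\<pi>\<^sub>b
  f\<parallel>\<^sup>2 = \<Sum>\<^sub>k \<parallel>d\<^sub>k f\<^bsub>k-1\<^esub>\<parallel>\<^sup>2\<close>. The p-th powers of the singular values of the paraproduct are the
  q-th powers of the eigenvalues of this quadratic form, and the whole proof compares quadratic
  forms.

  The comparison rests on a counting principle in the spirit of the min-max formula
  (\<open>counting_sum\<close>). Let a form have eigenvalues \<open>\<mu>\<close>, and let \<open>\<psi>\<^sub>x\<close> be linear functionals with
  weights \<open>\<beta>\<^sub>x\<close> such that, for every level t > 0, the form is at most t times the squared norm
  wherever all functionals of weight at least t vanish. Then the positive eigenvalues inject into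
  the weights with a loss of a factor 2, and \<open>\<Sum> \<mu>\<^sup>q \<le> 2\<^sup>q \<Sum> \<beta>\<^sup>q\<close>. This holds for all q > 0 alike
  and takes the place of the triangle inequality of the Schatten classes, which fails for p < 1.

  Upper bound. Split \<open>f\<^bsub>k-1\<^esub>\<close> into its martingale increments on the levels j < k. On level j the
  form \<open>y \<mapsto> \<parallel>d\<^sub>k (y \<otimes> 1)\<parallel>\<^sup>2\<close> is diagonalised by the eigenvectors of the conditional expectation of
  \<open>|d\<^sub>k|\<^sup>2\<close> onto level j, each of them with multiplicity \<open>d\<^sup>j\<close>. Averaging over the k - j last
  tensor factors makes the eigenvalue sum gain a power of d (\<open>partial_form_gain\<close>): the q-th powers
  of the eigenvalues add up to at most \<open>d\<^bsup>-\<gamma>(k-j)\<^esup> d\<^bsup>2k\<^esup> \<parallel>d\<^sub>k\<parallel>\<^sub>p\<^sup>p\<close> with \<open>\<gamma> = 2 min 1 q\<close>. One half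
  of this geometric decay pays for the sum over j in the form bound (\<open>form_sum_bound\<close>), the other
  half makes the sum of all weights converge to a multiple of the k-th terms of the Besov sum
  (\<open>\<beta>_total\<close>).

  Lower bound. Cutting the columns of \<open>d\<^sub>k\<close> into blocks according to their last digits costs only
  a constant (\<open>bt_le_blocks\<close>), and the blocks are recovered by testing on matrices \<open>y \<otimes> e\<^sub>s\<^sub>t\<close>
  with \<open>s \<noteq> t\<close>: these have trace 0 over the last factor, hence are martingale increments of level
  k - 1. Let k run through a residue class modulo m only. A combination f of such test vectors
  has, below level k - 1, no increments on the levels from k - m to k - 2, so up to a remainder of
  relative size \<open>\<rho>\<^sup>m\<close> in the Besov sum only the tested blocks are seen. For m large this remainder
  is absorbed (\<open>tail_bound\<close>), which also shows that the Besov sum is finite. The term k = 1 is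
  seen through \<open>f\<^sub>0\<close> alone, by testing on f = 1.

  Finally, the completion in the definition of the Besov space consists of all martingales with
  finite Besov sum (\<open>besov_space_iff_summable\<close>): truncations of such a martingale are matrices,
  hence elements of the algebra, and conversely finiteness passes to limits by a Fatou argument.
\<close>

section \<open>Counting eigenvalues\<close>

text \<open>
  More unknowns than equations, by elimination of one variable. The solution vanishes off J, so
  that it can serve as a coefficient family on any larger index set.
\<close>

lemma nontrivial_solution:
  fixes \<psi> :: "'x \<Rightarrow> 'i \<Rightarrow> complex"
  assumes "finite Y" "finite J" "card Y < card J"
  shows "\<exists>c. (\<exists>i\<in>J. c i \<noteq> 0) \<and> (\<forall>i. i \<notin> J \<longrightarrow> c i = 0) \<and> (\<forall>y\<in>Y. (\<Sum>i\<in>J. \<psi> y i * c i) = 0)"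
  using assms
proof (induction Y arbitrary: \<psi> J rule: finite_induct)
  case empty
  then obtain i where "i \<in> J" by fastforce
  then show ?case by (intro exI[of _ "\<lambda>j. if j = i then 1 else 0"]) auto
next
  case (insert y Y)
  show ?case
  proof (cases "\<forall>i\<in>J. \<psi> y i = 0")
    case True
    from insert.IH[of J \<psi>] insert.prems insert.hyps obtain c where
      "\<exists>i\<in>J. c i \<noteq> 0" "\<forall>i. i \<notin> J \<longrightarrow> c i = 0" "\<forall>y\<in>Y. (\<Sum>i\<in>J. \<psi> y i * c i) = 0" by auto
    then show ?thesis using True by (intro exI[of _ c]) auto
  next
    case False
    then obtain k where k: "k \<in> J" "\<psi> y k \<noteq> 0" by blast
    define \<phi> where "\<phi> z i = \<psi> z i - \<psi> z k * \<psi> y i / \<psi> y k" for z i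
    have "card Y < card (J - {k})" using insert.prems insert.hyps k by simp
    then obtain c where c: "\<exists>i\<in>J - {k}. c i \<noteq> 0" "\<forall>i. i \<notin> J - {k} \<longrightarrow> c i = 0"
      "\<forall>z\<in>Y. (\<Sum>i\<in>J - {k}. \<phi> z i * c i) = 0"
      using insert.IH[of "J - {k}" \<phi>] insert.prems by auto
    define c' where "c' = c(k := - (\<Sum>i\<in>J - {k}. \<psi> y i * c i) / \<psi> y k)"
    have e: "(\<Sum>i\<in>J. \<psi> z i * c' i) = (\<Sum>i\<in>J - {k}. \<phi> z i * c i)" for z
    proof -
      have "(\<Sum>i\<in>J. \<psi> z i * c' i) = \<psi> z k * c' k + (\<Sum>i\<in>J - {k}. \<psi> z i * c' i)"
        using k insert.prems by (simp add: sum.remove)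
      also have "(\<Sum>i\<in>J - {k}. \<psi> z i * c' i) = (\<Sum>i\<in>J - {k}. \<psi> z i * c i)"
        by (intro sum.cong) (auto simp: c'_def)
      also have "\<psi> z k * c' k = - (\<Sum>i\<in>J - {k}. \<psi> z k * \<psi> y i / \<psi> y k * c i)"
        by (simp add: c'_def sum_distrib_left sum_divide_distrib mult_ac)
      finally show ?thesis by (simp add: \<phi>_def algebra_simps sum_subtractf)
    qed
    have "(\<Sum>i\<in>J. \<psi> z i * c' i) = 0" if "z \<in> insert y Y" for z
    proof (cases "z = y")
      case True
      then show ?thesis unfolding e by (simp add: \<phi>_def k)
    next
      case False
      then show ?thesis unfolding e using that c(3) by simp
    qed
    moreover have "\<exists>i\<in>J. c' i \<noteq> 0" "\<forall>i. i \<notin> J \<longrightarrow> c' i = 0" using c k by (auto simp: c'_def)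
    ultimately show ?thesis by blast
  qed
qed

text \<open>
  Remove from J the index k of the smallest eigenvalue and take \<open>\<sigma>\<close> for the rest by induction. If
  \<open>\<sigma>\<close> had exhausted the weights of size at least \<open>t = \<mu> k / 2\<close>, there would be fewer such
  functionals than elements of J, hence a nonzero c supported in J that they all annihilate. On it
  the form is at most t times the squared norm, but also at least \<open>\<mu> k\<close> times the squared norm.
\<close>

lemma counting_injection:
  fixes \<psi> :: "'x \<Rightarrow> 'i \<Rightarrow> complex"
  assumes I: "finite I"
    and lower: "\<And>c. (\<Sum>i\<in>I. \<mu> i * (cmod (c i))\<^sup>2) \<le> Q c"
    and upper: "\<And>t c. t > 0 \<Longrightarrow> (\<And>x. x \<in> X \<Longrightarrow> t \<le> \<beta> x \<Longrightarrow> (\<Sum>i\<in>I. \<psi> x i * c i) = 0) \<Longrightarrow>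
      Q c \<le> t * (\<Sum>i\<in>I. (cmod (c i))\<^sup>2)"
    and J: "J \<subseteq> I" "\<And>i. i \<in> J \<Longrightarrow> \<mu> i > (0::real)"
  shows "\<exists>\<sigma>. inj_on \<sigma> J \<and> \<sigma> ` J \<subseteq> X \<and> (\<forall>i\<in>J. \<mu> i \<le> 2 * \<beta> (\<sigma> i))"
proof -
  have "finite J" using I J finite_subset by blast
  then show ?thesis using J
  proof (induction "card J" arbitrary: J)
    case 0
    then show ?case by auto
  next
    case (Suc n)
    have ne: "J \<noteq> {}" using Suc.hyps by auto
    obtain k where k: "k \<in> J" "\<And>i. i \<in> J \<Longrightarrow> \<mu> k \<le> \<mu> i"
      using arg_min_if_finite(1)[OF Suc.prems(1) ne, of \<mu>] arg_min_least[OF Suc.prems(1) ne, of _ \<mu>] by blast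
    define J' where "J' = J - {k}"
    have "n = card J'" "finite J'" "J' \<subseteq> I" "\<And>i. i \<in> J' \<Longrightarrow> \<mu> i > 0"
      using Suc.hyps Suc.prems k by (auto simp: J'_def)
    from Suc.hyps(1)[OF this] obtain \<sigma> where \<sigma>: "inj_on \<sigma> J'" "\<sigma> ` J' \<subseteq> X" "\<forall>i\<in>J'. \<mu> i \<le> 2 * \<beta> (\<sigma> i)"
      by blast
    define t where "t = \<mu> k / 2"
    have t: "t > 0" using Suc.prems k by (simp add: t_def)
    define Y where "Y = {x \<in> X. t \<le> \<beta> x}"
    have "\<not> Y \<subseteq> \<sigma> ` J'"
    proof
      assume Y: "Y \<subseteq> \<sigma> ` J'"
      then have fY: "finite Y" using \<open>finite J'\<close> finite_subset by blast
      have "card Y \<le> card J'" using Y \<open>finite J'\<close> by (meson card_image_le card_mono finite_imageI le_trans)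
      also have "\<dots> < card J" using Suc.hyps(2) \<open>n = card J'\<close> by simp
      finally obtain c where c: "\<exists>i\<in>J. c i \<noteq> 0" "\<forall>i. i \<notin> J \<longrightarrow> c i = 0"
        "\<forall>y\<in>Y. (\<Sum>i\<in>J. \<psi> y i * c i) = 0"
        using nontrivial_solution[OF fY Suc.prems(1), of \<psi>] by auto
      have sup: "(\<Sum>i\<in>I. \<psi> y i * c i) = (\<Sum>i\<in>J. \<psi> y i * c i)" for y
        using c(2) I Suc.prems by (intro sum.mono_neutral_right) auto
      have sup2: "(\<Sum>i\<in>I. g i * (cmod (c i))\<^sup>2) = (\<Sum>i\<in>J. g i * (cmod (c i))\<^sup>2)" for g
        using c(2) I Suc.prems by (intro sum.mono_neutral_right) auto
      have "Q c \<le> t * (\<Sum>i\<in>I. (cmod (c i))\<^sup>2)"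
        by (rule upper[OF t]) (use c(3) in \<open>auto simp: sup Y_def\<close>)
      moreover have "(\<Sum>i\<in>J. \<mu> k * (cmod (c i))\<^sup>2) \<le> (\<Sum>i\<in>J. \<mu> i * (cmod (c i))\<^sup>2)"
        using k by (intro sum_mono mult_right_mono) auto
      moreover have "(\<Sum>i\<in>J. \<mu> i * (cmod (c i))\<^sup>2) \<le> Q c" using lower[of c] sup2 by simp
      moreover have "(\<Sum>i\<in>J. (cmod (c i))\<^sup>2) > 0"
        using c(1) Suc.prems(1) by (auto intro: sum_pos2)
      then have "t * (\<Sum>i\<in>J. (cmod (c i))\<^sup>2) < \<mu> k * (\<Sum>i\<in>J. (cmod (c i))\<^sup>2)"
        using t by (intro mult_strict_right_mono) (auto simp: t_def)
      ultimately show False using sup2[of "\<lambda>_. t"] by (simp add: sum_distrib_left)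
    qed
    then obtain x where x: "x \<in> Y" "x \<notin> \<sigma> ` J'" by blast
    define \<sigma>' where "\<sigma>' = \<sigma>(k := x)"
    have Jk: "J = insert k J'" "k \<notin> J'" using k by (auto simp: J'_def)
    have im: "\<sigma>' ` J' = \<sigma> ` J'" using Jk by (auto simp: \<sigma>'_def)
    have "inj_on \<sigma>' J'" using \<sigma>(1) Jk by (auto simp: \<sigma>'_def inj_on_def)
    then have "inj_on \<sigma>' J" unfolding Jk(1) using Jk x im by (auto simp: \<sigma>'_def)
    moreover have "\<sigma>' ` J \<subseteq> X" unfolding Jk(1) using im \<sigma>(2) x by (auto simp: \<sigma>'_def Y_def)
    moreover have "\<forall>i\<in>J. \<mu> i \<le> 2 * \<beta> (\<sigma>' i)" unfolding Jk(1) using Jk(2) \<sigma>(3) x by (auto simp: \<sigma>'_def Y_def t_def)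
    ultimately show ?case by blast
  qed
qed

text \<open>
  The substitute for the triangle inequality: the hypothesis on \<open>Q\<close> is an inequality of quadratic
  forms, to which sums and truncations of operators contribute additively, whatever q is.
\<close>

lemma counting_sum:
  fixes \<psi> :: "'x \<Rightarrow> 'i \<Rightarrow> complex"
  assumes I: "finite I"
    and lower: "\<And>c. (\<Sum>i\<in>I. \<mu> i * (cmod (c i))\<^sup>2) \<le> Q c"
    and upper: "\<And>t c. t > 0 \<Longrightarrow> (\<And>x. x \<in> X \<Longrightarrow> t \<le> \<beta> x \<Longrightarrow> (\<Sum>i\<in>I. \<psi> x i * c i) = 0) \<Longrightarrow>
      Q c \<le> t * (\<Sum>i\<in>I. (cmod (c i))\<^sup>2)"
    and \<mu>: "\<And>i. i \<in> I \<Longrightarrow> \<mu> i \<ge> (0::real)"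
    and S: "\<And>F. finite F \<Longrightarrow> F \<subseteq> X \<Longrightarrow> (\<Sum>x\<in>F. \<beta> x powr q) \<le> S"
    and q: "q > 0"
  shows "(\<Sum>i\<in>I. \<mu> i powr q) \<le> 2 powr q * S"
proof -
  define J where "J = {i \<in> I. \<mu> i > 0}"
  have J: "J \<subseteq> I" "\<And>i. i \<in> J \<Longrightarrow> \<mu> i > 0" by (auto simp: J_def)
  have "\<exists>\<sigma>. inj_on \<sigma> J \<and> \<sigma> ` J \<subseteq> X \<and> (\<forall>i\<in>J. \<mu> i \<le> 2 * \<beta> (\<sigma> i))"
    by (rule counting_injection[where Q = Q and \<psi> = \<psi>, OF I lower upper J])
  then obtain \<sigma> where \<sigma>: "inj_on \<sigma> J" "\<sigma> ` J \<subseteq> X" "\<forall>i\<in>J. \<mu> i \<le> 2 * \<beta> (\<sigma> i)"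
    by (elim exE conjE)
  have fJ: "finite J" using I J finite_subset by blast
  have "(\<Sum>i\<in>I. \<mu> i powr q) = (\<Sum>i\<in>J. \<mu> i powr q)"
  proof (rule sum.mono_neutral_right[OF I J(1)])
    show "\<forall>i\<in>I - J. \<mu> i powr q = 0"
      using \<mu> by (force simp: J_def)
  qed
  also have "\<dots> \<le> (\<Sum>i\<in>J. 2 powr q * \<beta> (\<sigma> i) powr q)"
  proof (rule sum_mono)
    fix i assume i: "i \<in> J"
    then have "\<mu> i powr q \<le> (2 * \<beta> (\<sigma> i)) powr q"
      using \<sigma>(3) J(2)[OF i] q by (intro powr_mono2) auto
    then show "\<mu> i powr q \<le> 2 powr q * \<beta> (\<sigma> i) powr q" by (simp add: powr_mult)
  qed
  also have "\<dots> = 2 powr q * (\<Sum>x\<in>\<sigma> ` J. \<beta> x powr q)"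
    by (simp add: sum_distrib_left[symmetric] sum.reindex[OF \<sigma>(1)])
  also have "\<dots> \<le> 2 powr q * S"
    using S[of "\<sigma> ` J"] fJ \<sigma>(2) by (intro mult_left_mono) auto
  finally show ?thesis .
qed

section \<open>Spectral decomposition of positive forms\<close>

definition cdot :: "nat \<Rightarrow> (nat \<Rightarrow> complex) \<Rightarrow> (nat \<Rightarrow> complex) \<Rightarrow> complex" where
  "cdot N u v = (\<Sum>b<N. cnj (u b) * v b)"

definition gram_form :: "'a set \<Rightarrow> ('a \<Rightarrow> nat \<Rightarrow> complex) \<Rightarrow> nat \<Rightarrow> (nat \<Rightarrow> complex) \<Rightarrow> real" where
  "gram_form A z N v = (\<Sum>a\<in>A. (cmod (\<Sum>b<N. z a b * v b))\<^sup>2)"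

text \<open>
  Spectral decomposition of the positive matrix \<open>z\<^sup>* z\<close>, written with entries: eigenvalues l, and
  an eigenbasis u given by orthonormality, completeness and the expansion of \<open>z\<^sup>* z\<close>. The rows of
  z are indexed by an arbitrary finite set, because several blocks of rows are going to be
  stacked.
\<close>

definition eigsys :: "'a set \<Rightarrow> ('a \<Rightarrow> nat \<Rightarrow> complex) \<Rightarrow> nat \<Rightarrow> (nat \<Rightarrow> real) \<Rightarrow> (nat \<Rightarrow> nat \<Rightarrow> complex) \<Rightarrow> bool" where
  "eigsys A z N l u \<longleftrightarrow> (\<forall>i<N. 0 \<le> l i) \<and> (\<forall>i<N. \<forall>j<N. cdot N (u i) (u j) = of_bool (i = j)) \<and>
     (\<forall>b<N. \<forall>c<N. (\<Sum>i<N. u i b * cnj (u i c)) = of_bool (b = c)) \<and>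
     (\<forall>b<N. \<forall>c<N. (\<Sum>a\<in>A. cnj (z a b) * z a c) = (\<Sum>i<N. of_real (l i) * u i b * cnj (u i c)))"

lemma cmod_add_scaled_sq:
  "(cmod (x + \<zeta> * y))\<^sup>2 = (cmod x)\<^sup>2 + 2 * Re (cnj \<zeta> * (x * cnj y)) + (cmod \<zeta>)\<^sup>2 * (cmod y)\<^sup>2"
proof -
  have "complex_of_real ((cmod (x + \<zeta> * y))\<^sup>2) = (x + \<zeta> * y) * cnj (x + \<zeta> * y)"
    by (simp only: complex_norm_square)
  also have "\<dots> = x * cnj x + (cnj \<zeta> * (x * cnj y) + cnj (cnj \<zeta> * (x * cnj y))) + (\<zeta> * cnj \<zeta>) * (y * cnj y)"
    by (simp add: algebra_simps)
  also have "\<dots> = complex_of_real ((cmod x)\<^sup>2 + 2 * Re (cnj \<zeta> * (x * cnj y)) + (cmod \<zeta>)\<^sup>2 * (cmod y)\<^sup>2)"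
    by (simp only: complex_add_cnj complex_norm_square[symmetric] of_real_add of_real_mult)
  finally show ?thesis by (simp only: of_real_eq_iff)
qed

text \<open>
  The first-order condition at a maximum; a small positive multiple of s in the place of \<open>\<zeta>\<close> shows
  it.
\<close>

lemma critical_point:
  fixes s :: complex
  assumes "\<And>\<zeta>. 2 * Re (cnj \<zeta> * s) \<le> (cmod \<zeta>)\<^sup>2 * K"
  shows "s = 0"
proof (rule ccontr)
  assume s: "s \<noteq> 0"
  define e where "e = 1 / (\<bar>K\<bar> + 1)"
  have e: "e > 0" "e * K < 2" by (auto simp: e_def field_simps)
  have "cnj (of_real e * s) * s = of_real (e * (cmod s)\<^sup>2)"
    by (simp only: complex_cnj_mult complex_cnj_complex_of_real of_real_mult complex_norm_square)
       (simp add: mult_ac)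
  then have "2 * (e * (cmod s)\<^sup>2) \<le> (cmod (of_real e * s))\<^sup>2 * K"
    using assms[of "of_real e * s"] by (simp only: Re_complex_of_real)
  also have "\<dots> = (e * K) * (e * (cmod s)\<^sup>2)" using e by (simp add: norm_mult power2_eq_square)
  finally have "2 * (e * (cmod s)\<^sup>2) \<le> (e * K) * (e * (cmod s)\<^sup>2)" .
  moreover have "e * (cmod s)\<^sup>2 > 0" using e s by simp
  ultimately show False using e(2) by (simp add: mult_le_cancel_right)
qed

lemma cmod_sq_sum: "of_real (\<Sum>b<N. (cmod (v b))\<^sup>2) = cdot N v v"
  unfolding cdot_def of_real_sum complex_norm_square by (simp add: mult.commute)

lemma cdot_cnj: "cnj (cdot N u v) = cdot N v u"
  by (simp add: cdot_def mult.commute)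

lemma cdot_sum_right: "cdot N u (\<lambda>b. \<Sum>i\<in>I. c i * v i b) = (\<Sum>i\<in>I. c i * cdot N u (v i))"
  unfolding cdot_def sum_distrib_left by (subst sum.swap) (simp add: mult_ac)

text \<open>
  The maximum exists because the unit vectors orthogonal to the given ones form a nonempty closed
  part of a compact product of unit discs. The vectors are functions on all of \<open>nat\<close>; the values
  from N on do not enter the form, and are only kept within the discs.
\<close>

lemma gram_form_maximum:
  assumes n: "n < N"
  obtains w where "\<And>j. j < n \<Longrightarrow> cdot N (u j) w = 0" "(\<Sum>b<N. (cmod (w b))\<^sup>2) = 1"
    "\<And>v. (\<And>j. j < n \<Longrightarrow> cdot N (u j) v = 0) \<Longrightarrow>
        gram_form A z N v \<le> gram_form A z N w * (\<Sum>b<N. (cmod (v b))\<^sup>2)"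
proof -
  define K where "K = PiE UNIV (\<lambda>i::nat. cball (0::complex) 1)"
  define C where "C = {v. \<forall>j\<in>{..<n}. cdot N (u j) v = 0} \<inter> {v. (\<Sum>b<N. (cmod (v b))\<^sup>2) = 1}"
  have coord: "continuous_on S (\<lambda>v. v i)" for S :: "(nat \<Rightarrow> complex) set" and i
    by (rule continuous_on_subset[OF continuous_on_product_coordinates]) auto
  have "compactin (product_topology (\<lambda>_. euclidean) UNIV) K"
    unfolding K_def by (subst compactin_PiE) auto
  then have "compact K" by (simp add: euclidean_product_topology)
  moreover have "closed C"
  proof -
    have "{v. \<forall>j\<in>{..<n}. cdot N (u j) v = 0} = (\<Inter>j<n. {v. cdot N (u j) v = 0})" by auto
    moreover have "closed {v. cdot N (u j) v = 0}" for j
      unfolding cdot_def by (intro closed_Collect_eq continuous_intros coord)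
    moreover have "closed {v. (\<Sum>b<N. (cmod (v b))\<^sup>2) = 1}"
      by (intro closed_Collect_eq continuous_intros coord)
    ultimately show ?thesis unfolding C_def by (simp add: closed_Int closed_INT)
  qed
  ultimately have comp: "compact (K \<inter> C)" by (rule compact_Int_closed)
  have scale: "(\<lambda>b. if b < N then v b / of_real (sqrt (\<Sum>b<N. (cmod (v b))\<^sup>2)) else 0) \<in> K \<inter> C"
    if v: "\<And>j. j < n \<Longrightarrow> cdot N (u j) v = 0" "(\<Sum>b<N. (cmod (v b))\<^sup>2) > 0" for v
  proof -
    let ?s = "\<Sum>b<N. (cmod (v b))\<^sup>2"
    let ?w = "\<lambda>b. if b < N then v b / of_real (sqrt ?s) else 0"
    have "cdot N (u j) ?w = 0" if "j < n" for j
      using v(1)[OF that] by (simp add: cdot_def sum_divide_distrib[symmetric])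
    moreover have "(\<Sum>b<N. (cmod (?w b))\<^sup>2) = 1"
      using v(2) by (simp add: norm_divide power_divide sum_divide_distrib[symmetric])
    moreover have "cmod (?w b) \<le> 1" for b
    proof (cases "b < N")
      case True
      have "(cmod (v b))\<^sup>2 \<le> ?s" using True by (intro member_le_sum[of b "{..<N}" "\<lambda>b. (cmod (v b))\<^sup>2"]) auto
      then have "cmod (v b) \<le> sqrt ?s" by (rule real_le_rsqrt)
      then show ?thesis using True v(2) by (simp add: norm_divide)
    qed auto
    ultimately show ?thesis by (auto simp: K_def C_def PiE_def Pi_def extensional_def)
  qed
  obtain c where c: "\<exists>i\<in>{..<N}. c i \<noteq> 0" "\<forall>y\<in>{..<n}. (\<Sum>i<N. cnj (u y i) * c i) = 0"
    using nontrivial_solution[of "{..<n}" "{..<N}" "\<lambda>y i. cnj (u y i)"] n by auto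
  have "(\<Sum>b<N. (cmod (c b))\<^sup>2) > 0" using c(1) by (auto intro: sum_pos2)
  then have ne: "K \<inter> C \<noteq> {}" using scale[of c] c(2) by (auto simp: cdot_def)
  have "continuous_on (K \<inter> C) (gram_form A z N)"
    unfolding gram_form_def by (intro continuous_intros coord)
  from continuous_attains_sup[OF comp ne this] obtain w where w: "w \<in> K \<inter> C"
    "\<And>v. v \<in> K \<inter> C \<Longrightarrow> gram_form A z N v \<le> gram_form A z N w" by blast
  show ?thesis
  proof (rule that)
    show "cdot N (u j) w = 0" if "j < n" for j using w(1) that by (auto simp: C_def)
    show "(\<Sum>b<N. (cmod (w b))\<^sup>2) = 1" using w(1) by (auto simp: C_def)
    fix v assume v: "\<And>j. j < n \<Longrightarrow> cdot N (u j) v = 0"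
    let ?s = "\<Sum>b<N. (cmod (v b))\<^sup>2"
    show "gram_form A z N v \<le> gram_form A z N w * ?s"
    proof (cases "?s > 0")
      case True
      let ?w = "\<lambda>b. if b < N then v b / of_real (sqrt ?s) else 0"
      have "gram_form A z N ?w = gram_form A z N v / ?s"
        using True by (simp add: gram_form_def sum_divide_distrib[symmetric] norm_divide power_divide)
      then have "gram_form A z N v = gram_form A z N ?w * ?s" using True by simp
      also have "\<dots> \<le> gram_form A z N w * ?s"
        using w(2)[OF scale[OF v True]] True by (intro mult_right_mono) auto
      finally show ?thesis .
    next
      case False
      then have s0: "?s = 0" using sum_nonneg[of "{..<N}" "\<lambda>b. (cmod (v b))\<^sup>2"] by simp
      then have "\<forall>b<N. v b = 0" by (simp add: sum_nonneg_eq_0_iff)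
      then show ?thesis using s0 by (simp add: gram_form_def)
    qed
  qed
qed

text \<open>
  The eigenvectors are successive maximisers of the form on the orthogonal complement of the
  previous ones; the first-order condition says that such a maximiser is orthogonal, for the
  sesquilinear form S as well, to everything that is orthogonal to it and to the previous ones.
\<close>

lemma eigsys_exists:
  assumes "finite A"
  shows "\<exists>l u. eigsys A z N l u"
proof -
  define Z where "Z v a = (\<Sum>b<N. z a b * v b)" for v a
  define S where "S v w = (\<Sum>a\<in>A. Z v a * cnj (Z w a))" for v w
  have Zadd: "Z (\<lambda>b. v b + \<zeta> * w b) a = Z v a + \<zeta> * Z w a" for v w \<zeta> a
    by (simp add: Z_def algebra_simps sum.distrib sum_distrib_left)
  have Qadd: "gram_form A z N (\<lambda>b. v b + \<zeta> * w b) =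
     gram_form A z N v + 2 * Re (cnj \<zeta> * S v w) + (cmod \<zeta>)\<^sup>2 * gram_form A z N w" for v w \<zeta>
  proof -
    have "gram_form A z N v = (\<Sum>a\<in>A. (cmod (Z v a))\<^sup>2)" for v
      by (simp add: gram_form_def Z_def)
    then show ?thesis
      by (simp add: Zadd cmod_add_scaled_sq S_def sum.distrib sum_distrib_left Re_sum)
  qed
  have Nadd: "(\<Sum>b<N. (cmod (v b + \<zeta> * w b))\<^sup>2) = (\<Sum>b<N. (cmod (v b))\<^sup>2) + (cmod \<zeta>)\<^sup>2 * (\<Sum>b<N. (cmod (w b))\<^sup>2)"
    if "cdot N v w = 0" for v w \<zeta>
  proof -
    have "(\<Sum>b<N. v b * cnj (w b)) = 0"
      using arg_cong[OF that, of cnj] by (simp add: cdot_def)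
    then have "(\<Sum>b<N. Re (cnj \<zeta> * (v b * cnj (w b)))) = 0"
      unfolding Re_sum[symmetric] sum_distrib_left[symmetric] by simp
    then show ?thesis
      unfolding cmod_add_scaled_sq sum.distrib sum_distrib_left[symmetric] by simp
  qed
  have "\<exists>u. (\<forall>i<n. \<forall>j<n. cdot N (u i) (u j) = of_bool (i = j)) \<and>
     (\<forall>i<n. \<forall>w. (\<forall>j\<le>i. cdot N (u j) w = 0) \<longrightarrow> S (u i) w = 0)" if "n \<le> N" for n
    using that
  proof (induction n)
    case (Suc n)
    then obtain u where u0: "\<forall>i<n. \<forall>j<n. cdot N (u i) (u j) = of_bool (i = j)"
      "\<forall>i<n. \<forall>w. (\<forall>j\<le>i. cdot N (u j) w = 0) \<longrightarrow> S (u i) w = 0" using Suc_leD by blast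
    have u: "\<And>i j. i < n \<Longrightarrow> j < n \<Longrightarrow> cdot N (u i) (u j) = of_bool (i = j)"
      "\<And>i w. i < n \<Longrightarrow> (\<forall>j\<le>i. cdot N (u j) w = 0) \<Longrightarrow> S (u i) w = 0" using u0 by blast+
    from Suc.prems have "n < N" by simp
    then obtain w where w: "\<And>j. j < n \<Longrightarrow> cdot N (u j) w = 0" "(\<Sum>b<N. (cmod (w b))\<^sup>2) = 1"
      "\<And>v. (\<And>j. j < n \<Longrightarrow> cdot N (u j) v = 0) \<Longrightarrow>
        gram_form A z N v \<le> gram_form A z N w * (\<Sum>b<N. (cmod (v b))\<^sup>2)"
      using gram_form_maximum[of n N u A z] by blast
    have ww: "cdot N w w = 1" using cmod_sq_sum[where N = N and v = w] w(2) by simp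
    have crit: "S w x = 0" if x: "\<And>j. j < n \<Longrightarrow> cdot N (u j) x = 0" "cdot N w x = 0" for x
    proof (rule critical_point)
      fix \<zeta>
      have "cdot N (u j) (\<lambda>b. w b + \<zeta> * x b) = 0" if "j < n" for j
      proof -
        have "cdot N (u j) (\<lambda>b. w b + \<zeta> * x b) = cdot N (u j) w + \<zeta> * cdot N (u j) x"
          by (simp add: cdot_def algebra_simps sum.distrib sum_distrib_left)
        then show ?thesis using that x w by simp
      qed
      from w(3)[OF this]
      show "2 * Re (cnj \<zeta> * S w x) \<le> (cmod \<zeta>)\<^sup>2 *
         (gram_form A z N w * (\<Sum>b<N. (cmod (x b))\<^sup>2) - gram_form A z N x)"
        using Qadd[of w \<zeta> x] Nadd[OF x(2), of \<zeta>] w(2) by (simp add: algebra_simps)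
    qed
    define u' where "u' = u(n := w)"
    have "cdot N (u' i) (u' j) = of_bool (i = j)" if "i < Suc n" "j < Suc n" for i j
      using that u(1)[of i j] w(1)[of i] w(1)[of j] ww cdot_cnj[of N "u j" w]
      by (cases "i = n"; cases "j = n") (auto simp: u'_def)
    moreover have "S (u' i) x = 0" if "i < Suc n" "\<forall>j\<le>i. cdot N (u' j) x = 0" for i x
    proof (cases "i = n")
      case True
      have "cdot N (u j) x = 0" if "j < n" for j
        using \<open>\<forall>j\<le>i. cdot N (u' j) x = 0\<close>[rule_format, of j] that True by (simp add: u'_def)
      moreover have "cdot N w x = 0" using that(2)[rule_format, of n] True by (simp add: u'_def)
      ultimately show ?thesis using crit True by (simp add: u'_def)
    next
      case False
      then have i: "i < n" using that by simp
      have "\<forall>j\<le>i. cdot N (u j) x = 0" using that(2) i by (force simp: u'_def)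
      then show ?thesis using u(2)[OF i] False by (simp add: u'_def)
    qed
    ultimately show ?case by blast
  qed auto
  then obtain u where u0: "\<forall>i<N. \<forall>j<N. cdot N (u i) (u j) = of_bool (i = j)"
      "\<forall>i<N. \<forall>w. (\<forall>j\<le>i. cdot N (u j) w = 0) \<longrightarrow> S (u i) w = 0" by blast
  have u: "\<And>i j. i < N \<Longrightarrow> j < N \<Longrightarrow> cdot N (u i) (u j) = of_bool (i = j)"
      "\<And>i w. i < N \<Longrightarrow> (\<forall>j\<le>i. cdot N (u j) w = 0) \<Longrightarrow> S (u i) w = 0" using u0 by blast+
  \<comment> \<open>completeness: the left inverse of a square matrix is a right inverse\<close>
  have compl: "(\<Sum>i<N. u i b * cnj (u i c)) = of_bool (b = c)" if "b < N" "c < N" for b c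
  proof -
    define W where "W = Matrix.mat N N (\<lambda>(i, b). cnj (u i b))"
    define W' where "W' = Matrix.mat N N (\<lambda>(b, i). u i b)"
    have c: "W \<in> carrier_mat N N" "W' \<in> carrier_mat N N" by (auto simp: W_def W'_def)
    have "W * W' = 1\<^sub>m N"
    proof (rule eq_matI)
      fix i j assume "i < dim_row (1\<^sub>m N :: complex mat)" "j < dim_col (1\<^sub>m N :: complex mat)"
      then have ij: "i < N" "j < N" by auto
      then show "(W * W') $$ (i, j) = 1\<^sub>m N $$ (i, j)"
        using u(1)[OF ij] by (simp add: mat_mult_index[OF c ij]) (auto simp: W_def W'_def cdot_def)
    qed (use c in auto)
    then have "W' * W = 1\<^sub>m N" using mat_mult_left_right_inverse[OF c] by simp
    then have "(W' * W) $$ (b, c) = of_bool (b = c)" using that by simp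
    then show ?thesis using that by (simp add: mat_mult_index[OF c(2,1) that]) (auto simp: W_def W'_def)
  qed
  define l where "l i = gram_form A z N (u i)" for i
  have Sij: "S (u i) (u j) = (if i = j then of_real (l i) else 0)" if "i < N" "j < N" for i j
  proof -
    have 1: "S (u i) (u j) = 0" if "i < j" "j < N" for i j
      using that by (intro u(2)) (auto simp: u(1))
    have 2: "S (u j) (u i) = cnj (S (u i) (u j))" by (simp add: S_def mult.commute)
    have 3: "S (u i) (u i) = of_real (l i)"
      by (simp add: S_def l_def gram_form_def Z_def complex_norm_square del: of_real_power)
    show ?thesis using 1[of i j] 1[of j i] 2 3 that by (cases i j rule: linorder_cases) auto
  qed
  have z: "z a c = (\<Sum>i<N. Z (u i) a * cnj (u i c))" if "c < N" for a c
  proof -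
    have "(\<Sum>i<N. Z (u i) a * cnj (u i c)) = (\<Sum>b<N. z a b * (\<Sum>i<N. u i b * cnj (u i c)))"
      unfolding Z_def sum_distrib_left sum_distrib_right by (subst sum.swap) (simp add: mult_ac)
    also have "\<dots> = (\<Sum>b<N. z a b * of_bool (b = c))" using compl that by simp
    also have "\<dots> = z a c" using that by (simp add: of_bool_def if_distrib[of "\<lambda>x. _ * x"] cong: if_cong)
    finally show ?thesis by simp
  qed
  have "(\<Sum>a\<in>A. cnj (z a b) * z a c) = (\<Sum>i<N. of_real (l i) * u i b * cnj (u i c))"
    if bc: "b < N" "c < N" for b c
  proof -
    have "(\<Sum>a\<in>A. cnj (z a b) * z a c) =
       (\<Sum>a\<in>A. (\<Sum>j<N. cnj (Z (u j) a) * u j b) * (\<Sum>i<N. Z (u i) a * cnj (u i c)))"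
      by (subst (1 2) z) (use bc in auto)
    also have "\<dots> = (\<Sum>a\<in>A. \<Sum>j<N. \<Sum>i<N. u j b * cnj (u i c) * (Z (u i) a * cnj (Z (u j) a)))"
      by (simp add: sum_product mult_ac)
    also have "\<dots> = (\<Sum>j<N. \<Sum>i<N. u j b * cnj (u i c) * S (u i) (u j))"
      unfolding S_def sum_distrib_left by (subst sum.swap) (intro sum.cong refl sum.swap)
    also have "\<dots> = (\<Sum>j<N. \<Sum>i<N. if i = j then u j b * cnj (u i c) * of_real (l i) else 0)"
      by (intro sum.cong refl) (simp add: Sij)
    also have "\<dots> = (\<Sum>i<N. of_real (l i) * u i b * cnj (u i c))"
      by (simp add: mult_ac)
    finally show ?thesis .
  qed
  moreover have "l i \<ge> 0" for i by (simp add: l_def gram_form_def sum_nonneg)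
  ultimately have "eigsys A z N l u" unfolding eigsys_def using u(1) compl by auto
  then show ?thesis by blast
qed

lemma eigsys_parseval:
  assumes "eigsys A z N l u"
  shows "(\<Sum>i<N. (cmod (cdot N (u i) v))\<^sup>2) = (\<Sum>b<N. (cmod (v b))\<^sup>2)"
proof -
  have "complex_of_real (\<Sum>i<N. (cmod (cdot N (u i) v))\<^sup>2) = (\<Sum>i<N. cdot N (u i) v * cnj (cdot N (u i) v))"
    by (simp only: of_real_sum complex_norm_square)
  also have "\<dots> = (\<Sum>i<N. \<Sum>b<N. \<Sum>c<N. v b * cnj (v c) * (u i c * cnj (u i b)))"
    unfolding cdot_def by (simp add: sum_product mult_ac)
  also have "\<dots> = (\<Sum>b<N. \<Sum>c<N. v b * cnj (v c) * (\<Sum>i<N. u i c * cnj (u i b)))"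
    unfolding sum_distrib_left by (subst sum.swap) (intro sum.cong refl sum.swap)
  also have "\<dots> = (\<Sum>b<N. \<Sum>c<N. if c = b then v b * cnj (v c) else 0)"
    using assms by (intro sum.cong refl) (auto simp: eigsys_def)
  also have "\<dots> = (\<Sum>b<N. v b * cnj (v b))" by simp
  also have "\<dots> = of_real (\<Sum>b<N. (cmod (v b))\<^sup>2)" by (simp only: of_real_sum complex_norm_square)
  finally show ?thesis by (simp only: of_real_eq_iff)
qed

lemma eigsys_form:
  assumes "eigsys A z N l u"
  shows "gram_form A z N v = (\<Sum>i<N. l i * (cmod (cdot N (u i) v))\<^sup>2)"
proof -
  have "complex_of_real (gram_form A z N v) = (\<Sum>a\<in>A. (\<Sum>b<N. z a b * v b) * cnj (\<Sum>b<N. z a b * v b))"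
    by (simp only: gram_form_def of_real_sum complex_norm_square)
  also have "\<dots> = (\<Sum>a\<in>A. \<Sum>c<N. \<Sum>b<N. v c * cnj (v b) * (cnj (z a b) * z a c))"
    by (simp add: sum_product mult_ac)
  also have "\<dots> = (\<Sum>c<N. \<Sum>b<N. v c * cnj (v b) * (\<Sum>a\<in>A. cnj (z a b) * z a c))"
    unfolding sum_distrib_left by (subst sum.swap) (intro sum.cong refl sum.swap)
  also have "\<dots> = (\<Sum>c<N. \<Sum>b<N. v c * cnj (v b) * (\<Sum>i<N. of_real (l i) * u i b * cnj (u i c)))"
    using assms by (intro sum.cong refl) (auto simp: eigsys_def)
  also have "\<dots> = (\<Sum>i<N. \<Sum>c<N. \<Sum>b<N. v c * cnj (v b) * (of_real (l i) * u i b * cnj (u i c)))"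
    unfolding sum_distrib_left by (subst (2) sum.swap) (intro sum.cong refl sum.swap)
  also have "\<dots> = (\<Sum>i<N. of_real (l i) * (cdot N (u i) v * cnj (cdot N (u i) v)))"
    unfolding cdot_def cnj_sum complex_cnj_mult complex_cnj_cnj
    by (intro sum.cong refl) (simp add: sum_product sum_distrib_left mult_ac, rule sum.swap)
  also have "\<dots> = of_real (\<Sum>i<N. l i * (cmod (cdot N (u i) v))\<^sup>2)"
    by (simp only: of_real_sum of_real_mult complex_norm_square)
  finally show ?thesis by (simp only: of_real_eq_iff)
qed

lemma eigsysD:
  assumes "eigsys A z N l u"
  shows "i < N \<Longrightarrow> 0 \<le> l i" "i < N \<Longrightarrow> j < N \<Longrightarrow> cdot N (u i) (u j) = of_bool (i = j)"
  "i < N \<Longrightarrow> (\<Sum>b<N. (cmod (u i b))\<^sup>2) = 1"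
proof -
  show "i < N \<Longrightarrow> 0 \<le> l i" "i < N \<Longrightarrow> j < N \<Longrightarrow> cdot N (u i) (u j) = of_bool (i = j)" for i j
    using assms by (auto simp: eigsys_def)
  assume "i < N"
  then have "cdot N (u i) (u i) = 1" using assms by (auto simp: eigsys_def)
  then show "(\<Sum>b<N. (cmod (u i b))\<^sup>2) = 1" using cmod_sq_sum[of "u i" N] by (simp only: of_real_eq_1_iff)
qed

section \<open>Gain from partial traces\<close>

lemma powr_tangent_le:
  fixes x y q :: real
  assumes "0 \<le> x" "0 < y" "0 < q" "q \<le> 1"
  shows "x powr q \<le> y powr q + q * y powr (q - 1) * (x - y)"
proof (cases "x = 0")
  case True
  have "y powr (q - 1) * y = y powr q" using assms by (simp add: powr_mult_base mult.commute)
  then have "y powr q + q * y powr (q - 1) * (x - y) = (1 - q) * y powr q" using True by (simp add: algebra_simps)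
  then show ?thesis using True assms by simp
next
  case False
  have "(x / y) powr q * 1 powr (1 - q) \<le> q * (x / y) + (1 - q) * 1"
    by (rule Youngs_inequality_0) (use assms False in auto)
  then have "y powr q * (x / y) powr q \<le> y powr q * (q * (x / y) + (1 - q))"
    using assms by (intro mult_left_mono) auto
  moreover have "y powr q * (x / y) powr q = x powr q" using assms by (simp add: powr_divide)
  moreover have "y powr q = y * y powr (q - 1)" using assms by (simp add: powr_mult_base)
  then have "y powr q * (q * (x / y) + (1 - q)) = y powr q + q * y powr (q - 1) * (x - y)"
    using assms by (simp add: field_simps)
  ultimately show ?thesis by simp
qed

lemma powr_tangent_ge:
  fixes x y q :: real
  assumes "0 \<le> x" "0 < y" "1 \<le> q"
  shows "y powr q + q * y powr (q - 1) * (x - y) \<le> x powr q"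
proof (cases "x = 0")
  case True
  have "y powr (q - 1) * y = y powr q" using assms by (simp add: powr_mult_base mult.commute)
  then have "y powr q + q * y powr (q - 1) * (x - y) = (1 - q) * y powr q" using True by (simp add: algebra_simps)
  also have "\<dots> \<le> 0" using assms by (intro mult_nonpos_nonneg) auto
  finally show ?thesis using True assms by simp
next
  case False
  have "((x / y) powr q) powr (1 / q) * 1 powr (1 - 1 / q) \<le> (1 / q) * (x / y) powr q + (1 - 1 / q) * 1"
    by (rule Youngs_inequality_0) (use assms False in auto)
  then have "x / y \<le> (1 / q) * (x / y) powr q + (1 - 1 / q)"
    using assms by (simp add: powr_powr)
  then have "q * (x / y) \<le> q * ((1 / q) * (x / y) powr q + (1 - 1 / q))"
    using assms by (intro mult_left_mono) auto
  then have "q * (x / y) + (1 - q) \<le> (x / y) powr q" using assms by (simp add: algebra_simps)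
  then have "y powr q * (q * (x / y) + (1 - q)) \<le> y powr q * (x / y) powr q"
    using assms by (intro mult_left_mono) auto
  moreover have "y powr q * (x / y) powr q = x powr q" using assms by (simp add: powr_divide)
  moreover have "y powr q = y * y powr (q - 1)" using assms by (simp add: powr_mult_base)
  then have "y powr q * (q * (x / y) + (1 - q)) = y powr q + q * y powr (q - 1) * (x - y)"
    using assms by (simp add: field_simps)
  ultimately show ?thesis by simp
qed

text \<open>
  Jensen's inequality for weights of arbitrary total mass: sum the tangent inequality at the mean
  value y.
\<close>

lemma powr_jensen_le:
  fixes p x :: "'a \<Rightarrow> real"
  assumes X: "finite X" and p: "\<And>i. i \<in> X \<Longrightarrow> 0 \<le> p i" and x: "\<And>i. i \<in> X \<Longrightarrow> 0 \<le> x i"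
    and q: "0 < q" "q \<le> 1"
  shows "(\<Sum>i\<in>X. p i * x i powr q) \<le> (\<Sum>i\<in>X. p i) powr (1 - q) * (\<Sum>i\<in>X. p i * x i) powr q"
proof -
  let ?W = "\<Sum>i\<in>X. p i" and ?S = "\<Sum>i\<in>X. p i * x i"
  have S0: "?S \<ge> 0" and W0: "?W \<ge> 0" using p x by (auto intro: sum_nonneg)
  show ?thesis
  proof (cases "?S = 0")
    case True
    then have "\<forall>i\<in>X. p i * x i = 0" using X p x by (subst (asm) sum_nonneg_eq_0_iff) auto
    then have "(\<Sum>i\<in>X. p i * x i powr q) = 0" by (intro sum.neutral) auto
    then show ?thesis by simp
  next
    case False
    then have S: "?S > 0" using S0 by simp
    have "?W \<noteq> 0"
    proof
      assume "?W = 0"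
      then have "\<forall>i\<in>X. p i = 0" using X p by (subst (asm) sum_nonneg_eq_0_iff) auto
      then show False using S by simp
    qed
    then have W: "?W > 0" using W0 by simp
    define y where "y = ?S / ?W"
    have y: "y > 0" using S W by (simp add: y_def)
    have "(\<Sum>i\<in>X. p i * x i powr q) \<le> (\<Sum>i\<in>X. p i * (y powr q + q * y powr (q - 1) * (x i - y)))"
      using p x y q by (intro sum_mono mult_left_mono powr_tangent_le) auto
    also have "\<dots> = ?W * y powr q + q * y powr (q - 1) * (?S - ?W * y)"
      by (simp add: algebra_simps sum.distrib sum_distrib_left sum_distrib_right sum_subtractf)
    also have "\<dots> = ?W * y powr q" using W by (simp add: y_def)
    also have "\<dots> = ?W powr 1 * (?S powr q / ?W powr q)" using W S by (simp add: y_def powr_divide)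
    also have "\<dots> = ?W powr (1 - q) * ?S powr q" by (simp only: powr_diff) simp
    finally show ?thesis .
  qed
qed

lemma powr_jensen_ge:
  fixes p x :: "'a \<Rightarrow> real"
  assumes X: "finite X" and p: "\<And>i. i \<in> X \<Longrightarrow> 0 \<le> p i" and x: "\<And>i. i \<in> X \<Longrightarrow> 0 \<le> x i"
    and q: "1 \<le> q"
  shows "(\<Sum>i\<in>X. p i * x i) powr q \<le> (\<Sum>i\<in>X. p i) powr (q - 1) * (\<Sum>i\<in>X. p i * x i powr q)"
proof -
  let ?W = "\<Sum>i\<in>X. p i" and ?S = "\<Sum>i\<in>X. p i * x i"
  have S0: "?S \<ge> 0" and W0: "?W \<ge> 0" using p x by (auto intro: sum_nonneg)
  show ?thesis
  proof (cases "?S = 0")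
    case True
    then show ?thesis using p by (auto intro!: mult_nonneg_nonneg sum_nonneg)
  next
    case False
    then have S: "?S > 0" using S0 by simp
    have "?W \<noteq> 0"
    proof
      assume "?W = 0"
      then have "\<forall>i\<in>X. p i = 0" using X p by (subst (asm) sum_nonneg_eq_0_iff) auto
      then show False using S by simp
    qed
    then have W: "?W > 0" using W0 by simp
    define y where "y = ?S / ?W"
    have y: "y > 0" using S W by (simp add: y_def)
    have "?S powr q = ?W powr (q - 1) * (?W * y powr q)"
    proof -
      have "?W * y powr q = ?W powr 1 * (?S powr q / ?W powr q)" using W S by (simp add: y_def powr_divide)
      also have "\<dots> = ?S powr q / ?W powr (q - 1)" using W by (simp add: powr_diff)
      finally show ?thesis using W by simp
    qed
    also have "?W * y powr q = ?W * y powr q + q * y powr (q - 1) * (?S - ?W * y)" using W by (simp add: y_def)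
    also have "\<dots> = (\<Sum>i\<in>X. p i * (y powr q + q * y powr (q - 1) * (x i - y)))"
      by (simp add: algebra_simps sum.distrib sum_distrib_left sum_distrib_right sum_subtractf)
    also have "?W powr (q - 1) * \<dots> \<le> ?W powr (q - 1) * (\<Sum>i\<in>X. p i * x i powr q)"
      using p x y q by (intro sum_mono mult_left_mono powr_tangent_ge) auto
    finally show ?thesis .
  qed
qed

text \<open>
  The vector \<open>v \<otimes> e\<^sub>s\<close>, where the second tensor factor has dimension r.
\<close>

definition slot :: "nat \<Rightarrow> nat \<Rightarrow> (nat \<Rightarrow> complex) \<Rightarrow> nat \<Rightarrow> complex" where
  "slot r s v = (\<lambda>m. if m mod r = s then v (m div r) else 0)"

lemma sum_slot: "s < r \<Longrightarrow> (\<Sum>m<N * r. g m * slot r s v m) = (\<Sum>b<N. g (b * r + s) * v b)"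
  unfolding sum_nat_prod
  by (intro sum.cong refl) (simp add: slot_def if_distrib[of "\<lambda>c. _ * c"] sum.delta cong: if_cong)

lemma norm_slot: "s < r \<Longrightarrow> (\<Sum>m<N * r. (cmod (slot r s v m))\<^sup>2) = (\<Sum>b<N. (cmod (v b))\<^sup>2)"
  unfolding sum_nat_prod
  by (intro sum.cong refl) (simp add: slot_def if_distrib[of "\<lambda>c. (cmod c)\<^sup>2"] sum.delta cong: if_cong)

lemma eigsys_member:
  assumes "eigsys A z N l u" "i < N"
  shows "gram_form A z N (u i) = l i"
proof -
  have "gram_form A z N (u i) = (\<Sum>j<N. if j = i then l i else 0)"
    unfolding eigsys_form[OF assms(1)] using eigsysD(2)[OF assms(1) _ assms(2)]
    by (intro sum.cong refl) (auto simp: of_bool_def)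
  then show ?thesis using assms(2) by simp
qed

text \<open>
  The second system diagonalises \<open>v \<mapsto> \<Sum>\<^sub>s \<parallel>D (v \<otimes> e\<^sub>s)\<parallel>\<^sup>2\<close>, which is r times the form of the
  partial trace of \<open>D\<^sup>* D\<close>. Each \<open>\<nu> n\<close> is a mixture of the l i with the coefficients \<open>p n s i\<close>,
  whose sum over i is 1, and whose sum over both n and s is 1. For \<open>q \<ge> 1\<close> Jensen's inequality for
  the mixture, of mass r, gives the claim.

  For \<open>q \<le> 1\<close> the inequality for the mixture goes the wrong way. Instead, \<open>\<nu> n powr q\<close> is
  distributed over the pairs (s, i) in proportion to their shares \<open>h n s i = l i * p n s i / \<nu> n\<close>
  of the eigenvalue, and Jensen's inequality is applied in n; it needs that these shares have mass
  at most 1 in n.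
\<close>

lemma partial_form_gain:
  fixes D :: "'a \<Rightarrow> nat \<Rightarrow> complex"
  assumes finA: "finite A" and l: "eigsys A D (N * r) l u"
    and \<nu>: "eigsys (A \<times> {..<r}) (\<lambda>(a, s) b. D a (b * r + s)) N \<nu> w" and q: "q > 0"
  shows "(\<Sum>n<N. \<nu> n powr q) \<le> real r powr \<bar>q - 1\<bar> * (\<Sum>i<N * r. l i powr q)"
proof -
  let ?P = "gram_form (A \<times> {..<r}) (\<lambda>(a, s) b. D a (b * r + s)) N"
  let ?X = "{..<r} \<times> {..<N * r}"
  define us where "us s i = (\<lambda>b. u i (b * r + s))" for s i
  define p where "p n s i = (cmod (cdot N (us s i) (w n)))\<^sup>2" for n s i
  have lpos: "l i \<ge> 0" if "i < N * r" for i using eigsysD(1)[OF l] that by simp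
  have \<nu>pos: "\<nu> n \<ge> 0" if "n < N" for n using eigsysD(1)[OF \<nu>] that by simp
  have ppos: "p n s i \<ge> 0" for n s i by (simp add: p_def)
  have P: "?P v = (\<Sum>s<r. \<Sum>i<N * r. l i * (cmod (cdot N (us s i) v))\<^sup>2)" for v
  proof -
    have "?P v = (\<Sum>a\<in>A. \<Sum>s<r. (cmod (\<Sum>b<N. D a (b * r + s) * v b))\<^sup>2)"
      unfolding gram_form_def by (subst sum.cartesian_product) (auto intro: sum.cong)
    also have "\<dots> = (\<Sum>s<r. gram_form A D (N * r) (slot r s v))"
      unfolding gram_form_def by (subst sum.swap) (intro sum.cong refl, simp add: sum_slot)
    also have "\<dots> = (\<Sum>s<r. \<Sum>i<N * r. l i * (cmod (cdot N (us s i) v))\<^sup>2)"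
      unfolding eigsys_form[OF l] by (intro sum.cong refl) (simp add: cdot_def us_def sum_slot)
    finally show ?thesis .
  qed
  have \<nu>_eq: "\<nu> n = (\<Sum>x\<in>?X. p n (fst x) (snd x) * l (snd x))" if "n < N" for n
  proof -
    have "\<nu> n = (\<Sum>s<r. \<Sum>i<N * r. p n s i * l i)"
      using eigsys_member[OF \<nu> that] P[of "w n"] by (simp add: p_def mult.commute)
    then show ?thesis by (simp add: sum.cartesian_product case_prod_unfold)
  qed
  have p1: "(\<Sum>i<N * r. p n s i) = 1" if "n < N" "s < r" for n s
  proof -
    have "(\<Sum>i<N * r. p n s i) = (\<Sum>i<N * r. (cmod (cdot (N * r) (u i) (slot r s (w n))))\<^sup>2)"
      using that by (intro sum.cong refl) (simp add: p_def cdot_def us_def sum_slot)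
    also have "\<dots> = (\<Sum>m<N * r. (cmod (slot r s (w n) m))\<^sup>2)" by (rule eigsys_parseval[OF l])
    also have "\<dots> = 1" using that eigsysD(3)[OF \<nu>] by (simp add: norm_slot)
    finally show ?thesis .
  qed
  define \<pi> where "\<pi> s i = (\<Sum>b<N. (cmod (us s i b))\<^sup>2)" for s i
  have p2: "(\<Sum>n<N. p n s i) = \<pi> s i" for s i
  proof -
    have "p n s i = (cmod (cdot N (w n) (us s i)))\<^sup>2" for n
      unfolding p_def cdot_cnj[of N "w n", symmetric] by simp
    then show ?thesis using eigsys_parseval[OF \<nu>, of "us s i"] by (simp add: \<pi>_def)
  qed
  have \<pi>1: "(\<Sum>s<r. \<pi> s i) = 1" if "i < N * r" for i
  proof -
    have "(\<Sum>s<r. \<pi> s i) = (\<Sum>b<N. \<Sum>s<r. (cmod (u i (b * r + s)))\<^sup>2)"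
      unfolding \<pi>_def us_def by (rule sum.swap)
    also have "\<dots> = (\<Sum>m<N * r. (cmod (u i m))\<^sup>2)" by (rule sum_nat_prod[symmetric])
    finally show ?thesis using eigsysD(3)[OF l that] by simp
  qed
  show ?thesis
  proof (cases "q \<ge> 1")
    case True
    have W: "(\<Sum>x\<in>?X. p n (fst x) (snd x)) = real r" if "n < N" for n
    proof -
      have "(\<Sum>x\<in>?X. p n (fst x) (snd x)) = (\<Sum>s<r. \<Sum>i<N * r. p n s i)"
        by (simp add: sum.cartesian_product case_prod_unfold)
      also have "\<dots> = (\<Sum>s<r. 1)" using p1[OF that] by (intro sum.cong) auto
      finally show ?thesis by simp
    qed
    have "(\<Sum>n<N. \<nu> n powr q) \<le> (\<Sum>n<N. real r powr (q - 1) * (\<Sum>x\<in>?X. p n (fst x) (snd x) * l (snd x) powr q))"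
    proof (rule sum_mono)
      fix n assume "n \<in> {..<N}"
      then have n: "n < N" by simp
      show "\<nu> n powr q \<le> real r powr (q - 1) * (\<Sum>x\<in>?X. p n (fst x) (snd x) * l (snd x) powr q)"
        unfolding \<nu>_eq[OF n] W[OF n, symmetric]
        by (rule powr_jensen_ge) (use True lpos ppos in auto)
    qed
    also have "\<dots> = real r powr (q - 1) * (\<Sum>n<N. \<Sum>s<r. \<Sum>i<N * r. p n s i * l i powr q)"
      by (simp add: sum_distrib_left sum.cartesian_product case_prod_unfold)
    also have "(\<Sum>n<N. \<Sum>s<r. \<Sum>i<N * r. p n s i * l i powr q) = (\<Sum>i<N * r. \<Sum>s<r. \<Sum>n<N. p n s i * l i powr q)"
      by (subst sum.swap, subst (2) sum.swap, subst sum.swap) (rule refl)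
    also have "\<dots> = (\<Sum>i<N * r. l i powr q)"
      using \<pi>1 by (simp add: sum_distrib_right[symmetric] p2)
    finally show ?thesis using True by simp
  next
    case False
    then have q1: "q \<le> 1" by simp
    define h where "h n s i = (if \<nu> n = 0 then 0 else l i * p n s i / \<nu> n)" for n s i
    have hpos: "h n s i \<ge> 0" if "n < N" "i < N * r" for n s i
      using lpos[OF that(2)] \<nu>pos[OF that(1)] ppos by (simp add: h_def)
    \<comment> \<open>The form dominates its rank one part given by (s, i), and the claim says this in the
      eigenbasis w: y below is the image of the vector of that part under the inverse of the form.\<close>
    have h1: "(\<Sum>n<N. h n s i) \<le> 1" if s: "s < r" and i: "i < N * r" for s i
    proof -
      define g where "g n = cdot N (w n) (us s i)" for n
      define c where "c n = (if \<nu> n = 0 then 0 else g n / of_real (\<nu> n))" for n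
      define H where "H = (\<Sum>n<N. if \<nu> n = 0 then 0 else (cmod (g n))\<^sup>2 / \<nu> n)"
      have pg: "p n s i = (cmod (g n))\<^sup>2" for n
        unfolding p_def g_def cdot_cnj[of N "w n", symmetric] by simp
      define y where "y = (\<lambda>b. \<Sum>n<N. c n * w n b)"
      have wy: "cdot N (w m) y = c m" if "m < N" for m
        unfolding y_def cdot_sum_right using eigsysD(2)[OF \<nu> that] that
        by (simp add: of_bool_def if_distrib[of "\<lambda>c. _ * c"] cong: if_cong)
      have H0: "H \<ge> 0" unfolding H_def using \<nu>pos by (intro sum_nonneg) auto
      have Py: "?P y = H"
        unfolding eigsys_form[OF \<nu>] H_def
        by (intro sum.cong refl) (auto simp: wy c_def norm_divide power_divide power2_eq_square)
      have "cdot N (us s i) y = (\<Sum>n<N. c n * cnj (g n))"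
        unfolding y_def cdot_sum_right g_def cdot_cnj ..
      also have "\<dots> = of_real H"
        unfolding H_def of_real_sum
        by (intro sum.cong refl) (auto simp: c_def complex_norm_square[symmetric] simp del: of_real_power)
      finally have uy: "cmod (cdot N (us s i) y) = H" using H0 by simp
      have "l i * H\<^sup>2 \<le> (\<Sum>j<N * r. l j * (cmod (cdot N (us s j) y))\<^sup>2)"
        using i lpos member_le_sum[of i "{..<N * r}" "\<lambda>j. l j * (cmod (cdot N (us s j) y))\<^sup>2"] uy by auto
      also have "\<dots> \<le> (\<Sum>s<r. \<Sum>j<N * r. l j * (cmod (cdot N (us s j) y))\<^sup>2)"
        using s lpos
        by (intro member_le_sum[of s "{..<r}" "\<lambda>s. \<Sum>j<N * r. l j * (cmod (cdot N (us s j) y))\<^sup>2"])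
           (auto intro!: sum_nonneg)
      also have "\<dots> = H" using P[of y] Py by simp
      finally have "(l i * H) * H \<le> 1 * H" by (simp add: power2_eq_square mult_ac)
      then have "l i * H \<le> 1" using H0 by (cases "H = 0") auto
      moreover have "(\<Sum>n<N. h n s i) = l i * H"
        unfolding H_def sum_distrib_left by (intro sum.cong refl) (auto simp: h_def pg)
      ultimately show ?thesis by simp
    qed
    have h2: "(\<Sum>n<N. h n s i * \<nu> n) \<le> l i * \<pi> s i" if "i < N * r" for s i
    proof -
      have "(\<Sum>n<N. h n s i * \<nu> n) \<le> (\<Sum>n<N. l i * p n s i)"
        using lpos[OF that] ppos by (intro sum_mono) (auto simp: h_def)
      then show ?thesis by (simp add: sum_distrib_left[symmetric] p2)
    qed
    have h3: "\<nu> n powr q = (\<Sum>s<r. \<Sum>i<N * r. h n s i * \<nu> n powr q)" if n: "n < N" for n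
    proof (cases "\<nu> n = 0")
      case False
      have "(\<Sum>s<r. \<Sum>i<N * r. h n s i) = (\<Sum>s<r. \<Sum>i<N * r. l i * p n s i) / \<nu> n"
        using False by (simp add: h_def sum_divide_distrib)
      also have "(\<Sum>s<r. \<Sum>i<N * r. l i * p n s i) = \<nu> n"
        unfolding \<nu>_eq[OF n] by (simp add: sum.cartesian_product case_prod_unfold mult.commute)
      finally show ?thesis using False by (simp add: sum_distrib_right[symmetric])
    qed (simp add: h_def)
    have "(\<Sum>n<N. \<nu> n powr q) = (\<Sum>n<N. \<Sum>s<r. \<Sum>i<N * r. h n s i * \<nu> n powr q)"
      using h3 by simp
    also have "\<dots> = (\<Sum>i<N * r. \<Sum>s<r. \<Sum>n<N. h n s i * \<nu> n powr q)"
      by (subst sum.swap, subst (2) sum.swap, subst sum.swap) (rule refl)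
    also have "\<dots> \<le> (\<Sum>i<N * r. \<Sum>s<r. l i powr q * \<pi> s i powr q)"
    proof (intro sum_mono)
      fix i s assume "i \<in> {..<N * r}" "s \<in> {..<r}"
      then have i: "i < N * r" and s: "s < r" by auto
      have "(\<Sum>n<N. h n s i * \<nu> n powr q) \<le> (\<Sum>n<N. h n s i) powr (1 - q) * (\<Sum>n<N. h n s i * \<nu> n) powr q"
        by (rule powr_jensen_le) (use hpos i \<nu>pos q q1 in auto)
      also have "\<dots> \<le> 1 * (l i * \<pi> s i) powr q"
      proof (intro mult_mono powr_mono2 powr_le1)
        have "0 \<le> (\<Sum>n<N. h n s i)" using hpos i by (intro sum_nonneg) auto
        then show "\<bar>\<Sum>n<N. h n s i\<bar> \<le> 1" using h1[OF s i] by simp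
      qed (use h1[OF s i] h2[OF i] hpos[OF _ i] \<nu>pos q q1 in \<open>auto intro!: sum_nonneg\<close>)
      finally show "(\<Sum>n<N. h n s i * \<nu> n powr q) \<le> l i powr q * \<pi> s i powr q"
        by (simp add: powr_mult)
    qed
    also have "\<dots> \<le> (\<Sum>i<N * r. l i powr q * real r powr (1 - q))"
    proof (intro sum_mono)
      fix i assume "i \<in> {..<N * r}"
      then have i: "i < N * r" by simp
      have "(\<Sum>s<r. 1 * \<pi> s i powr q) \<le> (\<Sum>s<r. 1) powr (1 - q) * (\<Sum>s<r. 1 * \<pi> s i) powr q"
        by (rule powr_jensen_le) (use q q1 in \<open>auto simp: \<pi>_def intro!: sum_nonneg\<close>)
      then have "(\<Sum>s<r. \<pi> s i powr q) \<le> real r powr (1 - q)" using \<pi>1[OF i] by simp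
      then show "(\<Sum>s<r. l i powr q * \<pi> s i powr q) \<le> l i powr q * real r powr (1 - q)"
        unfolding sum_distrib_left[symmetric] by (intro mult_left_mono) auto
    qed
    also have "\<dots> = real r powr (1 - q) * (\<Sum>i<N * r. l i powr q)"
      by (simp add: sum_distrib_left mult.commute)
    finally show ?thesis using False by simp
  qed
qed

lemma sum_Times: "(\<Sum>x\<in>A \<times> B. h x) = (\<Sum>a\<in>A. \<Sum>b\<in>B. h (a, b))"
  by (subst sum.cartesian_product) (simp add: case_prod_unfold)

lemma eigsys_form_le:
  assumes e: "eigsys A z N l u" and t: "t \<ge> 0" and v: "\<And>i. i < N \<Longrightarrow> t \<le> l i \<Longrightarrow> cdot N (u i) v = 0"
  shows "gram_form A z N v \<le> t * (\<Sum>b<N. (cmod (v b))\<^sup>2)"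
proof -
  have "gram_form A z N v \<le> (\<Sum>i<N. t * (cmod (cdot N (u i) v))\<^sup>2)"
    unfolding eigsys_form[OF e]
  proof (rule sum_mono)
    fix i assume "i \<in> {..<N}"
    then show "l i * (cmod (cdot N (u i) v))\<^sup>2 \<le> t * (cmod (cdot N (u i) v))\<^sup>2"
      using v[of i] by (cases "t \<le> l i") (auto intro: mult_right_mono)
  qed
  then show ?thesis unfolding sum_distrib_left[symmetric] eigsys_parseval[OF e] .
qed

lemma eigsys_synthesis:
  fixes c :: "nat \<Rightarrow> complex"
  assumes e: "eigsys A z N l u"
  defines "v \<equiv> (\<lambda>b. \<Sum>i<N. c i * u i b)"
  shows "gram_form A z N v = (\<Sum>i<N. l i * (cmod (c i))\<^sup>2)" "(\<Sum>b<N. (cmod (v b))\<^sup>2) = (\<Sum>i<N. (cmod (c i))\<^sup>2)"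
proof -
  have c: "cdot N (u i) v = c i" if "i < N" for i
    unfolding v_def cdot_sum_right using eigsysD(2)[OF e that] that
    by (simp add: of_bool_def if_distrib[of "\<lambda>c. _ * c"] cong: if_cong)
  show "gram_form A z N v = (\<Sum>i<N. l i * (cmod (c i))\<^sup>2)" unfolding eigsys_form[OF e] by (simp add: c)
  show "(\<Sum>b<N. (cmod (v b))\<^sup>2) = (\<Sum>i<N. (cmod (c i))\<^sup>2)" using eigsys_parseval[OF e, of v] by (simp add: c)
qed

text \<open>
  The counting principle for the eigenvalues of one form.
\<close>

lemma eigsys_sum_le:
  assumes e: "eigsys A z N l u" and q: "q > 0"
    and \<psi>: "\<And>x c. x \<in> X \<Longrightarrow> \<psi> x (\<lambda>b. \<Sum>i<N. c i * u i b) = (\<Sum>i<N. c i * \<psi> x (u i))"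
    and upper: "\<And>t v. t > 0 \<Longrightarrow> (\<And>x. x \<in> X \<Longrightarrow> t \<le> \<beta> x \<Longrightarrow> \<psi> x v = (0::complex)) \<Longrightarrow>
      gram_form A z N v \<le> t * (\<Sum>b<N. (cmod (v b))\<^sup>2)"
    and X: "finite X"
  shows "(\<Sum>i<N. l i powr q) \<le> 2 powr q * (\<Sum>x\<in>X. \<beta> x powr q)"
proof (rule counting_sum[where X = X and \<beta> = \<beta> and \<psi> = "\<lambda>x i. \<psi> x (u i)"
      and Q = "\<lambda>c. gram_form A z N (\<lambda>b. \<Sum>i<N. c i * u i b)"])
  show "finite {..<N}" by simp
  show "(\<Sum>i<N. l i * (cmod (c i))\<^sup>2) \<le> gram_form A z N (\<lambda>b. \<Sum>i<N. c i * u i b)" for c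
    by (simp add: eigsys_synthesis[OF e])
  show "gram_form A z N (\<lambda>b. \<Sum>i<N. c i * u i b) \<le> t * (\<Sum>i<N. (cmod (c i))\<^sup>2)"
    if "t > 0" "\<And>x. x \<in> X \<Longrightarrow> t \<le> \<beta> x \<Longrightarrow> (\<Sum>i<N. \<psi> x (u i) * c i) = 0" for t c
  proof -
    have "\<psi> x (\<lambda>b. \<Sum>i<N. c i * u i b) = 0" if x: "x \<in> X" "t \<le> \<beta> x" for x
      unfolding \<psi>[OF x(1)] using \<open>\<And>x. x \<in> X \<Longrightarrow> t \<le> \<beta> x \<Longrightarrow> (\<Sum>i<N. \<psi> x (u i) * c i) = 0\<close>[OF x]
      by (simp add: mult.commute)
    from upper[OF that(1) this] show ?thesis by (simp add: eigsys_synthesis(2)[OF e])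
  qed
  show "l i \<ge> 0" if "i \<in> {..<N}" for i using eigsysD(1)[OF e] that by simp
  show "(\<Sum>x\<in>F. \<beta> x powr q) \<le> (\<Sum>x\<in>X. \<beta> x powr q)" if "finite F" "F \<subseteq> X" for F
    using that X by (intro sum_mono2) auto
qed (rule q)

section \<open>The L_p norm of a matrix\<close>

definition mrow :: "complex mat \<Rightarrow> nat \<Rightarrow> nat \<Rightarrow> complex" where
  "mrow x a b = x $$ (a, b)"

lemma unitary_diag_eigsys:
  assumes x: "x \<in> carrier_mat N N" and e: "eigsys {..<N} (mrow x) N l u"
  defines "U \<equiv> Matrix.mat N N (\<lambda>(b, i). u i b)"
  shows "U \<in> carrier_mat N N" "mat_adjoint U * U = 1\<^sub>m N"
    "mat_adjoint x * x = U * mat_diag N (\<lambda>i. complex_of_real (l i)) * mat_adjoint U"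
proof -
  show U: "U \<in> carrier_mat N N" by (simp add: U_def)
  have Ui: "mat_adjoint U $$ (i, b) = cnj (u i b)" if "i < N" "b < N" for i b
    unfolding mat_adjoint_index[OF U that] using that by (simp add: U_def)
  note aU = mat_adjoint_carrier[OF U]
  show "mat_adjoint U * U = 1\<^sub>m N"
  proof (rule eq_matI)
    fix i j assume "i < dim_row (1\<^sub>m N :: complex mat)" "j < dim_col (1\<^sub>m N :: complex mat)"
    then have ij: "i < N" "j < N" by auto
    then show "(mat_adjoint U * U) $$ (i, j) = 1\<^sub>m N $$ (i, j)"
      using eigsysD(2)[OF e ij] by (simp add: mat_mult_index[OF aU U ij] Ui) (auto simp: U_def cdot_def)
  qed (use U carrier_matD[OF aU] in auto)
  note ax = mat_adjoint_carrier[OF x]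
  have Ud: "U * mat_diag N (\<lambda>i. complex_of_real (l i)) = Matrix.mat N N (\<lambda>(b, i). u i b * of_real (l i))"
    using mat_diag_mult_right[OF U, of "\<lambda>i. complex_of_real (l i)"] by (auto simp: U_def intro!: eq_matI)
  have cUd: "Matrix.mat N N (\<lambda>(b, i). u i b * of_real (l i)) \<in> carrier_mat N N" by simp
  show "mat_adjoint x * x = U * mat_diag N (\<lambda>i. complex_of_real (l i)) * mat_adjoint U" unfolding Ud
  proof (rule eq_matI)
    fix b c assume "b < dim_row (Matrix.mat N N (\<lambda>(b, i). u i b * of_real (l i)) * mat_adjoint U)"
      "c < dim_col (Matrix.mat N N (\<lambda>(b, i). u i b * of_real (l i)) * mat_adjoint U)"
    then have bc: "b < N" "c < N" using aU by auto
    have "(mat_adjoint x * x) $$ (b, c) = (\<Sum>a<N. cnj (mrow x a b) * mrow x a c)"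
      using bc by (simp add: mat_mult_index[OF ax x bc] mat_adjoint_index[OF x] mrow_def)
    also have "\<dots> = (\<Sum>i<N. of_real (l i) * u i b * cnj (u i c))"
      using e bc by (auto simp: eigsys_def)
    also have "\<dots> = (Matrix.mat N N (\<lambda>(b, i). u i b * of_real (l i)) * mat_adjoint U) $$ (b, c)"
      unfolding mat_mult_index[OF cUd aU bc] using bc by (intro sum.cong refl) (simp add: Ui mult_ac)
    finally show "(mat_adjoint x * x) $$ (b, c) =
       (Matrix.mat N N (\<lambda>(b, i). u i b * of_real (l i)) * mat_adjoint U) $$ (b, c)" .
  qed (use carrier_matD[OF ax] carrier_matD[OF x] carrier_matD[OF aU] in auto)
qed

text \<open>
  The functional calculus does not depend on the diagonalisation: the unitary \<open>V\<^sup>* U\<close> intertwines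
  the two diagonal matrices, so its nonzero entries join equal eigenvalues only, and it
  intertwines their images under f too. This justifies the definite description in \<open>pos_powr\<close>.
\<close>

lemma unitary_diag_function_unique:
  fixes U V :: "complex mat" and l m :: "nat \<Rightarrow> real"
  assumes U: "U \<in> carrier_mat N N" "mat_adjoint U * U = 1\<^sub>m N"
    and V: "V \<in> carrier_mat N N" "mat_adjoint V * V = 1\<^sub>m N"
    and eq: "U * mat_diag N (\<lambda>i. complex_of_real (l i)) * mat_adjoint U
       = V * mat_diag N (\<lambda>i. complex_of_real (m i)) * mat_adjoint V"
  shows "U * mat_diag N (\<lambda>i. complex_of_real (f (l i))) * mat_adjoint U
       = V * mat_diag N (\<lambda>i. complex_of_real (f (m i))) * mat_adjoint V"
proof -
  define U' where "U' = mat_adjoint U"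
  define V' where "V' = mat_adjoint V"
  define dl where "dl f = mat_diag N (\<lambda>i. complex_of_real (f (l i)))" for f :: "real \<Rightarrow> real"
  define dm where "dm f = mat_diag N (\<lambda>i. complex_of_real (f (m i)))" for f :: "real \<Rightarrow> real"
  have c: "U' \<in> carrier_mat N N" "V' \<in> carrier_mat N N" "dl f \<in> carrier_mat N N" "dm f \<in> carrier_mat N N" for f
    unfolding U'_def V'_def dl_def dm_def using U V by auto
  note c' = c U(1) V(1)
  have inv: "U' * U = 1\<^sub>m N" "V' * V = 1\<^sub>m N" "U * U' = 1\<^sub>m N" "V * V' = 1\<^sub>m N"
    using U V mat_mult_left_right_inverse[OF c(1) U(1)] mat_mult_left_right_inverse[OF c(2) V(1)]
    by (auto simp: U'_def V'_def)
  define W where "W = V' * U"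
  have W: "W \<in> carrier_mat N N" unfolding W_def using c' by auto
  have e: "U * dl id * U' = V * dm id * V'" using eq by (simp add: dl_def dm_def U'_def V'_def)
  have as: "A * B * C = A * (B * C)"
    if "A \<in> carrier_mat N N" "B \<in> carrier_mat N N" "C \<in> carrier_mat N N" for A B C :: "complex mat"
    using that by (rule assoc_mult_mat)
  have mc: "A * B \<in> carrier_mat N N"
    if "A \<in> carrier_mat N N" "B \<in> carrier_mat N N" for A B :: "complex mat"
    using that by (rule mult_carrier_mat)
  have one: "1\<^sub>m N * A = A" "A * 1\<^sub>m N = A" if "A \<in> carrier_mat N N" for A :: "complex mat"
    using that by auto
  have "V' * (U * dl id * U') * U = W * dl id * (U' * U)"
    unfolding W_def using c' by (simp add: as mc)
  moreover have "V' * (V * dm id * V') * U = (V' * V) * dm id * W"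
    unfolding W_def using c' by (simp add: as mc)
  ultimately have key: "W * dl id = dm id * W"
    using e W c' by (simp add: inv one mc)
  have ent: "(W * dl f) $$ (i, j) = W $$ (i, j) * of_real (f (l j))"
    "(dm f * W) $$ (i, j) = of_real (f (m i)) * W $$ (i, j)" if "i < N" "j < N" for f i j
    using that mat_diag_mult_right[OF W] mat_diag_mult_left[OF W] by (simp_all add: dl_def dm_def)
  have keyf: "W * dl f = dm f * W" for f
  proof (rule eq_matI)
    fix i j assume "i < dim_row (dm f * W)" "j < dim_col (dm f * W)"
    then have ij: "i < N" "j < N" using W c(4)[of f] by auto
    have "(W * dl id) $$ (i, j) = (dm id * W) $$ (i, j)" by (rule arg_cong[OF key])
    from trans[OF ent(1)[OF ij, symmetric] trans[OF this ent(2)[OF ij]]]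
    have "W $$ (i, j) * of_real (l j) = of_real (m i) * W $$ (i, j)" unfolding id_apply .
    then have "W $$ (i, j) = 0 \<or> l j = m i" by (simp add: mult.commute)
    then show "(W * dl f) $$ (i, j) = (dm f * W) $$ (i, j)" by (auto simp: ent[OF ij])
  qed (use W c(3)[of f] c(4)[of f] in auto)
  have "U * dl f * U' = (V * V') * (U * dl f * U')" using c' by (simp add: inv one mc)
  also have "\<dots> = V * (W * dl f) * U'" unfolding W_def using c' by (simp add: as mc)
  also have "\<dots> = V * dm f * V' * (U * U')" unfolding keyf unfolding W_def using c' by (simp add: as mc)
  also have "\<dots> = V * dm f * V'" using c' by (simp add: inv one mc)
  finally show ?thesis by (simp add: dl_def dm_def U'_def V'_def)
qed

lemma Lp_norm_eigsys:
  assumes x: "x \<in> carrier_mat N N" and e: "eigsys {..<N} (mrow x) N l u" and p: "p > 0"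
  shows "Lp_norm p x powr p = (\<Sum>i<N. l i powr (p / 2)) / real N"
proof -
  define U where "U = Matrix.mat N N (\<lambda>(b, i). u i b)"
  note U = unitary_diag_eigsys[OF x e, folded U_def]
  define f where "f y = y powr (p / 2)" for y :: real
  define B where "B = U * mat_diag N (\<lambda>i. complex_of_real (f (l i))) * mat_adjoint U"
  have dim: "dim_row (mat_adjoint x * x) = N" using mat_adjoint_carrier[OF x] by auto
  have "pos_powr (mat_adjoint x * x) (p / 2) = B"
    unfolding pos_powr_def dim
  proof (rule the_equality)
    show "\<exists>V m. V \<in> carrier_mat N N \<and> mat_adjoint V * V = 1\<^sub>m N \<and> (\<forall>i<N. 0 \<le> m i) \<and>
     mat_adjoint x * x = V * mat_diag N (\<lambda>i. complex_of_real (m i)) * mat_adjoint V \<and>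
     B = V * mat_diag N (\<lambda>i. complex_of_real (m i powr (p / 2))) * mat_adjoint V"
      by (rule exI[of _ U], rule exI[of _ l]) (use U eigsysD(1)[OF e] in \<open>auto simp: B_def f_def\<close>)
    fix B' assume "\<exists>V m. V \<in> carrier_mat N N \<and> mat_adjoint V * V = 1\<^sub>m N \<and> (\<forall>i<N. 0 \<le> m i) \<and>
     mat_adjoint x * x = V * mat_diag N (\<lambda>i. complex_of_real (m i)) * mat_adjoint V \<and>
     B' = V * mat_diag N (\<lambda>i. complex_of_real (m i powr (p / 2))) * mat_adjoint V"
    then obtain V m where V: "V \<in> carrier_mat N N" "mat_adjoint V * V = 1\<^sub>m N"
      "mat_adjoint x * x = V * mat_diag N (\<lambda>i. complex_of_real (m i)) * mat_adjoint V"
      "B' = V * mat_diag N (\<lambda>i. complex_of_real (f (m i))) * mat_adjoint V" unfolding f_def by blast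
    show "B' = B" unfolding V(4) B_def
      by (rule unitary_diag_function_unique[OF V(1,2) U(1,2)]) (use V(3) U(3) in simp)
  qed
  moreover have "ntr B = of_real ((\<Sum>i<N. l i powr (p / 2)) / real N)"
  proof -
    note aU = mat_adjoint_carrier[OF U(1)]
    have Ud: "U * mat_diag N (\<lambda>i. complex_of_real (f (l i))) = Matrix.mat N N (\<lambda>(b, i). u i b * of_real (f (l i)))"
      using mat_diag_mult_right[OF U(1), of "\<lambda>i. complex_of_real (f (l i))"] by (auto simp: U_def intro!: eq_matI)
    have cUd: "Matrix.mat N N (\<lambda>(b, i). u i b * of_real (f (l i))) \<in> carrier_mat N N" by simp
    have Ui: "mat_adjoint U $$ (i, b) = cnj (u i b)" if "i < N" "b < N" for i b
      unfolding mat_adjoint_index[OF U(1) that] using that by (simp add: U_def)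
    have ent: "B $$ (b, b) = (\<Sum>i<N. of_real (f (l i) * (cmod (u i b))\<^sup>2))" if "b < N" for b
    proof -
      have "B $$ (b, b) = (\<Sum>i<N. u i b * of_real (f (l i)) * cnj (u i b))"
        unfolding B_def Ud using that
        by (simp add: mat_mult_index[OF cUd aU that that] Ui)
      also have "\<dots> = (\<Sum>i<N. of_real (f (l i) * (cmod (u i b))\<^sup>2))"
        unfolding of_real_mult complex_norm_square by (simp add: mult_ac)
      finally show ?thesis .
    qed
    have "dim_row B = N" unfolding B_def using U(1) by auto
    then have "ntr B = (\<Sum>b<N. B $$ (b, b)) / of_nat N" by (simp add: ntr_def)
    also have "(\<Sum>b<N. B $$ (b, b)) = (\<Sum>b<N. \<Sum>i<N. of_real (f (l i) * (cmod (u i b))\<^sup>2))"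
      by (intro sum.cong refl) (simp add: ent)
    also have "\<dots> = of_real (\<Sum>i<N. f (l i) * (\<Sum>b<N. (cmod (u i b))\<^sup>2))"
      unfolding of_real_sum sum_distrib_left by (rule sum.swap)
    also have "(\<Sum>i<N. f (l i) * (\<Sum>b<N. (cmod (u i b))\<^sup>2)) = (\<Sum>i<N. l i powr (p / 2))"
      using eigsysD(3)[OF e] by (simp add: f_def)
    finally show ?thesis by simp
  qed
  ultimately have "Lp_norm p x = ((\<Sum>i<N. l i powr (p / 2)) / real N) powr (1 / p)"
    unfolding Lp_norm_def by (simp only: Re_complex_of_real)
  moreover have "0 \<le> (\<Sum>i<N. l i powr (p / 2))" by (intro sum_nonneg) auto
  ultimately show ?thesis using p by (simp add: powr_powr)
qed

lemma mrow_eigsys_exists: "\<exists>l u. eigsys {..<N} (mrow x) N l u"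
  by (rule eigsys_exists) simp

text \<open>
  A quasi-triangle inequality. From \<open>|x + y|\<^sup>2 \<le> 2 |x|\<^sup>2 + 2 |y|\<^sup>2\<close> the weights are four times the
  eigenvalues of x and y, and counting contributes another factor 2 under the power.
\<close>

lemma Lp_powr_add:
  assumes x: "x \<in> carrier_mat N N" and y: "y \<in> carrier_mat N N" and p: "p > 0"
  shows "Lp_norm p (x + y) powr p \<le> 8 powr (p / 2) * (Lp_norm p x powr p + Lp_norm p y powr p)"
proof -
  have xy: "x + y \<in> carrier_mat N N" using x y by simp
  obtain l u where e: "eigsys {..<N} (mrow (x + y)) N l u" using mrow_eigsys_exists by blast
  obtain m w where m: "eigsys {..<N} (mrow x) N m w" using mrow_eigsys_exists by blast
  obtain n v where n: "eigsys {..<N} (mrow y) N n v" using mrow_eigsys_exists by blast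
  let ?q = "p / 2"
  define X where "X = (UNIV :: bool set) \<times> {..<N}"
  define \<beta> where "\<beta> = (\<lambda>(c, i). 4 * (if c then m i else n i))"
  define \<psi> where "\<psi> = (\<lambda>(c, i). cdot N (if c then w i else v i))"
  have "(\<Sum>i<N. l i powr ?q) \<le> 2 powr ?q * (\<Sum>x\<in>X. \<beta> x powr ?q)"
  proof (rule eigsys_sum_le[OF e, where \<psi> = \<psi>])
    show "\<psi> z (\<lambda>b. \<Sum>i<N. c i * u i b) = (\<Sum>i<N. c i * \<psi> z (u i))" for z c
      unfolding \<psi>_def by (cases z) (simp add: cdot_sum_right)
    fix t :: real and f :: "nat \<Rightarrow> complex"
    assume t: "t > 0" and f: "\<And>z. z \<in> X \<Longrightarrow> t \<le> \<beta> z \<Longrightarrow> \<psi> z f = 0"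
    let ?n = "\<Sum>b<N. (cmod (f b))\<^sup>2"
    have "gram_form {..<N} (mrow x) N f \<le> t / 4 * ?n"
      by (rule eigsys_form_le[OF m]) (use t f[of "(True, _)"] in \<open>auto simp: X_def \<beta>_def \<psi>_def\<close>)
    moreover have "gram_form {..<N} (mrow y) N f \<le> t / 4 * ?n"
      by (rule eigsys_form_le[OF n]) (use t f[of "(False, _)"] in \<open>auto simp: X_def \<beta>_def \<psi>_def\<close>)
    moreover have "gram_form {..<N} (mrow (x + y)) N f \<le>
       2 * gram_form {..<N} (mrow x) N f + 2 * gram_form {..<N} (mrow y) N f"
    proof -
      have "(cmod (s + s'))\<^sup>2 \<le> 2 * (cmod s)\<^sup>2 + 2 * (cmod s')\<^sup>2" for s s'
      proof -
        have "(cmod (s + s'))\<^sup>2 \<le> (cmod s + cmod s')\<^sup>2" by (intro power_mono norm_triangle_ineq) auto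
        also have "\<dots> \<le> 2 * (cmod s)\<^sup>2 + 2 * (cmod s')\<^sup>2"
          using sum_squares_bound[of "cmod s" "cmod s'"] by (simp add: power2_sum)
        finally show ?thesis .
      qed
      moreover have "(\<Sum>b<N. mrow (x + y) a b * f b) = (\<Sum>b<N. mrow x a b * f b) + (\<Sum>b<N. mrow y a b * f b)"
        if "a < N" for a
        using that x y by (simp add: mrow_def ring_distribs sum.distrib)
      ultimately show ?thesis
        unfolding gram_form_def sum_distrib_left sum.distrib[symmetric] by (intro sum_mono) simp
    qed
    ultimately show "gram_form {..<N} (mrow (x + y)) N f \<le> t * ?n" by simp
  qed (use p in \<open>auto simp: X_def\<close>)
  also have "(\<Sum>x\<in>X. \<beta> x powr ?q) = 4 powr ?q * ((\<Sum>i<N. m i powr ?q) + (\<Sum>i<N. n i powr ?q))"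
    unfolding X_def sum_Times by (simp add: \<beta>_def UNIV_bool powr_mult sum_distrib_left algebra_simps)
  finally have "(\<Sum>i<N. l i powr ?q) \<le> (2 * 4) powr ?q * ((\<Sum>i<N. m i powr ?q) + (\<Sum>i<N. n i powr ?q))"
    by (subst powr_mult) (simp add: mult.assoc)
  then have "(\<Sum>i<N. l i powr ?q) / N \<le> (2 * 4) powr ?q * ((\<Sum>i<N. m i powr ?q) + (\<Sum>i<N. n i powr ?q)) / N"
    by (intro divide_right_mono) auto
  then show ?thesis
    unfolding Lp_norm_eigsys[OF xy e p] Lp_norm_eigsys[OF x m p] Lp_norm_eigsys[OF y n p]
    by (simp add: add_divide_distrib[symmetric])
qed

lemma Lp_norm_zero:
  assumes "p > 0"
  shows "Lp_norm p (0\<^sub>m N N) powr p = 0"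
proof -
  obtain l u where e: "eigsys {..<N} (mrow (0\<^sub>m N N)) N l u" using mrow_eigsys_exists by blast
  have "l i = 0" if "i < N" for i
    using eigsys_member[OF e that] that by (simp add: gram_form_def mrow_def)
  then show ?thesis using Lp_norm_eigsys[OF _ e assms] by simp
qed

lemma sum_eigenvalues:
  assumes x: "x \<in> carrier_mat N N" and e: "eigsys {..<N} (mrow x) N l u"
  shows "(\<Sum>i<N. l i) = real N * sqn x"
proof -
  have "(\<Sum>a<N. cnj (mrow x a b) * mrow x a b) = (\<Sum>i<N. of_real (l i) * u i b * cnj (u i b))" if "b < N" for b
    using e that by (auto simp: eigsys_def)
  then have "(\<Sum>b<N. \<Sum>a<N. cnj (mrow x a b) * mrow x a b) = (\<Sum>b<N. \<Sum>i<N. of_real (l i) * u i b * cnj (u i b))"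
    by simp
  moreover have "(\<Sum>b<N. \<Sum>a<N. cnj (mrow x a b) * mrow x a b) = of_real (\<Sum>b<N. \<Sum>a<N. (cmod (mrow x a b))\<^sup>2)"
    unfolding of_real_sum complex_norm_square by (simp add: mult.commute)
  moreover have "(\<Sum>b<N. \<Sum>i<N. of_real (l i) * u i b * cnj (u i b)) = of_real (\<Sum>i<N. l i * (\<Sum>b<N. (cmod (u i b))\<^sup>2))"
    unfolding of_real_sum of_real_mult complex_norm_square sum_distrib_left
    by (subst sum.swap) (simp add: mult.assoc)
  ultimately have "(\<Sum>b<N. \<Sum>a<N. (cmod (mrow x a b))\<^sup>2) = (\<Sum>i<N. l i * (\<Sum>b<N. (cmod (u i b))\<^sup>2))"
    by (simp only: of_real_eq_iff)
  also have "\<dots> = (\<Sum>i<N. l i)" using eigsysD(3)[OF e] by simp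
  finally show ?thesis unfolding sqn_sum[OF x]
    by (subst (asm) sum.swap) (cases "N = 0", auto simp: mrow_def)
qed

text \<open>
  By Cauchy-Schwarz a form is at most r times the sum of its parts on r complementary sets of
  coordinates, so that \<open>r * \<nu> s i\<close> are admissible weights in the counting principle.
\<close>

lemma diagonal_blocks_bound:
  fixes D :: "'a \<Rightarrow> nat \<Rightarrow> complex"
  assumes finA: "finite A" and l: "eigsys A D (N * r) l u"
    and e: "\<And>s. s < r \<Longrightarrow> eigsys (B s) (z s) N (\<nu> s) (w s)"
    and le: "\<And>s v. s < r \<Longrightarrow> gram_form A D (N * r) (slot r s v) \<le> gram_form (B s) (z s) N v"
    and q: "q > 0"
  shows "(\<Sum>i<N * r. l i powr q) \<le> (2 * real r) powr q * (\<Sum>s<r. \<Sum>i<N. \<nu> s i powr q)"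
proof -
  define X where "X = {..<r} \<times> {..<N}"
  define \<beta> where "\<beta> = (\<lambda>(s, i). real r * \<nu> s i)"
  define part where "part s v = (\<lambda>b. v (b * r + s))" for s and v :: "nat \<Rightarrow> complex"
  define \<psi> where "\<psi> = (\<lambda>(s, i) v. cdot N (w s i) (part s v))"
  have "(\<Sum>i<N * r. l i powr q) \<le> 2 powr q * (\<Sum>x\<in>X. \<beta> x powr q)"
  proof (rule eigsys_sum_le[OF l q, where \<psi> = \<psi>])
    show "\<psi> x (\<lambda>b. \<Sum>i<N * r. c i * u i b) = (\<Sum>i<N * r. c i * \<psi> x (u i))" for x c
      unfolding \<psi>_def part_def by (cases x) (simp add: cdot_sum_right)
    fix t :: real and v :: "nat \<Rightarrow> complex"
    assume t: "t > 0" and v: "\<And>x. x \<in> X \<Longrightarrow> t \<le> \<beta> x \<Longrightarrow> \<psi> x v = 0"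
    have D: "(\<Sum>m<N * r. D a m * v m) = (\<Sum>s<r. \<Sum>b<N. D a (b * r + s) * part s v b)" for a
      unfolding sum_nat_prod part_def by (rule sum.swap)
    have "gram_form A D (N * r) v \<le> real r * (\<Sum>s<r. gram_form A D (N * r) (slot r s (part s v)))"
    proof -
      have "gram_form A D (N * r) v \<le> (\<Sum>a\<in>A. real r * (\<Sum>s<r. (cmod (\<Sum>b<N. D a (b * r + s) * part s v b))\<^sup>2))"
        unfolding gram_form_def D
      proof (rule sum_mono)
        fix a
        let ?y = "\<lambda>s. \<Sum>b<N. D a (b * r + s) * part s v b"
        have "(cmod (\<Sum>s<r. ?y s))\<^sup>2 \<le> (\<Sum>s<r. cmod (?y s))\<^sup>2" by (intro power_mono norm_sum) auto
        also have "\<dots> = (\<Sum>s<r. 1 * cmod (?y s))\<^sup>2" by simp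
        also have "\<dots> \<le> (\<Sum>s<r. 1\<^sup>2) * (\<Sum>s<r. (cmod (?y s))\<^sup>2)" by (rule Cauchy_Schwarz_ineq_sum)
        finally show "(cmod (\<Sum>s<r. ?y s))\<^sup>2 \<le> real r * (\<Sum>s<r. (cmod (?y s))\<^sup>2)" by simp
      qed
      also have "\<dots> = real r * (\<Sum>s<r. gram_form A D (N * r) (slot r s (part s v)))"
        unfolding gram_form_def sum_distrib_left[symmetric]
        by (subst sum.swap) (intro arg_cong2[where f = "(*)"] sum.cong refl, simp add: sum_slot)
      finally show ?thesis .
    qed
    also have "\<dots> \<le> real r * (\<Sum>s<r. t / real r * (\<Sum>b<N. (cmod (part s v b))\<^sup>2))"
    proof (intro mult_left_mono sum_mono)
      fix s assume "s \<in> {..<r}"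
      then have s: "s < r" by simp
      have "gram_form A D (N * r) (slot r s (part s v)) \<le> gram_form (B s) (z s) N (part s v)" by (rule le[OF s])
      also have "\<dots> \<le> t / real r * (\<Sum>b<N. (cmod (part s v b))\<^sup>2)"
      proof (rule eigsys_form_le[OF e[OF s]])
        fix i assume i: "i < N" "t / real r \<le> \<nu> s i"
        then have "t \<le> real r * \<nu> s i" using s by (simp add: field_simps)
        then show "cdot N (w s i) (part s v) = 0" using v[of "(s, i)"] s i by (auto simp: X_def \<beta>_def \<psi>_def)
      qed (use t in auto)
      finally show "gram_form A D (N * r) (slot r s (part s v)) \<le> t / real r * (\<Sum>b<N. (cmod (part s v b))\<^sup>2)" .
    qed auto
    also have "\<dots> \<le> t * (\<Sum>m<N * r. (cmod (v m))\<^sup>2)"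
    proof -
      have "(\<Sum>m<N * r. (cmod (v m))\<^sup>2) = (\<Sum>s<r. \<Sum>b<N. (cmod (part s v b))\<^sup>2)"
        unfolding sum_nat_prod part_def by (rule sum.swap)
      moreover have "real r * (\<Sum>s<r. t / real r * Y s) = t * (\<Sum>s<r. Y s)" for Y
        unfolding sum_distrib_left[symmetric] by (cases "r = 0") simp_all
      ultimately show ?thesis by simp
    qed
    finally show "gram_form A D (N * r) v \<le> t * (\<Sum>m<N * r. (cmod (v m))\<^sup>2)" .
  qed (auto simp: X_def)
  also have "(\<Sum>x\<in>X. \<beta> x powr q) = real r powr q * (\<Sum>s<r. \<Sum>i<N. \<nu> s i powr q)"
    unfolding X_def sum_Times by (simp add: \<beta>_def powr_mult sum_distrib_left)
  finally show ?thesis by (simp add: powr_mult)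
qed

section \<open>Singular vectors of compact operators\<close>

lemma hs_inner_add_left:
  assumes "x \<in> carrier_mat N N" "y \<in> carrier_mat N N" "z \<in> carrier_mat N N"
  shows "hs_inner (x + y) z = hs_inner x z + hs_inner y z"
proof -
  have xy: "x + y \<in> carrier_mat N N" using assms by simp
  show ?thesis
    unfolding hs_inner_sum[OF xy assms(3)] hs_inner_sum[OF assms(1,3)] hs_inner_sum[OF assms(2,3)]
    using assms by (simp add: algebra_simps sum.distrib add_divide_distrib)
qed

lemma hs_inner_smult_left:
  assumes "x \<in> carrier_mat N N" "z \<in> carrier_mat N N"
  shows "hs_inner (c \<cdot>\<^sub>m x) z = c * hs_inner x z"
proof -
  have xy: "c \<cdot>\<^sub>m x \<in> carrier_mat N N" using assms by simp
  show ?thesis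
    unfolding hs_inner_sum[OF xy assms(2)] hs_inner_sum[OF assms]
    using assms by (simp add: sum_distrib_left mult.assoc)
qed

lemma hs_inner_commute:
  assumes "x \<in> carrier_mat N N" "z \<in> carrier_mat N N"
  shows "cnj (hs_inner x z) = hs_inner z x"
  unfolding hs_inner_sum[OF assms] hs_inner_sum[OF assms(2,1)] by (simp add: mult.commute)

text \<open>
  The complex inner product of L_2, linear in the first argument, recovered from its real part.
\<close>

definition cip :: "'d::finite l2M \<Rightarrow> 'd l2M \<Rightarrow> complex" where
  "cip f g = Complex (inner f g) (inner f (scaleC \<i> g))"

lemma cip_LIMSEQ: "(\<lambda>n. hs_inner (Rep_l2M f n) (Rep_l2M (g :: 'd::finite l2M) n)) \<longlonglongrightarrow> cip f g"
proof -
  have i: "Re (hs_inner (Rep_l2M f n) (Rep_l2M (scaleC \<i> g) n)) = Im (hs_inner (Rep_l2M f n) (Rep_l2M g n))" for n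
  proof -
    note c = Rep_l2M_carrier[of f n] Rep_l2M_carrier[of g n]
    have "hs_inner (Rep_l2M f n) (Rep_l2M (scaleC \<i> g) n) = cnj (hs_inner (\<i> \<cdot>\<^sub>m Rep_l2M g n) (Rep_l2M f n))"
      using c by (subst hs_inner_commute[of _ "CARD('d) ^ n"]) (auto simp: scaleC.rep_eq)
    also have "\<dots> = cnj (\<i> * cnj (hs_inner (Rep_l2M f n) (Rep_l2M g n)))"
      using c by (subst hs_inner_smult_left[of _ "CARD('d) ^ n"]) (auto simp: hs_inner_commute[of _ "CARD('d) ^ n"])
    finally show ?thesis by simp
  qed
  have "(\<lambda>n. Complex (Re (hs_inner (Rep_l2M f n) (Rep_l2M g n))) (Im (hs_inner (Rep_l2M f n) (Rep_l2M g n))))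
    \<longlonglongrightarrow> cip f g"
    unfolding cip_def i[symmetric] by (intro tendsto_Complex inner_l2M_LIMSEQ)
  then show ?thesis by simp
qed

lemma cip_add_left: "cip (f + g) h = cip f h + cip g h"
proof -
  have "(\<lambda>n. hs_inner (Rep_l2M f n) (Rep_l2M h n) + hs_inner (Rep_l2M g n) (Rep_l2M h n)) \<longlonglongrightarrow> cip f h + cip g h"
    by (intro tendsto_add cip_LIMSEQ)
  then have "(\<lambda>n. hs_inner (Rep_l2M (f + g) n) (Rep_l2M h n)) \<longlonglongrightarrow> cip f h + cip g h"
    unfolding Rep_l2M_add by (simp add: hs_inner_add_left[OF Rep_l2M_carrier Rep_l2M_carrier Rep_l2M_carrier])
  then show ?thesis using cip_LIMSEQ LIMSEQ_unique by blast
qed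

lemma cip_scaleC_left: "cip (scaleC c f) h = c * cip f h"
proof -
  have "(\<lambda>n. c * hs_inner (Rep_l2M f n) (Rep_l2M h n)) \<longlonglongrightarrow> c * cip f h"
    by (intro tendsto_mult tendsto_const cip_LIMSEQ)
  then have "(\<lambda>n. hs_inner (Rep_l2M (scaleC c f) n) (Rep_l2M h n)) \<longlonglongrightarrow> c * cip f h"
    unfolding scaleC.rep_eq by (simp add: hs_inner_smult_left[OF Rep_l2M_carrier Rep_l2M_carrier])
  then show ?thesis using cip_LIMSEQ LIMSEQ_unique by blast
qed

lemma cip_cnj: "cnj (cip f g) = cip g f"
proof -
  have "(\<lambda>n. cnj (hs_inner (Rep_l2M f n) (Rep_l2M g n))) \<longlonglongrightarrow> cnj (cip f g)"
    by (intro tendsto_cnj cip_LIMSEQ)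
  then have "(\<lambda>n. hs_inner (Rep_l2M g n) (Rep_l2M f n)) \<longlonglongrightarrow> cnj (cip f g)"
    by (simp add: hs_inner_commute[OF Rep_l2M_carrier Rep_l2M_carrier])
  then show ?thesis using cip_LIMSEQ LIMSEQ_unique by blast
qed

lemma Re_cip: "Re (cip f g) = inner f g" by (simp add: cip_def)

lemma cip_self: "cip f f = of_real ((norm f)\<^sup>2)"
proof -
  have "Im (cip f f) = - Im (cip f f)" using arg_cong[OF cip_cnj[of f f], of Im] by simp
  then have "Im (cip f f) = 0" by simp
  then show ?thesis by (simp add: complex_eq_iff Re_cip power2_norm_eq_inner)
qed

lemma cip_simps [simp]: "cip 0 f = 0" "cip f 0 = 0" "cip (f - g) h = cip f h - cip g h"
  "cip f (scaleC c g) = cnj c * cip f g" "cip f (g + h) = cip f g + cip f h"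
proof -
  show 0: "cip 0 f = 0" for f :: "'a l2M" using cip_scaleC_left[of 0 0 f] by simp
  show "cip f 0 = 0" using arg_cong[OF 0[of f], of cnj] cip_cnj[of 0 f] by simp
  show "cip (f - g) h = cip f h - cip g h" using cip_add_left[of "f - g" g h] by simp
  show "cip f (scaleC c g) = cnj c * cip f g"
    using cip_scaleC_left[of c g f] cip_cnj[of f "scaleC c g"] cip_cnj[of f g]
    by (metis complex_cnj_cnj complex_cnj_mult)
  show "cip f (g + h) = cip f g + cip f h"
    using cip_add_left[of g h f] cip_cnj by (metis complex_cnj_add)
qed

lemma cip_sum_left: "cip (\<Sum>i\<in>I. v i) h = (\<Sum>i\<in>I. cip (v i) h)"
  by (induction I rule: infinite_finite_induct) (auto simp: cip_add_left)

lemma cip_sum_right: "cip h (\<Sum>i\<in>I. v i) = (\<Sum>i\<in>I. cip h (v i))"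
  by (induction I rule: infinite_finite_induct) auto

lemma norm_scaleC: "norm (scaleC c f) = cmod c * norm f"
proof -
  have "of_real ((norm (scaleC c f))\<^sup>2) = cip (scaleC c f) (scaleC c f)" by (simp only: cip_self)
  also have "\<dots> = (c * cnj c) * cip f f" by (simp add: cip_scaleC_left mult_ac)
  also have "\<dots> = of_real ((cmod c)\<^sup>2 * (norm f)\<^sup>2)" by (simp only: cip_self complex_norm_square of_real_mult)
  finally have "(norm (scaleC c f))\<^sup>2 = (cmod c * norm f)\<^sup>2"
    by (simp only: of_real_eq_iff power_mult_distrib)
  then show ?thesis by (simp add: power2_eq_iff_nonneg)
qed

lemma scaleR_scaleC: "r *\<^sub>R f = scaleC (of_real r) f"
  by (simp add: scaleR_l2M_def)

definition orthonormal :: "'i set \<Rightarrow> ('i \<Rightarrow> 'd::finite l2M) \<Rightarrow> bool" where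
  "orthonormal I v \<longleftrightarrow> (\<forall>i\<in>I. \<forall>j\<in>I. cip (v i) (v j) = of_bool (i = j))"

lemma orthonormal_coeff:
  assumes "orthonormal I v" "finite I" "j \<in> I"
  shows "cip (\<Sum>i\<in>I. scaleC (c i) (v i)) (v j) = c j"
proof -
  have "cip (\<Sum>i\<in>I. scaleC (c i) (v i)) (v j) = (\<Sum>i\<in>I. if i = j then c i else 0)"
    unfolding cip_sum_left cip_scaleC_left using assms by (intro sum.cong refl) (auto simp: orthonormal_def)
  then show ?thesis using assms by simp
qed

lemma orthonormal_norm:
  assumes "orthonormal I v" "finite I"
  shows "(norm (\<Sum>i\<in>I. scaleC (c i) (v i)))\<^sup>2 = (\<Sum>i\<in>I. (cmod (c i))\<^sup>2)"
proof -
  have "of_real ((norm (\<Sum>i\<in>I. scaleC (c i) (v i)))\<^sup>2) = (\<Sum>j\<in>I. cip (\<Sum>i\<in>I. scaleC (c i) (v i)) (scaleC (c j) (v j)))"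
    by (simp only: cip_self[symmetric] cip_sum_right)
  also have "\<dots> = (\<Sum>j\<in>I. c j * cnj (c j))"
    by (intro sum.cong refl) (simp add: orthonormal_coeff[OF assms] mult.commute)
  also have "\<dots> = of_real (\<Sum>i\<in>I. (cmod (c i))\<^sup>2)" by (simp only: of_real_sum complex_norm_square)
  finally show ?thesis by (simp only: of_real_eq_iff)
qed

text \<open>
  If no finite orthonormal family spanned V, Gram-Schmidt steps could be continued forever and
  would produce the infinite orthonormal sequence that is excluded.
\<close>

lemma finite_orthonormal_basis:
  fixes V :: "'d::finite l2M set"
  assumes V: "l2M.subspace V"
    and noseq: "\<And>e :: nat \<Rightarrow> 'd l2M. (\<And>n. e n \<in> V) \<Longrightarrow> orthonormal UNIV e \<Longrightarrow> False"
  shows "\<exists>B. finite B \<and> orthonormal B id \<and> l2M.span B = V \<and> card B = l2M.dim V"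
proof -
  have "\<exists>B. finite B \<and> B \<subseteq> V \<and> orthonormal B id \<and> V \<subseteq> l2M.span B"
  proof (rule ccontr)
    assume no: "\<not> ?thesis"
    have ext: "\<exists>r\<in>V. cip r r = 1 \<and> (\<forall>b\<in>B. cip r b = 0)" if B: "finite B" "B \<subseteq> V" "orthonormal B id" for B
    proof -
      obtain v where v: "v \<in> V" "v \<notin> l2M.span B" using no B by blast
      define w where "w = (\<Sum>b\<in>B. scaleC (cip v b) b)"
      have wB: "w \<in> l2M.span B" unfolding w_def by (intro l2M.span_sum l2M.span_scale l2M.span_base)
      have wV: "w \<in> V" using wB B V l2M.span_minimal by blast
      define u where "u = v - w"
      have u0: "norm u > 0" using v wB by (auto simp: u_def)
      have uV: "u \<in> V" using v wV V l2M.subspace_diff by (auto simp: u_def)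
      have ub: "cip u b = 0" if "b \<in> B" for b
        using orthonormal_coeff[OF B(3,1) that, of "\<lambda>b. cip v b"] by (simp add: u_def w_def)
      define r where "r = scaleC (of_real (1 / norm u)) u"
      have "r \<in> V" using uV V by (simp add: r_def l2M.subspace_scale)
      moreover have "cip r r = 1"
        using u0 by (simp add: cip_self r_def norm_scaleC norm_divide)
      moreover have "cip r b = 0" if "b \<in> B" for b using ub[OF that] by (simp add: r_def cip_scaleC_left)
      ultimately show ?thesis by blast
    qed
    define P where "P f n r \<longleftrightarrow> r \<in> V \<and> cip r r = 1 \<and> (\<forall>m<n. cip r (f m) = 0)"
      for f :: "nat \<Rightarrow> 'd l2M" and n r
    have "\<exists>f. \<forall>n. P f n (f n)"
    proof (rule dependent_wellorder_choice)
      fix f n assume f: "\<And>m. m < n \<Longrightarrow> P f m (f m)"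
      have o: "cip (f i) (f j) = of_bool (i = j)" if "i < n" "j < n" for i j
        using f[OF that(1)] f[OF that(2)] cip_cnj[of "f j" "f i"]
        by (cases i j rule: linorder_cases) (auto simp: P_def)
      have "orthonormal (f ` {..<n}) id"
        unfolding orthonormal_def
      proof (intro ballI)
        fix x y assume "x \<in> f ` {..<n}" "y \<in> f ` {..<n}"
        then obtain i j where ij: "x = f i" "y = f j" "i < n" "j < n" by auto
        have "i = j" if "f i = f j" using o[OF ij(3,4)] o[OF ij(3,3)] that by (cases "i = j") auto
        then show "cip (id x) (id y) = of_bool (x = y)" using o[OF ij(3,4)] ij by auto
      qed
      then have "\<exists>r\<in>V. cip r r = 1 \<and> (\<forall>b\<in>f ` {..<n}. cip r b = 0)"
        using f by (intro ext) (auto simp: P_def)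
      then show "\<exists>r. P f n r" by (auto simp: P_def)
    qed (auto simp: P_def)
    then obtain f where f: "\<And>n. P f n (f n)" by blast
    have "orthonormal UNIV f" unfolding orthonormal_def
    proof (intro ballI)
      fix i j
      show "cip (f i) (f j) = of_bool (i = j)"
        using f[of i] f[of j] cip_cnj[of "f j" "f i"]
        by (cases i j rule: linorder_cases) (auto simp: P_def)
    qed
    then show False using noseq[of f] f by (auto simp: P_def)
  qed
  then obtain B where B: "finite B" "B \<subseteq> V" "orthonormal B id" "V \<subseteq> l2M.span B" by blast
  have sp: "l2M.span B = V" using B V l2M.span_minimal by blast
  have "l2M.independent B"
  proof
    assume "l2M.dependent B"
    then obtain u where u: "\<exists>v\<in>B. u v \<noteq> 0" "(\<Sum>v\<in>B. scaleC (u v) v) = 0"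
      using l2M.dependent_finite[OF B(1)] by blast
    then obtain v where v: "v \<in> B" "u v \<noteq> 0" by blast
    then show False using orthonormal_coeff[OF B(3,1) v(1), of u] u(2) by simp
  qed
  then have "l2M.dim V = card B" using l2M.dim_eq_card[of B V] sp by (metis l2M.span_span)
  then show ?thesis using B sp by metis
qed

locale compact_operator =
  fixes T :: "'d::finite l2M \<Rightarrow> 'd l2M"
  assumes T: "T \<in> bounded_ops" and comp: "compact (closure (T ` cball 0 1))"
begin

lemma bl: "bounded_linear T" using T by (simp add: bounded_ops_def)
lemma T_scaleC: "T (scaleC c f) = scaleC c (T f)" using T by (simp add: bounded_ops_def)
lemma T_add: "T (f + g) = T f + T g" using bl by (simp add: linear_simps)
lemma T_diff: "T (f - g) = T f - T g" using bl by (simp add: linear_simps)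
lemma T_zero: "T 0 = 0" using bl by (simp add: linear_simps)
lemma T_sum: "T (\<Sum>i\<in>I. v i) = (\<Sum>i\<in>I. T (v i))"
  using bl by (simp add: bounded_linear.linear linear_sum)

lemma singular_space_iff: "f \<in> singular_space T s \<longleftrightarrow> (\<forall>g. cip (T f) (T g) = of_real (s\<^sup>2) * cip f g)"
proof
  assume f: "f \<in> singular_space T s"
  have "Re (cip (T f) (T g)) = Re (of_real (s\<^sup>2) * cip f g)" for g
    using f unfolding singular_space_def by (simp add: Re_cip)
  moreover have "Im (cip (T f) (T g)) = Im (of_real (s\<^sup>2) * cip f g)" for g
    using f unfolding singular_space_def by (simp add: cip_def T_scaleC[symmetric])
  ultimately show "\<forall>g. cip (T f) (T g) = of_real (s\<^sup>2) * cip f g" by (simp only: complex_eq_iff) simp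
next
  assume "\<forall>g. cip (T f) (T g) = of_real (s\<^sup>2) * cip f g"
  then have "Re (cip (T f) (T g)) = Re (of_real (s\<^sup>2) * cip f g)" for g by simp
  then show "f \<in> singular_space T s" by (simp add: singular_space_def Re_cip)
qed

lemma singular_subspace: "l2M.subspace (singular_space T s)"
  unfolding l2M.subspace_def
  by (auto simp: singular_space_iff T_zero T_add T_scaleC cip_add_left cip_scaleC_left algebra_simps)

lemma singular_spaces_orthogonal:
  assumes "f \<in> singular_space T s" "g \<in> singular_space T s'" "s > 0" "s' > 0" "s \<noteq> s'"
  shows "cip f g = 0"
proof -
  have 1: "cip (T f) (T g) = of_real (s\<^sup>2) * cip f g" using assms(1) by (simp add: singular_space_iff)
  have "cip (T g) (T f) = of_real (s'\<^sup>2) * cip g f" using assms(2) by (simp add: singular_space_iff)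
  then have 2: "cip (T f) (T g) = of_real (s'\<^sup>2) * cip f g"
    unfolding cip_cnj[of "T g" "T f", symmetric] by (simp add: cip_cnj)
  have "of_real (s\<^sup>2 - s'\<^sup>2) * cip f g = 0"
    using trans[OF 1[symmetric] 2] by (simp only: of_real_diff left_diff_distrib right_minus_eq)
  moreover have "s\<^sup>2 - s'\<^sup>2 \<noteq> 0" using assms by (simp add: power2_eq_iff)
  ultimately show ?thesis by (metis mult_eq_0_iff of_real_eq_0_iff)
qed

text \<open>
  A sequence of orthogonal vectors of norm at least \<open>\<tau>\<close> has no Cauchy subsequence.
\<close>

lemma no_orthogonal_sequence:
  fixes e :: "nat \<Rightarrow> 'd l2M"
  assumes e: "\<And>n. norm (e n) = 1" and o: "\<And>m n. m \<noteq> n \<Longrightarrow> cip (T (e m)) (T (e n)) = 0"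
    and \<tau>: "\<tau> > 0" "\<And>n. norm (T (e n)) \<ge> \<tau>"
  shows False
proof -
  have "\<forall>n. T (e n) \<in> closure (T ` cball 0 1)"
    using e closure_subset[of "T ` cball 0 1"] by (auto simp: image_subset_iff)
  from comp[unfolded compact_def, THEN spec, THEN mp, OF this]
  obtain l r where r: "strict_mono (r :: nat \<Rightarrow> nat)" "((\<lambda>n. T (e n)) \<circ> r) \<longlonglongrightarrow> l" by blast
  from r(2) have "Cauchy ((\<lambda>n. T (e n)) \<circ> r)" by (rule LIMSEQ_imp_Cauchy)
  from metric_CauchyD[OF this \<tau>(1)]
  obtain M where M: "\<And>m n. m \<ge> M \<Longrightarrow> n \<ge> M \<Longrightarrow> dist (T (e (r m))) (T (e (r n))) < \<tau>"
    by (auto simp: o_def)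
  let ?x = "T (e (r M))" and ?y = "T (e (r (Suc M)))"
  have "r M \<noteq> r (Suc M)" using r(1) by (metis n_not_Suc_n strict_mono_eq)
  then have "cip ?x ?y = 0" by (rule o)
  then have "inner ?x ?y = 0" using Re_cip[of ?x ?y] by simp
  then have "(norm (?x - ?y))\<^sup>2 = (norm ?x)\<^sup>2 + (norm ?y)\<^sup>2"
    by (simp add: power2_norm_eq_inner inner_diff inner_commute)
  moreover have "\<tau>\<^sup>2 \<le> (norm ?x)\<^sup>2" using \<tau> by (intro power_mono) auto
  ultimately have "\<tau>\<^sup>2 \<le> (norm (?x - ?y))\<^sup>2" using zero_le_power2[of "norm ?y"] by linarith
  then have "\<tau> \<le> norm (?x - ?y)" by (rule power2_le_imp_le) simp
  then show False using M[of M "Suc M"] by (simp add: dist_norm)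
qed

lemma singular_norm:
  assumes "f \<in> singular_space T s"
  shows "(norm (T f))\<^sup>2 = s\<^sup>2 * (norm f)\<^sup>2"
  using assms unfolding singular_space_def by (simp add: power2_norm_eq_inner)

lemma sbasis_exists:
  assumes "s > 0"
  shows "\<exists>B. finite B \<and> orthonormal B id \<and> l2M.span B = singular_space T s \<and> card B = singular_mult T s"
  unfolding singular_mult_def
proof (rule finite_orthonormal_basis[OF singular_subspace])
  fix e :: "nat \<Rightarrow> 'd l2M"
  assume e: "\<And>n. e n \<in> singular_space T s" and o: "orthonormal UNIV e"
  have n1: "norm (e n) = 1" for n
    using o cip_self[of "e n"] unfolding orthonormal_def by (metis UNIV_I norm_eq_1 of_bool_eq(2) of_real_eq_1_iff power2_norm_eq_inner)
  show False
  proof (rule no_orthogonal_sequence[of e s])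
    show "norm (e n) = 1" for n by (rule n1)
    show "cip (T (e m)) (T (e n)) = 0" if "m \<noteq> n" for m n
      using e[of m] o that by (auto simp: singular_space_iff orthonormal_def)
    show "s \<le> norm (T (e n))" for n
      using singular_norm[OF e[of n]] n1[of n] assms by (simp add: power2_eq_iff_nonneg)
  qed (rule assms)
qed

definition sbasis :: "real \<Rightarrow> 'd l2M set" where
  "sbasis s = (SOME B. finite B \<and> orthonormal B id \<and> l2M.span B = singular_space T s \<and> card B = singular_mult T s)"

lemma sbasis:
  assumes "s > 0"
  shows "finite (sbasis s)" "orthonormal (sbasis s) id" "l2M.span (sbasis s) = singular_space T s"
    "card (sbasis s) = singular_mult T s" "b \<in> sbasis s \<Longrightarrow> b \<in> singular_space T s"
proof -
  note someI_ex[OF sbasis_exists[OF assms], folded sbasis_def]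
  then show "finite (sbasis s)" "orthonormal (sbasis s) id" "l2M.span (sbasis s) = singular_space T s"
    "card (sbasis s) = singular_mult T s" by blast+
  then show "b \<in> sbasis s \<Longrightarrow> b \<in> singular_space T s" using l2M.span_base by blast
qed

text \<open>
  An orthonormal system of singular vectors for the singular values from \<open>\<tau>\<close> on.
\<close>

definition svecs :: "real \<Rightarrow> 'd l2M set" where
  "svecs \<tau> = (\<Union>s\<in>{s. \<tau> \<le> s \<and> 0 < s}. sbasis s)"

lemma sbasis_cip:
  assumes "b \<in> sbasis s" "b' \<in> sbasis s'" "s > 0" "s' > 0"
  shows "cip b b' = of_bool (b = b')"
proof (cases "s = s'")
  case True
  then show ?thesis using assms sbasis(2)[OF assms(3)] by (auto simp: orthonormal_def)
next
  case False
  have "cip b b' = 0"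
    using singular_spaces_orthogonal[OF sbasis(5) sbasis(5), OF assms(3,1) assms(4,2) assms(3,4) False] .
  moreover have "cip b b = 1" using assms sbasis(2)[OF assms(3)] by (auto simp: orthonormal_def)
  ultimately show ?thesis by auto
qed

lemma sbasis_unique:
  assumes "b \<in> sbasis s" "b \<in> sbasis s'" "s > 0" "s' > 0"
  shows "s = s'"
proof (rule ccontr)
  assume "s \<noteq> s'"
  then have "cip b b = 0"
    using singular_spaces_orthogonal[OF sbasis(5) sbasis(5), OF assms(3,1) assms(4,2) assms(3,4)] by blast
  then show False using sbasis_cip[OF assms(1,1,3,3)] by simp
qed

lemma svecs_orthonormal: "orthonormal (svecs \<tau>) id"
  unfolding orthonormal_def svecs_def using sbasis_cip by auto

lemma finite_svecs:
  assumes "\<tau> > 0"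
  shows "finite (svecs \<tau>)"
proof (rule ccontr)
  assume "infinite (svecs \<tau>)"
  then obtain e :: "nat \<Rightarrow> 'd l2M" where e: "inj e" "range e \<subseteq> svecs \<tau>"
    using infinite_countable_subset by blast
  have o: "cip (e m) (e n) = of_bool (m = n)" for m n
  proof -
    have "e m \<in> svecs \<tau>" "e n \<in> svecs \<tau>" using e(2) by auto
    then have "cip (e m) (e n) = of_bool (e m = e n)"
      using svecs_orthonormal[of \<tau>] by (simp add: orthonormal_def)
    then show ?thesis using e(1) by (simp add: inj_eq)
  qed
  have n1: "norm (e n) = 1" for n
    using o[of n n] cip_self[of "e n"] by (metis norm_eq_1 of_bool_eq(2) of_real_eq_1_iff power2_norm_eq_inner)
  have "\<exists>s. \<tau> \<le> s \<and> 0 < s \<and> e n \<in> singular_space T s" for n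
  proof -
    have "e n \<in> svecs \<tau>" using e(2) by blast
    then obtain s where "\<tau> \<le> s" "0 < s" "e n \<in> sbasis s" unfolding svecs_def by blast
    then show ?thesis using sbasis(5) by blast
  qed
  then obtain s where s: "\<And>n. \<tau> \<le> s n" "\<And>n. 0 < s n" "\<And>n. e n \<in> singular_space T (s n)" by metis
  show False
  proof (rule no_orthogonal_sequence[of e \<tau>])
    show "norm (e n) = 1" for n by (rule n1)
    show "cip (T (e m)) (T (e n)) = 0" if "m \<noteq> n" for m n
      using s(3)[of m] o that by (auto simp: singular_space_iff)
    show "\<tau> \<le> norm (T (e n))" for n
      using singular_norm[OF s(3)[of n]] n1[of n] s(1,2)[of n] by (simp add: power2_eq_iff_nonneg)
  qed (rule assms)
qed

text \<open>
  The spectral theorem for \<open>T\<^sup>* T\<close> as an inequality: orthogonally to the finitely many singular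
  vectors B with value at least t, the form is at most t. Otherwise the supremum \<open>\<sigma>\<close> of the form
  over the unit sphere of the complement N of B exceeds t. A maximising sequence x has a
  subsequence along which T x converges; by the parallelogram law the subsequence itself is
  Cauchy. Its limit z attains \<open>\<sigma>\<close>, so it is a singular vector with value \<open>sqrt \<sigma>\<close>, and as such in
  the span of B, to which it is orthogonal.
\<close>

lemma compact_form_bound:
  assumes t: "t > 0" and f: "\<And>s b. 0 < s \<Longrightarrow> t \<le> s\<^sup>2 \<Longrightarrow> b \<in> sbasis s \<Longrightarrow> cip f b = 0"
  shows "(norm (T f))\<^sup>2 \<le> t * (norm f)\<^sup>2"
proof (rule ccontr)
  assume neg: "\<not> ?thesis"
  define B where "B = svecs (sqrt t)"
  have finB: "finite B" unfolding B_def using t by (intro finite_svecs) simp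
  have oB: "orthonormal B id" unfolding B_def by (rule svecs_orthonormal)
  define N where "N = {f. \<forall>b\<in>B. cip f b = 0}"
  have N: "x - y \<in> N" "x + y \<in> N" "r *\<^sub>R x \<in> N" if "x \<in> N" "y \<in> N" for x y r
    using that by (auto simp: N_def cip_add_left scaleR_scaleC cip_scaleC_left)
  have fN: "f \<in> N"
  proof -
    have "t \<le> s\<^sup>2" if "sqrt t \<le> s" for s using that t by (metis real_sqrt_le_iff real_sqrt_abs real_sqrt_ge_zero abs_of_nonneg order_trans less_imp_le)
    then show ?thesis using f unfolding N_def B_def svecs_def by auto
  qed
  have f0: "f \<noteq> 0" using neg by (auto simp: T_zero)
  obtain K where K: "\<And>x. norm (T x) \<le> norm x * K" using bounded_linear.bounded[OF bl] by blast
  define A where "A = (\<lambda>x. (norm (T x))\<^sup>2) ` {x \<in> N. norm x = 1}"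
  define \<sigma> where "\<sigma> = Sup A"
  have bdd: "bdd_above A"
  proof (rule bdd_aboveI[of _ "K\<^sup>2"])
    fix a assume "a \<in> A"
    then obtain x where "a = (norm (T x))\<^sup>2" "norm x = 1" by (auto simp: A_def)
    then show "a \<le> K\<^sup>2" using K[of x] by (simp add: power_mono)
  qed
  define f1 where "f1 = (1 / norm f) *\<^sub>R f"
  have f1: "f1 \<in> N" "norm f1 = 1" using N(3)[OF fN fN] f0 by (auto simp: f1_def)
  have "(norm (T f1))\<^sup>2 = (norm (T f))\<^sup>2 / (norm f)\<^sup>2"
    unfolding f1_def linear_cmul[OF bounded_linear.linear[OF bl]] using f0 by (simp add: power_divide)
  also have "\<dots> > t" using neg f0 by (simp add: field_simps)
  finally have Af1: "(norm (T f1))\<^sup>2 > t" .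
  have inA: "(norm (T f1))\<^sup>2 \<in> A" using f1 by (auto simp: A_def)
  have \<sigma>t: "\<sigma> > t" using cSup_upper[OF inA bdd] Af1 by (simp add: \<sigma>_def)
  have ub: "(norm (T x))\<^sup>2 \<le> \<sigma> * (norm x)\<^sup>2" if x: "x \<in> N" for x
  proof (cases "x = 0")
    case False
    have "(1 / norm x) *\<^sub>R x \<in> N" "norm ((1 / norm x) *\<^sub>R x) = 1" using N(3)[OF x x] False by auto
    then have "(norm (T ((1 / norm x) *\<^sub>R x)))\<^sup>2 \<le> \<sigma>"
      unfolding \<sigma>_def by (intro cSup_upper bdd) (auto simp: A_def)
    then have "(norm (T x))\<^sup>2 / (norm x)\<^sup>2 \<le> \<sigma>"
      unfolding linear_cmul[OF bounded_linear.linear[OF bl]] using False by (simp add: power_divide)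
    then show ?thesis using False by (simp add: field_simps)
  qed (simp add: T_zero)
  have "\<exists>x\<in>N. norm x = 1 \<and> (norm (T x))\<^sup>2 > \<sigma> - 1 / real (Suc n)" for n
  proof -
    have "\<sigma> - 1 / real (Suc n) < Sup A" by (simp add: \<sigma>_def)
    then obtain a where "a \<in> A" "\<sigma> - 1 / real (Suc n) < a" using less_cSupE[of _ A] inA by blast
    then show ?thesis by (auto simp: A_def)
  qed
  then obtain x where x: "\<And>n. x n \<in> N" "\<And>n. norm (x n) = 1" "\<And>n. (norm (T (x n)))\<^sup>2 > \<sigma> - 1 / real (Suc n)"
    by metis
  have "\<forall>n. T (x n) \<in> closure (T ` cball 0 1)"
    using x(2) closure_subset[of "T ` cball 0 1"] by (auto simp: image_subset_iff)
  from comp[unfolded compact_def, THEN spec, THEN mp, OF this]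
  obtain y r where r: "strict_mono (r :: nat \<Rightarrow> nat)" "((\<lambda>n. T (x n)) \<circ> r) \<longlonglongrightarrow> y" by blast
  from r(2) have CT: "Cauchy ((\<lambda>n. T (x n)) \<circ> r)" by (rule LIMSEQ_imp_Cauchy)
  have near: "\<sigma> * (norm (x m - x n))\<^sup>2 \<le> 2 / real (Suc m) + 2 / real (Suc n) + (norm (T (x m) - T (x n)))\<^sup>2" for m n
  proof -
    have par: "(norm (g + h))\<^sup>2 + (norm (g - h))\<^sup>2 = 2 * (norm g)\<^sup>2 + 2 * (norm h)\<^sup>2" for g h :: "'d l2M"
      by (simp add: power2_norm_eq_inner inner_add inner_diff)
    have "(norm (T (x m + x n)))\<^sup>2 \<le> \<sigma> * (norm (x m + x n))\<^sup>2" using x(1) by (intro ub N)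
    moreover have "(norm (T (x m + x n)))\<^sup>2 = 2 * (norm (T (x m)))\<^sup>2 + 2 * (norm (T (x n)))\<^sup>2 - (norm (T (x m) - T (x n)))\<^sup>2"
      using par[of "T (x m)" "T (x n)"] by (simp add: T_add)
    moreover have "(norm (x m + x n))\<^sup>2 = 4 - (norm (x m - x n))\<^sup>2" using par[of "x m" "x n"] x(2) by simp
    ultimately have "\<sigma> * (norm (x m - x n))\<^sup>2 \<le> 4 * \<sigma> - 2 * (norm (T (x m)))\<^sup>2 - 2 * (norm (T (x n)))\<^sup>2 + (norm (T (x m) - T (x n)))\<^sup>2"
      by (simp add: algebra_simps)
    then show ?thesis using x(3)[of m] x(3)[of n] by simp
  qed
  have "Cauchy (x \<circ> r)"
  proof (rule metric_CauchyI)
    fix e :: real assume e: "e > 0"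
    define e2 where "e2 = \<sigma> * e\<^sup>2 / 8"
    have e2: "e2 > 0" using e t \<sigma>t by (simp add: e2_def)
    obtain M1 where M1: "\<And>m n. m \<ge> M1 \<Longrightarrow> n \<ge> M1 \<Longrightarrow> dist (((\<lambda>n. T (x n)) \<circ> r) m) (((\<lambda>n. T (x n)) \<circ> r) n) < sqrt e2"
      using metric_CauchyD[OF CT, of "sqrt e2"] e2 by auto
    obtain M2 where M2: "1 / real (Suc M2) < e2" using e2 nat_approx_posE by metis
    have M2': "1 / real (Suc (r m)) < e2" if "m \<ge> M2" for m
    proof -
      have "Suc M2 \<le> Suc (r m)" using that seq_suble[OF r(1), of m] by simp
      then have "1 / real (Suc (r m)) \<le> 1 / real (Suc M2)" by (intro divide_left_mono) auto
      then show ?thesis using M2 by simp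
    qed
    have "dist ((x \<circ> r) m) ((x \<circ> r) n) < e" if mn: "m \<ge> max M1 M2" "n \<ge> max M1 M2" for m n
    proof -
      have "norm (T (x (r m)) - T (x (r n))) < sqrt e2" using M1[of m n] mn by (simp add: dist_norm)
      then have "(norm (T (x (r m)) - T (x (r n))))\<^sup>2 < (sqrt e2)\<^sup>2" by (intro power_strict_mono) auto
      then have "(norm (T (x (r m)) - T (x (r n))))\<^sup>2 < e2" using e2 by simp
      then have "\<sigma> * (norm (x (r m) - x (r n)))\<^sup>2 < 2 * e2 + 2 * e2 + e2"
        using near[of "r m" "r n"] M2'[of m] M2'[of n] mn by simp
      also have "\<dots> < \<sigma> * e\<^sup>2" using e t \<sigma>t by (simp add: e2_def)
      finally have "(norm (x (r m) - x (r n)))\<^sup>2 < e\<^sup>2" using t \<sigma>t by (simp add: mult_less_cancel_left)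
      then show ?thesis using e by (simp add: dist_norm power_less_imp_less_base)
    qed
    then show "\<exists>M. \<forall>m\<ge>M. \<forall>n\<ge>M. dist ((x \<circ> r) m) ((x \<circ> r) n) < e" by blast
  qed
  then obtain z where z: "(x \<circ> r) \<longlonglongrightarrow> z" using Cauchy_convergent convergent_def by blast
  have zN: "z \<in> N"
  proof -
    have "cip z b = 0" if "b \<in> B" for b
    proof -
      have "(\<lambda>n. cip ((x \<circ> r) n) b) \<longlonglongrightarrow> cip z b"
        unfolding cip_def by (intro tendsto_Complex tendsto_inner z tendsto_const)
      moreover have "cip ((x \<circ> r) n) b = 0" for n using x(1)[of "r n"] that by (simp add: N_def)
      ultimately show ?thesis using LIMSEQ_unique[OF _ tendsto_const] by auto
    qed
    then show ?thesis by (simp add: N_def)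
  qed
  have z1: "norm z = 1"
  proof -
    have "(\<lambda>n. norm ((x \<circ> r) n)) \<longlonglongrightarrow> norm z" by (intro tendsto_norm z)
    then show ?thesis using x(2) LIMSEQ_unique[OF _ tendsto_const] by (auto simp: o_def)
  qed
  have Tz: "(norm (T z))\<^sup>2 = \<sigma>"
  proof (rule antisym)
    show "(norm (T z))\<^sup>2 \<le> \<sigma>" using ub[OF zN] z1 by simp
    have "(\<lambda>n. (norm (T ((x \<circ> r) n)))\<^sup>2) \<longlonglongrightarrow> (norm (T z))\<^sup>2"
      by (intro tendsto_power tendsto_norm bounded_linear.tendsto[OF bl] z)
    moreover have "(\<lambda>n. \<sigma> - 1 / real (Suc n)) \<longlonglongrightarrow> \<sigma> - 0"
      by (intro tendsto_diff tendsto_const LIMSEQ_Suc lim_1_over_n)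
    moreover have "\<sigma> - 1 / real (Suc n) \<le> (norm (T ((x \<circ> r) n)))\<^sup>2" for n
    proof -
      have "Suc n \<le> Suc (r n)" using seq_suble[OF r(1), of n] by simp
      then have "1 / real (Suc (r n)) \<le> 1 / real (Suc n)" by (intro divide_left_mono) auto
      then show ?thesis using x(3)[of "r n"] by simp
    qed
    ultimately show "\<sigma> \<le> (norm (T z))\<^sup>2" using LIMSEQ_le by fastforce
  qed
  \<comment> \<open>first-order condition at the maximiser z\<close>
  have orth: "inner (T z) (T g) = \<sigma> * inner z g" if g: "g \<in> N" for g
  proof -
    define s where "s = inner (T z) (T g) - \<sigma> * inner z g"
    define k where "k = \<sigma> * (norm g)\<^sup>2 - (norm (T g))\<^sup>2"
    have q: "2 * a * s \<le> a\<^sup>2 * k" for a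
    proof -
      have "(norm (T (z + a *\<^sub>R g)))\<^sup>2 \<le> \<sigma> * (norm (z + a *\<^sub>R g))\<^sup>2" using zN g by (intro ub N)
      moreover have "T (z + a *\<^sub>R g) = T z + a *\<^sub>R T g"
        by (simp add: T_add linear_cmul[OF bounded_linear.linear[OF bl]])
      moreover have e: "(norm (u + a *\<^sub>R v))\<^sup>2 = (norm u)\<^sup>2 + 2 * a * inner u v + a\<^sup>2 * (norm v)\<^sup>2" for u v :: "'d l2M"
        by (simp add: power2_norm_eq_inner inner_add inner_commute algebra_simps power2_eq_square[of a])
      ultimately show ?thesis using Tz z1 by (simp add: e s_def k_def algebra_simps)
    qed
    have "s = 0"
    proof (rule ccontr)
      assume s: "s \<noteq> 0"
      define a where "a = s / (\<bar>k\<bar> + 1)"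
      have "2 * a * s \<le> a\<^sup>2 * (\<bar>k\<bar> + 1)"
      proof -
        have "a\<^sup>2 * k \<le> a\<^sup>2 * (\<bar>k\<bar> + 1)" by (intro mult_left_mono) auto
        then show ?thesis using q[of a] by linarith
      qed
      also have "\<dots> = a * s" by (simp add: a_def power2_eq_square)
      finally have "a * s \<le> 0" by simp
      moreover have "a * s > 0" using s by (auto simp: a_def power2_eq_square[symmetric] zero_less_divide_iff)
      ultimately show False by simp
    qed
    then show ?thesis by (simp add: s_def)
  qed
  have "z \<in> singular_space T (sqrt \<sigma>)"
    unfolding singular_space_def
  proof (intro CollectI allI)
    fix g
    define h where "h = (\<Sum>b\<in>B. scaleC (cip g b) b)"
    have gh: "g - h \<in> N"
      using orthonormal_coeff[OF oB finB, of _ "\<lambda>b. cip g b"] by (auto simp: N_def h_def)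
    have zb: "cip z b = 0" if "b \<in> B" for b using zN that by (simp add: N_def)
    have Tzb: "cip (T z) (T b) = 0" if "b \<in> B" for b
    proof -
      have "\<exists>s>0. b \<in> sbasis s" using that by (auto simp: B_def svecs_def)
      then obtain s where "s > 0" "b \<in> sbasis s" by blast
      then have "cip (T b) (T z) = of_real (s\<^sup>2) * cip b z" using sbasis(5) singular_space_iff by blast
      then show ?thesis using zb[OF that] cip_cnj[of "T b" "T z"] cip_cnj[of z b] by (metis complex_cnj_zero mult_zero_right)
    qed
    have "cip z h = 0" unfolding h_def cip_sum_right using zb by simp
    moreover have "cip (T z) (T h) = 0" unfolding h_def T_sum T_scaleC cip_sum_right using Tzb by simp
    ultimately have "inner z h = 0" "inner (T z) (T h) = 0"
      unfolding Re_cip[symmetric] by simp_all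
    then have "inner (T z) (T g) = inner (T z) (T (g - h))" "inner z g = inner z (g - h)"
      by (simp_all add: T_diff inner_diff_right)
    then show "inner (T z) (T g) = (sqrt \<sigma>)\<^sup>2 * inner z g" using orth[OF gh] t \<sigma>t by simp
  qed
  moreover have s0: "sqrt \<sigma> > 0" using t \<sigma>t by simp
  ultimately have "z \<in> l2M.span (sbasis (sqrt \<sigma>))" using sbasis(3)[OF s0] by simp
  moreover have "sbasis (sqrt \<sigma>) \<subseteq> {b. cip z b = 0}"
  proof
    fix b assume b: "b \<in> sbasis (sqrt \<sigma>)"
    have "sqrt t \<le> sqrt \<sigma>" using \<sigma>t by simp
    then have "b \<in> B" unfolding B_def svecs_def using b s0 by blast
    then show "b \<in> {b. cip z b = 0}" using zN by (simp add: N_def)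
  qed
  moreover have "l2M.subspace {b. cip z b = 0}" unfolding l2M.subspace_def by simp
  ultimately have "z \<in> {b. cip z b = 0}" using l2M.span_minimal by blast
  then show False using cip_self[of z] z1 by simp
qed

definition singular_vectors :: "'d l2M set" where
  "singular_vectors = {x. \<exists>s>0. x \<in> sbasis s}"

lemma sbasis_norm:
  assumes "s > 0" "x \<in> sbasis s"
  shows "(norm (T x))\<^sup>2 = s\<^sup>2"
proof -
  have "cip x x = 1" using sbasis_cip[OF assms(2,2,1,1)] by simp
  then have "(norm x)\<^sup>2 = 1" unfolding cip_self by (simp only: of_real_eq_1_iff)
  then show ?thesis using singular_norm[OF sbasis(5)[OF assms]] by simp
qed

lemma singular_vectors_form_bound:
  assumes t: "t > 0" and f: "\<And>x. x \<in> singular_vectors \<Longrightarrow> t \<le> (norm (T x))\<^sup>2 \<Longrightarrow> cip f x = 0"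
  shows "(norm (T f))\<^sup>2 \<le> t * (norm f)\<^sup>2"
proof (rule compact_form_bound[OF t])
  fix s b assume s: "0 < s" "t \<le> s\<^sup>2" "b \<in> sbasis s"
  then show "cip f b = 0" using f[of b] sbasis_norm[OF s(1,3)] by (auto simp: singular_vectors_def)
qed

text \<open>
  For the lower estimate singular vectors are the functionals of the counting principle; the sum
  of their weights is bounded by the Schatten sum.
\<close>

lemma singular_vectors_sum:
  assumes q: "p = 2 * q" and G: "finite G" "G \<subseteq> singular_vectors"
    and sm: "(\<lambda>s. real (singular_mult T s) * s powr p) summable_on {0<..}"
  shows "(\<Sum>x\<in>G. (norm (T x))\<^sup>2 powr q) \<le> (\<Sum>\<^sub>\<infinity>s\<in>{0<..}. real (singular_mult T s) * s powr p)"
proof -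
  have "\<forall>x\<in>G. \<exists>s. s > 0 \<and> x \<in> sbasis s" using G by (auto simp: singular_vectors_def)
  then obtain \<sigma> where \<sigma>: "\<And>x. x \<in> G \<Longrightarrow> \<sigma> x > 0" "\<And>x. x \<in> G \<Longrightarrow> x \<in> sbasis (\<sigma> x)" by metis
  have val: "(norm (T x))\<^sup>2 powr q = \<sigma> x powr p" if "x \<in> G" for x
  proof -
    have "(norm (T x))\<^sup>2 = \<sigma> x powr 2" using sbasis_norm[OF \<sigma>(1)[OF that] \<sigma>(2)[OF that]] \<sigma>(1)[OF that] by simp
    then have "(norm (T x))\<^sup>2 powr q = (\<sigma> x powr 2) powr q" by (simp only:)
    then show ?thesis by (simp only: powr_powr q)
  qed
  have "(\<Sum>x\<in>G. (norm (T x))\<^sup>2 powr q) = (\<Sum>s\<in>\<sigma> ` G. \<Sum>x\<in>{x \<in> G. \<sigma> x = s}. (norm (T x))\<^sup>2 powr q)"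
    by (rule sum.image_gen[OF G(1)])
  also have "\<dots> \<le> (\<Sum>s\<in>\<sigma> ` G. real (singular_mult T s) * s powr p)"
  proof (rule sum_mono)
    fix s assume "s \<in> \<sigma> ` G"
    then have s: "s > 0" using \<sigma> by auto
    have "(\<Sum>x\<in>{x \<in> G. \<sigma> x = s}. (norm (T x))\<^sup>2 powr q) = real (card {x \<in> G. \<sigma> x = s}) * s powr p"
      using val by simp
    also have "card {x \<in> G. \<sigma> x = s} \<le> card (sbasis s)"
      using \<sigma>(2) by (intro card_mono sbasis(1)[OF s]) auto
    then have "real (card {x \<in> G. \<sigma> x = s}) * s powr p \<le> real (singular_mult T s) * s powr p"
      using sbasis(4)[OF s] by (intro mult_right_mono) auto
    finally show "(\<Sum>x\<in>{x \<in> G. \<sigma> x = s}. (norm (T x))\<^sup>2 powr q) \<le> real (singular_mult T s) * s powr p" .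
  qed
  also have "\<dots> \<le> (\<Sum>\<^sub>\<infinity>s\<in>{0<..}. real (singular_mult T s) * s powr p)"
    using G \<sigma> by (intro finite_sum_le_infsum[OF sm]) auto
  finally show ?thesis .
qed

end

section \<open>Matrices inside L_2\<close>

lemma tensor_one_add:
  assumes "x \<in> carrier_mat N N" "y \<in> carrier_mat N N"
  shows "tensor_one r (x + y) = tensor_one r x + tensor_one r y"
  using assms by (intro eq_matI) (auto simp: tensor_one_def div_prod_index)

lemma tensor_one_smult:
  assumes "x \<in> carrier_mat N N"
  shows "tensor_one r (c \<cdot>\<^sub>m x) = c \<cdot>\<^sub>m tensor_one r x"
  using assms by (intro eq_matI) (auto simp: tensor_one_def div_prod_index)

lemma tensor_one_zero: "tensor_one r (0\<^sub>m N N) = 0\<^sub>m (N * r) (N * r)"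
  by (intro eq_matI) (auto simp: tensor_one_def div_prod_index)

lemma tensor_one_one: "tensor_one r (1\<^sub>m N) = 1\<^sub>m (N * r)"
proof (intro eq_matI)
  fix i j assume "i < dim_row (1\<^sub>m (N * r) :: complex mat)" "j < dim_col (1\<^sub>m (N * r) :: complex mat)"
  then have ij: "i < N * r" "j < N * r" by auto
  have "i = j" if "i mod r = j mod r" "i div r = j div r" using that by (metis div_mult_mod_eq)
  then show "tensor_one r (1\<^sub>m N) $$ (i, j) = 1\<^sub>m (N * r) $$ (i, j)"
    using ij by (auto simp: tensor_one_def div_prod_index)
qed (auto simp: tensor_one_def)

lemma partial_trace_diff:
  assumes "x \<in> carrier_mat (N * r) (N * r)" "y \<in> carrier_mat (N * r) (N * r)" "r > 0"
  shows "partial_trace r (x - y) = partial_trace r x - partial_trace r y"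
  using assms less_prod_index[of _ N _ r]
  by (intro eq_matI) (auto simp: partial_trace_def sum_subtractf diff_divide_distrib)

lemma partial_trace_zero:
  assumes "r > 0"
  shows "partial_trace r (0\<^sub>m (N * r) (N * r)) = 0\<^sub>m N N"
proof (rule eq_matI)
  have c: "partial_trace r (0\<^sub>m (N * r) (N * r)) \<in> carrier_mat N N"
    using assms by (intro partial_trace_carrier) auto
  fix i j assume "i < dim_row (0\<^sub>m N N :: complex mat)" "j < dim_col (0\<^sub>m N N :: complex mat)"
  then have ij: "i < N" "j < N" by auto
  have "partial_trace r (0\<^sub>m (N * r) (N * r)) $$ (i, j) = (\<Sum>a<r. 0\<^sub>m (N * r) (N * r) $$ (i * r + a, j * r + a)) / of_nat r"
    using ij assms by (intro partial_trace_index) auto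
  also have "(\<Sum>a<r. 0\<^sub>m (N * r) (N * r) $$ (i * r + a, j * r + a) :: complex) = 0"
    by (intro sum.neutral ballI) (simp add: less_prod_index ij)
  finally show "partial_trace r (0\<^sub>m (N * r) (N * r)) $$ (i, j) = 0\<^sub>m N N $$ (i, j)" using ij by simp
qed (use carrier_matD[OF partial_trace_carrier[OF assms, of "0\<^sub>m (N * r) (N * r)" N]] in simp_all)

lemma partial_trace_mult_tensor_one:
  assumes x: "x \<in> carrier_mat (N * r) (N * r)" and z: "z \<in> carrier_mat N N" and r: "r > 0"
  shows "partial_trace r (x * tensor_one r z) = partial_trace r x * z"
proof -
  have "partial_trace r (tensor_one r (1\<^sub>m N) * x * tensor_one r z) = 1\<^sub>m N * partial_trace r x * z"
    by (rule partial_trace_bimodule) (use assms in auto)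
  then show ?thesis using x z partial_trace_carrier[OF r x] by (simp add: tensor_one_one)
qed

lemma sqn_increment:
  assumes y: "y \<in> carrier_mat (N * r) (N * r)" and r: "r > 0"
    and x: "x = partial_trace r y \<or> x = 0\<^sub>m N N"
  shows "sqn (y - tensor_one r x) = sqn y - sqn x"
proof (cases "x = 0\<^sub>m N N")
  case True
  have "sqn (0\<^sub>m N N :: complex mat) = 0" by (subst sqn_sum[of _ N]) auto
  moreover have "y - 0\<^sub>m (N * r) (N * r) = y" using y by auto
  ultimately show ?thesis using True by (simp add: tensor_one_zero)
next
  case False
  then have xe: "x = partial_trace r y" using x by simp
  have cx: "x \<in> carrier_mat N N" using xe partial_trace_carrier[OF r y] by simp
  have "hs_inner y (tensor_one r x) = hs_inner x x" using hs_inner_tensor_one[OF y cx r] xe by simp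
  then show ?thesis
    using Re_hs_inner_polar(2)[OF y tensor_one_carrier[OF cx, of r]] sqn_tensor_one[OF cx r] by simp
qed

lemma Rep_l2_embed_ge:
  assumes "x \<in> carrier_mat (CARD('d) ^ n) (CARD('d) ^ n)" "k \<ge> 1" "n \<le> k"
  shows "Rep_l2M (l2_embed n x :: 'd::finite l2M) k = tensor_one (CARD('d) ^ (k - n)) x"
  using Rep_l2_embed[OF assms(1)] embed_seq_ge[OF assms(2,3,1)] by simp

text \<open>
  The early members of a martingale are conditional expectations of the later ones.
\<close>

lemma l2M_eq_tail:
  fixes f g :: "'d::finite l2M"
  assumes "\<And>k. n \<le> k \<Longrightarrow> 1 \<le> k \<Longrightarrow> Rep_l2M f k = Rep_l2M g k"
  shows "f = g"
proof -
  have "Rep_l2M f j = Rep_l2M g j" for j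
  proof (cases "j = 0")
    case True
    then show ?thesis using Rep_l2M_martingale[of f] Rep_l2M_martingale[of g] by (simp add: martingales_def)
  next
    case False
    define m where "m = max j n"
    have "partial_trace (CARD('d) ^ (m - j)) (Rep_l2M f m) = Rep_l2M f j"
      "partial_trace (CARD('d) ^ (m - j)) (Rep_l2M g m) = Rep_l2M g j"
      using martingale_steps'[OF Rep_l2M_martingale[of f], of j m]
        martingale_steps'[OF Rep_l2M_martingale[of g], of j m] False by (auto simp: m_def)
    moreover have "Rep_l2M f m = Rep_l2M g m" using False by (intro assms) (auto simp: m_def)
    ultimately show ?thesis by simp
  qed
  then show ?thesis by (simp add: Rep_l2M_inject[symmetric] ext)
qed

lemma l2_embed_tensor_one:
  assumes x: "x \<in> carrier_mat (CARD('d) ^ n) (CARD('d) ^ n)" and nm: "n \<le> m"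
  shows "(l2_embed m (tensor_one (CARD('d) ^ (m - n)) x) :: 'd::finite l2M) = l2_embed n x"
proof (rule l2M_eq_tail[of m])
  fix k assume k: "m \<le> k" "1 \<le> k"
  have e: "CARD('d) ^ m = CARD('d) ^ n * CARD('d) ^ (m - n)" using nm by (simp flip: power_add)
  have c: "tensor_one (CARD('d) ^ (m - n)) x \<in> carrier_mat (CARD('d) ^ m) (CARD('d) ^ m)"
    unfolding e using x by simp
  have "CARD('d) ^ (m - n) * CARD('d) ^ (k - m) = CARD('d) ^ (k - n)" using nm k by (simp flip: power_add)
  then show "Rep_l2M (l2_embed m (tensor_one (CARD('d) ^ (m - n)) x) :: 'd l2M) k = Rep_l2M (l2_embed n x :: 'd l2M) k"
    using nm k tensor_one_tensor_one[OF x, of "CARD('d) ^ (k - m)" "CARD('d) ^ (m - n)"]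
    by (simp add: Rep_l2_embed_ge[OF c k(2,1)] Rep_l2_embed_ge[OF x])
qed

lemma l2_embed_add:
  assumes x: "x \<in> carrier_mat (CARD('d) ^ n) (CARD('d) ^ n)" and y: "y \<in> carrier_mat (CARD('d) ^ n) (CARD('d) ^ n)"
  shows "(l2_embed n (x + y) :: 'd::finite l2M) = l2_embed n x + l2_embed n y"
proof (rule l2M_eq_tail[of n])
  fix k assume k: "n \<le> k" "1 \<le> k"
  show "Rep_l2M (l2_embed n (x + y) :: 'd l2M) k = Rep_l2M (l2_embed n x + l2_embed n y :: 'd l2M) k"
    using k x y by (simp add: Rep_l2M_add Rep_l2_embed_ge tensor_one_add)
qed

lemma l2_embed_smult:
  assumes x: "x \<in> carrier_mat (CARD('d) ^ n) (CARD('d) ^ n)"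
  shows "(l2_embed n (c \<cdot>\<^sub>m x) :: 'd::finite l2M) = scaleC c (l2_embed n x)"
proof (rule l2M_eq_tail[of n])
  fix k assume k: "n \<le> k" "1 \<le> k"
  show "Rep_l2M (l2_embed n (c \<cdot>\<^sub>m x) :: 'd l2M) k = Rep_l2M (scaleC c (l2_embed n x) :: 'd l2M) k"
    using k x by (simp add: scaleC.rep_eq Rep_l2_embed_ge tensor_one_smult)
qed

lemma l2_embed_zero: "(l2_embed n (0\<^sub>m (CARD('d) ^ n) (CARD('d) ^ n)) :: 'd::finite l2M) = 0"
proof -
  have "(l2_embed n (0 \<cdot>\<^sub>m 0\<^sub>m (CARD('d) ^ n) (CARD('d) ^ n)) :: 'd l2M) = 0"
    by (subst l2_embed_smult) auto
  then show ?thesis by simp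
qed

lemma cip_l2_embed:
  assumes "x \<in> carrier_mat (CARD('d) ^ n) (CARD('d) ^ n)" "y \<in> carrier_mat (CARD('d) ^ n) (CARD('d) ^ n)"
  shows "cip (l2_embed n x :: 'd::finite l2M) (l2_embed n y) = hs_inner x y"
proof -
  have "\<forall>\<^sub>F k in sequentially. hs_inner (Rep_l2M (l2_embed n x :: 'd l2M) k) (Rep_l2M (l2_embed n y :: 'd l2M) k) = hs_inner x y"
    using eventually_ge_at_top[of "Suc n"]
  proof eventually_elim
    case (elim k)
    then show ?case
      using hs_inner_tensor_one[OF tensor_one_carrier[OF assms(1)] assms(2), of "CARD('d) ^ (k - n)"]
        partial_trace_tensor_one[OF assms(1), of "CARD('d) ^ (k - n)"] assms
      by (simp add: Rep_l2_embed_ge)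
  qed
  then have "(\<lambda>k. hs_inner (Rep_l2M (l2_embed n x :: 'd l2M) k) (Rep_l2M (l2_embed n y :: 'd l2M) k))
     \<longlonglongrightarrow> hs_inner x y" by (rule tendsto_eventually)
  then show ?thesis using cip_LIMSEQ LIMSEQ_unique by blast
qed

lemma norm_l2_embed:
  assumes "x \<in> carrier_mat (CARD('d) ^ n) (CARD('d) ^ n)"
  shows "(norm (l2_embed n x :: 'd::finite l2M))\<^sup>2 = sqn x"
  using inner_l2_embed[OF assms assms] by (simp add: power2_norm_eq_inner)

text \<open>
  If the conditional expectation on the previous level vanishes, so do those on all lower levels.
\<close>

lemma cip_l2_embed_orthogonal:
  assumes x: "x \<in> carrier_mat (CARD('d) ^ m) (CARD('d) ^ m)" and y: "y \<in> carrier_mat (CARD('d) ^ n) (CARD('d) ^ n)"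
    and mn: "m < n" and tr: "partial_trace CARD('d) y = 0\<^sub>m (CARD('d) ^ (n - 1)) (CARD('d) ^ (n - 1))"
  shows "cip (l2_embed n y :: 'd::finite l2M) (l2_embed m x) = 0"
proof -
  let ?d = "CARD('d)"
  let ?w = "tensor_one (?d ^ (n - 1 - m)) x"
  have e: "?d ^ (n - 1) = ?d ^ m * ?d ^ (n - 1 - m)" using mn by (simp flip: power_add)
  have w: "?w \<in> carrier_mat (?d ^ (n - 1)) (?d ^ (n - 1))" unfolding e using x by simp
  have e2: "?d ^ (n - 1) * ?d = ?d ^ n" using mn by (cases n) auto
  have y': "y \<in> carrier_mat (?d ^ (n - 1) * ?d) (?d ^ (n - 1) * ?d)" using y e2 by simp
  have tw: "tensor_one ?d ?w \<in> carrier_mat (?d ^ n) (?d ^ n)" using tensor_one_carrier[OF w, of ?d] e2 by simp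
  have "(l2_embed m x :: 'd l2M) = l2_embed (n - 1) ?w" using l2_embed_tensor_one[OF x, of "n - 1"] mn by simp
  also have "\<dots> = l2_embed n (tensor_one ?d ?w)"
    using l2_embed_tensor_one[OF w, of n] mn by (simp add: Suc_leI)
  finally have "cip (l2_embed n y :: 'd l2M) (l2_embed m x) = hs_inner y (tensor_one ?d ?w)"
    by (simp only: cip_l2_embed[OF y tw])
  also have "\<dots> = hs_inner (partial_trace ?d y) ?w" by (rule hs_inner_tensor_one[OF y' w]) simp
  also have "\<dots> = 0" unfolding tr using w by (subst hs_inner_sum[of _ "?d ^ (n - 1)"]) auto
  finally show ?thesis .
qed

lemma mdiff_carrier:
  assumes "x \<in> martingales d" "n \<ge> 1"
  shows "mdiff d x n \<in> carrier_mat (d ^ n) (d ^ n)"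
proof -
  have "d ^ (n - 1) * d = d ^ n" using assms(2) by (cases n) auto
  then have "tensor_one d (x (n - 1)) \<in> carrier_mat (d ^ n) (d ^ n)"
    using tensor_one_carrier[OF martingales_carrier[OF assms(1), of "n - 1"], of d] by simp
  then show ?thesis unfolding mdiff_def using martingales_carrier[OF assms(1), of n] by auto
qed

lemma partial_trace_mdiff:
  assumes "x \<in> martingales d" "n \<ge> 2" "d > 0"
  shows "partial_trace d (mdiff d x n) = 0\<^sub>m (d ^ (n - 1)) (d ^ (n - 1))"
proof -
  have e: "d ^ (n - 1) * d = d ^ n" using assms(2) by (cases n) auto
  note c = martingales_carrier[OF assms(1), of "n - 1"]
  have "partial_trace d (mdiff d x n) = partial_trace d (x n) - partial_trace d (tensor_one d (x (n - 1)))"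
    unfolding mdiff_def
    by (rule partial_trace_diff[of _ "d ^ (n - 1)"]) (use e martingales_carrier[OF assms(1), of n] tensor_one_carrier[OF c, of d] assms in auto)
  also have "partial_trace d (tensor_one d (x (n - 1))) = x (n - 1)"
    by (rule partial_trace_tensor_one[OF c assms(3)])
  also have "partial_trace d (x n) = x (n - 1)"
    using assms(1,2) unfolding martingales_def by (cases n) (auto simp: Suc_le_eq)
  finally show ?thesis using c by auto
qed

instance l2M :: (finite) banach ..

lemma orthogonal_series:
  fixes v :: "nat \<Rightarrow> 'd::finite l2M"
  assumes o: "\<And>m n. m < n \<Longrightarrow> cip (v n) (v m) = 0"
  shows orthogonal_finite_sum: "finite K \<Longrightarrow> (norm (\<Sum>k\<in>K. v k))\<^sup>2 = (\<Sum>k\<in>K. (norm (v k))\<^sup>2)"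
    and orthogonal_summable: "(\<And>K. finite K \<Longrightarrow> (\<Sum>k\<in>K. (norm (v k))\<^sup>2) \<le> B) \<Longrightarrow> summable v"
    and orthogonal_suminf_le: "(\<And>K. finite K \<Longrightarrow> (\<Sum>k\<in>K. (norm (v k))\<^sup>2) \<le> B) \<Longrightarrow> (norm (\<Sum>k. v k))\<^sup>2 \<le> B"
    and orthogonal_suminf_ge: "summable v \<Longrightarrow> finite K \<Longrightarrow> (\<Sum>k\<in>K. (norm (v k))\<^sup>2) \<le> (norm (\<Sum>k. v k))\<^sup>2"
proof -
  have o': "cip (v m) (v n) = 0" if "m \<noteq> n" for m n
    using o[of m n] o[of n m] that cip_cnj[of "v n" "v m"] by (cases m n rule: linorder_cases) auto
  show fs: "(norm (\<Sum>k\<in>K. v k))\<^sup>2 = (\<Sum>k\<in>K. (norm (v k))\<^sup>2)" if "finite K" for K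
  proof -
    have "of_real ((norm (\<Sum>k\<in>K. v k))\<^sup>2) = (\<Sum>m\<in>K. \<Sum>n\<in>K. cip (v m) (v n))"
      unfolding cip_self[symmetric] cip_sum_right cip_sum_left by (rule sum.swap)
    also have "\<dots> = (\<Sum>m\<in>K. \<Sum>n\<in>K. if m = n then cip (v m) (v m) else 0)"
      by (intro sum.cong refl) (auto simp: o')
    also have "\<dots> = of_real (\<Sum>k\<in>K. (norm (v k))\<^sup>2)" using that by (simp add: cip_self)
    finally show ?thesis by (simp only: of_real_eq_iff)
  qed
  have sm: "summable v" if B: "\<And>K. finite K \<Longrightarrow> (\<Sum>k\<in>K. (norm (v k))\<^sup>2) \<le> B" for B
  proof -
    have s2: "summable (\<lambda>k. (norm (v k))\<^sup>2)"
      by (rule summableI_nonneg_bounded[of _ B]) (use B in auto)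
    show ?thesis unfolding summable_Cauchy
    proof (intro allI impI)
      fix e :: real assume e: "e > 0"
      have "\<exists>N. \<forall>m\<ge>N. \<forall>n. norm (sum (\<lambda>k. (norm (v k))\<^sup>2) {m..<n}) < e\<^sup>2"
        using s2[unfolded summable_Cauchy, rule_format, of "e\<^sup>2"] e by simp
      then obtain N where N: "\<And>m n. m \<ge> N \<Longrightarrow> norm (sum (\<lambda>k. (norm (v k))\<^sup>2) {m..<n}) < e\<^sup>2"
        by blast
      have "norm (sum v {m..<n}) < e" if "m \<ge> N" for m n
      proof -
        have "(norm (sum v {m..<n}))\<^sup>2 < e\<^sup>2" using N[OF that, of n] fs[of "{m..<n}"] by simp
        then show ?thesis by (rule power_less_imp_less_base) (use e in auto)
      qed
      then show "\<exists>N. \<forall>m\<ge>N. \<forall>n. norm (sum v {m..<n}) < e" by blast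
    qed
  qed
  show "summable v" if "\<And>K. finite K \<Longrightarrow> (\<Sum>k\<in>K. (norm (v k))\<^sup>2) \<le> B" by (rule sm[OF that])
  have lim: "(\<lambda>n. (norm (\<Sum>k<n. v k))\<^sup>2) \<longlonglongrightarrow> (norm (\<Sum>k. v k))\<^sup>2" if "summable v"
    by (intro tendsto_power tendsto_norm summable_LIMSEQ that)
  show "(norm (\<Sum>k. v k))\<^sup>2 \<le> B" if B: "\<And>K. finite K \<Longrightarrow> (\<Sum>k\<in>K. (norm (v k))\<^sup>2) \<le> B"
    by (rule LIMSEQ_le_const2[OF lim[OF sm[OF B]]]) (use B fs in auto)
  show "(\<Sum>k\<in>K. (norm (v k))\<^sup>2) \<le> (norm (\<Sum>k. v k))\<^sup>2" if "summable v" "finite K"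
  proof (rule LIMSEQ_le_const[OF lim[OF that(1)]])
    have "(\<Sum>k\<in>K. (norm (v k))\<^sup>2) \<le> (norm (\<Sum>k<n. v k))\<^sup>2" if "n \<ge> Suc (Max K)" for n
    proof -
      have "k < n" if "k \<in> K" for k using Max_ge[OF \<open>finite K\<close> that] \<open>n \<ge> Suc (Max K)\<close> by simp
      then have "K \<subseteq> {..<n}" by auto
      then have "(\<Sum>k\<in>K. (norm (v k))\<^sup>2) \<le> (\<Sum>k<n. (norm (v k))\<^sup>2)" by (intro sum_mono2) auto
      then show ?thesis using fs[of "{..<n}"] by simp
    qed
    then show "\<exists>N. \<forall>n\<ge>N. (\<Sum>k\<in>K. (norm (v k))\<^sup>2) \<le> (norm (\<Sum>k<n. v k))\<^sup>2" by blast
  qed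
qed

text \<open>
  The initial member counts as the increment of index 0, so that the increments always add up to
  the sequence itself, whatever its value at 0.
\<close>

definition mincr :: "nat \<Rightarrow> (nat \<Rightarrow> complex mat) \<Rightarrow> nat \<Rightarrow> complex mat" where
  "mincr d Y j = (if j = 0 then Y 0 else mdiff d Y j)"

lemma mincr_carrier:
  assumes "\<And>n. Y n \<in> carrier_mat (d ^ n) (d ^ n)"
  shows "mincr d Y j \<in> carrier_mat (d ^ j) (d ^ j)"
proof (cases j)
  case (Suc i)
  then show ?thesis using tensor_one_carrier[OF assms[of i], of d]
    unfolding mincr_def mdiff_def by (auto intro!: minus_carrier_mat simp: mult.commute)
qed (use assms[of 0] in \<open>simp add: mincr_def\<close>)

lemma l2_embed_mult_telescope:
  fixes Y :: "nat \<Rightarrow> complex mat"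
  assumes D: "D \<in> carrier_mat (CARD('d) ^ k) (CARD('d) ^ k)"
    and Y: "\<And>n. Y n \<in> carrier_mat (CARD('d) ^ n) (CARD('d) ^ n)" and nk: "n \<le> k"
  shows "(l2_embed k (D * tensor_one (CARD('d) ^ (k - n)) (Y n)) :: 'd::finite l2M) =
    (\<Sum>j\<le>n. l2_embed k (D * tensor_one (CARD('d) ^ (k - j)) (mincr CARD('d) Y j)))"
  using nk
proof (induction n)
  case 0
  then show ?case by (simp add: mincr_def)
next
  case (Suc n)
  let ?d = "CARD('d)"
  have tc: "tensor_one (?d ^ (k - j)) y \<in> carrier_mat (?d ^ k) (?d ^ k)"
    if "j \<le> k" "y \<in> carrier_mat (?d ^ j) (?d ^ j)" for j y
    using tensor_one_carrier[OF that(2), of "?d ^ (k - j)"] that(1) by (simp flip: power_add)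
  note m = mincr_carrier[OF Y, of "Suc n"]
  have t: "tensor_one ?d (Y n) \<in> carrier_mat (?d ^ Suc n) (?d ^ Suc n)"
    using tensor_one_carrier[OF Y[of n], of ?d] by (simp add: mult.commute)
  have "Y (Suc n) = mincr ?d Y (Suc n) + tensor_one ?d (Y n)"
    using t Y[of "Suc n"] by (intro eq_matI) (auto simp: mincr_def mdiff_def)
  then have "tensor_one (?d ^ (k - Suc n)) (Y (Suc n)) =
      tensor_one (?d ^ (k - Suc n)) (mincr ?d Y (Suc n)) + tensor_one (?d ^ (k - Suc n)) (tensor_one ?d (Y n))"
    using tensor_one_add[OF m t] by simp
  also have "tensor_one (?d ^ (k - Suc n)) (tensor_one ?d (Y n)) = tensor_one (?d ^ (k - n)) (Y n)"
    using tensor_one_tensor_one[OF Y[of n], of "?d ^ (k - Suc n)" ?d] Suc.prems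
    by (simp flip: power_Suc add: Suc_diff_Suc)
  finally have "D * tensor_one (?d ^ (k - Suc n)) (Y (Suc n)) =
      D * tensor_one (?d ^ (k - Suc n)) (mincr ?d Y (Suc n)) + D * tensor_one (?d ^ (k - n)) (Y n)"
    using mult_add_distrib_mat[OF D tc[OF Suc.prems m] tc[OF _ Y[of n]]] Suc.prems by simp
  then have "(l2_embed k (D * tensor_one (?d ^ (k - Suc n)) (Y (Suc n))) :: 'd l2M) =
      l2_embed k (D * tensor_one (?d ^ (k - Suc n)) (mincr ?d Y (Suc n))) + l2_embed k (D * tensor_one (?d ^ (k - n)) (Y n))"
    using l2_embed_add[OF mult_carrier_mat[OF D tc[OF Suc.prems m]] mult_carrier_mat[OF D tc[OF _ Y[of n]]]]
      Suc.prems by simp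
  then show ?case using Suc by simp
qed

text \<open>
  The form \<open>y \<mapsto> \<parallel>D (y \<otimes> 1)\<parallel>\<^sup>2\<close> acts on the columns of y separately, by the form of the partial
  trace. Every eigenvalue of the latter is therefore counted once per column.
\<close>

lemma sqn_mult_tensor_one:
  assumes D: "D \<in> carrier_mat (N * r) (N * r)" and y: "y \<in> carrier_mat N N"
  shows "sqn (D * tensor_one r y) =
    (\<Sum>c<N. gram_form ({..<N * r} \<times> {..<r}) (\<lambda>(a, s) b. D $$ (a, b * r + s)) N (\<lambda>b. y $$ (b, c))) / real (N * r)"
proof -
  note t = tensor_one_carrier[OF y, of r]
  have Dt: "D * tensor_one r y \<in> carrier_mat (N * r) (N * r)" by (rule mult_carrier_mat[OF D t])
  have ent: "(D * tensor_one r y) $$ (a, c * r + s) = (\<Sum>b<N. D $$ (a, b * r + s) * y $$ (b, c))"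
    if "a < N * r" "c < N" "s < r" for a c s
  proof -
    have "(D * tensor_one r y) $$ (a, c * r + s) = (\<Sum>l<N * r. D $$ (a, l) * tensor_one r y $$ (l, c * r + s))"
      by (rule mat_mult_index[OF D t that(1)]) (use that less_prod_index in auto)
    also have "\<dots> = (\<Sum>b<N. \<Sum>s'<r. D $$ (a, b * r + s') * (if s' = s then y $$ (b, c) else 0))"
      unfolding sum_nat_prod by (intro sum.cong refl) (use that y in \<open>auto simp: tensor_one_index[where N = N]\<close>)
    also have "\<dots> = (\<Sum>b<N. D $$ (a, b * r + s) * y $$ (b, c))"
      using that by (simp add: if_distrib[of "\<lambda>c. _ * c"] sum.delta cong: if_cong)
    finally show ?thesis .
  qed
  have "(\<Sum>a<N * r. \<Sum>j<N * r. (cmod ((D * tensor_one r y) $$ (a, j)))\<^sup>2) =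
     (\<Sum>a<N * r. \<Sum>c<N. \<Sum>s<r. (cmod (\<Sum>b<N. D $$ (a, b * r + s) * y $$ (b, c)))\<^sup>2)"
    unfolding sum_nat_prod[of _ N r, symmetric]
    by (rule sum.cong[OF refl], subst sum_nat_prod) (intro sum.cong refl, simp add: ent)
  also have "\<dots> = (\<Sum>c<N. \<Sum>a<N * r. \<Sum>s<r. (cmod (\<Sum>b<N. D $$ (a, b * r + s) * y $$ (b, c)))\<^sup>2)"
    by (rule sum.swap)
  also have "\<dots> = (\<Sum>c<N. gram_form ({..<N * r} \<times> {..<r}) (\<lambda>(a, s) b. D $$ (a, b * r + s)) N (\<lambda>b. y $$ (b, c)))"
    unfolding gram_form_def sum_Times by simp
  finally show ?thesis unfolding sqn_sum[OF Dt] by simp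
qed

text \<open>
  Both conventions for \<open>f\<^sub>0\<close> at once. The energy inequality below is the same for them because the
  increment of level 1 is taken relative to \<open>f\<^sub>0\<close>.
\<close>

locale start_map =
  fixes F :: "'d::finite l2M \<Rightarrow> nat \<Rightarrow> complex mat"
  assumes F_Rep: "k \<ge> 1 \<Longrightarrow> F f k = Rep_l2M f k"
    and F_0: "(\<forall>f. F f 0 = 0\<^sub>m 1 1) \<or> (\<forall>f. F f 0 = partial_trace CARD('d) (Rep_l2M f 1))"
begin

lemma Rep1_carrier: "Rep_l2M (f :: 'd l2M) 1 \<in> carrier_mat (1 * CARD('d)) (1 * CARD('d))"
  using Rep_l2M_carrier[of f 1] by simp

lemma F_carrier: "F f k \<in> carrier_mat (CARD('d) ^ k) (CARD('d) ^ k)"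
proof (cases "k = 0")
  case True
  then show ?thesis using F_0 partial_trace_carrier[OF _ Rep1_carrier[of f]] by auto
next
  case False
  then show ?thesis using F_Rep[of k f] Rep_l2M_carrier[of f k] by simp
qed

lemma F_add: "F (f + g) k = F f k + F g k"
proof (cases "k = 0")
  case True
  have "partial_trace CARD('d) (Rep_l2M f 1 + Rep_l2M g 1) = partial_trace CARD('d) (Rep_l2M f 1) + partial_trace CARD('d) (Rep_l2M g 1)"
    by (rule partial_trace_add[OF Rep1_carrier Rep1_carrier]) simp
  then show ?thesis using F_0 True by (auto simp: Rep_l2M_add)
qed (simp add: F_Rep Rep_l2M_add)

lemma F_scaleC: "F (scaleC c f) k = c \<cdot>\<^sub>m F f k"
proof (cases "k = 0")
  case True
  have "partial_trace CARD('d) (c \<cdot>\<^sub>m Rep_l2M f 1) = c \<cdot>\<^sub>m partial_trace CARD('d) (Rep_l2M f 1)"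
    by (rule partial_trace_smult[OF Rep1_carrier]) simp
  then show ?thesis using F_0 True by (auto simp: scaleC.rep_eq)
qed (simp add: F_Rep scaleC.rep_eq)

abbreviation "incr f \<equiv> mincr CARD('d) (F f)"

lemma incr_carrier: "incr f j \<in> carrier_mat (CARD('d) ^ j) (CARD('d) ^ j)"
  by (rule mincr_carrier) (rule F_carrier)

lemma incr_index:
  assumes "a < CARD('d) ^ j" "b < CARD('d) ^ j"
  shows "incr (f + g) j $$ (a, b) = incr f j $$ (a, b) + incr g j $$ (a, b)"
    "incr (scaleC c f) j $$ (a, b) = c * incr f j $$ (a, b)"
proof -
  have t: "tensor_one CARD('d) (F f (j - 1)) \<in> carrier_mat (CARD('d) ^ j) (CARD('d) ^ j)" if "j \<noteq> 0" for f
    using tensor_one_carrier[OF F_carrier[of f "j - 1"], of "CARD('d)"] that by (cases j) (auto simp: mult.commute)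
  have ta: "tensor_one CARD('d) (F f (j - 1) + F g (j - 1)) = tensor_one CARD('d) (F f (j - 1)) + tensor_one CARD('d) (F g (j - 1))"
    by (rule tensor_one_add[OF F_carrier F_carrier])
  have ts: "tensor_one CARD('d) (c \<cdot>\<^sub>m F f (j - 1)) = c \<cdot>\<^sub>m tensor_one CARD('d) (F f (j - 1))"
    by (rule tensor_one_smult[OF F_carrier])
  note c = F_carrier[of f j] F_carrier[of g j]
  show "incr (f + g) j $$ (a, b) = incr f j $$ (a, b) + incr g j $$ (a, b)"
  proof (cases "j = 0")
    case False
    then show ?thesis using assms c t[OF False, of f] t[OF False, of g]
      by (simp add: mincr_def mdiff_def F_add ta del: One_nat_def)
  qed (use assms c in \<open>simp add: mincr_def F_add\<close>)
  show "incr (scaleC c f) j $$ (a, b) = c * incr f j $$ (a, b)"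
  proof (cases "j = 0")
    case False
    then show ?thesis using assms c t[OF False, of f]
      by (simp add: mincr_def mdiff_def F_scaleC ts right_diff_distrib del: One_nat_def)
  qed (use assms c in \<open>simp add: mincr_def F_scaleC\<close>)
qed

lemma incr_sum_index:
  assumes "a < CARD('d) ^ j" "b < CARD('d) ^ j" "finite I"
  shows "incr (\<Sum>i\<in>I. scaleC (c i) (v i)) j $$ (a, b) = (\<Sum>i\<in>I. c i * incr (v i) j $$ (a, b))"
  using assms(3)
proof (induction I rule: finite_induct)
  case empty
  then show ?case using incr_index(2)[OF assms(1,2), of 0 0] by simp
next
  case (insert x I)
  then show ?case by (simp add: incr_index[OF assms(1,2)])
qed

lemma incr_energy: "(\<Sum>j<n. sqn (incr f j)) \<le> (norm f)\<^sup>2"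
proof -
  have eq: "(\<Sum>j\<le>n. sqn (incr f j)) = sqn (F f n)" for n
  proof (induction n)
    case 0
    then show ?case by (simp add: mincr_def)
  next
    case (Suc n)
    have y: "F f (Suc n) \<in> carrier_mat (CARD('d) ^ n * CARD('d)) (CARD('d) ^ n * CARD('d))"
      using F_carrier[of f "Suc n"] by (simp add: mult.commute)
    have "F f n = partial_trace CARD('d) (F f (Suc n)) \<or> F f n = 0\<^sub>m (CARD('d) ^ n) (CARD('d) ^ n)"
    proof (cases "n = 0")
      case True
      then show ?thesis using F_0 F_Rep[of 1 f] by auto
    next
      case False
      then show ?thesis using F_Rep[of n f] F_Rep[of "Suc n" f] Rep_l2M_martingale[of f]
        by (auto simp: martingales_def)
    qed
    from sqn_increment[OF y _ this] have "sqn (incr f (Suc n)) = sqn (F f (Suc n)) - sqn (F f n)"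
      by (simp add: mincr_def mdiff_def)
    then show ?case using Suc by simp
  qed
  have "(\<Sum>j<n. sqn (incr f j)) \<le> (\<Sum>j\<le>Suc n. sqn (incr f j))"
    by (rule sum_mono2) (auto intro: sqn_nonneg[OF incr_carrier])
  also have "\<dots> = sqn (Rep_l2M f (Suc n))" unfolding eq by (simp add: F_Rep)
  also have "\<dots> \<le> inner f f" by (rule sqn_le_inner) simp
  finally show ?thesis by (simp add: power2_norm_eq_inner)
qed

lemma F_embed:
  fixes n :: nat and y :: "complex mat"
  assumes n: "n \<ge> 1" and y: "y \<in> carrier_mat (CARD('d) ^ n) (CARD('d) ^ n)"
    and tr: "partial_trace CARD('d) y = 0\<^sub>m (CARD('d) ^ (n - 1)) (CARD('d) ^ (n - 1))"
  defines "g \<equiv> l2_embed n y :: 'd l2M"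
  shows "n \<le> i \<Longrightarrow> F g i = tensor_one (CARD('d) ^ (i - n)) y"
    and "i < n \<Longrightarrow> F g i = 0\<^sub>m (CARD('d) ^ i) (CARD('d) ^ i)"
proof -
  let ?d = "CARD('d)"
  have Rge: "Rep_l2M g i = tensor_one (?d ^ (i - n)) y" if "n \<le> i" for i
    unfolding g_def by (rule Rep_l2_embed_ge[OF y]) (use that n in auto)
  then show "n \<le> i \<Longrightarrow> F g i = tensor_one (?d ^ (i - n)) y" using F_Rep[of i g] n by simp
  have Rn: "Rep_l2M g n = y" using Rge[of n] tensor_one_1[OF y] by simp
  have Rlt: "Rep_l2M g i = 0\<^sub>m (?d ^ i) (?d ^ i)" if i: "1 \<le> i" "i < n" for i
  proof -
    have "Rep_l2M g (n - 1) = partial_trace (?d ^ (n - (n - 1))) (Rep_l2M g n)"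
      using martingale_steps'[OF Rep_l2M_martingale[of g], of "n - 1" n] i by simp
    also have "\<dots> = 0\<^sub>m (?d ^ (n - 1)) (?d ^ (n - 1))" using tr Rn n by simp
    finally have z: "Rep_l2M g (n - 1) = 0\<^sub>m (?d ^ (n - 1)) (?d ^ (n - 1))" .
    have e: "?d ^ (n - 1) = ?d ^ i * ?d ^ (n - 1 - i)" using i by (simp flip: power_add)
    have "Rep_l2M g i = partial_trace (?d ^ (n - 1 - i)) (Rep_l2M g (n - 1))"
      using martingale_steps'[OF Rep_l2M_martingale[of g], of i "n - 1"] i by simp
    then show ?thesis unfolding z unfolding e by (simp add: partial_trace_zero)
  qed
  show "i < n \<Longrightarrow> F g i = 0\<^sub>m (?d ^ i) (?d ^ i)"
  proof (cases "i = 0")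
    case True
    have "partial_trace ?d (Rep_l2M g 1) = 0\<^sub>m 1 1"
    proof (cases "n = 1")
      case True
      then show ?thesis using tr Rn by simp
    next
      case False
      then have "Rep_l2M g 1 = 0\<^sub>m (1 * ?d) (1 * ?d)" using Rlt[of 1] n by simp
      then show ?thesis using partial_trace_zero[of ?d 1] by simp
    qed
    then show ?thesis using F_0 True by auto
  qed (use Rlt[of i] F_Rep[of i g] in auto)
qed

lemma incr_embed:
  assumes n: "n \<ge> 1" and y: "y \<in> carrier_mat (CARD('d) ^ n) (CARD('d) ^ n)"
    and tr: "partial_trace CARD('d) y = 0\<^sub>m (CARD('d) ^ (n - 1)) (CARD('d) ^ (n - 1))"
  shows "incr (l2_embed n y) j = (if j = n then y else 0\<^sub>m (CARD('d) ^ j) (CARD('d) ^ j))"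
proof -
  let ?d = "CARD('d)"
  note ge = F_embed(1)[OF n y tr] and lt = F_embed(2)[OF n y tr]
  consider "j = 0" | "j > 0" "j < n" | "j = n" "j > 0" | "j > n" using n by linarith
  then show ?thesis
  proof cases
    case 1
    then show ?thesis using lt[of 0] n by (simp add: mincr_def)
  next
    case 2
    have "?d ^ (j - 1) * ?d = ?d ^ j" using 2 by (cases j) auto
    then have "tensor_one ?d (0\<^sub>m (?d ^ (j - 1)) (?d ^ (j - 1))) = 0\<^sub>m (?d ^ j) (?d ^ j)" by (simp add: tensor_one_zero)
    then show ?thesis using 2 lt[of j] lt[of "j - 1"] by (simp add: mincr_def mdiff_def)
  next
    case 3
    have "?d ^ (j - 1) * ?d = ?d ^ j" using 3 by (cases j) auto
    then have "tensor_one ?d (0\<^sub>m (?d ^ (j - 1)) (?d ^ (j - 1))) = 0\<^sub>m (?d ^ j) (?d ^ j)" by (simp add: tensor_one_zero)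
    moreover have "y - 0\<^sub>m (?d ^ n) (?d ^ n) = y" using y by auto
    ultimately show ?thesis using 3 ge[of n] lt[of "n - 1"] tensor_one_1[OF y] by (simp add: mincr_def mdiff_def)
  next
    case 4
    have "?d ^ (j - 1 - n) * ?d = ?d ^ (j - n)" using 4 by (simp flip: power_Suc2 add: Suc_diff_Suc)
    then have "tensor_one ?d (tensor_one (?d ^ (j - 1 - n)) y) = tensor_one (?d ^ (j - n)) y"
      using tensor_one_tensor_one[OF y, of ?d "?d ^ (j - 1 - n)"] by simp
    moreover have "tensor_one (?d ^ (j - n)) y \<in> carrier_mat (?d ^ j) (?d ^ j)"
      using tensor_one_carrier[OF y, of "?d ^ (j - n)"] 4 by (simp flip: power_add)
    ultimately show ?thesis using 4 ge[of j] ge[of "j - 1"] by (simp add: mincr_def mdiff_def)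
  qed
qed

end

lemma start_map_Rep: "start_map (Rep_l2M :: 'd::finite l2M \<Rightarrow> _)"
proof
  show "(\<forall>f :: 'd l2M. Rep_l2M f 0 = 0\<^sub>m 1 1) \<or> (\<forall>f :: 'd l2M. Rep_l2M f 0 = partial_trace CARD('d) (Rep_l2M f 1))"
    using Rep_l2M_martingale by (auto simp: martingales_def)
qed simp

lemma start_map_scalar_start: "start_map (scalar_start :: 'd::finite l2M \<Rightarrow> _)"
  by standard (auto simp: scalar_start_def)

section \<open>Weights of the paraproduct\<close>

lemma geometric_tail_bound:
  fixes x :: real
  assumes "0 \<le> x" "x < 1"
  shows "(\<Sum>i<n. x ^ i) \<le> 1 / (1 - x)" "(\<Sum>j<n. x ^ (n - j)) \<le> 1 / (1 - x)"
proof -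
  show 1: "(\<Sum>i<n. x ^ i) \<le> 1 / (1 - x)"
    using sum_le_suminf[of "\<lambda>i. x ^ i" "{..<n}"] assms suminf_geometric[of x] by (simp add: summable_geometric)
  have "(\<Sum>j<n. x ^ (n - j)) = (\<Sum>j<n. x ^ Suc (n - Suc j))"
    by (intro sum.cong refl) (simp add: Suc_diff_Suc)
  also have "\<dots> = (\<Sum>i<n. x ^ Suc i)" by (rule sum.nat_diff_reindex)
  also have "\<dots> \<le> (\<Sum>i<n. x ^ i)" using assms by (intro sum_mono) (simp add: mult_left_le_one_le)
  finally show "(\<Sum>j<n. x ^ (n - j)) \<le> 1 / (1 - x)" using 1 by simp
qed

definition col_blocks :: "nat \<Rightarrow> complex mat \<Rightarrow> nat \<times> nat \<Rightarrow> nat \<Rightarrow> complex" where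
  "col_blocks r D = (\<lambda>(a, s) b. D $$ (a, b * r + s))"

text \<open>
  The factor \<open>d powr (- \<gamma>)\<close> is gained per level. It is split into two equal factors \<open>\<rho>\<close>: one of
  them is kept for the convergence of the sum of the weights \<open>\<beta>\<close>. The other one is put into the
  weights, where, after taking the root, it becomes the factor \<open>\<theta>\<close> per level that makes the
  increments summable.

  For the levels j < k, \<open>eig k j\<close> diagonalises the form \<open>y \<mapsto> \<parallel>d\<^sub>k (y \<otimes> 1)\<parallel>\<^sup>2\<close> on level j, the
  functionals \<open>\<psi> k j i c\<close> are the coefficients of the column c of y in its eigenbasis, and \<open>\<beta> k j
  i\<close> is the weight given to them.
\<close>

locale besov_data =
  fixes d :: nat and p :: real and b :: "nat \<Rightarrow> complex mat"
  assumes d2: "d \<ge> 2" and p: "p > 0" and b: "b \<in> martingales d"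
begin

abbreviation D :: "nat \<Rightarrow> complex mat" where "D \<equiv> mdiff d b"
abbreviation bt :: "nat \<Rightarrow> real" where "bt \<equiv> besov_term d p b"

definition q :: real where "q = p / 2"
definition \<gamma> :: real where "\<gamma> = 2 * min 1 q"
definition \<rho> :: real where "\<rho> = real d powr (- \<gamma> / 2)"
definition \<theta> :: real where "\<theta> = \<rho> powr (1 / p)"
definition \<Gamma> :: real where "\<Gamma> = 1 / (1 - \<theta>)"

definition eig :: "nat \<Rightarrow> nat \<Rightarrow> (nat \<Rightarrow> real) \<times> (nat \<Rightarrow> nat \<Rightarrow> complex)" where
  "eig k j = (SOME (\<nu>, w). eigsys ({..<d ^ k} \<times> {..<d ^ (k - j)}) (col_blocks (d ^ (k - j)) (D k)) (d ^ j) \<nu> w)"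

definition \<beta> :: "nat \<Rightarrow> nat \<Rightarrow> nat \<Rightarrow> real" where
  "\<beta> k j i = \<Gamma>\<^sup>2 * fst (eig k j) i / (real (d ^ (k - j)) * \<theta> ^ (2 * (k - j)))"

definition \<psi> :: "nat \<Rightarrow> nat \<Rightarrow> nat \<Rightarrow> nat \<Rightarrow> complex mat \<Rightarrow> complex" where
  "\<psi> k j i c y = cdot (d ^ j) (snd (eig k j) i) (\<lambda>b. y $$ (b, c))"

lemma eig: "eigsys ({..<d ^ k} \<times> {..<d ^ (k - j)}) (col_blocks (d ^ (k - j)) (D k)) (d ^ j) (fst (eig k j)) (snd (eig k j))"
proof -
  have "\<exists>\<nu> w. eigsys ({..<d ^ k} \<times> {..<d ^ (k - j)}) (col_blocks (d ^ (k - j)) (D k)) (d ^ j) \<nu> w"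
    by (rule eigsys_exists) simp
  then have "\<exists>x. case x of (\<nu>, w) \<Rightarrow> eigsys ({..<d ^ k} \<times> {..<d ^ (k - j)}) (col_blocks (d ^ (k - j)) (D k)) (d ^ j) \<nu> w"
    by auto
  from someI_ex[OF this] show ?thesis unfolding eig_def by (simp add: case_prod_unfold)
qed

lemma q: "q > 0" using p by (simp add: q_def)
lemma d_gt_1: "real d > 1" using d2 by simp
lemma \<gamma>_pos: "\<gamma> > 0" using q by (simp add: \<gamma>_def)

lemma \<rho>: "0 < \<rho>" "\<rho> < 1"
proof -
  show "0 < \<rho>" using d2 by (simp add: \<rho>_def)
  show "\<rho> < 1" unfolding \<rho>_def using d_gt_1 \<gamma>_pos by (simp add: powr_less_one)
qed

lemma \<theta>: "0 < \<theta>" "\<theta> < 1"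
proof -
  show "0 < \<theta>" using \<rho> by (simp add: \<theta>_def)
  have "\<rho> powr (1 / p) < 1 powr (1 / p)" using \<rho> p by (intro powr_less_mono2) auto
  then show "\<theta> < 1" by (simp add: \<theta>_def)
qed

lemma \<Gamma>_pos: "\<Gamma> > 0" using \<theta> by (simp add: \<Gamma>_def)

lemma D_carrier: "k \<ge> 1 \<Longrightarrow> D k \<in> carrier_mat (d ^ k) (d ^ k)"
  by (rule mdiff_carrier[OF b])

lemma d_pos [simp]: "d > 0" using d2 by simp

lemma d_split: "j \<le> k \<Longrightarrow> d ^ k = d ^ j * d ^ (k - j)"
  by (simp flip: power_add)

lemma bt_nonneg: "bt k \<ge> 0" by (simp add: besov_term_def)

text \<open>
  The gain for r = \<open>d ^ (k - j)\<close> has the exponent \<open>\<bar>q - 1\<bar>\<close>, the normalisation of the trace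
  contributes - q, and passing from \<open>d ^ k\<close> to the \<open>d ^ j\<close> columns contributes - 1. Altogether
  this is \<open>- \<gamma>\<close>.
\<close>

lemma \<beta>_sum:
  assumes k: "k \<ge> 1" and j: "j < k"
  shows "(\<Sum>i<d ^ j. \<Sum>c<d ^ j. \<beta> k j i powr q) \<le> \<Gamma> powr p * \<rho> ^ (k - j) * bt k"
proof -
  define m where "m = k - j"
  define r where "r = real (d ^ m)"
  have r: "r > 0" by (simp add: r_def)
  obtain l u where l: "eigsys {..<d ^ k} (mrow (D k)) (d ^ k) l u" using mrow_eigsys_exists by blast
  have z: "(\<lambda>(a, s) b. mrow (D k) a (b * d ^ m + s)) = col_blocks (d ^ m) (D k)"
    by (simp add: col_blocks_def mrow_def)
  have l': "eigsys {..<d ^ k} (mrow (D k)) (d ^ j * d ^ m) l u" using l d_split[of j k] j by (simp add: m_def)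
  have gain: "(\<Sum>i<d ^ j. fst (eig k j) i powr q) \<le> real (d ^ m) powr \<bar>q - 1\<bar> * (\<Sum>i<d ^ j * d ^ m. l i powr q)"
    using partial_form_gain[OF _ l' _ q, of "fst (eig k j)" "snd (eig k j)"] eig[of k j] z by (simp add: m_def)
  also have "(\<Sum>i<d ^ j * d ^ m. l i powr q) = real (d ^ k) * Lp_norm p (D k) powr p"
    using Lp_norm_eigsys[OF D_carrier[OF k] l p] d_split[of j k] j by (simp add: q_def m_def)
  finally have gain: "(\<Sum>i<d ^ j. fst (eig k j) i powr q) \<le> r powr \<bar>q - 1\<bar> * (real (d ^ k) * Lp_norm p (D k) powr p)"
    by (simp add: r_def)
  have \<theta>m: "(\<theta> ^ (2 * m)) powr q = \<rho> ^ m"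
  proof -
    have "\<theta> ^ (2 * m) = \<theta> powr real (2 * m)" by (rule powr_realpow[OF \<theta>(1), symmetric])
    then have "(\<theta> ^ (2 * m)) powr q = (\<theta> powr real (2 * m)) powr q" by (simp only:)
    also have "\<dots> = \<rho> powr real m" using p by (simp add: \<theta>_def powr_powr q_def)
    finally show ?thesis using \<rho> by (simp add: powr_realpow)
  qed
  have \<Gamma>p: "(\<Gamma>\<^sup>2) powr q = \<Gamma> powr p"
  proof -
    have "\<Gamma>\<^sup>2 = \<Gamma> powr 2" using \<Gamma>_pos by simp
    then show ?thesis by (simp only: powr_powr) (simp add: q_def)
  qed
  have \<rho>m: "r powr (- \<gamma>) = \<rho> ^ m * \<rho> ^ m"
  proof -
    have "r = real d powr real m" using d_gt_1 by (simp add: r_def powr_realpow)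
    then have "r powr (- \<gamma>) = \<rho> powr (2 * real m)" by (simp add: \<rho>_def powr_powr mult_ac)
    also have "\<dots> = \<rho> powr real m * \<rho> powr real m" by (simp add: powr_add[symmetric])
    finally show ?thesis using \<rho> by (simp add: powr_realpow)
  qed
  have dj: "real (d ^ j) = real (d ^ k) / r" using d_split[of j k] j by (simp add: r_def m_def)
  have "(\<Sum>i<d ^ j. \<Sum>c<d ^ j. \<beta> k j i powr q) = real (d ^ j) * (\<Sum>i<d ^ j. \<beta> k j i powr q)"
    by (simp add: sum_distrib_left)
  also have "(\<Sum>i<d ^ j. \<beta> k j i powr q) = (\<Sum>i<d ^ j. \<Gamma> powr p / (r powr q * \<rho> ^ m) * fst (eig k j) i powr q)"
  proof (rule sum.cong[OF refl])
    fix i assume "i \<in> {..<d ^ j}"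
    then have "fst (eig k j) i \<ge> 0" using eigsysD(1)[OF eig, of i j k] by simp
    then show "\<beta> k j i powr q = \<Gamma> powr p / (r powr q * \<rho> ^ m) * fst (eig k j) i powr q"
      unfolding \<beta>_def m_def[symmetric] using \<theta> by (simp add: powr_divide powr_mult \<theta>m \<Gamma>p r_def)
  qed
  also have "\<dots> = \<Gamma> powr p / (r powr q * \<rho> ^ m) * (\<Sum>i<d ^ j. fst (eig k j) i powr q)"
    by (simp add: sum_distrib_left)
  also have "real (d ^ j) * \<dots> \<le> real (d ^ j) * (\<Gamma> powr p / (r powr q * \<rho> ^ m) * (r powr \<bar>q - 1\<bar> * (real (d ^ k) * Lp_norm p (D k) powr p)))"
    using gain \<rho> by (intro mult_left_mono) auto
  also have "\<dots> = \<Gamma> powr p * (r powr (\<bar>q - 1\<bar> - q - 1)) / \<rho> ^ m * bt k"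
  proof -
    have e1: "r powr (\<bar>q - 1\<bar> - q - 1) = r powr \<bar>q - 1\<bar> / r powr q / r"
      using r by (simp add: powr_diff)
    have e2: "bt k = real (d ^ k) * real (d ^ k) * Lp_norm p (D k) powr p"
      by (simp add: besov_term_def power_mult power2_eq_square mult_2 power_add)
    show ?thesis unfolding dj e1 e2 using r \<rho> by (simp add: field_simps)
  qed
  also have "\<bar>q - 1\<bar> - q - 1 = - \<gamma>" by (simp add: \<gamma>_def min_def)
  also have "\<Gamma> powr p * (r powr - \<gamma>) / \<rho> ^ m * bt k = \<Gamma> powr p * \<rho> ^ m * bt k"
    unfolding \<rho>m using \<rho> by simp
  finally show ?thesis by (simp add: m_def)
qed

text \<open>
  If the functionals of weight at least t vanish on y, then multiplication by \<open>d\<^sub>k\<close> changes the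
  norm of y at most by the factor \<open>sqrt t / \<Gamma> * \<theta> ^ (k - j)\<close>.
\<close>

lemma step_bound:
  assumes k: "k \<ge> 1" and j: "j < k" and y: "y \<in> carrier_mat (d ^ j) (d ^ j)" and t: "t > 0"
    and van: "\<And>i c. i < d ^ j \<Longrightarrow> c < d ^ j \<Longrightarrow> t \<le> \<beta> k j i \<Longrightarrow> \<psi> k j i c y = 0"
  shows "sqn (D k * tensor_one (d ^ (k - j)) y) \<le> t / \<Gamma>\<^sup>2 * \<theta> ^ (2 * (k - j)) * sqn y"
proof -
  define r where "r = d ^ (k - j)"
  have r: "real r > 0" by (simp add: r_def)
  have dk: "d ^ k = d ^ j * r" using d_split[of j k] j by (simp add: r_def)
  have Dk: "D k \<in> carrier_mat (d ^ j * r) (d ^ j * r)" using D_carrier[OF k] dk by simp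
  define s where "s = t * (real r * \<theta> ^ (2 * (k - j))) / \<Gamma>\<^sup>2"
  have s: "s \<ge> 0" using t \<theta> by (simp add: s_def)
  have "sqn (D k * tensor_one r y) =
    (\<Sum>c<d ^ j. gram_form ({..<d ^ k} \<times> {..<r}) (col_blocks r (D k)) (d ^ j) (\<lambda>b. y $$ (b, c))) / real (d ^ j * r)"
    using sqn_mult_tensor_one[OF Dk y] dk by (simp add: col_blocks_def)
  also have "\<dots> \<le> (\<Sum>c<d ^ j. s * (\<Sum>b<d ^ j. (cmod (y $$ (b, c)))\<^sup>2)) / real (d ^ j * r)"
  proof (intro divide_right_mono sum_mono)
    fix c assume "c \<in> {..<d ^ j}"
    then have c: "c < d ^ j" by simp
    show "gram_form ({..<d ^ k} \<times> {..<r}) (col_blocks r (D k)) (d ^ j) (\<lambda>b. y $$ (b, c)) \<le> s * (\<Sum>b<d ^ j. (cmod (y $$ (b, c)))\<^sup>2)"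
      unfolding r_def
    proof (rule eigsys_form_le[OF eig s])
      fix i assume i: "i < d ^ j" "s \<le> fst (eig k j) i"
      have "t \<le> \<beta> k j i" using i(2) r \<theta> \<Gamma>_pos unfolding \<beta>_def s_def r_def[symmetric]
        by (simp add: field_simps)
      then show "cdot (d ^ j) (snd (eig k j) i) (\<lambda>b. y $$ (b, c)) = 0" using van[OF i(1) c] by (simp add: \<psi>_def)
    qed
  qed simp
  also have "\<dots> = s / real r * sqn y"
    unfolding sqn_sum[OF y] by (subst sum.swap) (simp add: sum_distrib_left[symmetric])
  also have "s / real r = t / \<Gamma>\<^sup>2 * \<theta> ^ (2 * (k - j))" using r by (simp add: s_def)
  finally show ?thesis by (simp add: r_def)
qed

text \<open>
  The Schur test for the matrix \<open>\<theta> ^ (k - j)\<close>, whose row and column sums are at most \<open>\<Gamma>\<close>, combined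
  with the factors of \<open>step_bound\<close>. The set \<open>A k\<close> restricts the increments that are taken into
  account: all of them for the upper bound, the distant ones for the lower bound.
\<close>

lemma form_sum_bound:
  assumes dd: "d = CARD('d::finite)" and K: "K \<subseteq> {1..n}" and y: "\<And>j. y j \<in> carrier_mat (d ^ j) (d ^ j)" and t: "t > 0"
    and van: "\<And>k j i c. k \<in> K \<Longrightarrow> j < k \<Longrightarrow> j \<in> A k \<Longrightarrow> i < d ^ j \<Longrightarrow> c < d ^ j \<Longrightarrow> t \<le> \<beta> k j i \<Longrightarrow> \<psi> k j i c (y j) = 0"
  shows "(\<Sum>k\<in>K. (norm (\<Sum>j\<in>{..<k} \<inter> A k. l2_embed k (D k * tensor_one (d ^ (k - j)) (y j)) :: 'd l2M))\<^sup>2)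
     \<le> t * (\<Sum>j<n. sqn (y j))"
proof -
  define a where "a j = sqrt (sqn (y j))" for j
  have a2: "(a j)\<^sup>2 = sqn (y j)" and a0: "a j \<ge> 0" for j using sqn_nonneg[OF y[of j]] by (simp_all add: a_def)
  define s where "s = sqrt t / \<Gamma>"
  have s: "s \<ge> 0" "s\<^sup>2 = t / \<Gamma>\<^sup>2" using t \<Gamma>_pos by (simp_all add: s_def power_divide)
  have each: "(norm (\<Sum>j\<in>{..<k} \<inter> A k. l2_embed k (D k * tensor_one (d ^ (k - j)) (y j)) :: 'd l2M))\<^sup>2
      \<le> s\<^sup>2 * \<Gamma> * (\<Sum>j<n. if j < k then \<theta> ^ (k - j) * (a j)\<^sup>2 else 0)" if k: "k \<in> K" for k
  proof -
    have k1: "k \<ge> 1" "k \<le> n" using K k by auto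
    let ?g = "\<lambda>j. l2_embed k (D k * tensor_one (d ^ (k - j)) (y j)) :: 'd l2M"
    have g: "norm (?g j) \<le> s * (\<theta> ^ (k - j) * a j)" if j: "j < k" "j \<in> A k" for j
    proof -
      have tc: "tensor_one (d ^ (k - j)) (y j) \<in> carrier_mat (d ^ k) (d ^ k)"
        using tensor_one_carrier[OF y[of j], of "d ^ (k - j)"] d_split[of j k] j by simp
      have "(norm (?g j))\<^sup>2 = sqn (D k * tensor_one (d ^ (k - j)) (y j))"
        by (rule norm_l2_embed[where 'd = 'd, folded dd, OF mult_carrier_mat[OF D_carrier[OF k1(1)] tc]])
      also have "\<dots> \<le> t / \<Gamma>\<^sup>2 * \<theta> ^ (2 * (k - j)) * sqn (y j)"
        by (rule step_bound[OF k1(1) j(1) y t]) (use van[OF k j] in auto)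
      also have "\<dots> = (s * (\<theta> ^ (k - j) * a j))\<^sup>2"
        by (simp add: s(2)[symmetric] a2[symmetric] power_mult_distrib power_mult mult.commute[of 2])
      finally show ?thesis by (rule power2_le_imp_le) (use s a0 \<theta> in auto)
    qed
    have "norm (\<Sum>j\<in>{..<k} \<inter> A k. ?g j) \<le> (\<Sum>j\<in>{..<k} \<inter> A k. norm (?g j))" by (rule norm_sum)
    also have "\<dots> \<le> (\<Sum>j\<in>{..<k} \<inter> A k. s * (\<theta> ^ (k - j) * a j))" using g by (intro sum_mono) auto
    also have "\<dots> \<le> (\<Sum>j<k. s * (\<theta> ^ (k - j) * a j))" using s a0 \<theta> by (intro sum_mono2) auto
    finally have "(norm (\<Sum>j\<in>{..<k} \<inter> A k. ?g j))\<^sup>2 \<le> (s * (\<Sum>j<k. \<theta> ^ (k - j) * a j))\<^sup>2"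
      by (intro power_mono) (auto simp: sum_distrib_left)
    then have n: "(norm (\<Sum>j\<in>{..<k} \<inter> A k. ?g j))\<^sup>2 \<le> s\<^sup>2 * (\<Sum>j<k. \<theta> ^ (k - j) * a j)\<^sup>2"
      by (simp add: power_mult_distrib)
    have "(\<Sum>j<k. \<theta> ^ (k - j) * a j)\<^sup>2 \<le> (\<Sum>j<k. \<theta> ^ (k - j)) * (\<Sum>j<k. \<theta> ^ (k - j) * (a j)\<^sup>2)"
      using powr_jensen_ge[of "{..<k}" "\<lambda>j. \<theta> ^ (k - j)" a 2] a0 \<theta>
      by (simp add: sum_nonneg)
    also have "\<dots> \<le> \<Gamma> * (\<Sum>j<k. \<theta> ^ (k - j) * (a j)\<^sup>2)"
      using geometric_tail_bound(2)[of \<theta> k] \<theta> unfolding \<Gamma>_def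
      by (intro mult_right_mono) (auto intro: sum_nonneg)
    also have "(\<Sum>j<k. \<theta> ^ (k - j) * (a j)\<^sup>2) = (\<Sum>j<n. if j < k then \<theta> ^ (k - j) * (a j)\<^sup>2 else 0)"
    proof -
      have "(\<Sum>j<n. if j < k then \<theta> ^ (k - j) * (a j)\<^sup>2 else 0) = (\<Sum>j\<in>{..<n} \<inter> {j. j < k}. \<theta> ^ (k - j) * (a j)\<^sup>2)"
        by (simp add: sum.inter_restrict)
      moreover have "{..<n} \<inter> {j. j < k} = {..<k}" using k1 by auto
      ultimately show ?thesis by simp
    qed
    finally have "s\<^sup>2 * (\<Sum>j<k. \<theta> ^ (k - j) * a j)\<^sup>2
       \<le> s\<^sup>2 * (\<Gamma> * (\<Sum>j<n. if j < k then \<theta> ^ (k - j) * (a j)\<^sup>2 else 0))"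
      by (intro mult_left_mono) auto
    then show ?thesis using n by (simp only: mult.assoc)
  qed
  have "(\<Sum>k\<in>K. (norm (\<Sum>j\<in>{..<k} \<inter> A k. l2_embed k (D k * tensor_one (d ^ (k - j)) (y j)) :: 'd l2M))\<^sup>2)
     \<le> (\<Sum>k\<in>K. s\<^sup>2 * \<Gamma> * (\<Sum>j<n. if j < k then \<theta> ^ (k - j) * (a j)\<^sup>2 else 0))"
    using each by (rule sum_mono)
  also have "\<dots> \<le> (\<Sum>k\<in>{1..n}. s\<^sup>2 * \<Gamma> * (\<Sum>j<n. if j < k then \<theta> ^ (k - j) * (a j)\<^sup>2 else 0))"
    using K \<theta> \<Gamma>_pos by (intro sum_mono2) (auto intro!: mult_nonneg_nonneg sum_nonneg)
  also have "\<dots> = s\<^sup>2 * \<Gamma> * (\<Sum>j<n. \<Sum>k\<in>{1..n}. if j < k then \<theta> ^ (k - j) * (a j)\<^sup>2 else 0)"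
    unfolding sum_distrib_left[symmetric] by (subst sum.swap) (rule refl)
  also have "\<dots> \<le> s\<^sup>2 * \<Gamma> * (\<Sum>j<n. \<Gamma> * (a j)\<^sup>2)"
  proof (intro mult_left_mono sum_mono)
    fix j assume j: "j \<in> {..<n}"
    have "(\<Sum>k\<in>{1..n}. if j < k then \<theta> ^ (k - j) * (a j)\<^sup>2 else 0) = (\<Sum>k\<in>{1..n} \<inter> {k. j < k}. \<theta> ^ (k - j) * (a j)\<^sup>2)"
      by (simp add: sum.inter_restrict)
    also have "\<dots> \<le> (\<Sum>k\<in>(\<lambda>i. i + j) ` {..<Suc n}. \<theta> ^ (k - j) * (a j)\<^sup>2)"
    proof (rule sum_mono2)
      show "{1..n} \<inter> {k. j < k} \<subseteq> (\<lambda>i. i + j) ` {..<Suc n}"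
      proof
        fix k assume "k \<in> {1..n} \<inter> {k. j < k}"
        then have "k = (k - j) + j" "k - j \<in> {..<Suc n}" by auto
        then show "k \<in> (\<lambda>i. i + j) ` {..<Suc n}" by (rule image_eqI)
      qed
    qed (use \<theta> in auto)
    also have "\<dots> = (\<Sum>i<Suc n. \<theta> ^ i) * (a j)\<^sup>2"
      by (subst sum.reindex) (auto simp: inj_on_def sum_distrib_right distrib_right)
    also have "\<dots> \<le> \<Gamma> * (a j)\<^sup>2"
      unfolding \<Gamma>_def using geometric_tail_bound(1)[of \<theta> "Suc n"] \<theta> by (intro mult_right_mono) auto
    finally show "(\<Sum>k\<in>{1..n}. if j < k then \<theta> ^ (k - j) * (a j)\<^sup>2 else 0) \<le> \<Gamma> * (a j)\<^sup>2" .
  qed (use \<Gamma>_pos in auto)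
  also have "\<dots> = s\<^sup>2 * \<Gamma>\<^sup>2 * (\<Sum>j<n. (a j)\<^sup>2)"
    by (simp add: sum_distrib_left[symmetric] power2_eq_square[of \<Gamma>])
  also have "\<dots> = t * (\<Sum>j<n. sqn (y j))"
    using \<Gamma>_pos by (simp add: s(2) a2)
  finally show ?thesis .
qed

text \<open>
  With \<open>m = 0\<close> this bounds all weights; a larger m leaves only the pairs of levels at distance
  more than m and makes the bound small.
\<close>

lemma \<beta>_total:
  assumes K: "finite K" "K \<subseteq> {1..}"
    and F: "F \<subseteq> {(k, j, i, c). k \<in> K \<and> j + m < k \<and> i < d ^ j \<and> c < d ^ j}"
  shows "(\<Sum>(k, j, i, c)\<in>F. \<beta> k j i powr q) \<le> \<Gamma> powr p * \<rho> ^ m / (1 - \<rho>) * (\<Sum>k\<in>K. bt k)"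
proof -
  let ?X = "SIGMA k:K. SIGMA j:{..<k - m}. {..<d ^ j} \<times> {..<d ^ j}"
  have FX: "F \<subseteq> ?X" using F by auto
  have fin: "finite ?X" using K by auto
  have "(\<Sum>(k, j, i, c)\<in>F. \<beta> k j i powr q) \<le> (\<Sum>(k, j, i, c)\<in>?X. \<beta> k j i powr q)"
    using FX fin by (intro sum_mono2) auto
  also have "\<dots> = (\<Sum>k\<in>K. \<Sum>j<k - m. \<Sum>i<d ^ j. \<Sum>c<d ^ j. \<beta> k j i powr q)"
    using K(1) by (simp add: sum.Sigma case_prod_unfold del: sum_constant)
  also have "\<dots> \<le> (\<Sum>k\<in>K. \<Sum>j<k - m. \<Gamma> powr p * \<rho> ^ (k - j) * bt k)"
    using K by (intro sum_mono \<beta>_sum) auto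
  also have "\<dots> = (\<Sum>k\<in>K. \<Gamma> powr p * \<rho> ^ m * bt k * (\<Sum>j<k - m. \<rho> ^ (k - m - j)))"
  proof (intro sum.cong refl)
    fix k
    have "\<rho> ^ (k - j) = \<rho> ^ m * \<rho> ^ (k - m - j)" if "j < k - m" for j
      using that by (simp flip: power_add)
    then show "(\<Sum>j<k - m. \<Gamma> powr p * \<rho> ^ (k - j) * bt k) = \<Gamma> powr p * \<rho> ^ m * bt k * (\<Sum>j<k - m. \<rho> ^ (k - m - j))"
      by (simp add: sum_distrib_left mult_ac)
  qed
  also have "\<dots> \<le> (\<Sum>k\<in>K. \<Gamma> powr p * \<rho> ^ m * bt k * (1 / (1 - \<rho>)))"
    by (intro sum_mono mult_left_mono geometric_tail_bound(2)) (use \<rho> bt_nonneg in auto)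
  also have "\<dots> = \<Gamma> powr p * \<rho> ^ m / (1 - \<rho>) * (\<Sum>k\<in>K. bt k)"
    by (simp add: sum_distrib_left sum_divide_distrib mult_ac)
  finally show ?thesis .
qed

lemma \<beta>_single:
  assumes k: "k \<ge> 1" and j: "j < k" and i: "i < d ^ j"
  shows "\<beta> k j i powr q \<le> \<Gamma> powr p * bt k"
proof -
  have "\<beta> k j i powr q \<le> (\<Sum>c<d ^ j. \<beta> k j i powr q)"
    by (rule member_le_sum[of 0]) auto
  also have "\<dots> \<le> (\<Sum>i<d ^ j. \<Sum>c<d ^ j. \<beta> k j i powr q)"
    using i by (intro member_le_sum[of i "{..<d ^ j}" "\<lambda>i. \<Sum>c<d ^ j. \<beta> k j i powr q"]) (auto intro: sum_nonneg)
  also have "\<dots> \<le> \<Gamma> powr p * \<rho> ^ (k - j) * bt k" by (rule \<beta>_sum[OF k j])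
  also have "\<dots> \<le> \<Gamma> powr p * 1 * bt k"
    using \<rho> bt_nonneg by (intro mult_right_mono mult_left_mono power_le_one) auto
  finally show ?thesis by simp
qed

end

section \<open>The upper bound\<close>

text \<open>
  Matrices of a fixed level with entries bounded by R: the continuous image of a compact product
  of discs.
\<close>

lemma compact_matrix_cube:
  "compact ((\<lambda>c. l2_embed n (Matrix.mat (CARD('d) ^ n) (CARD('d) ^ n) c) :: 'd::finite l2M)
     ` (PiE UNIV (\<lambda>_. cball 0 R)))"
proof (rule compact_continuous_image)
  let ?N = "CARD('d) ^ n"
  let ?E = "\<lambda>c. l2_embed n (Matrix.mat ?N ?N c) :: 'd l2M"
  have "compactin (product_topology (\<lambda>_. euclidean) UNIV) (PiE UNIV (\<lambda>_::nat \<times> nat. cball (0::complex) R))"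
    by (subst compactin_PiE) auto
  then show "compact (PiE UNIV (\<lambda>_::nat \<times> nat. cball (0::complex) R))" by (simp add: euclidean_product_topology)
  have coord: "continuous_on S (\<lambda>v. v i)" for S :: "(nat \<times> nat \<Rightarrow> complex) set" and i
    by (rule continuous_on_subset[OF continuous_on_product_coordinates]) auto
  have dist: "dist (?E c) (?E c0) = sqrt ((\<Sum>i<?N. \<Sum>j<?N. (cmod (c (i, j) - c0 (i, j)))\<^sup>2) / real ?N)" for c c0
  proof -
    let ?m = "Matrix.mat ?N ?N"
    have "?m c = ?m (\<lambda>x. c x - c0 x) + ?m c0" by (intro eq_matI) auto
    then have "?E c = ?E (\<lambda>x. c x - c0 x) + ?E c0"
      using l2_embed_add[where 'd = 'd, of "?m (\<lambda>x. c x - c0 x)" n "?m c0"] by simp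
    then have "(dist (?E c) (?E c0))\<^sup>2 = sqn (?m (\<lambda>x. c x - c0 x))"
      using norm_l2_embed[where 'd = 'd, of "?m (\<lambda>x. c x - c0 x)" n] by (simp add: dist_norm)
    also have "\<dots> = (\<Sum>i<?N. \<Sum>j<?N. (cmod (c (i, j) - c0 (i, j)))\<^sup>2) / real ?N"
      by (subst sqn_sum[of _ ?N]) auto
    finally have "(dist (?E c) (?E c0))\<^sup>2 = (\<Sum>i<?N. \<Sum>j<?N. (cmod (c (i, j) - c0 (i, j)))\<^sup>2) / real ?N" .
    then show ?thesis by (rule real_sqrt_unique[OF _ zero_le_dist, symmetric])
  qed
  show "continuous_on (PiE UNIV (\<lambda>_. cball 0 R)) ?E"
    unfolding continuous_on_def
  proof (intro ballI)
    fix c0 assume c0: "c0 \<in> PiE UNIV (\<lambda>_::nat \<times> nat. cball (0::complex) R)"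
    have "continuous_on (PiE UNIV (\<lambda>_. cball 0 R)) (\<lambda>c. dist (?E c) (?E c0))"
      unfolding dist by (intro continuous_intros coord) auto
    then have "((\<lambda>c. dist (?E c) (?E c0)) \<longlongrightarrow> dist (?E c0) (?E c0)) (at c0 within PiE UNIV (\<lambda>_. cball 0 R))"
      using c0 unfolding continuous_on_def by blast
    then show "(?E \<longlongrightarrow> ?E c0) (at c0 within PiE UNIV (\<lambda>_. cball 0 R))"
      by (subst tendsto_dist_iff) simp
  qed
qed

lemma compact_closureI:
  fixes S :: "'a::{complete_space, real_normed_vector} set"
  assumes approx: "\<And>e. e > 0 \<Longrightarrow> \<exists>C. compact C \<and> (\<forall>x\<in>S. \<exists>y\<in>C. dist x y \<le> e)"
  shows "compact (closure S)"
  unfolding compact_eq_totally_bounded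
proof (intro conjI allI impI)
  show "complete (closure S)" by (simp add: complete_eq_closed)
  fix e :: real assume e: "e > 0"
  obtain C where C: "compact C" "\<And>x. x \<in> S \<Longrightarrow> \<exists>y\<in>C. dist x y \<le> e / 4" using approx[of "e / 4"] e by auto
  obtain k where k: "finite k" "C \<subseteq> (\<Union>x\<in>k. ball x (e / 4))"
    using compact_eq_totally_bounded[of C] C(1) e by (metis zero_less_divide_iff zero_less_numeral)
  have "S \<subseteq> (\<Union>x\<in>k. cball x (e / 2))"
  proof
    fix x assume "x \<in> S"
    then obtain y where y: "y \<in> C" "dist x y \<le> e / 4" using C(2) by blast
    then obtain z where z: "z \<in> k" "dist z y < e / 4" using k(2) by auto
    have "dist z x \<le> dist z y + dist x y" by (rule dist_triangle2)
    then show "x \<in> (\<Union>x\<in>k. cball x (e / 2))" using y z by force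
  qed
  moreover have "closed (\<Union>x\<in>k. cball x (e / 2))" using k(1) by auto
  ultimately have "closure S \<subseteq> (\<Union>x\<in>k. cball x (e / 2))" by (rule closure_minimal)
  also have "\<dots> \<subseteq> (\<Union>x\<in>k. ball x e)" using e by (force simp: mem_ball)
  finally show "\<exists>k. finite k \<and> closure S \<subseteq> (\<Union>x\<in>k. ball x e)" using k(1) by blast
qed

locale paraproduct_setup = besov_data "CARD('d)" p b + start_map F
  for p :: real and b :: "nat \<Rightarrow> complex mat" and F :: "'d::finite l2M \<Rightarrow> nat \<Rightarrow> complex mat"
begin

abbreviation trm :: "'d l2M \<Rightarrow> nat \<Rightarrow> 'd l2M" where "trm \<equiv> paraproduct_term F b"
abbreviation T :: "'d l2M \<Rightarrow> 'd l2M" where "T \<equiv> paraproduct F b"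

lemma tensor_F_carrier: "k \<ge> 1 \<Longrightarrow> tensor_one CARD('d) (F f (k - 1)) \<in> carrier_mat (CARD('d) ^ k) (CARD('d) ^ k)"
  using tensor_one_carrier[OF F_carrier[of f "k - 1"], of "CARD('d)"] by (cases k) (auto simp: mult.commute)

lemma trm_matrix_carrier:
  "k \<ge> 1 \<Longrightarrow> D k * tensor_one CARD('d) (F f (k - 1)) \<in> carrier_mat (CARD('d) ^ k) (CARD('d) ^ k)"
  by (rule mult_carrier_mat[OF D_carrier tensor_F_carrier])

lemma trm_decomp:
  assumes k: "k \<ge> 1"
  shows "trm f k = (\<Sum>j<k. l2_embed k (D k * tensor_one (CARD('d) ^ (k - j)) (incr f j)))"
proof -
  have "{..k - 1} = {..<k}" using k by auto
  then show ?thesis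
    using l2_embed_mult_telescope[OF D_carrier[OF k] F_carrier[of f], of "k - 1"] k
    by (simp add: paraproduct_term_def)
qed

text \<open>
  The conditional expectation of the n-th term on level n - 1 vanishes, since that of \<open>d\<^sub>n\<close> does
  and the other factor belongs to that level.
\<close>

lemma trm_orthogonal:
  assumes "1 \<le> m" "m < n"
  shows "cip (trm f n) (trm f m) = 0"
  unfolding paraproduct_term_def
proof (rule cip_l2_embed_orthogonal)
  have n: "n \<ge> 1" using assms by simp
  show "D m * tensor_one CARD('d) (F f (m - 1)) \<in> carrier_mat (CARD('d) ^ m) (CARD('d) ^ m)"
    by (rule trm_matrix_carrier[OF assms(1)])
  show "D n * tensor_one CARD('d) (F f (n - 1)) \<in> carrier_mat (CARD('d) ^ n) (CARD('d) ^ n)"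
    by (rule trm_matrix_carrier[OF n])
  have e: "CARD('d) ^ (n - 1) * CARD('d) = CARD('d) ^ n" using n by (cases n) auto
  have "partial_trace CARD('d) (D n * tensor_one CARD('d) (F f (n - 1))) = partial_trace CARD('d) (D n) * F f (n - 1)"
    by (rule partial_trace_mult_tensor_one[OF _ F_carrier]) (use D_carrier[OF n] e in auto)
  also have "partial_trace CARD('d) (D n) = 0\<^sub>m (CARD('d) ^ (n - 1)) (CARD('d) ^ (n - 1))"
    by (rule partial_trace_mdiff[OF b]) (use assms in auto)
  finally show "partial_trace CARD('d) (D n * tensor_one CARD('d) (F f (n - 1))) = 0\<^sub>m (CARD('d) ^ (n - 1)) (CARD('d) ^ (n - 1))"
    using F_carrier[of f "n - 1"] by simp
qed (rule assms)

lemma trm_add: assumes k: "k \<ge> 1" shows "trm (f + g) k = trm f k + trm g k"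
proof -
  have "tensor_one CARD('d) (F (f + g) (k - 1)) = tensor_one CARD('d) (F f (k - 1)) + tensor_one CARD('d) (F g (k - 1))"
    unfolding F_add by (rule tensor_one_add[OF F_carrier F_carrier])
  then show ?thesis
    unfolding paraproduct_term_def
    using l2_embed_add[OF trm_matrix_carrier[OF k, of f] trm_matrix_carrier[OF k, of g]]
      mult_add_distrib_mat[OF D_carrier[OF k] tensor_F_carrier[OF k, of f] tensor_F_carrier[OF k, of g]] by simp
qed

lemma trm_scaleC: assumes k: "k \<ge> 1" shows "trm (scaleC c f) k = scaleC c (trm f k)"
proof -
  have "tensor_one CARD('d) (F (scaleC c f) (k - 1)) = c \<cdot>\<^sub>m tensor_one CARD('d) (F f (k - 1))"
    unfolding F_scaleC by (rule tensor_one_smult[OF F_carrier])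
  then show ?thesis
    unfolding paraproduct_term_def
    using l2_embed_smult[OF trm_matrix_carrier[OF k, of f]]
      mult_smult_distrib[OF D_carrier[OF k] tensor_F_carrier[OF k, of f]] by simp
qed

lemma \<psi>_sum:
  assumes "c < CARD('d) ^ j" "finite I"
  shows "\<psi> k j i c (incr (\<Sum>x\<in>I. scaleC (a x) (u x)) j) = (\<Sum>x\<in>I. a x * \<psi> k j i c (incr (u x) j))"
proof -
  have "\<psi> k j i c (incr (\<Sum>x\<in>I. scaleC (a x) (u x)) j) =
     cdot (CARD('d) ^ j) (snd (eig k j) i) (\<lambda>b. \<Sum>x\<in>I. a x * incr (u x) j $$ (b, c))"
    unfolding \<psi>_def cdot_def by (intro sum.cong refl) (simp add: incr_sum_index assms)
  then show ?thesis by (simp add: cdot_sum_right \<psi>_def)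
qed

lemma form_bound:
  assumes K: "finite K" "K \<subseteq> {1..}" and t: "t > 0"
    and van: "\<And>k j i c. k \<in> K \<Longrightarrow> j < k \<Longrightarrow> i < CARD('d) ^ j \<Longrightarrow> c < CARD('d) ^ j \<Longrightarrow> t \<le> \<beta> k j i \<Longrightarrow> \<psi> k j i c (incr f j) = 0"
  shows "(\<Sum>k\<in>K. (norm (trm f k))\<^sup>2) \<le> t * (norm f)\<^sup>2"
proof -
  define n where "n = (if K = {} then 0 else Max K)"
  have Kn: "K \<subseteq> {1..n}" using K by (auto simp: n_def)
  have "(\<Sum>k\<in>K. (norm (trm f k))\<^sup>2) =
     (\<Sum>k\<in>K. (norm (\<Sum>j\<in>{..<k} \<inter> UNIV. l2_embed k (D k * tensor_one (CARD('d) ^ (k - j)) (incr f j)) :: 'd l2M))\<^sup>2)"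
    using K by (intro sum.cong refl) (auto simp: trm_decomp)
  also have "\<dots> \<le> t * (\<Sum>j<n. sqn (incr f j))"
    by (rule form_sum_bound[OF refl Kn incr_carrier t]) (use van in auto)
  also have "\<dots> \<le> t * (norm f)\<^sup>2" using incr_energy[of f n] t by (intro mult_left_mono) auto
  finally show ?thesis .
qed

text \<open>
  If the Besov terms are small then no weight reaches the level t. This makes the operator
  bounded, and its tails small in norm.
\<close>

lemma small_terms_bound:
  assumes K: "finite K" "K \<subseteq> {1..}" and t: "t > 0" and small: "\<And>k. k \<in> K \<Longrightarrow> \<Gamma> powr p * bt k < t powr q"
  shows "(\<Sum>k\<in>K. (norm (trm f k))\<^sup>2) \<le> t * (norm f)\<^sup>2"
proof (rule form_bound[OF K t])
  fix k j i c assume k: "k \<in> K" and j: "j < k" and i: "i < CARD('d) ^ j" and le: "t \<le> \<beta> k j i"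
  have "t powr q \<le> \<beta> k j i powr q" using le t q by (intro powr_mono2) auto
  also have "\<dots> \<le> \<Gamma> powr p * bt k" by (rule \<beta>_single) (use k K j i in auto)
  also have "\<dots> < t powr q" by (rule small[OF k])
  finally show "\<psi> k j i c (incr f j) = 0" by simp
qed

end

locale summable_paraproduct = paraproduct_setup p b F
  for p :: real and b :: "nat \<Rightarrow> complex mat" and F :: "'d::finite l2M \<Rightarrow> nat \<Rightarrow> complex mat" +
  assumes sm: "summable (\<lambda>k. bt (Suc k))"
begin

abbreviation v :: "'d l2M \<Rightarrow> nat \<Rightarrow> 'd l2M" where "v f k \<equiv> trm f (Suc k)"

lemma v_orth: "m < n \<Longrightarrow> cip (v f n) (v f m) = 0"
  by (rule trm_orthogonal) auto

lemma reindex: "(\<Sum>k\<in>K. (norm (v f k))\<^sup>2) = (\<Sum>k\<in>Suc ` K. (norm (trm f k))\<^sup>2)"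
  by (subst sum.reindex) auto

lemma tail_small:
  assumes t: "t > 0"
  shows "\<exists>n. \<forall>k\<ge>n. \<Gamma> powr p * bt (Suc k) < t powr q"
proof -
  have "(\<lambda>k. \<Gamma> powr p * bt (Suc k)) \<longlonglongrightarrow> \<Gamma> powr p * 0"
    by (intro tendsto_mult tendsto_const summable_LIMSEQ_zero sm)
  then have "\<forall>\<^sub>F k in sequentially. \<Gamma> powr p * bt (Suc k) < t powr q"
    using t by (intro order_tendstoD(2)[of _ "\<Gamma> powr p * 0"]) auto
  then show ?thesis by (simp add: eventually_sequentially)
qed

lemma bound_exists: "\<exists>B>0. \<forall>f K. finite K \<longrightarrow> (\<Sum>k\<in>K. (norm (v f k))\<^sup>2) \<le> B * (norm f)\<^sup>2"
proof -
  have "Bseq (\<lambda>k. \<Gamma> powr p * bt (Suc k))"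
    by (intro convergent_imp_Bseq convergentI[of _ "\<Gamma> powr p * 0"] tendsto_mult tendsto_const summable_LIMSEQ_zero sm)
  then obtain M where M: "M > 0" "\<And>k. \<bar>\<Gamma> powr p * bt (Suc k)\<bar> \<le> M" by (auto simp: Bseq_def)
  define B where "B = (M + 1) powr (1 / q)"
  have B: "B > 0" "B powr q = M + 1" using M(1) q by (auto simp: B_def powr_powr)
  have "(\<Sum>k\<in>K. (norm (v f k))\<^sup>2) \<le> B * (norm f)\<^sup>2" if "finite K" for f K
    unfolding reindex
  proof (rule small_terms_bound[OF _ _ B(1)])
    fix k assume "k \<in> Suc ` K"
    then obtain j where j: "k = Suc j" by auto
    show "\<Gamma> powr p * bt k < B powr q" using M(2)[of j] unfolding B(2) j by linarith
  qed (use that in auto)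
  then show ?thesis using B(1) by blast
qed

lemma summable_v: "summable (v f)"
proof -
  obtain B where B: "\<And>K. finite K \<Longrightarrow> (\<Sum>k\<in>K. (norm (v f k))\<^sup>2) \<le> B * (norm f)\<^sup>2" using bound_exists by blast
  show ?thesis by (rule orthogonal_summable[of "v f" "B * (norm f)\<^sup>2"]) (use v_orth B in auto)
qed

lemma T_bounded_op: "T \<in> bounded_ops"
proof -
  obtain B where B: "B > 0" "\<And>f K. finite K \<Longrightarrow> (\<Sum>k\<in>K. (norm (v f k))\<^sup>2) \<le> B * (norm f)\<^sup>2"
    using bound_exists by blast
  have add: "T (f + g) = T f + T g" for f g
    unfolding paraproduct_def suminf_add[OF summable_v summable_v] by (simp add: trm_add)
  have bl: "bounded_linear (scaleC c :: 'd l2M \<Rightarrow> 'd l2M)" for c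
    by (rule bounded_linear_intro[of _ "cmod c"])
       (auto simp: l2M.scale_right_distrib scaleR_scaleC norm_scaleC mult.commute)
  have scal: "T (scaleC c f) = scaleC c (T f)" for c f
    unfolding paraproduct_def bounded_linear.suminf[OF bl summable_v] by (simp add: trm_scaleC)
  have "norm (T f) \<le> norm f * sqrt B" for f
  proof (rule power2_le_imp_le)
    have "(norm (T f))\<^sup>2 \<le> B * (norm f)\<^sup>2"
      unfolding paraproduct_def by (rule orthogonal_suminf_le[OF v_orth B(2)])
    then show "(norm (T f))\<^sup>2 \<le> (norm f * sqrt B)\<^sup>2" using B(1) by (simp add: power_mult_distrib mult.commute)
  qed (use B in auto)
  then have "bounded_linear T"
    by (intro bounded_linear_intro[of _ "sqrt B"]) (auto simp: add scal scaleR_scaleC)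
  then show ?thesis using scal by (simp add: bounded_ops_def)
qed

text \<open>
  The first n terms take values in the matrices of level n; these partial sums are the finite rank
  approximations that make T compact.
\<close>

lemma partial_sum_matrix:
  "\<exists>z\<in>carrier_mat (CARD('d) ^ n) (CARD('d) ^ n). (\<Sum>k<n. v f k) = l2_embed n z"
proof -
  have "\<exists>z\<in>carrier_mat (CARD('d) ^ n) (CARD('d) ^ n). (\<Sum>k<m. v f k) = l2_embed n z" if "m \<le> n" for m
    using that
  proof (induction m)
    case 0
    show ?case by (rule bexI[of _ "0\<^sub>m (CARD('d) ^ n) (CARD('d) ^ n)"]) (auto simp: l2_embed_zero)
  next
    case (Suc m)
    then obtain z where z: "z \<in> carrier_mat (CARD('d) ^ n) (CARD('d) ^ n)" "(\<Sum>k<m. v f k) = l2_embed n z" by auto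
    define x where "x = D (Suc m) * tensor_one CARD('d) (F f (Suc m - 1))"
    have x: "x \<in> carrier_mat (CARD('d) ^ Suc m) (CARD('d) ^ Suc m)"
      unfolding x_def by (rule trm_matrix_carrier) simp
    define x' where "x' = tensor_one (CARD('d) ^ (n - Suc m)) x"
    have e: "CARD('d) ^ Suc m * CARD('d) ^ (n - Suc m) = CARD('d) ^ n"
      using Suc.prems by (simp only: power_add[symmetric]) simp
    have x': "x' \<in> carrier_mat (CARD('d) ^ n) (CARD('d) ^ n)"
      using tensor_one_carrier[OF x, of "CARD('d) ^ (n - Suc m)"] unfolding e x'_def .
    have "v f m = l2_embed n x'"
      using l2_embed_tensor_one[OF x Suc.prems] by (simp add: x'_def paraproduct_term_def x_def)
    then have "(\<Sum>k<Suc m. v f k) = l2_embed n (z + x')" using z l2_embed_add[OF z(1) x'] by simp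
    then show ?case using z x' by (intro bexI[of _ "z + x'"]) auto
  qed
  then show ?thesis by simp
qed

lemma compact_T: "compact (closure (T ` cball 0 1))"
proof (rule compact_closureI)
  fix e :: real assume e: "e > 0"
  obtain B where B: "B > 0" "\<And>f K. finite K \<Longrightarrow> (\<Sum>k\<in>K. (norm (v f k))\<^sup>2) \<le> B * (norm f)\<^sup>2"
    using bound_exists by blast
  obtain n where n: "\<And>k. k \<ge> n \<Longrightarrow> \<Gamma> powr p * bt (Suc k) < (e\<^sup>2) powr q" using tail_small[of "e\<^sup>2"] e by auto
  define R where "R = sqrt (real (CARD('d) ^ n) * B)"
  let ?C = "(\<lambda>c. l2_embed n (Matrix.mat (CARD('d) ^ n) (CARD('d) ^ n) c) :: 'd l2M) ` (PiE UNIV (\<lambda>_. cball 0 R))"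
  have "\<exists>y\<in>?C. dist (T f) y \<le> e" if f: "f \<in> cball 0 1" for f
  proof -
    have f1: "norm f \<le> 1" using f by simp
    then have f2: "(norm f)\<^sup>2 \<le> 1" by (simp add: power_le_one)
    obtain z where z: "z \<in> carrier_mat (CARD('d) ^ n) (CARD('d) ^ n)" "(\<Sum>k<n. v f k) = l2_embed n z"
      using partial_sum_matrix by blast
    have "T f - (\<Sum>k<n. v f k) = (\<Sum>k. v f (k + n))"
      unfolding paraproduct_def using suminf_minus_initial_segment[OF summable_v[of f], of n] by simp
    moreover have "(norm (\<Sum>k. v f (k + n)))\<^sup>2 \<le> e\<^sup>2 * (norm f)\<^sup>2"
    proof (rule orthogonal_suminf_le)
      show "cip (v f (l + n)) (v f (m + n)) = 0" if "m < l" for m l using that by (intro v_orth) simp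
      fix K :: "nat set" assume K: "finite K"
      have "(\<Sum>k\<in>K. (norm (v f (k + n)))\<^sup>2) = (\<Sum>k\<in>(\<lambda>k. Suc (k + n)) ` K. (norm (trm f k))\<^sup>2)"
        by (subst sum.reindex) (auto simp: inj_on_def)
      also have "\<dots> \<le> e\<^sup>2 * (norm f)\<^sup>2"
        by (rule small_terms_bound) (use K e n in auto)
      finally show "(\<Sum>k\<in>K. (norm (v f (k + n)))\<^sup>2) \<le> e\<^sup>2 * (norm f)\<^sup>2" .
    qed
    moreover have "e\<^sup>2 * (norm f)\<^sup>2 \<le> e\<^sup>2" using f2 e by (simp add: mult_left_le)
    ultimately have "(norm (T f - l2_embed n z))\<^sup>2 \<le> e\<^sup>2" using z(2) by simp
    then have d: "dist (T f) (l2_embed n z) \<le> e" unfolding dist_norm by (rule power2_le_imp_le) (use e in simp)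
    have "sqn z = (norm (\<Sum>k<n. v f k))\<^sup>2" using norm_l2_embed[OF z(1)] z(2) by simp
    also have "\<dots> = (\<Sum>k<n. (norm (v f k))\<^sup>2)" by (rule orthogonal_finite_sum[OF v_orth]) auto
    also have "\<dots> \<le> B * (norm f)\<^sup>2" by (rule B(2)) simp
    also have "\<dots> \<le> B" using f2 B(1) by (simp add: mult_left_le)
    finally have sz: "sqn z \<le> B" .
    define c where "c = (\<lambda>(i, j). if i < CARD('d) ^ n \<and> j < CARD('d) ^ n then z $$ (i, j) else 0)"
    have "Matrix.mat (CARD('d) ^ n) (CARD('d) ^ n) c = z" using z(1) by (intro eq_matI) (auto simp: c_def)
    moreover have "c \<in> PiE UNIV (\<lambda>_. cball 0 R)"
    proof -
      have "cmod (z $$ (i, j)) \<le> R" if ij: "i < CARD('d) ^ n" "j < CARD('d) ^ n" for i j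
      proof -
        have "(cmod (z $$ (i, j)))\<^sup>2 \<le> real (CARD('d) ^ n) * sqn z" by (rule entry_le_sqn[OF z(1) ij])
        also have "\<dots> \<le> real (CARD('d) ^ n) * B" using sz by (intro mult_left_mono) auto
        finally show ?thesis unfolding R_def by (rule real_le_rsqrt)
      qed
      moreover have "R \<ge> 0" using B(1) by (simp add: R_def)
      ultimately show ?thesis by (auto simp: c_def PiE_def Pi_def extensional_def)
    qed
    ultimately have "l2_embed n z \<in> ?C" by (metis (no_types, lifting) imageI)
    then show ?thesis using d by blast
  qed
  then show "\<exists>C. compact C \<and> (\<forall>x\<in>T ` cball 0 1. \<exists>y\<in>C. dist x y \<le> e)"
    using compact_matrix_cube[of n R] by blast
qed

text \<open>
  The counting principle for finitely many singular vectors of T, with all weights \<open>\<beta>\<close>.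
\<close>

lemma singular_sum_bound:
  assumes S: "finite S" "S \<subseteq> {0<..}"
  shows "(\<Sum>s\<in>S. real (singular_mult T s) * s powr p) \<le> 2 powr q * (\<Gamma> powr p / (1 - \<rho>)) * (\<Sum>k. bt (Suc k))"
proof -
  interpret C: compact_operator T by standard (rule T_bounded_op, rule compact_T)
  define I where "I = (\<Union>s\<in>S. C.sbasis s)"
  have Spos: "s > 0" if "s \<in> S" for s using S that by auto
  have finI: "finite I" unfolding I_def by (rule finite_UN_I[OF S(1) C.sbasis(1)[OF Spos]])
  have orthI: "orthonormal I id"
    unfolding orthonormal_def
  proof (intro ballI)
    fix x y assume "x \<in> I" "y \<in> I"
    then obtain s s' where "s \<in> S" "x \<in> C.sbasis s" "s' \<in> S" "y \<in> C.sbasis s'" unfolding I_def by blast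
    then show "cip (id x) (id y) = of_bool (x = y)" using C.sbasis_cip[of x s y s'] Spos by simp
  qed
  have sI: "\<exists>s>0. x \<in> singular_space T s" if x: "x \<in> I" for x
  proof -
    obtain s where "s \<in> S" "x \<in> C.sbasis s" using x unfolding I_def by blast
    then show ?thesis using C.sbasis(5)[OF Spos] Spos by blast
  qed
  have TT: "cip (T x) (T y) = (if x = y then of_real ((norm (T x))\<^sup>2) else 0)" if xy: "x \<in> I" "y \<in> I" for x y
  proof (cases "x = y")
    case False
    obtain s where "x \<in> singular_space T s" using sI[OF xy(1)] by blast
    then have "cip (T x) (T y) = of_real (s\<^sup>2) * cip x y" by (simp add: C.singular_space_iff)
    then show ?thesis using orthI xy False by (auto simp: orthonormal_def)
  qed (simp add: cip_self)
  define Q where "Q c = (norm (T (\<Sum>x\<in>I. scaleC (c x) x)))\<^sup>2" for c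
  have Q: "Q c = (\<Sum>x\<in>I. (norm (T x))\<^sup>2 * (cmod (c x))\<^sup>2)" for c
  proof -
    have "of_real (Q c) = (\<Sum>x\<in>I. \<Sum>y\<in>I. c x * cnj (c y) * cip (T x) (T y))"
      unfolding Q_def cip_self[symmetric] C.T_sum C.T_scaleC cip_sum_left cip_sum_right
      by (simp add: cip_scaleC_left mult.assoc mult.left_commute, rule sum.swap)
    also have "\<dots> = (\<Sum>x\<in>I. \<Sum>y\<in>I. if x = y then c x * cnj (c x) * of_real ((norm (T x))\<^sup>2) else 0)"
      by (intro sum.cong refl) (auto simp: TT)
    also have "\<dots> = (\<Sum>x\<in>I. c x * cnj (c x) * of_real ((norm (T x))\<^sup>2))" using finI by simp
    also have "\<dots> = of_real (\<Sum>x\<in>I. (norm (T x))\<^sup>2 * (cmod (c x))\<^sup>2)"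
      unfolding of_real_sum of_real_mult complex_norm_square by (simp add: mult.commute)
    finally show ?thesis by (simp only: of_real_eq_iff)
  qed
  define X where "X = {(k, j, i, c). 1 \<le> k \<and> j < k \<and> i < CARD('d) ^ j \<and> c < CARD('d) ^ j}"
  define bet where "bet = (\<lambda>(k, j, i, c :: nat). \<beta> k j i)"
  define ps where "ps = (\<lambda>(k, j, i, c) f. \<psi> k j i c (incr f j))"
  have "(\<Sum>x\<in>I. (norm (T x))\<^sup>2 powr q) \<le> 2 powr q * (\<Gamma> powr p / (1 - \<rho>) * (\<Sum>k. bt (Suc k)))"
  proof (rule counting_sum[where Q = Q and X = X and \<beta> = bet and \<psi> = ps])
    show "(\<Sum>x\<in>I. (norm (T x))\<^sup>2 * (cmod (c x))\<^sup>2) \<le> Q c" for c by (simp add: Q)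
    fix t :: real and c
    assume t: "t > 0" and van: "\<And>x. x \<in> X \<Longrightarrow> t \<le> bet x \<Longrightarrow> (\<Sum>y\<in>I. ps x y * c y) = 0"
    define f where "f = (\<Sum>x\<in>I. scaleC (c x) x)"
    have nf: "(norm f)\<^sup>2 = (\<Sum>x\<in>I. (cmod (c x))\<^sup>2)"
      using orthonormal_norm[OF orthI finI, of c] by (simp add: f_def)
    have "Q c \<le> t * (norm f)\<^sup>2"
      unfolding Q_def f_def[symmetric] paraproduct_def
    proof (rule orthogonal_suminf_le[OF v_orth])
      fix K :: "nat set" assume K: "finite K"
      show "(\<Sum>k\<in>K. (norm (v f k))\<^sup>2) \<le> t * (norm f)\<^sup>2"
        unfolding reindex
      proof (rule form_bound[OF _ _ t])
        fix k j i e assume k: "k \<in> Suc ` K" "j < k" "i < CARD('d) ^ j" "e < CARD('d) ^ j" "t \<le> \<beta> k j i"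
        have "(\<Sum>y\<in>I. ps (k, j, i, e) y * c y) = 0" by (rule van) (use k in \<open>auto simp: X_def bet_def\<close>)
        then show "\<psi> k j i e (incr f j) = 0"
          using \<psi>_sum[OF k(4) finI, of k i c "\<lambda>x. x"] by (simp add: f_def ps_def mult.commute)
      qed (use K in auto)
    qed
    then show "Q c \<le> t * (\<Sum>x\<in>I. (cmod (c x))\<^sup>2)" by (simp add: nf)
  next
    fix G assume G: "finite G" "G \<subseteq> X"
    define n where "n = (if G = {} then 0 else Max (fst ` G))"
    have "fst x \<le> n" if "x \<in> G" for x using G that by (auto simp: n_def)
    then have "(\<Sum>(k, j, i, c)\<in>G. \<beta> k j i powr q) \<le> \<Gamma> powr p * \<rho> ^ 0 / (1 - \<rho>) * (\<Sum>k\<in>{1..n}. bt k)"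
      using G by (intro \<beta>_total) (force simp: X_def)+
    also have "(\<Sum>k\<in>{1..n}. bt k) = (\<Sum>k<n. bt (Suc k))"
      by (simp add: sum.atLeast1_atMost_eq)
    also have "\<dots> \<le> (\<Sum>k. bt (Suc k))" by (rule sum_le_suminf[OF sm]) (auto simp: bt_nonneg)
    finally show "(\<Sum>x\<in>G. bet x powr q) \<le> \<Gamma> powr p / (1 - \<rho>) * (\<Sum>k. bt (Suc k))"
      using \<rho> by (simp add: bet_def case_prod_unfold mult_left_mono divide_right_mono)
  qed (use finI q in auto)
  moreover have "(\<Sum>x\<in>I. (norm (T x))\<^sup>2 powr q) = (\<Sum>s\<in>S. real (singular_mult T s) * s powr p)"
  proof -
    have "(\<Sum>x\<in>I. (norm (T x))\<^sup>2 powr q) = (\<Sum>s\<in>S. \<Sum>x\<in>C.sbasis s. (norm (T x))\<^sup>2 powr q)"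
      unfolding I_def
    proof (rule sum.UNION_disjoint[OF S(1)])
      show "\<forall>s\<in>S. finite (C.sbasis s)" using C.sbasis(1)[OF Spos] by blast
      show "\<forall>s\<in>S. \<forall>s'\<in>S. s \<noteq> s' \<longrightarrow> C.sbasis s \<inter> C.sbasis s' = {}"
        using C.sbasis_unique Spos by blast
    qed
    also have "\<dots> = (\<Sum>s\<in>S. real (singular_mult T s) * s powr p)"
    proof (intro sum.cong refl)
      fix s assume "s \<in> S"
      then have s: "s > 0" using S by auto
      have "(norm (T x))\<^sup>2 powr q = s powr p" if x: "x \<in> C.sbasis s" for x
      proof -
        have "(norm (T x))\<^sup>2 = s\<^sup>2" by (rule C.sbasis_norm[OF s x])
        also have "\<dots> = s powr 2" using s by simp
        finally have "(norm (T x))\<^sup>2 = s powr 2" .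
        then have "(norm (T x))\<^sup>2 powr q = (s powr 2) powr q" by (simp only:)
        then show ?thesis by (simp only: powr_powr) (simp add: q_def)
      qed
      then show "(\<Sum>x\<in>C.sbasis s. (norm (T x))\<^sup>2 powr q) = real (singular_mult T s) * s powr p"
        using C.sbasis(4)[OF s] by simp
    qed
    finally show ?thesis .
  qed
  ultimately show ?thesis by (simp add: mult.assoc)
qed

lemma T_schatten:
  "paraproduct_in_schatten p F b"
  "(\<Sum>\<^sub>\<infinity>s\<in>{0<..}. real (singular_mult T s) * s powr p) \<le> 2 powr q * (\<Gamma> powr p / (1 - \<rho>)) * (\<Sum>k. bt (Suc k))"
proof -
  have s: "(\<lambda>s. real (singular_mult T s) * s powr p) summable_on {0<..}"
    by (rule nonneg_bdd_above_summable_on)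
       (auto intro!: bdd_aboveI2[of _ _ "2 powr q * (\<Gamma> powr p / (1 - \<rho>)) * (\<Sum>k. bt (Suc k))"] singular_sum_bound)
  then show "paraproduct_in_schatten p F b"
    unfolding paraproduct_in_schatten_def schatten_class_def
    using summable_v T_bounded_op compact_T by auto
  show "(\<Sum>\<^sub>\<infinity>s\<in>{0<..}. real (singular_mult T s) * s powr p) \<le> 2 powr q * (\<Gamma> powr p / (1 - \<rho>)) * (\<Sum>k. bt (Suc k))"
    by (rule infsum_le_finite_sums[OF s]) (rule singular_sum_bound)
qed

end

section \<open>Test vectors\<close>

context besov_data
begin

text \<open>
  The columns of \<open>d\<^sub>k\<close> are indexed by triples of a number below \<open>d ^ (k - 2)\<close> and two last digits
  s, u. The block of s consists of the columns with digit s, those with different u being stacked.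
  It belongs to the form \<open>v \<mapsto> \<parallel>d\<^sub>k ((v \<otimes> e\<^sub>s) \<otimes> 1)\<parallel>\<^sup>2\<close>, up to normalisation.
\<close>

definition zblk :: "nat \<Rightarrow> nat \<Rightarrow> nat \<times> nat \<Rightarrow> nat \<Rightarrow> complex" where
  "zblk k s = (\<lambda>(a, u) b. D k $$ (a, (b * d + s) * d + u))"

definition beig :: "nat \<Rightarrow> nat \<Rightarrow> (nat \<Rightarrow> real) \<times> (nat \<Rightarrow> nat \<Rightarrow> complex)" where
  "beig k s = (SOME (\<nu>, w). eigsys ({..<d ^ k} \<times> {..<d}) (zblk k s) (d ^ (k - 2)) \<nu> w)"

definition \<mu> :: "nat \<Rightarrow> nat \<Rightarrow> nat \<Rightarrow> real" where
  "\<mu> k s i = fst (beig k s) i / real d"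

lemma beig: "eigsys ({..<d ^ k} \<times> {..<d}) (zblk k s) (d ^ (k - 2)) (fst (beig k s)) (snd (beig k s))"
proof -
  have "\<exists>\<nu> w. eigsys ({..<d ^ k} \<times> {..<d}) (zblk k s) (d ^ (k - 2)) \<nu> w"
    by (rule eigsys_exists) simp
  then have "\<exists>x. case x of (\<nu>, w) \<Rightarrow> eigsys ({..<d ^ k} \<times> {..<d}) (zblk k s) (d ^ (k - 2)) \<nu> w"
    by auto
  from someI_ex[OF this] show ?thesis unfolding beig_def by (simp add: case_prod_unfold)
qed

lemma \<mu>_nonneg: "i < d ^ (k - 2) \<Longrightarrow> \<mu> k s i \<ge> 0"
  unfolding \<mu>_def using eigsysD(1)[OF beig, of i k s] by simp

text \<open>
  The columns split into d * d classes by their two last digits, and the part of the form on the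
  class of (s, u) is dominated by the form of the block s. The sum over c counts the possible
  positions of the nonzero column of a test matrix.
\<close>

lemma bt_le_blocks:
  assumes k: "k \<ge> 2"
  shows "bt k \<le> real d ^ 3 * (2 * real d ^ 3) powr q *
    (\<Sum>s<d. \<Sum>i<d ^ (k - 2). \<Sum>c<d ^ (k - 2). \<mu> k s i powr q)"
proof -
  define N where "N = d ^ (k - 2)"
  obtain m where m: "k = m + 2" using k by (metis add.commute le_Suc_ex)
  have dk: "d ^ k = N * (d * d)" by (simp add: N_def m mult_ac)
  obtain l u where l: "eigsys {..<d ^ k} (mrow (D k)) (d ^ k) l u" using mrow_eigsys_exists by blast
  have l': "eigsys {..<d ^ k} (mrow (D k)) (N * (d * d)) l u" using l dk by simp
  define \<nu> where "\<nu> s = fst (beig k s)" for s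
  have "(\<Sum>i<N * (d * d). l i powr q) \<le> (2 * real (d * d)) powr q * (\<Sum>x<d * d. \<Sum>i<N. \<nu> (x div d) i powr q)"
  proof (rule diagonal_blocks_bound[OF _ l'])
    show "eigsys ({..<d ^ k} \<times> {..<d}) (zblk k (x div d)) N (\<nu> (x div d)) (snd (beig k (x div d)))" for x
      using beig[of k "x div d"] by (simp add: N_def \<nu>_def)
    fix x v assume x: "x < d * d"
    have u: "x mod d < d" by simp
    have e: "b * (d * d) + x = (b * d + x div d) * d + x mod d" for b
      by (simp add: algebra_simps)
    have "gram_form {..<d ^ k} (mrow (D k)) (N * (d * d)) (slot (d * d) x v) =
       (\<Sum>a<d ^ k. (cmod (\<Sum>b<N. zblk k (x div d) (a, x mod d) b * v b))\<^sup>2)"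
      unfolding gram_form_def sum_slot[OF x] by (simp add: zblk_def mrow_def e)
    also have "\<dots> \<le> (\<Sum>a<d ^ k. \<Sum>u<d. (cmod (\<Sum>b<N. zblk k (x div d) (a, u) b * v b))\<^sup>2)"
      by (intro sum_mono member_le_sum[of "x mod d" "{..<d}" "\<lambda>u. (cmod (\<Sum>b<N. zblk k (x div d) (_, u) b * v b))\<^sup>2"]) auto
    also have "\<dots> = gram_form ({..<d ^ k} \<times> {..<d}) (zblk k (x div d)) N v"
      unfolding gram_form_def sum_Times ..
    finally show "gram_form {..<d ^ k} (mrow (D k)) (N * (d * d)) (slot (d * d) x v)
       \<le> gram_form ({..<d ^ k} \<times> {..<d}) (zblk k (x div d)) N v" .
  qed (auto simp: q)
  also have "(\<Sum>x<d * d. \<Sum>i<N. \<nu> (x div d) i powr q) = real d * (\<Sum>s<d. \<Sum>i<N. \<nu> s i powr q)"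
    unfolding sum_nat_prod by (simp add: sum_distrib_left)
  finally have 1: "(\<Sum>i<N * (d * d). l i powr q) \<le> (2 * real (d * d)) powr q * (real d * (\<Sum>s<d. \<Sum>i<N. \<nu> s i powr q))" .
  have k1: "k \<ge> 1" using k by simp
  have "bt k = real (d ^ k) * (real (d ^ k) * Lp_norm p (D k) powr p)"
    by (simp add: besov_term_def power_mult power2_eq_square mult_2 power_add)
  also have "real (d ^ k) * Lp_norm p (D k) powr p = (\<Sum>i<N * (d * d). l i powr q)"
    using Lp_norm_eigsys[OF D_carrier[OF k1] l p] dk by (simp add: q_def)
  finally have "bt k \<le> real (d ^ k) * ((2 * real (d * d)) powr q * (real d * (\<Sum>s<d. \<Sum>i<N. \<nu> s i powr q)))"
    using 1 by (simp add: mult_left_mono)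
  also have "\<dots> = real d ^ 3 * (2 * real d ^ 3) powr q * (real N * (\<Sum>s<d. \<Sum>i<N. (\<nu> s i / real d) powr q))"
  proof -
    have "(\<Sum>s<d. \<Sum>i<N. (\<nu> s i / real d) powr q) = (\<Sum>s<d. \<Sum>i<N. \<nu> s i powr q) / real d powr q"
      using eigsysD(1)[OF beig, of _ k] by (simp add: powr_divide \<nu>_def N_def sum_divide_distrib)
    moreover have "(2 * real d ^ 3) powr q = (2 * real (d * d)) powr q * real d powr q"
      by (simp add: powr_mult[symmetric] power3_eq_cube mult.assoc)
    moreover have "real (d ^ k) = real N * real d * real d" using dk by simp
    ultimately show ?thesis by (simp add: power3_eq_cube)
  qed
  also have "real N * (\<Sum>s<d. \<Sum>i<N. (\<nu> s i / real d) powr q) = (\<Sum>s<d. \<Sum>i<N. \<Sum>c<N. \<mu> k s i powr q)"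
    by (simp add: sum_distrib_left \<mu>_def \<nu>_def)
  finally show ?thesis by (simp add: N_def)
qed

text \<open>
  Some digit other than s, so that the matrix unit with indices s and \<open>off s\<close> has trace 0.
\<close>

definition off :: "nat \<Rightarrow> nat" where "off s = (if s = 0 then 1 else 0)"

lemma off: "off s < d" "off s \<noteq> s" using d2 by (auto simp: off_def)

text \<open>
  The test matrix \<open>w e\<^sub>c\<^sup>* \<otimes> e\<^sub>s\<^sub>t\<close> of level k - 1, where w is the i-th eigenvector of the block s
  and t is \<open>off s\<close>. The square root normalises it with respect to the normalised trace.
\<close>

definition tmat :: "nat \<Rightarrow> nat \<Rightarrow> nat \<Rightarrow> nat \<Rightarrow> complex mat" where
  "tmat s k i c = Matrix.mat (d ^ (k - 1)) (d ^ (k - 1)) (\<lambda>(a, e). if a mod d = s \<and> e = c * d + off s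
     then of_real (sqrt (real (d ^ (k - 1)))) * snd (beig k s) i (a div d) else 0)"

lemma tmat_carrier: "tmat s k i c \<in> carrier_mat (d ^ (k - 1)) (d ^ (k - 1))"
  by (simp add: tmat_def)

lemma tmat_index:
  assumes k: "k \<ge> 2" and "s < d" "a < d ^ (k - 2)" "a' < d" "e < d ^ (k - 2)" "e' < d"
  shows "tmat s k i c $$ (a * d + a', e * d + e') = (if a' = s \<and> e = c \<and> e' = off s
     then of_real (sqrt (real (d ^ (k - 1)))) * snd (beig k s) i a else 0)"
proof -
  have dk: "d ^ (k - 1) = d ^ (k - 2) * d" using k by (cases k; cases "k - 1") auto
  have lt: "a * d + a' < d ^ (k - 1)" "e * d + e' < d ^ (k - 1)"
    unfolding dk using assms less_prod_index by auto
  have "(e * d + e' = c * d + off s) \<longleftrightarrow> (e = c \<and> e' = off s)"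
  proof
    assume h: "e * d + e' = c * d + off s"
    have "(e * d + e') div d = (c * d + off s) div d" "(e * d + e') mod d = (c * d + off s) mod d"
      using h by simp_all
    then show "e = c \<and> e' = off s" using assms off(1)[of s] by simp
  qed auto
  then show ?thesis using lt assms by (auto simp: tmat_def)
qed

lemma partial_trace_tmat:
  assumes k: "k \<ge> 2" and s: "s < d"
  shows "partial_trace d (tmat s k i c) = 0\<^sub>m (d ^ (k - 2)) (d ^ (k - 2))"
proof (rule eq_matI)
  have dk: "d ^ (k - 1) = d ^ (k - 2) * d" using k by (cases k; cases "k - 1") auto
  have cm: "tmat s k i c \<in> carrier_mat (d ^ (k - 2) * d) (d ^ (k - 2) * d)" using tmat_carrier[of s k i c] dk by simp
  note pc = partial_trace_carrier[OF d_pos cm]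
  show "dim_row (partial_trace d (tmat s k i c)) = dim_row (0\<^sub>m (d ^ (k - 2)) (d ^ (k - 2)) :: complex mat)"
    "dim_col (partial_trace d (tmat s k i c)) = dim_col (0\<^sub>m (d ^ (k - 2)) (d ^ (k - 2)) :: complex mat)"
    using pc by auto
  fix a e assume "a < dim_row (0\<^sub>m (d ^ (k - 2)) (d ^ (k - 2)) :: complex mat)" "e < dim_col (0\<^sub>m (d ^ (k - 2)) (d ^ (k - 2)) :: complex mat)"
  then have ae: "a < d ^ (k - 2)" "e < d ^ (k - 2)" by auto
  have "(\<Sum>x<d. tmat s k i c $$ (a * d + x, e * d + x)) = 0"
    using off(2)[of s] by (intro sum.neutral) (auto simp: tmat_index[OF k s ae(1) _ ae(2)])
  then show "partial_trace d (tmat s k i c) $$ (a, e) = 0\<^sub>m (d ^ (k - 2)) (d ^ (k - 2)) $$ (a, e)"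
    using partial_trace_index[OF d_pos cm ae] ae by simp
qed

lemma hs_inner_tmat:
  assumes k: "k \<ge> 2" and s: "s < d" and i: "i < d ^ (k - 2)" "i' < d ^ (k - 2)" and c: "c < d ^ (k - 2)" "c' < d ^ (k - 2)"
  shows "hs_inner (tmat s k i c) (tmat s k i' c') = of_bool (i = i' \<and> c = c')"
proof -
  define N where "N = d ^ (k - 2)"
  have dk: "d ^ (k - 1) = N * d" using k by (cases k; cases "k - 1") (auto simp: N_def)
  have idx: "tmat s k i c $$ (a * d + a', e * d + e') = (if a' = s \<and> e = c \<and> e' = off s
     then of_real (sqrt (real (d ^ (k - 1)))) * snd (beig k s) i a else 0)"
    if "a < N" "a' < d" "e < N" "e' < d" for a a' e e' i c
    using tmat_index[OF k s, of a a' e e' i c] that by (simp add: N_def)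
  have "(\<Sum>x<N * d. \<Sum>y<N * d. tmat s k i c $$ (x, y) * cnj (tmat s k i' c' $$ (x, y))) =
    (\<Sum>a<N. \<Sum>a'<d. \<Sum>e<N. \<Sum>e'<d. if a' = s \<and> e' = off s \<and> e = c \<and> c = c' then
       of_nat (N * d) * (snd (beig k s) i a * cnj (snd (beig k s) i' a)) else 0)"
    unfolding sum_nat_prod
  proof (intro sum.cong refl)
    fix a a' e e' assume "a \<in> {..<N}" "a' \<in> {..<d}" "e \<in> {..<N}" "e' \<in> {..<d}"
    then have ae: "a < N" "a' < d" "e < N" "e' < d" by auto
    have "complex_of_real (sqrt (real (d ^ (k - 1)))) * complex_of_real (sqrt (real (d ^ (k - 1)))) = of_nat (N * d)"
      unfolding of_real_mult[symmetric] dk by simp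
    then show "tmat s k i c $$ (a * d + a', e * d + e') * cnj (tmat s k i' c' $$ (a * d + a', e * d + e')) =
      (if a' = s \<and> e' = off s \<and> e = c \<and> c = c' then
       of_nat (N * d) * (snd (beig k s) i a * cnj (snd (beig k s) i' a)) else 0)"
      unfolding idx[OF ae] by (auto simp: mult_ac)
  qed
  also have "\<dots> = (if c = c' then of_nat (N * d) * (\<Sum>a<N. snd (beig k s) i a * cnj (snd (beig k s) i' a)) else 0)"
  proof -
    have "(\<Sum>a'<d. \<Sum>e<N. \<Sum>e'<d. if a' = s \<and> e' = off s \<and> e = c \<and> c = c' then g else 0) = (if c = c' then g else 0)" for g :: complex
    proof -
      have "(\<Sum>a'<d. \<Sum>e<N. \<Sum>e'<d. if a' = s \<and> e' = off s \<and> e = c \<and> c = c' then g else 0) =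
        (\<Sum>a'<d. if a' = s then (\<Sum>e<N. if e = c then (\<Sum>e'<d. if e' = off s then if c = c' then g else 0 else 0) else 0) else 0)"
      proof (rule sum.cong[OF refl])
        fix a' :: nat
        show "(\<Sum>e<N. \<Sum>e'<d. if a' = s \<and> e' = off s \<and> e = c \<and> c = c' then g else 0) =
           (if a' = s then (\<Sum>e<N. if e = c then (\<Sum>e'<d. if e' = off s then if c = c' then g else 0 else 0) else 0) else 0)"
        proof (cases "a' = s")
          case True
          then show ?thesis by (simp only: True if_True simp_thms) (intro sum.cong refl, auto)
        qed simp
      qed
      also have "\<dots> = (if c = c' then g else 0)"
        unfolding sum.delta[OF finite_lessThan] using s c(1) off(1)[of s] by (simp add: N_def)
      finally show ?thesis .
    qed
    then show ?thesis by (simp add: sum_distrib_left)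
  qed
  also have "(\<Sum>a<N. snd (beig k s) i a * cnj (snd (beig k s) i' a)) = cdot N (snd (beig k s) i') (snd (beig k s) i)"
    by (simp add: cdot_def mult.commute)
  also have "\<dots> = of_bool (i = i')"
    using eigsysD(2)[OF beig i(2,1), of s] by (auto simp: N_def)
  finally have "(\<Sum>x<N * d. \<Sum>y<N * d. tmat s k i c $$ (x, y) * cnj (tmat s k i' c' $$ (x, y))) =
    of_nat (N * d) * of_bool (i = i' \<and> c = c')" by auto
  moreover have "N * d > 0" by (simp add: N_def)
  ultimately show ?thesis
    using hs_inner_sum[OF tmat_carrier[of s k i c] tmat_carrier[of s k i' c']] unfolding dk by simp
qed

text \<open>
  For fixed s the test matrices of level k - 1 diagonalise the form of \<open>d\<^sub>k\<close>, because this form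
  acts on the columns separately and their nonzero entries involve the block s only.
\<close>

lemma sqn_test_combination:
  assumes k: "k \<ge> 2" and s: "s < d" and y: "y \<in> carrier_mat (d ^ (k - 1)) (d ^ (k - 1))"
    and ent: "\<And>a e. a < d ^ (k - 1) \<Longrightarrow> e < d ^ (k - 1) \<Longrightarrow>
       y $$ (a, e) = (\<Sum>i<d ^ (k - 2). \<Sum>c<d ^ (k - 2). C i c * tmat s k i c $$ (a, e))"
  shows "sqn (D k * tensor_one d y) = (\<Sum>i<d ^ (k - 2). \<Sum>c<d ^ (k - 2). \<mu> k s i * (cmod (C i c))\<^sup>2)"
proof -
  define N where "N = d ^ (k - 2)"
  have dk: "d ^ (k - 1) = N * d" using k by (cases k; cases "k - 1") (auto simp: N_def)
  have dk2: "d ^ k = N * d * d" using k dk by (cases k) auto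
  define R where "R = complex_of_real (sqrt (real (N * d)))"
  have Rk: "complex_of_real (sqrt (real (d ^ (k - 1)))) = R" unfolding R_def dk ..
  have R: "(cmod R)\<^sup>2 = real (N * d)" by (simp add: R_def)
  define V where "V e = (\<lambda>b. \<Sum>i<N. (R * C i e) * snd (beig k s) i b)" for e
  have idx: "y $$ (b * d + b', e * d + e') = (if b' = s \<and> e' = off s then V e b else 0)"
    if be: "b < N" "b' < d" "e < N" "e' < d" for b b' e e'
  proof -
    have lt: "b * d + b' < d ^ (k - 1)" "e * d + e' < d ^ (k - 1)" unfolding dk using be less_prod_index by auto
    have "y $$ (b * d + b', e * d + e') = (\<Sum>i<N. \<Sum>c<N. C i c * tmat s k i c $$ (b * d + b', e * d + e'))"
      using ent[OF lt] by (simp add: N_def)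
    also have "\<dots> = (\<Sum>i<N. \<Sum>c<N. if c = e then (if b' = s \<and> e' = off s then R * C i e * snd (beig k s) i b else 0) else 0)"
    proof (intro sum.cong refl)
      fix i c
      show "C i c * tmat s k i c $$ (b * d + b', e * d + e') =
         (if c = e then (if b' = s \<and> e' = off s then R * C i e * snd (beig k s) i b else 0) else 0)"
        using tmat_index[OF k s, folded N_def, of b b' e e' i c, unfolded Rk] be by auto
    qed
    also have "\<dots> = (if b' = s \<and> e' = off s then V e b else 0)"
    proof (cases "b' = s \<and> e' = off s")
      case True
      then show ?thesis using be by (simp add: V_def)
    next
      case False
      then show ?thesis by (simp only: False if_False) simp
    qed
    finally show ?thesis .
  qed
  have Dk: "D k \<in> carrier_mat (N * d * d) (N * d * d)" using D_carrier[of k] k dk2 by simp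
  have y': "y \<in> carrier_mat (N * d) (N * d)" using y dk by simp
  have gf: "gram_form ({..<N * d * d} \<times> {..<d}) (\<lambda>(a, u) b. D k $$ (a, b * d + u)) (N * d) (\<lambda>b. y $$ (b, e * d + e')) =
      (if e' = off s then gram_form ({..<d ^ k} \<times> {..<d}) (zblk k s) N (V e) else 0)" if e: "e < N" "e' < d" for e e'
  proof (cases "e' = off s")
    case True
    have "(\<Sum>m<N * d. g m * y $$ (m, e * d + e')) = (\<Sum>b<N. g (b * d + s) * V e b)" for g :: "nat \<Rightarrow> complex"
    proof -
      have "(\<Sum>m<N * d. g m * y $$ (m, e * d + e')) = (\<Sum>b<N. \<Sum>b'<d. if b' = s then g (b * d + s) * V e b else 0)"
        unfolding sum_nat_prod using e True by (intro sum.cong refl) (auto simp: idx)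
      then show ?thesis using s by simp
    qed
    then show ?thesis using True by (simp add: gram_form_def zblk_def case_prod_unfold dk2)
  next
    case False
    have "y $$ (m, e * d + e') = 0" if "m < N * d" for m
      using idx[of "m div d" "m mod d" e e'] that e False by (simp add: div_prod_index)
    then show ?thesis using False by (simp add: gram_form_def case_prod_unfold)
  qed
  have "sqn (D k * tensor_one d y) = (\<Sum>x<N * d. gram_form ({..<N * d * d} \<times> {..<d}) (\<lambda>(a, u) b. D k $$ (a, b * d + u)) (N * d) (\<lambda>b. y $$ (b, x))) / real (N * d * d)"
    by (rule sqn_mult_tensor_one[OF Dk y'])
  also have "(\<Sum>x<N * d. gram_form ({..<N * d * d} \<times> {..<d}) (\<lambda>(a, u) b. D k $$ (a, b * d + u)) (N * d) (\<lambda>b. y $$ (b, x))) =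
     (\<Sum>e<N. \<Sum>e'<d. if e' = off s then gram_form ({..<d ^ k} \<times> {..<d}) (zblk k s) N (V e) else 0)"
    unfolding sum_nat_prod[of _ N d] by (intro sum.cong refl gf) auto
  also have "\<dots> = (\<Sum>e<N. gram_form ({..<d ^ k} \<times> {..<d}) (zblk k s) N (V e))"
    using off(1)[of s] by simp
  also have "\<dots> = (\<Sum>e<N. \<Sum>i<N. fst (beig k s) i * (cmod (R * C i e))\<^sup>2)"
    unfolding V_def using eigsys_synthesis(1)[OF beig, of k s] by (simp add: N_def)
  also have "\<dots> = (\<Sum>i<N. \<Sum>e<N. fst (beig k s) i * (cmod (R * C i e))\<^sup>2)" by (rule sum.swap)
  also have "\<dots> / real (N * d * d) = (\<Sum>i<N. \<Sum>c<N. \<mu> k s i * (cmod (C i c))\<^sup>2)"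
    unfolding sum_divide_distrib
  proof (intro sum.cong refl)
    fix i c
    have "N > 0" by (simp add: N_def)
    then show "fst (beig k s) i * (cmod (R * C i c))\<^sup>2 / real (N * d * d) = \<mu> k s i * (cmod (C i c))\<^sup>2"
      unfolding norm_mult power_mult_distrib R by (simp add: \<mu>_def)
  qed
  finally show ?thesis by (simp add: N_def)
qed

end

section \<open>The lower bound\<close>

locale schatten_paraproduct = paraproduct_setup p b F
  for p :: real and b :: "nat \<Rightarrow> complex mat" and F :: "'d::finite l2M \<Rightarrow> nat \<Rightarrow> complex mat" +
  assumes sch: "paraproduct_in_schatten p F b"
begin

sublocale C: compact_operator T
proof
  have "T \<in> schatten_class p" using sch unfolding paraproduct_in_schatten_def by (rule conjunct2)
  then have *: "T \<in> bounded_ops \<and> compact (closure (T ` cball 0 1)) \<and>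
      (\<lambda>s. real (singular_mult T s) * s powr p) summable_on {0<..}"
    unfolding schatten_class_def mem_Collect_eq .
  show "T \<in> bounded_ops" by (rule conjunct1[OF *])
  show "compact (closure (T ` cball 0 1))" by (rule conjunct1[OF conjunct2[OF *]])
qed

abbreviation schatten_sum :: real where
  "schatten_sum \<equiv> (\<Sum>\<^sub>\<infinity>s\<in>{0<..}. real (singular_mult T s) * s powr p)"

lemma sum_on: "(\<lambda>s. real (singular_mult T s) * s powr p) summable_on {0<..}"
proof -
  have "T \<in> schatten_class p" using sch unfolding paraproduct_in_schatten_def by (rule conjunct2)
  then show ?thesis unfolding schatten_class_def mem_Collect_eq by (rule conjunct2[OF conjunct2])
qed

lemma schatten_sum_nonneg: "schatten_sum \<ge> 0"
  by (rule infsum_nonneg) (simp only: mult_nonneg_nonneg of_nat_0_le_iff powr_ge_zero)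

lemma singular_vectors_sum:
  "finite G \<Longrightarrow> G \<subseteq> C.singular_vectors \<Longrightarrow> (\<Sum>x\<in>G. (norm (T x))\<^sup>2 powr q) \<le> schatten_sum"
  by (rule C.singular_vectors_sum[OF _ _ _ sum_on]) (simp_all add: q_def)

lemma terms_le_norm:
  assumes "finite K" "K \<subseteq> {1..}"
  shows "(\<Sum>k\<in>K. (norm (trm f k))\<^sup>2) \<le> (norm (T f))\<^sup>2"
proof -
  have "summable (\<lambda>k. trm f (Suc k))" using sch by (simp add: paraproduct_in_schatten_def)
  moreover have "cip (trm f (Suc n)) (trm f (Suc m)) = 0" if "m < n" for m n
    using that by (intro trm_orthogonal) auto
  ultimately have "(\<Sum>k\<in>(\<lambda>k. k - 1) ` K. (norm (trm f (Suc k)))\<^sup>2) \<le> (norm (T f))\<^sup>2"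
    unfolding paraproduct_def by (intro orthogonal_suminf_ge) (use assms in auto)
  moreover have "(\<Sum>k\<in>(\<lambda>k. k - 1) ` K. (norm (trm f (Suc k)))\<^sup>2) = (\<Sum>k\<in>K. (norm (trm f k))\<^sup>2)"
  proof (subst sum.reindex)
    show "inj_on (\<lambda>k. k - 1) K"
    proof (rule inj_onI)
      fix x y assume "x \<in> K" "y \<in> K" "x - 1 = y - 1"
      moreover from this have "x \<ge> 1" "y \<ge> 1" using assms by auto
      ultimately show "x = y" by linarith
    qed
    show "(\<Sum>k\<in>K. ((\<lambda>k. (norm (trm f (Suc k)))\<^sup>2) \<circ> (\<lambda>k. k - 1)) k) = (\<Sum>k\<in>K. (norm (trm f k))\<^sup>2)"
    proof (intro sum.cong refl)
      fix k assume "k \<in> K"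
      then have "Suc (k - 1) = k" using assms by auto
      then show "((\<lambda>k. (norm (trm f (Suc k)))\<^sup>2) \<circ> (\<lambda>k. k - 1)) k = (norm (trm f k))\<^sup>2" by (simp only: o_apply)
    qed
  qed
  ultimately show ?thesis by simp
qed

definition tvec :: "nat \<Rightarrow> nat \<times> nat \<times> nat \<Rightarrow> 'd l2M" where
  "tvec s = (\<lambda>(k, i, c). l2_embed (k - 1) (tmat s k i c))"

definition tidx :: "nat set \<Rightarrow> (nat \<times> nat \<times> nat) set" where
  "tidx K = (SIGMA k:K. {..<CARD('d) ^ (k - 2)} \<times> {..<CARD('d) ^ (k - 2)})"

lemma finite_tidx: "finite K \<Longrightarrow> finite (tidx K)"
  unfolding tidx_def by (intro finite_SigmaI finite_cartesian_product finite_lessThan)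

lemma sum_tidx: "finite K \<Longrightarrow> (\<Sum>(k, i, c)\<in>tidx K. h k i c) = (\<Sum>k\<in>K. \<Sum>i<CARD('d) ^ (k - 2). \<Sum>c<CARD('d) ^ (k - 2). h k i c)"
proof -
  assume K: "finite K"
  have "(\<Sum>k\<in>K. \<Sum>z\<in>{..<CARD('d) ^ (k - 2)} \<times> {..<CARD('d) ^ (k - 2)}. case z of (i, c) \<Rightarrow> h k i c)
      = (\<Sum>(k, i, c)\<in>tidx K. h k i c)"
    unfolding tidx_def by (rule sum.Sigma) (use K in auto)
  moreover have "(\<Sum>k\<in>K. \<Sum>z\<in>{..<CARD('d) ^ (k - 2)} \<times> {..<CARD('d) ^ (k - 2)}. case z of (i, c) \<Rightarrow> h k i c)
      = (\<Sum>k\<in>K. \<Sum>i<CARD('d) ^ (k - 2). \<Sum>c<CARD('d) ^ (k - 2). h k i c)"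
    by (rule sum.cong[OF refl], rule sum.cartesian_product[symmetric])
  ultimately show ?thesis by (rule trans[OF sym])
qed

lemma tvec_trace:
  assumes "k \<ge> 2" "s < CARD('d)"
  shows "partial_trace CARD('d) (tmat s k i c) = 0\<^sub>m (CARD('d) ^ (k - 1 - 1)) (CARD('d) ^ (k - 1 - 1))"
proof -
  have "k - 1 - 1 = k - 2" by simp
  then show ?thesis using partial_trace_tmat[OF assms, of i c] by (simp only:)
qed

lemma tvec_orthonormal:
  assumes s: "s < CARD('d)" and K: "K \<subseteq> {2..}"
  shows "orthonormal (tidx K) (tvec s)"
  unfolding orthonormal_def
proof (intro ballI)
  have lt0: "cip (tvec s (k, i, c)) (tvec s (k', i', c')) = 0" if "2 \<le> k'" "k' < k" for k i c k' i' c'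
    unfolding tvec_def case_prod_conv
    by (rule cip_l2_embed_orthogonal[OF tmat_carrier tmat_carrier _ tvec_trace]) (use that s in auto)
  fix x y assume xy: "x \<in> tidx K" "y \<in> tidx K"
  obtain k i c k' i' c' where e: "x = (k, i, c)" "y = (k', i', c')" by (metis surj_pair)
  have kk: "k \<ge> 2" "k' \<ge> 2" using xy K by (auto simp: e tidx_def)
  show "cip (tvec s x) (tvec s y) = of_bool (x = y)"
  proof (cases k k' rule: linorder_cases)
    case less
    then show ?thesis using lt0[OF kk(1) less, of i' c' i c]
        cip_cnj[of "tvec s y" "tvec s x"] by (simp add: e)
  next
    case equal
    have "cip (tvec s x) (tvec s y) = hs_inner (tmat s k i c) (tmat s k i' c')"
      unfolding e tvec_def case_prod_conv equal by (rule cip_l2_embed[OF tmat_carrier tmat_carrier])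
    also have "\<dots> = of_bool (i = i' \<and> c = c')"
      by (rule hs_inner_tmat[OF kk(1) s]) (use xy equal in \<open>auto simp: e tidx_def\<close>)
    finally show ?thesis using equal by (simp add: e)
  next
    case greater
    then show ?thesis using lt0[OF kk(2) greater, of i c i' c'] by (simp add: e)
  qed
qed

lemma incr_tvec:
  assumes s: "s < CARD('d)" and k: "k \<ge> 2"
  shows "incr (tvec s (k, i, c)) j = (if j = k - 1 then tmat s k i c else 0\<^sub>m (CARD('d) ^ j) (CARD('d) ^ j))"
  unfolding tvec_def case_prod_conv
proof (rule incr_embed[OF _ tmat_carrier tvec_trace])
  show "k - 1 \<ge> 1" using k by linarith
qed (fact k s)+

lemma incr_test:
  fixes cf :: "nat \<times> nat \<times> nat \<Rightarrow> complex"
  assumes s: "s < CARD('d)" and K: "finite K" "K \<subseteq> {2..}"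
  defines "f \<equiv> (\<Sum>x\<in>tidx K. scaleC (cf x) (tvec s x))"
  shows "Suc j \<notin> K \<Longrightarrow> incr f j = 0\<^sub>m (CARD('d) ^ j) (CARD('d) ^ j)"
    and "k \<in> K \<Longrightarrow> a < CARD('d) ^ (k - 1) \<Longrightarrow> e < CARD('d) ^ (k - 1) \<Longrightarrow>
      incr f (k - 1) $$ (a, e) = (\<Sum>i<CARD('d) ^ (k - 2). \<Sum>c<CARD('d) ^ (k - 2). cf (k, i, c) * tmat s k i c $$ (a, e))"
proof -
  have ent: "incr f j $$ (a, e) = (\<Sum>k\<in>K. \<Sum>i<CARD('d) ^ (k - 2). \<Sum>c<CARD('d) ^ (k - 2).
      if j = k - 1 then cf (k, i, c) * tmat s k i c $$ (a, e) else 0)"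
    if ae: "a < CARD('d) ^ j" "e < CARD('d) ^ j" for j a e
  proof -
    have "incr f j $$ (a, e) = (\<Sum>x\<in>tidx K. cf x * incr (tvec s x) j $$ (a, e))"
      unfolding f_def by (rule incr_sum_index[OF ae finite_tidx[OF K(1)]])
    also have "\<dots> = (\<Sum>(k, i, c)\<in>tidx K. cf (k, i, c) * incr (tvec s (k, i, c)) j $$ (a, e))"
      by (simp add: case_prod_unfold)
    also have "\<dots> = (\<Sum>k\<in>K. \<Sum>i<CARD('d) ^ (k - 2). \<Sum>c<CARD('d) ^ (k - 2). cf (k, i, c) * incr (tvec s (k, i, c)) j $$ (a, e))"
      by (rule sum_tidx[OF K(1)])
    also have "\<dots> = (\<Sum>k\<in>K. \<Sum>i<CARD('d) ^ (k - 2). \<Sum>c<CARD('d) ^ (k - 2).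
      if j = k - 1 then cf (k, i, c) * tmat s k i c $$ (a, e) else 0)"
    proof (intro sum.cong refl)
      fix k i c assume "k \<in> K"
      then have k: "k \<ge> 2" using K by auto
      show "cf (k, i, c) * incr (tvec s (k, i, c)) j $$ (a, e) = (if j = k - 1 then cf (k, i, c) * tmat s k i c $$ (a, e) else 0)"
        unfolding incr_tvec[OF s k] using ae by auto
    qed
    finally show ?thesis .
  qed
  show "incr f j = 0\<^sub>m (CARD('d) ^ j) (CARD('d) ^ j)" if j: "Suc j \<notin> K"
  proof (rule eq_matI)
    fix a e assume "a < dim_row (0\<^sub>m (CARD('d) ^ j) (CARD('d) ^ j) :: complex mat)" "e < dim_col (0\<^sub>m (CARD('d) ^ j) (CARD('d) ^ j) :: complex mat)"
    then have ae: "a < CARD('d) ^ j" "e < CARD('d) ^ j" by auto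
    have ne: "j \<noteq> k - 1" if "k \<in> K" for k using that j K by (cases k) auto
    show "incr f j $$ (a, e) = 0\<^sub>m (CARD('d) ^ j) (CARD('d) ^ j) $$ (a, e)"
      unfolding ent[OF ae] using ne ae by (simp add: sum.neutral)
  qed (use incr_carrier[of f j] in auto)
  assume k: "k \<in> K" and ae: "a < CARD('d) ^ (k - 1)" "e < CARD('d) ^ (k - 1)"
  have "incr f (k - 1) $$ (a, e) = (\<Sum>k'\<in>K. if k' = k then
     (\<Sum>i<CARD('d) ^ (k - 2). \<Sum>c<CARD('d) ^ (k - 2). cf (k, i, c) * tmat s k i c $$ (a, e)) else 0)"
    unfolding ent[OF ae]
  proof (intro sum.cong refl)
    fix k' assume k': "k' \<in> K"
    have "k - 1 = k' - 1 \<longleftrightarrow> k' = k" using k k' K by (cases k; cases k') auto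
    then show "(\<Sum>i<CARD('d) ^ (k' - 2). \<Sum>c<CARD('d) ^ (k' - 2). if k - 1 = k' - 1 then cf (k', i, c) * tmat s k' i c $$ (a, e) else 0) =
      (if k' = k then (\<Sum>i<CARD('d) ^ (k - 2). \<Sum>c<CARD('d) ^ (k - 2). cf (k, i, c) * tmat s k i c $$ (a, e)) else 0)"
      by (cases "k' = k") simp_all
  qed
  then show "incr f (k - 1) $$ (a, e) = (\<Sum>i<CARD('d) ^ (k - 2). \<Sum>c<CARD('d) ^ (k - 2). cf (k, i, c) * tmat s k i c $$ (a, e))"
    using k K(1) by simp
qed


text \<open>
  The counting principle for the main part \<open>Q\<close> of the form on the test vectors: the difference
  between the term \<open>d\<^sub>k f\<^bsub>k-1\<^esub>\<close> and its remainder, which collects the increments of f at distance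
  more than m below k. As f has increments only on levels j with \<open>Suc j \<in> K\<close>, and K lies in one
  residue class, nothing but the increment of level k - 1 is left in \<open>Q\<close>. The terms themselves are
  controlled by the singular vectors of T, the remainder by the weights \<open>\<beta>\<close> of distant levels;
  both are used at t / 4, since \<open>\<parallel>x - y\<parallel>\<^sup>2 \<le> 2 \<parallel>x\<parallel>\<^sup>2 + 2 \<parallel>y\<parallel>\<^sup>2\<close>.
\<close>

lemma residue_class_bound:
  assumes s: "s < CARD('d)" and m: "m \<ge> 1" and K: "finite K" "K \<subseteq> {2..}" and res: "\<And>k. k \<in> K \<Longrightarrow> k mod m = r0"
  shows "(\<Sum>k\<in>K. \<Sum>i<CARD('d) ^ (k - 2). \<Sum>c<CARD('d) ^ (k - 2). \<mu> k s i powr q)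
    \<le> 8 powr q * (schatten_sum + \<Gamma> powr p * \<rho> ^ m / (1 - \<rho>) * (\<Sum>k\<in>K. bt k))"
proof -
  define I where "I = tidx K"
  have finI: "finite I" unfolding I_def by (rule finite_tidx[OF K(1)])
  have oI: "orthonormal I (tvec s)" unfolding I_def by (rule tvec_orthonormal[OF s K(2)])
  define A where "A k = {j. j + m < k}" for k :: nat
  define f where "f cf = (\<Sum>x\<in>I. scaleC (cf x) (tvec s x))" for cf
  define rest where "rest g k = (\<Sum>j\<in>{..<k} \<inter> A k. l2_embed k (D k * tensor_one (CARD('d) ^ (k - j)) (incr g j)) :: 'd l2M)" for g k
  define Q where "Q cf = (\<Sum>k\<in>K. (norm (trm (f cf) k - rest (f cf) k))\<^sup>2)" for cf
  define mu where "mu = (\<lambda>(k, i, c :: nat). \<mu> k s i)"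
  define X where "X = Inl ` C.singular_vectors \<union> Inr ` {(k, j, i, c). k \<in> K \<and> j + m < k \<and> i < CARD('d) ^ j \<and> c < CARD('d) ^ j}"
  define bet where "bet = case_sum (\<lambda>y. 4 * (norm (T y))\<^sup>2) (\<lambda>(k, j, i, c :: nat). 4 * \<beta> k j i)"
  define ps where "ps x z = case_sum (\<lambda>y. cip (tvec s z) y) (\<lambda>(k, j, i, c). \<psi> k j i c (incr (tvec s z) j)) x" for x z
  have K1: "k \<ge> 2" if "k \<in> K" for k using that K by auto
  have main: "trm (f cf) k - rest (f cf) k = l2_embed k (D k * tensor_one CARD('d) (incr (f cf) (k - 1)))" if k: "k \<in> K" for cf k
  proof -
    let ?g = "\<lambda>j. l2_embed k (D k * tensor_one (CARD('d) ^ (k - j)) (incr (f cf) j)) :: 'd l2M"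
    have k2: "k \<ge> 2" by (rule K1[OF k])
    have z: "?g j = 0" if "j < k - 1" "\<not> j + m < k" for j
    proof -
      have "Suc j \<notin> K"
      proof
        assume "Suc j \<in> K"
        then have "Suc j mod m = k mod m" using res k by simp
        moreover have lt: "Suc j < k" "k - Suc j < m" using that by auto
        ultimately have "m dvd k - Suc j" using mod_eq_dvd_iff_nat[of "Suc j" k m] by simp
        then have "m \<le> k - Suc j" by (rule dvd_imp_le) (use lt in simp)
        then show False using lt by simp
      qed
      then have "incr (f cf) j = 0\<^sub>m (CARD('d) ^ j) (CARD('d) ^ j)"
        unfolding f_def I_def by (rule incr_test(1)[OF s K])
      moreover have "CARD('d) ^ j * CARD('d) ^ (k - j) = CARD('d) ^ k" using that by (simp flip: power_add)
      ultimately have "tensor_one (CARD('d) ^ (k - j)) (incr (f cf) j) = 0\<^sub>m (CARD('d) ^ k) (CARD('d) ^ k)"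
        by (simp add: tensor_one_zero)
      moreover have "D k * 0\<^sub>m (CARD('d) ^ k) (CARD('d) ^ k) = 0\<^sub>m (CARD('d) ^ k) (CARD('d) ^ k)"
        using D_carrier[of k] k2 by (intro right_mult_zero_mat) auto
      ultimately show ?thesis by (simp add: l2_embed_zero)
    qed
    have k1: "k \<ge> 1" using k2 by simp
    have "trm (f cf) k = (\<Sum>j<k. ?g j)" by (rule trm_decomp[OF k1])
    also have "{..<k} = insert (k - 1) {..<k - 1}" using k2 by auto
    also have "(\<Sum>j\<in>insert (k - 1) {..<k - 1}. ?g j) = ?g (k - 1) + (\<Sum>j<k - 1. ?g j)" by simp
    also have "(\<Sum>j<k - 1. ?g j) = rest (f cf) k"
      unfolding rest_def by (rule sum.mono_neutral_right) (use m z in \<open>auto simp: A_def\<close>)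
    also have "?g (k - 1) = l2_embed k (D k * tensor_one CARD('d) (incr (f cf) (k - 1)))" using k2 by simp
    finally show ?thesis by simp
  qed
  have Q: "Q cf = (\<Sum>x\<in>I. mu x * (cmod (cf x))\<^sup>2)" for cf
  proof -
    have "Q cf = (\<Sum>k\<in>K. \<Sum>i<CARD('d) ^ (k - 2). \<Sum>c<CARD('d) ^ (k - 2). \<mu> k s i * (cmod (cf (k, i, c)))\<^sup>2)"
      unfolding Q_def
    proof (intro sum.cong refl)
      fix k assume k: "k \<in> K"
      have k2: "k \<ge> 2" by (rule K1[OF k])
      have tc: "tensor_one CARD('d) (incr (f cf) (k - 1)) \<in> carrier_mat (CARD('d) ^ k) (CARD('d) ^ k)"
        using tensor_one_carrier[OF incr_carrier[of "f cf" "k - 1"], of "CARD('d)"] k2 by (cases k) (auto simp: mult.commute)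
      have "(norm (trm (f cf) k - rest (f cf) k))\<^sup>2 = sqn (D k * tensor_one CARD('d) (incr (f cf) (k - 1)))"
        unfolding main[OF k] by (rule norm_l2_embed[OF mult_carrier_mat[OF D_carrier tc]]) (use k2 in simp)
      also have "\<dots> = (\<Sum>i<CARD('d) ^ (k - 2). \<Sum>c<CARD('d) ^ (k - 2). \<mu> k s i * (cmod (cf (k, i, c)))\<^sup>2)"
        by (rule sqn_test_combination[OF k2 s incr_carrier]) (use incr_test(2)[OF s K k, of _ _ cf] in \<open>simp add: f_def I_def\<close>)
      finally show "(norm (trm (f cf) k - rest (f cf) k))\<^sup>2 =
         (\<Sum>i<CARD('d) ^ (k - 2). \<Sum>c<CARD('d) ^ (k - 2). \<mu> k s i * (cmod (cf (k, i, c)))\<^sup>2)" .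
    qed
    also have "\<dots> = (\<Sum>(k, i, c)\<in>I. \<mu> k s i * (cmod (cf (k, i, c)))\<^sup>2)"
      unfolding I_def by (rule sum_tidx[OF K(1), symmetric])
    finally show ?thesis by (simp add: mu_def case_prod_unfold)
  qed
  have nf: "(norm (f cf))\<^sup>2 = (\<Sum>x\<in>I. (cmod (cf x))\<^sup>2)" for cf
    unfolding f_def by (rule orthonormal_norm[OF oI finI])
  define S where "S = 4 powr q * (schatten_sum + \<Gamma> powr p * \<rho> ^ m / (1 - \<rho>) * (\<Sum>k\<in>K. bt k))"
  have "(\<Sum>x\<in>I. mu x powr q) \<le> 2 powr q * S"
  proof (rule counting_sum[where Q = Q and X = X and \<beta> = bet and \<psi> = ps])
    show "(\<Sum>x\<in>I. mu x * (cmod (c x))\<^sup>2) \<le> Q c" for c by (simp add: Q)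
    fix t :: real and cf
    assume t: "t > 0" and van: "\<And>x. x \<in> X \<Longrightarrow> t \<le> bet x \<Longrightarrow> (\<Sum>y\<in>I. ps x y * cf y) = 0"
    have 1: "(norm (T (f cf)))\<^sup>2 \<le> t / 4 * (norm (f cf))\<^sup>2"
    proof (rule C.singular_vectors_form_bound)
      fix x assume x: "x \<in> C.singular_vectors" "t / 4 \<le> (norm (T x))\<^sup>2"
      have "(\<Sum>y\<in>I. ps (Inl x) y * cf y) = 0" by (rule van) (use x in \<open>auto simp: X_def bet_def\<close>)
      then show "cip (f cf) x = 0"
        by (simp add: f_def cip_sum_left cip_scaleC_left ps_def mult.commute)
    qed (use t in simp)
    have Kn: "K \<subseteq> {1..Max (insert 0 K)}"
    proof
      fix k assume k: "k \<in> K"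
      have "k \<le> Max (insert 0 K)" using K(1) k by (intro Max_ge) auto
      then show "k \<in> {1..Max (insert 0 K)}" using K1[OF k] by simp
    qed
    have Kpos: "K \<subseteq> {1..}" using K(2) by auto
    have 2: "(\<Sum>k\<in>K. (norm (rest (f cf) k))\<^sup>2) \<le> t / 4 * (norm (f cf))\<^sup>2"
    proof -
      have "(\<Sum>k\<in>K. (norm (rest (f cf) k))\<^sup>2) \<le> t / 4 * (\<Sum>j<Max (insert 0 K). sqn (incr (f cf) j))"
        unfolding rest_def
      proof (rule form_sum_bound[OF refl Kn incr_carrier])
        fix k j i c assume h: "k \<in> K" "j < k" "j \<in> A k" "i < CARD('d) ^ j" "c < CARD('d) ^ j" "t / 4 \<le> \<beta> k j i"
        have "(\<Sum>y\<in>I. ps (Inr (k, j, i, c)) y * cf y) = 0"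
          by (rule van) (use h in \<open>auto simp: X_def bet_def A_def\<close>)
        moreover have "\<psi> k j i c (incr (f cf) j) = (\<Sum>x\<in>I. cf x * \<psi> k j i c (incr (tvec s x) j))"
          unfolding f_def by (rule \<psi>_sum[OF h(5) finI])
        ultimately show "\<psi> k j i c (incr (f cf) j) = 0" by (simp add: ps_def mult.commute)
      qed (use t in simp)
      also have "\<dots> \<le> t / 4 * (norm (f cf))\<^sup>2" using incr_energy[of "f cf"] t by (intro mult_left_mono) auto
      finally show ?thesis .
    qed
    have sq: "(norm (x - y))\<^sup>2 \<le> 2 * (norm x)\<^sup>2 + 2 * (norm y)\<^sup>2" for x y :: "'d l2M"
    proof -
      have "(norm (x - y))\<^sup>2 + (norm (x + y))\<^sup>2 = 2 * (norm x)\<^sup>2 + 2 * (norm y)\<^sup>2"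
        by (simp add: power2_norm_eq_inner inner_add inner_diff)
      then show ?thesis using zero_le_power2[of "norm (x + y)"] by linarith
    qed
    have "Q cf \<le> (\<Sum>k\<in>K. 2 * (norm (trm (f cf) k))\<^sup>2 + 2 * (norm (rest (f cf) k))\<^sup>2)"
      unfolding Q_def by (intro sum_mono sq)
    also have "\<dots> = 2 * (\<Sum>k\<in>K. (norm (trm (f cf) k))\<^sup>2) + 2 * (\<Sum>k\<in>K. (norm (rest (f cf) k))\<^sup>2)"
      by (simp add: sum.distrib sum_distrib_left)
    also have "\<dots> \<le> 2 * (t / 4 * (norm (f cf))\<^sup>2) + 2 * (t / 4 * (norm (f cf))\<^sup>2)"
      using terms_le_norm[OF K(1) Kpos, of "f cf"] 1 2 by (intro add_mono mult_left_mono) auto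
    finally show "Q cf \<le> t * (\<Sum>x\<in>I. (cmod (cf x))\<^sup>2)" by (simp add: nf)
  next
    show "mu x \<ge> 0" if "x \<in> I" for x using that \<mu>_nonneg by (auto simp: mu_def I_def tidx_def)
    fix G assume G: "finite G" "G \<subseteq> X"
    define G1 where "G1 = Inl -` G"
    define G2 where "G2 = Inr -` G"
    have fin: "finite G1" "finite G2" using G by (auto simp: G1_def G2_def intro: finite_vimageI)
    have Geq: "G = Inl ` G1 \<union> Inr ` G2"
      unfolding G1_def G2_def using G(2) by (auto simp: X_def image_iff)
    have "(\<Sum>x\<in>G. bet x powr q) = (\<Sum>x\<in>G1. bet (Inl x) powr q) + (\<Sum>x\<in>G2. bet (Inr x) powr q)"
      unfolding Geq using fin by (subst sum.union_disjoint) (auto simp: sum.reindex)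
    also have "(\<Sum>x\<in>G1. bet (Inl x) powr q) = 4 powr q * (\<Sum>x\<in>G1. (norm (T x))\<^sup>2 powr q)"
      by (simp add: bet_def powr_mult sum_distrib_left)
    also have "(\<Sum>x\<in>G2. bet (Inr x) powr q) = 4 powr q * (\<Sum>(k, j, i, c)\<in>G2. \<beta> k j i powr q)"
      by (simp add: bet_def case_prod_unfold powr_mult sum_distrib_left)
    also have "4 powr q * (\<Sum>x\<in>G1. (norm (T x))\<^sup>2 powr q) + 4 powr q * (\<Sum>(k, j, i, c)\<in>G2. \<beta> k j i powr q) \<le> S"
    proof -
      have "(\<Sum>x\<in>G1. (norm (T x))\<^sup>2 powr q) \<le> schatten_sum"
        by (rule singular_vectors_sum[OF fin(1)]) (use G in \<open>auto simp: G1_def X_def\<close>)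
      moreover have "(\<Sum>(k, j, i, c)\<in>G2. \<beta> k j i powr q) \<le> \<Gamma> powr p * \<rho> ^ m / (1 - \<rho>) * (\<Sum>k\<in>K. bt k)"
      proof (rule \<beta>_total[OF K(1)])
        show "G2 \<subseteq> {(k, j, i, c). k \<in> K \<and> j + m < k \<and> i < CARD('d) ^ j \<and> c < CARD('d) ^ j}"
          using G by (auto simp: G2_def X_def)
        show "K \<subseteq> {1..}" using K(2) by auto
      qed
      ultimately show ?thesis unfolding S_def distrib_left by (intro add_mono mult_left_mono) auto
    qed
    finally show "(\<Sum>x\<in>G. bet x powr q) \<le> S" .
  qed (use finI q in auto)
  moreover have "(\<Sum>x\<in>I. mu x powr q) = (\<Sum>k\<in>K. \<Sum>i<CARD('d) ^ (k - 2). \<Sum>c<CARD('d) ^ (k - 2). \<mu> k s i powr q)"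
    using sum_tidx[OF K(1), of "\<lambda>k i c. \<mu> k s i powr q"] by (simp add: mu_def I_def case_prod_unfold)
  moreover have "2 powr q * 4 powr q = (8 powr q :: real)" by (simp add: powr_mult[symmetric])
  ultimately show ?thesis by (simp add: S_def mult.assoc[symmetric])
qed

end

context besov_data
begin

definition block_const :: real where
  "block_const = real d * (real d ^ 3 * (2 * real d ^ 3) powr q) * 8 powr q"

text \<open>
  A distance for which the remainder in \<open>residue_class_bound\<close> is at most half of the Besov sum. It
  depends on d and p only.
\<close>

definition gap :: nat where
  "gap = (SOME m. 1 \<le> m \<and> block_const * (\<Gamma> powr p / (1 - \<rho>)) * \<rho> ^ m \<le> 1 / 2)"

lemma block_const_nonneg: "block_const \<ge> 0"
  unfolding block_const_def by (intro mult_nonneg_nonneg) auto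

lemma gap: "1 \<le> gap" "block_const * (\<Gamma> powr p / (1 - \<rho>)) * \<rho> ^ gap \<le> 1 / 2"
proof -
  have "(\<lambda>m. block_const * (\<Gamma> powr p / (1 - \<rho>)) * \<rho> ^ m) \<longlonglongrightarrow> block_const * (\<Gamma> powr p / (1 - \<rho>)) * 0"
    by (intro tendsto_mult tendsto_const LIMSEQ_realpow_zero less_imp_le \<rho>)
  then have "\<forall>\<^sub>F m in sequentially. block_const * (\<Gamma> powr p / (1 - \<rho>)) * \<rho> ^ m < 1 / 2"
    by (rule order_tendstoD(2)) simp
  then obtain M where M: "\<And>m. m \<ge> M \<Longrightarrow> block_const * (\<Gamma> powr p / (1 - \<rho>)) * \<rho> ^ m < 1 / 2"
    unfolding eventually_sequentially by blast
  have "1 \<le> Suc M \<and> block_const * (\<Gamma> powr p / (1 - \<rho>)) * \<rho> ^ Suc M \<le> 1 / 2"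
    by (rule conjI[OF _ less_imp_le[OF M]]) simp_all
  then have "1 \<le> gap \<and> block_const * (\<Gamma> powr p / (1 - \<rho>)) * \<rho> ^ gap \<le> 1 / 2"
    unfolding gap_def by (rule someI)
  then show "1 \<le> gap" "block_const * (\<Gamma> powr p / (1 - \<rho>)) * \<rho> ^ gap \<le> 1 / 2" by (rule conjunct1, rule conjunct2)
qed

definition tail_const :: real where "tail_const = 2 * block_const * real gap"

definition first_const :: real where "first_const = real d ^ 2 * real d powr q * 2 powr q"

definition upper_const :: real where "upper_const = 2 powr q * (\<Gamma> powr p / (1 - \<rho>))"

lemma tail_const_nonneg: "tail_const \<ge> 0"
  unfolding tail_const_def using block_const_nonneg by simp

lemma first_const_nonneg: "first_const \<ge> 0"
  unfolding first_const_def by simp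

lemma upper_const_nonneg: "upper_const \<ge> 0"
  unfolding upper_const_def using \<rho> by simp

text \<open>
  On level 1 there are only d eigenvalues, so the L_p norm is controlled by the L_2 norm.
\<close>

lemma bt_1_le: "bt 1 \<le> real d ^ 2 * real d powr q * sqn (D 1) powr q"
proof -
  have D: "D 1 \<in> carrier_mat d d" using D_carrier[of 1] by simp
  obtain l u where e: "eigsys {..<d} (mrow (D 1)) d l u" using mrow_eigsys_exists by blast
  have l0: "l i \<ge> 0" if "i < d" for i by (rule eigsysD(1)[OF e that])
  have tot: "(\<Sum>i<d. l i) = real d * sqn (D 1)" by (rule sum_eigenvalues[OF D e])
  have "l i powr q \<le> (real d * sqn (D 1)) powr q" if i: "i < d" for i
  proof (rule powr_mono2)
    show "l i \<le> real d * sqn (D 1)" unfolding tot[symmetric] using i l0 by (intro member_le_sum) auto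
  qed (use l0[OF i] q in auto)
  then have "(\<Sum>i<d. l i powr q) \<le> (\<Sum>i<d. (real d * sqn (D 1)) powr q)" by (intro sum_mono) auto
  then have "(\<Sum>i<d. l i powr q) / real d \<le> (real d * sqn (D 1)) powr q"
    using d2 by (simp add: divide_le_eq mult.commute)
  moreover have "Lp_norm p (D 1) powr p = (\<Sum>i<d. l i powr q) / real d"
    unfolding q_def by (rule Lp_norm_eigsys[OF D e p])
  ultimately have "Lp_norm p (D 1) powr p \<le> real d powr q * sqn (D 1) powr q"
    using sqn_nonneg[OF D] by (simp add: powr_mult)
  then show ?thesis unfolding besov_term_def
    by (simp add: mult.assoc mult_left_mono del: One_nat_def)
qed

end

context schatten_paraproduct
begin

lemma block_sum_bound:
  assumes s: "s < CARD('d)" and K: "finite K" "K \<subseteq> {2..}"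
  shows "(\<Sum>k\<in>K. \<Sum>i<CARD('d) ^ (k - 2). \<Sum>c<CARD('d) ^ (k - 2). \<mu> k s i powr q)
    \<le> 8 powr q * (real gap * schatten_sum + \<Gamma> powr p * \<rho> ^ gap / (1 - \<rho>) * (\<Sum>k\<in>K. bt k))"
proof -
  define g where "g k = (\<Sum>i<CARD('d) ^ (k - 2). \<Sum>c<CARD('d) ^ (k - 2). \<mu> k s i powr q)" for k
  define E where "E = \<Gamma> powr p * \<rho> ^ gap / (1 - \<rho>)"
  define R where "R r = {k \<in> K. k mod gap = r}" for r
  have R: "R r \<subseteq> {2..}" "finite (R r)" for r using K by (auto simp: R_def)
  have img: "(\<lambda>k. k mod gap) ` K \<subseteq> {..<gap}" using gap(1) by auto
  have "(\<Sum>k\<in>K. g k) = (\<Sum>r<gap. \<Sum>k\<in>R r. g k)"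
    unfolding R_def by (rule sum.group[symmetric, OF K(1) finite_lessThan img])
  also have "\<dots> \<le> (\<Sum>r<gap. 8 powr q * (schatten_sum + E * (\<Sum>k\<in>R r. bt k)))"
  proof (rule sum_mono)
    fix r
    show "(\<Sum>k\<in>R r. g k) \<le> 8 powr q * (schatten_sum + E * (\<Sum>k\<in>R r. bt k))"
      unfolding g_def E_def by (rule residue_class_bound[OF s gap(1) R(2,1), of r r]) (simp add: R_def)
  qed
  also have "\<dots> = 8 powr q * (real gap * schatten_sum + E * (\<Sum>r<gap. \<Sum>k\<in>R r. bt k))"
    by (simp add: sum.distrib sum_distrib_left[symmetric])
  also have "(\<Sum>r<gap. \<Sum>k\<in>R r. bt k) = (\<Sum>k\<in>K. bt k)"
    unfolding R_def by (rule sum.group[OF K(1) finite_lessThan img])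
  finally show ?thesis unfolding g_def E_def .
qed

text \<open>
  The Besov sum occurs on both sides, and by the choice of the gap its coefficient on the right is
  at most 1 / 2. As K is finite, the term can be subtracted.
\<close>

lemma tail_bound:
  assumes K: "finite K" "K \<subseteq> {2..}"
  shows "(\<Sum>k\<in>K. bt k) \<le> tail_const * schatten_sum"
proof -
  define c where "c = real CARD('d) ^ 3 * (2 * real CARD('d) ^ 3) powr q"
  define E where "E = \<Gamma> powr p * \<rho> ^ gap / (1 - \<rho>)"
  define B where "B = (\<Sum>k\<in>K. bt k)"
  have c0: "c \<ge> 0" by (simp add: c_def)
  have B0: "B \<ge> 0" unfolding B_def by (intro sum_nonneg bt_nonneg)
  have "B \<le> (\<Sum>k\<in>K. c * (\<Sum>s<CARD('d). \<Sum>i<CARD('d) ^ (k - 2). \<Sum>c<CARD('d) ^ (k - 2). \<mu> k s i powr q))"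
    unfolding B_def c_def by (intro sum_mono bt_le_blocks) (use K in auto)
  also have "\<dots> = c * (\<Sum>k\<in>K. \<Sum>s<CARD('d). \<Sum>i<CARD('d) ^ (k - 2). \<Sum>c<CARD('d) ^ (k - 2). \<mu> k s i powr q)"
    by (rule sum_distrib_left[symmetric])
  also have "(\<Sum>k\<in>K. \<Sum>s<CARD('d). \<Sum>i<CARD('d) ^ (k - 2). \<Sum>c<CARD('d) ^ (k - 2). \<mu> k s i powr q)
      = (\<Sum>s<CARD('d). \<Sum>k\<in>K. \<Sum>i<CARD('d) ^ (k - 2). \<Sum>c<CARD('d) ^ (k - 2). \<mu> k s i powr q)"
    by (rule sum.swap)
  also have "c * \<dots> \<le> c * (\<Sum>s<CARD('d). 8 powr q * (real gap * schatten_sum + E * B))"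
    unfolding B_def E_def by (intro mult_left_mono[OF _ c0] sum_mono block_sum_bound[OF _ K]) simp
  also have "\<dots> = block_const * real gap * schatten_sum + block_const * E * B"
    unfolding block_const_def c_def[symmetric] by (simp add: algebra_simps)
  also have "block_const * E * B \<le> 1 / 2 * B"
    using gap(2) B0 by (intro mult_right_mono) (simp_all add: E_def)
  finally have "B \<le> tail_const * schatten_sum" unfolding tail_const_def by (simp add: algebra_simps)
  then show ?thesis unfolding B_def .
qed

lemma besov_sum_bound:
  "summable (\<lambda>k. bt (Suc k))" "(\<Sum>k. bt (Suc k)) \<le> bt 1 + tail_const * schatten_sum"
proof -
  have part: "(\<Sum>k<n. bt (Suc k)) \<le> bt 1 + tail_const * schatten_sum" for n
  proof -
    have "(\<Sum>k<n. bt (Suc k)) \<le> (\<Sum>k<Suc n. bt (Suc k))" by (simp add: bt_nonneg)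
    also have "\<dots> = bt 1 + (\<Sum>k<n. bt (Suc (Suc k)))" unfolding sum.lessThan_Suc_shift by simp
    also have "(\<Sum>k<n. bt (Suc (Suc k))) = (\<Sum>k\<in>(\<lambda>k. Suc (Suc k)) ` {..<n}. bt k)"
      by (subst sum.reindex) (auto simp: inj_on_def)
    also have "\<dots> \<le> tail_const * schatten_sum" by (rule tail_bound) auto
    finally show ?thesis by simp
  qed
  show s: "summable (\<lambda>k. bt (Suc k))"
    by (rule summableI_nonneg_bounded[OF bt_nonneg part])
  show "(\<Sum>k. bt (Suc k)) \<le> bt 1 + tail_const * schatten_sum"
    by (rule suminf_le_const[OF s part])
qed

text \<open>
  The vector 1 is mapped by the first term to \<open>d\<^sub>1\<close>. The counting principle on the one-dimensional
  space spanned by it turns this lower bound for the norm of T into one for the Schatten sum.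
\<close>

lemma first_term_bound:
  assumes F: "F (l2_embed 0 (1\<^sub>m 1)) 0 = 1\<^sub>m 1"
  shows "bt 1 \<le> first_const * schatten_sum"
proof -
  define f where "f = (l2_embed 0 (1\<^sub>m 1) :: 'd l2M)"
  have nf: "(norm f)\<^sup>2 = 1"
  proof -
    have "(norm f)\<^sup>2 = sqn (1\<^sub>m 1)" unfolding f_def by (rule norm_l2_embed) simp
    also have "\<dots> = 1" by (subst sqn_sum[of _ 1]) auto
    finally show ?thesis .
  qed
  have D1: "D 1 \<in> carrier_mat CARD('d) CARD('d)" using D_carrier[of 1] by simp
  have "trm f 1 = l2_embed 1 (D 1)"
    unfolding paraproduct_term_def diff_self_eq_0 f_def F using D1 tensor_one_one[of "CARD('d)" 1] by simp
  then have "sqn (D 1) = (norm (trm f 1))\<^sup>2"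
    using norm_l2_embed[of "D 1" 1, where 'd = 'd] D1 by simp
  also have "\<dots> \<le> (norm (T f))\<^sup>2" using terms_le_norm[of "{1}" f] by simp
  finally have le: "sqn (D 1) \<le> (norm (T f))\<^sup>2" .
  have "(\<Sum>i\<in>{()}. sqn (D 1) powr q) \<le> 2 powr q * schatten_sum"
  proof (rule counting_sum[where Q = "\<lambda>c. sqn (D 1) * (cmod (c ()))\<^sup>2" and X = C.singular_vectors
        and \<beta> = "\<lambda>x. (norm (T x))\<^sup>2" and \<psi> = "\<lambda>x _. cip f x"])
    fix t :: real and c :: "unit \<Rightarrow> complex"
    assume t: "t > 0" and van: "\<And>x. x \<in> C.singular_vectors \<Longrightarrow> t \<le> (norm (T x))\<^sup>2 \<Longrightarrow> (\<Sum>i\<in>{()}. cip f x * c i) = 0"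
    show "sqn (D 1) * (cmod (c ()))\<^sup>2 \<le> t * (\<Sum>i\<in>{()}. (cmod (c i))\<^sup>2)"
    proof (cases "c () = 0")
      case False
      have "(norm (T f))\<^sup>2 \<le> t * (norm f)\<^sup>2"
      proof (rule C.singular_vectors_form_bound[OF t])
        fix x assume "x \<in> C.singular_vectors" "t \<le> (norm (T x))\<^sup>2"
        from van[OF this] False show "cip f x = 0" by simp
      qed
      then have "sqn (D 1) \<le> t" using le nf by simp
      then show ?thesis by (simp add: mult_right_mono)
    qed simp
  next
    fix G assume "finite G" "G \<subseteq> C.singular_vectors"
    then show "(\<Sum>x\<in>G. (norm (T x))\<^sup>2 powr q) \<le> schatten_sum" by (rule singular_vectors_sum)
  qed (use q sqn_nonneg[OF D1] in simp_all)
  then have "sqn (D 1) powr q \<le> 2 powr q * schatten_sum" by simp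
  then have "real CARD('d) ^ 2 * real CARD('d) powr q * sqn (D 1) powr q
      \<le> real CARD('d) ^ 2 * real CARD('d) powr q * (2 powr q * schatten_sum)"
    by (intro mult_left_mono) auto
  with bt_1_le show ?thesis unfolding first_const_def mult.assoc by linarith
qed

lemma first_term_zero:
  assumes "b 1 = 0\<^sub>m CARD('d) CARD('d)"
  shows "bt 1 = 0"
proof -
  have "b 0 = 0\<^sub>m 1 1" using b by (simp add: martingales_def)
  then have "D 1 = 0\<^sub>m CARD('d) CARD('d)"
    unfolding mdiff_def diff_self_eq_0 assms using tensor_one_zero[of "CARD('d)" 1] by simp
  then show ?thesis using Lp_norm_zero[OF p, of "CARD('d)"] by (simp add: besov_term_def del: One_nat_def)
qed

end

section \<open>The algebra and the Besov space\<close>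

lemma tensor_one_mult_index:
  assumes x: "x \<in> carrier_mat N N" and y: "y \<in> carrier_mat (N * r) (N * r)"
    and i: "i < N" "a < r" "c < N * r"
  shows "(tensor_one r x * y) $$ (i * r + a, c) = (\<Sum>l<N. x $$ (i, l) * y $$ (l * r + a, c))"
proof -
  have "(tensor_one r x * y) $$ (i * r + a, c) = (\<Sum>l<N * r. tensor_one r x $$ (i * r + a, l) * y $$ (l, c))"
    by (rule mat_mult_index[OF tensor_one_carrier[OF x] y]) (use i less_prod_index in auto)
  also have "\<dots> = (\<Sum>l<N. \<Sum>s<r. (if a = s then x $$ (i, l) else 0) * y $$ (l * r + s, c))"
    unfolding sum_nat_prod by (intro sum.cong refl) (use i x in \<open>auto simp: tensor_one_index[where N = N]\<close>)
  also have "\<dots> = (\<Sum>l<N. x $$ (i, l) * y $$ (l * r + a, c))"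
    using i by (simp add: if_distrib[of "\<lambda>c. c * _"] sum.delta cong: if_cong)
  finally show ?thesis .
qed

lemma tensor_one_mult:
  assumes x: "x \<in> carrier_mat N N" and y: "y \<in> carrier_mat N N" and r: "r > 0"
  shows "tensor_one r (x * y) = tensor_one r x * tensor_one r y"
proof (rule eq_mat_prodI[OF _ _ r])
  note xy = mult_carrier_mat[OF x y]
  show "tensor_one r (x * y) \<in> carrier_mat (N * r) (N * r)" by (rule tensor_one_carrier[OF xy])
  show "tensor_one r x * tensor_one r y \<in> carrier_mat (N * r) (N * r)"
    by (rule mult_carrier_mat[OF tensor_one_carrier[OF x] tensor_one_carrier[OF y]])
  fix i j a c assume ij: "i < N" "j < N" "a < r" "c < r"
  have "(tensor_one r x * tensor_one r y) $$ (i * r + a, j * r + c)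
      = (\<Sum>l<N. x $$ (i, l) * tensor_one r y $$ (l * r + a, j * r + c))"
    by (rule tensor_one_mult_index[OF x tensor_one_carrier[OF y]]) (use ij less_prod_index in auto)
  also have "\<dots> = (\<Sum>l<N. x $$ (i, l) * (if a = c then y $$ (l, j) else 0))"
    by (intro sum.cong refl) (use ij in \<open>simp add: tensor_one_index[OF y]\<close>)
  also have "\<dots> = (if a = c then (x * y) $$ (i, j) else 0)"
    unfolding mat_mult_index[OF x y ij(1,2)] by simp
  also have "\<dots> = tensor_one r (x * y) $$ (i * r + a, j * r + c)"
    using ij by (simp add: tensor_one_index[OF xy])
  finally show "tensor_one r (x * y) $$ (i * r + a, j * r + c)
      = (tensor_one r x * tensor_one r y) $$ (i * r + a, j * r + c)" by simp
qed

lemma sqn_tensor_one_mult_le: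
  assumes x: "x \<in> carrier_mat N N" and y: "y \<in> carrier_mat (N * r) (N * r)"
  shows "sqn (tensor_one r x * y) \<le> (\<Sum>i<N. \<Sum>l<N. (cmod (x $$ (i, l)))\<^sup>2) * sqn y"
proof -
  define X where "X i = (\<Sum>l<N. (cmod (x $$ (i, l)))\<^sup>2)" for i
  define Y where "Y a = (\<Sum>l<N. \<Sum>c<N * r. (cmod (y $$ (l * r + a, c)))\<^sup>2)" for a
  have xy: "tensor_one r x * y \<in> carrier_mat (N * r) (N * r)"
    by (rule mult_carrier_mat[OF tensor_one_carrier[OF x] y])
  have cs: "(cmod ((tensor_one r x * y) $$ (i * r + a, c)))\<^sup>2 \<le> X i * (\<Sum>l<N. (cmod (y $$ (l * r + a, c)))\<^sup>2)"
    if "i < N" "a < r" "c < N * r" for i a c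
  proof -
    have "cmod ((tensor_one r x * y) $$ (i * r + a, c)) \<le> (\<Sum>l<N. cmod (x $$ (i, l)) * cmod (y $$ (l * r + a, c)))"
      unfolding tensor_one_mult_index[OF x y that] norm_mult[symmetric] by (rule norm_sum)
    then have "(cmod ((tensor_one r x * y) $$ (i * r + a, c)))\<^sup>2 \<le> (\<Sum>l<N. cmod (x $$ (i, l)) * cmod (y $$ (l * r + a, c)))\<^sup>2"
      by (intro power_mono) auto
    also have "\<dots> \<le> X i * (\<Sum>l<N. (cmod (y $$ (l * r + a, c)))\<^sup>2)"
      unfolding X_def by (rule Cauchy_Schwarz_ineq_sum)
    finally show ?thesis .
  qed
  have "(\<Sum>i<N * r. \<Sum>c<N * r. (cmod ((tensor_one r x * y) $$ (i, c)))\<^sup>2)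
      = (\<Sum>i<N. \<Sum>a<r. \<Sum>c<N * r. (cmod ((tensor_one r x * y) $$ (i * r + a, c)))\<^sup>2)"
    by (rule sum_nat_prod)
  also have "\<dots> \<le> (\<Sum>i<N. \<Sum>a<r. \<Sum>c<N * r. X i * (\<Sum>l<N. (cmod (y $$ (l * r + a, c)))\<^sup>2))"
    by (intro sum_mono cs) auto
  also have "\<dots> = (\<Sum>i<N. X i * (\<Sum>a<r. Y a))"
    unfolding Y_def sum_distrib_left[symmetric] by (intro sum.cong refl arg_cong2[where f = "(*)"] sum.swap)
  also have "\<dots> = (\<Sum>i<N. X i) * (\<Sum>a<r. Y a)" by (rule sum_distrib_right[symmetric])
  also have "(\<Sum>a<r. Y a) = (\<Sum>l<N. \<Sum>a<r. \<Sum>c<N * r. (cmod (y $$ (l * r + a, c)))\<^sup>2)"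
    unfolding Y_def by (rule sum.swap)
  also have "\<dots> = (\<Sum>l<N * r. \<Sum>c<N * r. (cmod (y $$ (l, c)))\<^sup>2)" by (rule sum_nat_prod[symmetric])
  finally show ?thesis
    unfolding sqn_sum[OF xy] sqn_sum[OF y] X_def times_divide_eq_right by (rule divide_right_mono) simp
qed

text \<open>
  A compatible bounded sequence given from level n on is completed downwards by conditional
  expectations.
\<close>

lemma l2M_of_tail:
  fixes y :: "nat \<Rightarrow> complex mat"
  assumes n: "n \<ge> 1" and c: "\<And>k. k \<ge> n \<Longrightarrow> y k \<in> carrier_mat (CARD('d) ^ k) (CARD('d) ^ k)"
    and tr: "\<And>k. k \<ge> n \<Longrightarrow> partial_trace CARD('d) (y (Suc k)) = y k"
    and bd: "\<And>k. k \<ge> n \<Longrightarrow> sqn (y k) \<le> B"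
  shows "\<exists>g :: 'd::finite l2M. \<forall>k\<ge>n. Rep_l2M g k = y k"
proof -
  let ?d = "CARD('d)"
  define e where "e = embed_seq ?d n (y n)"
  have em: "e \<in> martingales ?d" unfolding e_def by (rule embed_seq_martingale[OF c]) auto
  have en: "e n = y n" using embed_seq_ge[of n n "y n" ?d] c n tensor_one_1[of "y n" "?d ^ n"] by (simp add: e_def)
  define G where "G k = (if k \<le> n then e k else y k)" for k
  have Gm: "G \<in> martingales ?d"
    unfolding martingales_def mem_Collect_eq
  proof (intro conjI allI impI)
    show "G 0 = 0\<^sub>m 1 1" using em by (simp add: G_def martingales_def)
    fix k :: nat assume k: "k \<ge> 1"
    show "G k \<in> carrier_mat (?d ^ k) (?d ^ k)" using martingales_carrier[OF em, of k] c[of k] by (simp add: G_def)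
    show "partial_trace ?d (G (Suc k)) = G k"
    proof (cases "k < n")
      case True
      then show ?thesis using em k by (simp add: G_def martingales_def)
    next
      case False
      then show ?thesis using tr[of k] en by (cases "k = n") (simp_all add: G_def)
    qed
  qed
  have "sqn (G k) \<le> B" if "k \<ge> 1" for k
  proof (cases "k \<le> n")
    case True
    then have "sqn (e k) \<le> sqn (e n)" by (intro martingale_sqn_mono[OF em]) (use that in auto)
    then show ?thesis using bd[of n] en True by (simp add: G_def)
  next
    case False
    then show ?thesis using bd[of k] by (simp add: G_def)
  qed
  then have "L2_Cauchy ?d G" by (subst L2_Cauchy_iff_bounded[OF Gm]) auto
  then have "Rep_l2M (Abs_l2M G :: 'd l2M) = G" using Gm by (intro Abs_l2M_inverse) simp
  moreover have "G k = y k" if "k \<ge> n" for k using that en by (simp add: G_def)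
  ultimately show ?thesis by (intro exI[of _ "Abs_l2M G"]) simp
qed

text \<open>
  Left multiplication by a matrix is a bounded operator on L_2, with a bound not depending on the
  level on which it is carried out, and it maps 1 to that matrix.
\<close>

lemma left_mult_exists:
  assumes n: "n \<ge> 1" and x: "x \<in> carrier_mat (CARD('d) ^ n) (CARD('d) ^ n)"
  shows "\<exists>T\<in>left_mults. T (l2_embed 1 (1\<^sub>m CARD('d))) = (l2_embed n x :: 'd::finite l2M)"
proof -
  let ?d = "CARD('d)"
  define C where "C = (\<Sum>i<?d ^ n. \<Sum>l<?d ^ n. (cmod (x $$ (i, l)))\<^sup>2)"
  have C0: "C \<ge> 0" unfolding C_def by (intro sum_nonneg) auto
  define X where "X k = tensor_one (?d ^ (k - n)) x" for k
  have dk: "?d ^ k = ?d ^ n * ?d ^ (k - n)" if "k \<ge> n" for k using that by (simp flip: power_add)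
  have Xc: "X k \<in> carrier_mat (?d ^ k) (?d ^ k)" if "k \<ge> n" for k
    unfolding X_def dk[OF that] by (rule tensor_one_carrier[OF x])
  have XX: "tensor_one (?d ^ (m - k)) (X k) = X m" if "k \<ge> n" "m \<ge> k" for k m
  proof -
    have "?d ^ (k - n) * ?d ^ (m - k) = ?d ^ (m - n)" using that by (simp flip: power_add)
    then show ?thesis unfolding X_def by (simp add: tensor_one_tensor_one[OF x])
  qed
  have bd: "sqn (X k * y) \<le> C * sqn y" if "k \<ge> n" "y \<in> carrier_mat (?d ^ k) (?d ^ k)" for k y
    unfolding X_def C_def by (rule sqn_tensor_one_mult_le[OF x]) (use that dk[of k] in simp)
  have "\<exists>g :: 'd l2M. \<forall>k\<ge>n. Rep_l2M g k = X k * Rep_l2M f k" for f :: "'d l2M"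
  proof (rule l2M_of_tail[OF n])
    fix k assume k: "k \<ge> n"
    show "X k * Rep_l2M f k \<in> carrier_mat (?d ^ k) (?d ^ k)" by (rule mult_carrier_mat[OF Xc[OF k] Rep_l2M_carrier])
    have "sqn (Rep_l2M f k) \<le> (norm f)\<^sup>2" using sqn_le_inner[of k f] k n by (simp add: power2_norm_eq_inner)
    then have "C * sqn (Rep_l2M f k) \<le> C * (norm f)\<^sup>2" by (rule mult_left_mono[OF _ C0])
    with bd[OF k Rep_l2M_carrier] show "sqn (X k * Rep_l2M f k) \<le> C * (norm f)\<^sup>2" by (rule order_trans)
    have S: "Rep_l2M f (Suc k) \<in> carrier_mat (?d ^ k * ?d) (?d ^ k * ?d)"
      using Rep_l2M_carrier[of f "Suc k"] by (simp add: mult.commute)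
    have "X (Suc k) = tensor_one ?d (X k)" using XX[OF k, of "Suc k"] by simp
    moreover have "tensor_one ?d (1\<^sub>m (?d ^ k)) = 1\<^sub>m (?d ^ k * ?d)" by (rule tensor_one_one)
    moreover have "tensor_one ?d (X k) * Rep_l2M f (Suc k) \<in> carrier_mat (?d ^ k * ?d) (?d ^ k * ?d)"
      by (rule mult_carrier_mat[OF tensor_one_carrier[OF Xc[OF k]] S])
    moreover have "partial_trace ?d (Rep_l2M f (Suc k)) = Rep_l2M f k"
      using Rep_l2M_martingale[of f] k n by (simp add: martingales_def)
    moreover have "X k * Rep_l2M f k * 1\<^sub>m (?d ^ k) = X k * Rep_l2M f k"
      by (rule right_mult_one_mat[OF mult_carrier_mat[OF Xc[OF k] Rep_l2M_carrier]])
    ultimately show "partial_trace ?d (X (Suc k) * Rep_l2M f (Suc k)) = X k * Rep_l2M f k"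
      using partial_trace_bimodule[OF S Xc[OF k] one_carrier_mat[of "?d ^ k"]]
        right_mult_one_mat[of "tensor_one ?d (X k) * Rep_l2M f (Suc k)" "?d ^ k * ?d"] by simp
  qed
  then obtain T :: "'d l2M \<Rightarrow> 'd l2M" where T: "\<And>f k. k \<ge> n \<Longrightarrow> Rep_l2M (T f) k = X k * Rep_l2M f k" by metis
  have lin: "T (f + g) = T f + T g" "T (scaleC c f) = scaleC c (T f)" for f g c
  proof -
    show "T (f + g) = T f + T g"
    proof (rule l2M_eq_tail[of n])
      fix k assume k: "k \<ge> n"
      show "Rep_l2M (T (f + g)) k = Rep_l2M (T f + T g) k"
        unfolding Rep_l2M_add T[OF k] by (rule mult_add_distrib_mat[OF Xc[OF k] Rep_l2M_carrier Rep_l2M_carrier])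
    qed
    show "T (scaleC c f) = scaleC c (T f)"
    proof (rule l2M_eq_tail[of n])
      fix k assume k: "k \<ge> n"
      show "Rep_l2M (T (scaleC c f)) k = Rep_l2M (scaleC c (T f)) k"
        unfolding scaleC.rep_eq T[OF k] by (rule mult_smult_distrib[OF Xc[OF k] Rep_l2M_carrier])
    qed
  qed
  have "norm (T f) \<le> norm f * sqrt C" for f
  proof -
    have "inner (T f) (T f) \<le> C * inner f f"
    proof (rule LIMSEQ_le[OF inner_l2M_LIMSEQ tendsto_mult_left[OF inner_l2M_LIMSEQ]])
      show "\<exists>N. \<forall>k\<ge>N. sqn (Rep_l2M (T f) k) \<le> C * sqn (Rep_l2M f k)"
        using bd[OF _ Rep_l2M_carrier] T by (intro exI[of _ n]) simp
    qed
    then have "sqrt (inner (T f) (T f)) \<le> sqrt (C * inner f f)" by (rule real_sqrt_le_mono)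
    then show ?thesis by (simp add: norm_eq_sqrt_inner real_sqrt_mult mult.commute)
  qed
  then have "bounded_linear T"
    by (intro bounded_linear_intro[of _ "sqrt C"]) (simp_all add: lin scaleR_l2M_def)
  then have Tb: "T \<in> bounded_ops" by (simp add: bounded_ops_def lin)
  have Temb: "T (l2_embed m y) = l2_embed m (X m * y)" if m: "m \<ge> n" and y: "y \<in> carrier_mat (?d ^ m) (?d ^ m)" for m y
  proof (rule l2M_eq_tail[of m])
    fix k assume k: "k \<ge> m" "k \<ge> 1"
    have "Rep_l2M (T (l2_embed m y)) k = X k * tensor_one (?d ^ (k - m)) y"
      using T[of k "l2_embed m y"] Rep_l2_embed_ge[OF y k(2,1)] k m by simp
    also have "\<dots> = tensor_one (?d ^ (k - m)) (X m) * tensor_one (?d ^ (k - m)) y" using XX[OF m k(1)] by simp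
    also have "\<dots> = tensor_one (?d ^ (k - m)) (X m * y)" by (rule tensor_one_mult[OF Xc[OF m] y, symmetric]) simp
    also have "\<dots> = Rep_l2M (l2_embed m (X m * y) :: 'd l2M) k"
      by (rule Rep_l2_embed_ge[OF mult_carrier_mat[OF Xc[OF m] y] k(2,1), symmetric])
    finally show "Rep_l2M (T (l2_embed m y)) k = Rep_l2M (l2_embed m (X m * y) :: 'd l2M) k" .
  qed
  have "T \<in> left_mults"
    unfolding left_mults_def mem_Collect_eq using Tb Temb x unfolding X_def by blast
  moreover have "T (l2_embed 1 (1\<^sub>m ?d)) = l2_embed n x"
  proof -
    have e: "?d ^ n = ?d * ?d ^ (n - 1)" using n by (cases n) auto
    have "(l2_embed 1 (1\<^sub>m ?d) :: 'd l2M) = l2_embed n (1\<^sub>m (?d ^ n))"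
      using l2_embed_tensor_one[of "1\<^sub>m ?d" 1 n, where 'd = 'd] n tensor_one_one[of "?d ^ (n - 1)" ?d] e by simp
    moreover have "X n * 1\<^sub>m (?d ^ n) = x" using tensor_one_1[OF x] right_mult_one_mat[OF x] by (simp add: X_def)
    ultimately show ?thesis using Temb[of n "1\<^sub>m (?d ^ n)"] by simp
  qed
  ultimately show ?thesis by blast
qed

lemma left_mults_subset: "(left_mults :: ('d::finite l2M \<Rightarrow> 'd l2M) set) \<subseteq> vN_tensor"
proof
  fix T :: "'d l2M \<Rightarrow> 'd l2M" assume T: "T \<in> left_mults"
  then have "T \<in> bounded_ops" by (simp add: left_mults_def)
  moreover have "T \<circ> A = A \<circ> T" if "A \<in> commutant left_mults" for A
  proof -
    have "A \<circ> T = T \<circ> A" using that T unfolding commutant_def by simp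
    then show ?thesis by (rule sym)
  qed
  ultimately show "T \<in> vN_tensor" unfolding vN_tensor_def commutant_def[of "commutant left_mults"] by simp
qed

lemma embed_seq_vN:
  assumes "n \<ge> 1" "x \<in> carrier_mat (CARD('d) ^ n) (CARD('d) ^ n)"
  shows "embed_seq CARD('d) n x \<in> vN_martingales TYPE('d::finite)"
proof -
  obtain T where T: "T \<in> left_mults" "T (l2_embed 1 (1\<^sub>m CARD('d))) = (l2_embed n x :: 'd l2M)"
    using left_mult_exists[OF assms] by blast
  have "embed_seq CARD('d) n x = Rep_l2M (T (l2_embed 1 (1\<^sub>m CARD('d))))"
    using Rep_l2_embed[OF assms(2)] T(2) by simp
  moreover have "T \<in> vN_tensor" using T(1) left_mults_subset by (rule subsetD[rotated])
  ultimately show ?thesis unfolding vN_martingales_def mem_Collect_eq by (intro exI[of _ T] conjI)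
qed

lemma vN_martingales_martingale: "x \<in> vN_martingales TYPE('d::finite) \<Longrightarrow> x \<in> martingales CARD('d)"
  unfolding vN_martingales_def mem_Collect_eq by (elim exE conjE) (simp only: Rep_l2M_martingale)

lemma mdiff_truncation:
  assumes b: "b \<in> martingales d" and d: "d > 0" and n: "n \<ge> 1" and k: "k \<ge> 1"
  shows "mdiff d (embed_seq d n (b n)) k = (if k \<le> n then mdiff d b k else 0\<^sub>m (d ^ k) (d ^ k))"
proof -
  note bn = martingales_carrier[OF b, of n]
  have low: "embed_seq d n (b n) i = b i" if "i \<le> n" for i
    using that martingale_steps'[OF b d, of i n] b by (cases "i = 0") (auto simp: embed_seq_def martingales_def)
  show ?thesis
  proof (cases "k \<le> n")
    case True
    then show ?thesis using low[of k] low[of "k - 1"] by (simp add: mdiff_def)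
  next
    case False
    have e: "d ^ (k - n) = d ^ (k - 1 - n) * d" using False by (metis Suc_diff_Suc diff_Suc_eq_diff_pred mult.commute not_le power_Suc)
    have "embed_seq d n (b n) k = tensor_one (d ^ (k - n)) (b n)" by (rule embed_seq_ge) (use False k bn in auto)
    moreover have "embed_seq d n (b n) (k - 1) = tensor_one (d ^ (k - 1 - n)) (b n)" by (rule embed_seq_ge) (use False n bn in auto)
    moreover have "tensor_one d (tensor_one (d ^ (k - 1 - n)) (b n)) = tensor_one (d ^ (k - n)) (b n)"
      unfolding e by (rule tensor_one_tensor_one[OF bn d]) (use d in simp)
    moreover have "tensor_one (d ^ (k - n)) (b n) \<in> carrier_mat (d ^ k) (d ^ k)"
      using tensor_one_carrier[OF bn, of "d ^ (k - n)"] False by (simp flip: power_add)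
    ultimately show ?thesis using False by (simp add: mdiff_def)
  qed
qed

lemma mdiff_diff:
  assumes x: "x \<in> martingales d" and y: "y \<in> martingales d" and k: "k \<ge> 1"
  shows "mdiff d (\<lambda>n. x n - y n) k = mdiff d x k - mdiff d y k"
proof -
  note c = martingales_carrier[OF x] martingales_carrier[OF y]
  have e: "d ^ k = d ^ (k - 1) * d" using k by (cases k) auto
  have t: "tensor_one d (x (k - 1)) \<in> carrier_mat (d ^ k) (d ^ k)" "tensor_one d (y (k - 1)) \<in> carrier_mat (d ^ k) (d ^ k)"
    unfolding e by (rule tensor_one_carrier[OF c(1)], rule tensor_one_carrier[OF c(2)])
  have "tensor_one d (x (k - 1) - y (k - 1)) = tensor_one d (x (k - 1)) - tensor_one d (y (k - 1))"
    using c[of "k - 1"] by (intro eq_matI) (auto simp: tensor_one_def div_prod_index)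
  then show ?thesis unfolding mdiff_def using t c[of k] by (intro eq_matI) auto
qed

lemma Lp_norm_uminus:
  assumes x: "x \<in> carrier_mat N N"
  shows "Lp_norm p (- x) = Lp_norm p x"
proof -
  have mx: "- x \<in> carrier_mat N N" using x by simp
  note a = mult_carrier_mat[OF mat_adjoint_carrier[OF mx] mx] mult_carrier_mat[OF mat_adjoint_carrier[OF x] x]
  have "mat_adjoint (- x) * (- x) = mat_adjoint x * x"
  proof (rule eq_matI)
    fix i j assume "i < dim_row (mat_adjoint x * x)" "j < dim_col (mat_adjoint x * x)"
    then have ij: "i < N" "j < N" using carrier_matD[OF a(2)] by simp_all
    show "(mat_adjoint (- x) * (- x)) $$ (i, j) = (mat_adjoint x * x) $$ (i, j)"
      unfolding mat_mult_index[OF mat_adjoint_carrier[OF mx] mx ij] mat_mult_index[OF mat_adjoint_carrier[OF x] x ij]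
    proof (rule sum.cong[OF refl])
      fix l assume "l \<in> {..<N}"
      then have l: "l < N" by simp
      have "(- x) $$ (l, i) = - x $$ (l, i)" "(- x) $$ (l, j) = - x $$ (l, j)" using x l ij by auto
      then show "mat_adjoint (- x) $$ (i, l) * (- x) $$ (l, j) = mat_adjoint x $$ (i, l) * x $$ (l, j)"
        unfolding mat_adjoint_index[OF mx ij(1) l] mat_adjoint_index[OF x ij(1) l] by simp
    qed
  qed (use carrier_matD[OF a(1)] carrier_matD[OF a(2)] in simp_all)
  then show ?thesis by (simp add: Lp_norm_def)
qed

lemma Lp_powr_diff:
  assumes x: "x \<in> carrier_mat N N" and y: "y \<in> carrier_mat N N" and p: "p > 0"
  shows "Lp_norm p (x - y) powr p \<le> 8 powr (p / 2) * (Lp_norm p x powr p + Lp_norm p y powr p)"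
proof -
  have "x - y = x + - y" using x y by (intro eq_matI) auto
  then show ?thesis using Lp_powr_add[OF x _ p, of "- y"] Lp_norm_uminus[OF y, of p] y by simp
qed

lemma besov_term_nonneg: "besov_term d p b k \<ge> 0"
  by (simp add: besov_term_def)

lemma besov_term_le:
  assumes "Lp_norm p (mdiff d x k) powr p \<le> A * (Lp_norm p (mdiff d y k) powr p + c)"
  shows "besov_term d p x k \<le> A * (besov_term d p y k + real d ^ (2 * k) * c)"
  using mult_left_mono[OF assms, of "real d ^ (2 * k)"] by (simp add: besov_term_def algebra_simps)

lemma besov_term_diff_le:
  assumes x: "x \<in> martingales d" and y: "y \<in> martingales d" and k: "k \<ge> 1" and p: "p > 0"
  shows "besov_term d p (\<lambda>n. x n - y n) k \<le> 8 powr (p / 2) * (besov_term d p x k + besov_term d p y k)"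
proof -
  have "Lp_norm p (mdiff d (\<lambda>n. x n - y n) k) powr p
      \<le> 8 powr (p / 2) * (Lp_norm p (mdiff d x k) powr p + Lp_norm p (mdiff d y k) powr p)"
    unfolding mdiff_diff[OF x y k] by (rule Lp_powr_diff[OF mdiff_carrier[OF x k] mdiff_carrier[OF y k] p])
  from besov_term_le[OF this] show ?thesis by (simp add: besov_term_def)
qed

text \<open>
  The truncations at the levels j + 1 approximate b: two of them differ by a part of the tail of
  b, and every single difference is eventually stationary.
\<close>

lemma summable_imp_besov_space:
  assumes b: "b \<in> martingales CARD('d::finite)" and p: "p > 0"
    and sm: "summable (\<lambda>k. besov_term CARD('d) p b (Suc k))"
  shows "b \<in> besov_space TYPE('d) p"
proof -
  let ?d = "CARD('d)"
  define X where "X j = embed_seq ?d (Suc j) (b (Suc j))" for j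
  note bc = martingales_carrier[OF b]
  have X: "X j \<in> vN_martingales TYPE('d)" for j
    unfolding X_def by (rule embed_seq_vN[OF _ bc]) simp
  note Xm = vN_martingales_martingale[OF X]
  have mX: "mdiff ?d (X j) k = (if k \<le> Suc j then mdiff ?d b k else 0\<^sub>m (?d ^ k) (?d ^ k))" if "k \<ge> 1" for j k
    unfolding X_def by (rule mdiff_truncation[OF b]) (use that in auto)
  have zero: "Lp_norm p (0\<^sub>m N N) powr p = 0" for N by (rule Lp_norm_zero[OF p])
  have dz: "mdiff ?d b k - mdiff ?d b k = 0\<^sub>m (?d ^ k) (?d ^ k)" if "k \<ge> 1" for k
    using mdiff_carrier[OF b that] by (rule minus_r_inv_mat)
  have smX: "summable (\<lambda>k. besov_term ?d p (X j) (Suc k))" for j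
  proof (rule summable_finite[of "{..j}"])
    fix k assume "k \<notin> {..j}"
    then show "besov_term ?d p (X j) (Suc k) = 0" unfolding besov_term_def by (subst mX) (auto simp: zero)
  qed simp
  have le: "besov_term ?d p (\<lambda>n. X i n - X j n) (Suc k) \<le> (if k < N then 0 else besov_term ?d p b (Suc k))"
    if ij: "i \<ge> N" "j \<ge> N" for i j N k
  proof -
    have D: "mdiff ?d b (Suc k) \<in> carrier_mat (?d ^ Suc k) (?d ^ Suc k)" by (rule mdiff_carrier[OF b]) simp
    have "mdiff ?d (\<lambda>n. X i n - X j n) (Suc k) = mdiff ?d (X i) (Suc k) - mdiff ?d (X j) (Suc k)"
      by (rule mdiff_diff[OF Xm Xm]) simp
    then have m: "mdiff ?d (\<lambda>n. X i n - X j n) (Suc k) =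
        (if k \<le> i then mdiff ?d b (Suc k) else 0\<^sub>m (?d ^ Suc k) (?d ^ Suc k))
        - (if k \<le> j then mdiff ?d b (Suc k) else 0\<^sub>m (?d ^ Suc k) (?d ^ Suc k))"
      using mX[of "Suc k" i] mX[of "Suc k" j] by (simp only: Suc_le_mono le_add1 plus_1_eq_Suc)
    consider "k \<le> i" "k \<le> j" | "k \<le> i" "\<not> k \<le> j" | "\<not> k \<le> i" "k \<le> j" | "\<not> k \<le> i" "\<not> k \<le> j" by blast
    then show ?thesis
    proof cases
      case 1
      then have "mdiff ?d (\<lambda>n. X i n - X j n) (Suc k) = 0\<^sub>m (?d ^ Suc k) (?d ^ Suc k)"
        unfolding m using dz[of "Suc k"] by (simp only: if_True le_add1 plus_1_eq_Suc)
      then have "besov_term ?d p (\<lambda>n. X i n - X j n) (Suc k) = 0" unfolding besov_term_def by (simp only: zero mult_zero_right)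
      then show ?thesis by (simp add: besov_term_nonneg)
    next
      case 2
      have "mdiff ?d b (Suc k) - 0\<^sub>m (?d ^ Suc k) (?d ^ Suc k) = mdiff ?d b (Suc k)" using D by (intro eq_matI) auto
      then have "mdiff ?d (\<lambda>n. X i n - X j n) (Suc k) = mdiff ?d b (Suc k)" unfolding m using 2 by (simp only: if_True if_False)
      then show ?thesis using 2 ij by (simp add: besov_term_def)
    next
      case 3
      have "0\<^sub>m (?d ^ Suc k) (?d ^ Suc k) - mdiff ?d b (Suc k) = - mdiff ?d b (Suc k)" using D by (intro eq_matI) auto
      then have "mdiff ?d (\<lambda>n. X i n - X j n) (Suc k) = - mdiff ?d b (Suc k)" unfolding m using 3 by (simp only: if_True if_False)
      then show ?thesis using 3 ij Lp_norm_uminus[OF D, of p] by (simp add: besov_term_def)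
    next
      case 4
      have "0\<^sub>m (?d ^ Suc k) (?d ^ Suc k) - 0\<^sub>m (?d ^ Suc k) (?d ^ Suc k) = (0\<^sub>m (?d ^ Suc k) (?d ^ Suc k) :: complex mat)"
        by (rule minus_r_inv_mat) simp
      then have "mdiff ?d (\<lambda>n. X i n - X j n) (Suc k) = 0\<^sub>m (?d ^ Suc k) (?d ^ Suc k)"
        unfolding m using 4 by (simp only: if_False)
      then have "besov_term ?d p (\<lambda>n. X i n - X j n) (Suc k) = 0" unfolding besov_term_def by (simp only: zero mult_zero_right)
      then show ?thesis by (simp add: besov_term_nonneg)
    qed
  qed
  have cauchy: "\<exists>N. \<forall>i\<ge>N. \<forall>j\<ge>N. besov_norm ?d p (\<lambda>n. X i n - X j n) < e" if e: "e > 0" for e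
  proof -
    obtain N where N: "\<And>n. n \<ge> N \<Longrightarrow> norm (\<Sum>k. besov_term ?d p b (Suc (k + n))) < e powr p"
      using suminf_exist_split[OF _ sm, of "e powr p"] e by auto
    have "besov_norm ?d p (\<lambda>n. X i n - X j n) < e" if ij: "i \<ge> N" "j \<ge> N" for i j
    proof -
      let ?h = "\<lambda>k. besov_term ?d p (\<lambda>n. X i n - X j n) (Suc k)"
      let ?t = "\<lambda>k. besov_term ?d p b (Suc (k + N))"
      have st: "summable ?t" using summable_ignore_initial_segment[OF sm, of N] by simp
      have sh: "summable (\<lambda>k. ?h (k + N))"
      proof (rule summable_comparison_test'[OF st])
        fix k show "norm (?h (k + N)) \<le> ?t k" using le[OF ij, of "k + N"] besov_term_nonneg by (simp add: abs_of_nonneg)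
      qed
      have s0: "summable ?h" by (rule iffD1[OF summable_iff_shift[of ?h N] sh])
      have "?h k = 0" if "k < N" for k using le[OF ij, of k] that besov_term_nonneg by (intro antisym) simp_all
      then have "(\<Sum>k. ?h k) = (\<Sum>k. ?h (k + N))"
        using suminf_split_initial_segment[OF s0, of N] by simp
      also have "\<dots> \<le> (\<Sum>k. ?t k)"
      proof (rule suminf_le[OF _ sh st])
        fix k show "?h (k + N) \<le> ?t k" using le[OF ij, of "k + N"] by simp
      qed
      also have "\<dots> < e powr p" using N[of N] by simp
      finally have "(\<Sum>k. ?h k) < e powr p" .
      moreover have "(\<Sum>k. ?h k) \<ge> 0"
        by (rule suminf_nonneg[OF s0 besov_term_nonneg])
      ultimately have "(\<Sum>k. ?h k) powr (1 / p) < (e powr p) powr (1 / p)"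
        using p by (intro powr_less_mono2) auto
      then show ?thesis unfolding besov_norm_def using p e by (simp add: powr_powr)
    qed
    then show ?thesis by blast
  qed
  have lim: "(\<lambda>j. Lp_norm p (mdiff ?d (X j) k - mdiff ?d b k)) \<longlonglongrightarrow> 0" if k: "k \<ge> 1" for k
  proof (rule tendsto_eventually, rule eventually_sequentiallyI[of k])
    fix j assume "k \<le> j"
    then have "mdiff ?d (X j) k - mdiff ?d b k = 0\<^sub>m (?d ^ k) (?d ^ k)" using mX[OF k, of j] dz[OF k] by simp
    then show "Lp_norm p (mdiff ?d (X j) k - mdiff ?d b k) = 0" using zero[of "?d ^ k"] by simp
  qed
  show ?thesis unfolding besov_space_def mem_Collect_eq
  proof (rule conjI[OF b], rule exI[of _ X], rule conjI[OF _ conjI])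
    show "\<forall>j. X j \<in> vN_martingales TYPE('d) \<and> summable (\<lambda>k. besov_term ?d p (X j) (Suc k))"
      by (rule allI, rule conjI[OF X smX])
    show "\<forall>e>0. \<exists>N. \<forall>i\<ge>N. \<forall>j\<ge>N. besov_norm ?d p (\<lambda>n. X i n - X j n) < e"
      by (rule allI, rule impI, rule cauchy)
    show "\<forall>k\<ge>1. (\<lambda>j. Lp_norm p (mdiff ?d (X j) k - mdiff ?d b k)) \<longlonglongrightarrow> 0"
      by (rule allI, rule impI, rule lim)
  qed
qed

text \<open>
  Fix a member \<open>X N\<close> from which on the sequence has mutual distance below 1. A finite part of the
  Besov sum of b is at most a constant times the sums of \<open>X N\<close>, of \<open>X N - X i\<close> and of an error
  that vanishes as i grows; the resulting bound does not depend on the number of terms.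
\<close>

lemma besov_space_summable:
  assumes p: "p > 0" and bB: "b \<in> besov_space TYPE('d::finite) p"
  shows "summable (\<lambda>k. besov_term CARD('d) p b (Suc k))"
proof -
  let ?d = "CARD('d)"
  define A where "A = (8 :: real) powr (p / 2)"
  have A0: "A \<ge> 0" by (simp add: A_def)
  note bX = bB[unfolded besov_space_def mem_Collect_eq]
  have b: "b \<in> martingales ?d" by (rule conjunct1[OF bX])
  obtain X where X_all: "(\<forall>j. X j \<in> vN_martingales TYPE('d) \<and> summable (\<lambda>k. besov_term ?d p (X j) (Suc k))) \<and>
     (\<forall>e>0. \<exists>N. \<forall>i\<ge>N. \<forall>j\<ge>N. besov_norm ?d p (\<lambda>n. X i n - X j n) < e) \<and>
     (\<forall>k\<ge>1. (\<lambda>j. Lp_norm p (mdiff ?d (X j) k - mdiff ?d b k)) \<longlonglongrightarrow> 0)"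
    using conjunct2[OF bX] ..
  have X: "X j \<in> vN_martingales TYPE('d)" and smX: "summable (\<lambda>k. besov_term ?d p (X j) (Suc k))" for j
    using conjunct1[OF X_all] by simp_all
  have cauchy: "\<exists>N. \<forall>i\<ge>N. \<forall>j\<ge>N. besov_norm ?d p (\<lambda>n. X i n - X j n) < e" if "e > 0" for e
    by (rule mp[OF spec[OF conjunct1[OF conjunct2[OF X_all]]] that])
  have lim: "(\<lambda>j. Lp_norm p (mdiff ?d (X j) k - mdiff ?d b k)) \<longlonglongrightarrow> 0" if "k \<ge> 1" for k
    by (rule mp[OF spec[OF conjunct2[OF conjunct2[OF X_all]]] that])
  note Xm = vN_martingales_martingale[OF X]
  obtain N where N: "\<And>i. i \<ge> N \<Longrightarrow> besov_norm ?d p (\<lambda>n. X N n - X i n) < 1"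
    using cauchy[of 1] by auto
  define S where "S = (\<Sum>k. besov_term ?d p (X N) (Suc k))"
  define err where "err i k = real ?d ^ (2 * k) * Lp_norm p (mdiff ?d (X i) k - mdiff ?d b k) powr p" for i k
  have diff: "(\<Sum>k<K. besov_term ?d p (\<lambda>n. X N n - X i n) (Suc k)) \<le> 1" if i: "i \<ge> N" for i K
  proof -
    let ?h = "\<lambda>k. besov_term ?d p (\<lambda>n. X N n - X i n) (Suc k)"
    have s: "summable ?h"
    proof (rule summable_comparison_test'[OF summable_mult[OF summable_add[OF smX[of N] smX[of i]], of A]])
      fix k
      show "norm (?h k) \<le> A * (besov_term ?d p (X N) (Suc k) + besov_term ?d p (X i) (Suc k))"
        using besov_term_diff_le[OF Xm[of N] Xm[of i] _ p, of "Suc k"] besov_term_nonneg[of ?d p] by (simp add: A_def)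
    qed
    have "(\<Sum>k<K. ?h k) \<le> (\<Sum>k. ?h k)" by (rule sum_le_suminf[OF s]) (auto simp: besov_term_nonneg)
    also have "\<dots> \<le> 1"
    proof (rule ccontr)
      assume "\<not> (\<Sum>k. ?h k) \<le> 1"
      then have "(\<Sum>k. ?h k) powr (1 / p) \<ge> 1" using p by (intro ge_one_powr_ge_zero) auto
      then show False using N[OF i] by (simp add: besov_norm_def)
    qed
    finally show ?thesis .
  qed
  have step: "besov_term ?d p b (Suc k) \<le> A * (err i (Suc k) + A * (besov_term ?d p (X N) (Suc k)
      + besov_term ?d p (\<lambda>n. X N n - X i n) (Suc k)))" for i k
  proof -
    have c: "mdiff ?d (X N) (Suc k) \<in> carrier_mat (?d ^ Suc k) (?d ^ Suc k)"
      "mdiff ?d (X i) (Suc k) \<in> carrier_mat (?d ^ Suc k) (?d ^ Suc k)"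
      "mdiff ?d b (Suc k) \<in> carrier_mat (?d ^ Suc k) (?d ^ Suc k)"
      using mdiff_carrier[OF Xm, of "Suc k"] mdiff_carrier[OF b, of "Suc k"] by auto
    have cd: "x - y \<in> carrier_mat n n" if "x \<in> carrier_mat n n" "y \<in> carrier_mat n n" for x y :: "complex mat" and n
      by (rule minus_carrier_mat[OF that(2)])
    have sub_sub: "x - (x - y) = y" if "x \<in> carrier_mat n n" "y \<in> carrier_mat n n" for x y :: "complex mat" and n
      using that by (intro eq_matI) auto
    have 1: "Lp_norm p (mdiff ?d b (Suc k)) powr p \<le> A * (Lp_norm p (mdiff ?d (X i) (Suc k)) powr p
        + Lp_norm p (mdiff ?d (X i) (Suc k) - mdiff ?d b (Suc k)) powr p)"
      using Lp_powr_diff[OF c(2) cd[OF c(2,3)] p] unfolding sub_sub[OF c(2,3)] A_def .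
    have e: "mdiff ?d (\<lambda>n. X N n - X i n) (Suc k) = mdiff ?d (X N) (Suc k) - mdiff ?d (X i) (Suc k)"
      by (rule mdiff_diff[OF Xm Xm]) simp
    have 2: "Lp_norm p (mdiff ?d (X i) (Suc k)) powr p \<le> A * (Lp_norm p (mdiff ?d (X N) (Suc k)) powr p
        + Lp_norm p (mdiff ?d (\<lambda>n. X N n - X i n) (Suc k)) powr p)"
      using Lp_powr_diff[OF c(1) cd[OF c(1,2)] p] unfolding sub_sub[OF c(1,2)] e A_def .
    have "besov_term ?d p b (Suc k) \<le> A * (besov_term ?d p (X i) (Suc k) + err i (Suc k))"
      unfolding err_def by (rule besov_term_le[OF 1])
    also have "\<dots> \<le> A * (A * (besov_term ?d p (X N) (Suc k) + besov_term ?d p (\<lambda>n. X N n - X i n) (Suc k)) + err i (Suc k))"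
      using besov_term_le[OF 2] by (intro mult_left_mono[OF _ A0] add_right_mono) (simp add: besov_term_def)
    finally show ?thesis by (simp add: add.commute)
  qed
  have bound: "(\<Sum>k<K. besov_term ?d p b (Suc k)) \<le> A * (A * (S + 1))" for K
  proof -
    have "(\<lambda>i. A * ((\<Sum>k<K. err i (Suc k)) + A * (S + 1))) \<longlonglongrightarrow> A * ((\<Sum>k<K. real ?d ^ (2 * Suc k) * 0 powr p) + A * (S + 1))"
      unfolding err_def using p by (intro tendsto_intros lim tendsto_powr') (auto simp: Lp_norm_def)
    moreover have "(\<Sum>k<K. besov_term ?d p b (Suc k)) \<le> A * ((\<Sum>k<K. err i (Suc k)) + A * (S + 1))" if i: "i \<ge> N" for i
    proof -
      have "(\<Sum>k<K. besov_term ?d p b (Suc k)) \<le> (\<Sum>k<K. A * (err i (Suc k) + A * (besov_term ?d p (X N) (Suc k)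
        + besov_term ?d p (\<lambda>n. X N n - X i n) (Suc k))))" by (intro sum_mono step)
      also have "\<dots> = A * ((\<Sum>k<K. err i (Suc k)) + A * ((\<Sum>k<K. besov_term ?d p (X N) (Suc k))
        + (\<Sum>k<K. besov_term ?d p (\<lambda>n. X N n - X i n) (Suc k))))"
        by (simp only: sum_distrib_left[symmetric] sum.distrib)
      also have "\<dots> \<le> A * ((\<Sum>k<K. err i (Suc k)) + A * (S + 1))"
      proof (intro mult_left_mono[OF _ A0] add_left_mono add_mono diff[OF i])
        show "(\<Sum>k<K. besov_term ?d p (X N) (Suc k)) \<le> S"
          unfolding S_def by (rule sum_le_suminf[OF smX]) (auto simp: besov_term_nonneg)
      qed
      finally show ?thesis .
    qed
    ultimately have "(\<Sum>k<K. besov_term ?d p b (Suc k)) \<le> A * ((\<Sum>k<K. real ?d ^ (2 * Suc k) * 0 powr p) + A * (S + 1))"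
      by (intro LIMSEQ_le_const) auto
    then show ?thesis using p by simp
  qed
  show ?thesis by (rule summableI_nonneg_bounded[OF besov_term_nonneg bound])
qed

lemma besov_space_iff_summable:
  assumes "b \<in> martingales CARD('d::finite)" "p > 0"
  shows "b \<in> besov_space TYPE('d) p \<longleftrightarrow> summable (\<lambda>k. besov_term CARD('d) p b (Suc k))"
  using summable_imp_besov_space[OF assms] besov_space_summable[OF assms(2)] by blast

section \<open>The equivalence\<close>

text \<open>
  The summand 1 ensures that the constant is positive also if c is 0.
\<close>

lemma powr_inverse_bound:
  fixes x y c :: real
  assumes "x \<le> c * y" "0 \<le> x" "0 \<le> y" "0 \<le> c" "p > 0"
  shows "x powr (1 / p) \<le> (c powr (1 / p) + 1) * y powr (1 / p)"
proof -
  have "x powr (1 / p) \<le> (c * y) powr (1 / p)" using assms by (intro powr_mono2) auto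
  also have "\<dots> = c powr (1 / p) * y powr (1 / p)" using assms by (simp add: powr_mult)
  finally show ?thesis by (simp add: distrib_right add_increasing2)
qed

text \<open>
  The equivalence for both conventions. For the lower estimate of the norm, the difference of
  level 1 either vanishes or is seen through \<open>f\<^sub>0\<close>. The constants do not depend on b, nor on the
  convention.
\<close>

lemma paraproduct_schatten_besov:
  fixes F :: "'d::finite l2M \<Rightarrow> nat \<Rightarrow> complex mat"
  assumes d: "CARD('d) \<ge> 2" and p: "p > 0" and b: "b \<in> martingales CARD('d)" and F: "start_map F"
  defines "C \<equiv> besov_data.upper_const CARD('d) p powr (1 / p) + 1"
    and "C' \<equiv> (besov_data.first_const CARD('d) p + besov_data.tail_const CARD('d) p) powr (1 / p) + 1"
  shows "paraproduct_in_schatten p F b \<longleftrightarrow> b \<in> besov_space TYPE('d) p"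
    and "b \<in> besov_space TYPE('d) p \<Longrightarrow> schatten_norm p (paraproduct F b) \<le> C * besov_norm CARD('d) p b"
    and "b \<in> besov_space TYPE('d) p \<Longrightarrow>
      b 1 = 0\<^sub>m CARD('d) CARD('d) \<or> F (l2_embed 0 (1\<^sub>m 1)) 0 = 1\<^sub>m 1 \<Longrightarrow>
      besov_norm CARD('d) p b \<le> C' * schatten_norm p (paraproduct F b)"
proof -
  interpret F: start_map F by (rule F)
  interpret paraproduct_setup p b F by unfold_locales (use d p b in auto)
  note iff = besov_space_iff_summable[OF b p]
  have up: "paraproduct_in_schatten p F b" "schatten_norm p T \<le> C * besov_norm CARD('d) p b"
    if "b \<in> besov_space TYPE('d) p"
  proof -
    have s: "summable (\<lambda>k. bt (Suc k))" using that iff by blast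
    interpret S: summable_paraproduct p b F by unfold_locales (rule s)
    show sch: "paraproduct_in_schatten p F b" by (rule S.T_schatten)
    interpret L: schatten_paraproduct p b F by unfold_locales (rule sch)
    show "schatten_norm p T \<le> C * besov_norm CARD('d) p b"
      unfolding schatten_norm_def besov_norm_def C_def
      by (rule powr_inverse_bound[OF S.T_schatten(2)[folded upper_const_def] L.schatten_sum_nonneg
            suminf_nonneg[OF s bt_nonneg] upper_const_nonneg p])
  qed
  have low: "b \<in> besov_space TYPE('d) p" if sch: "paraproduct_in_schatten p F b"
  proof -
    interpret L: schatten_paraproduct p b F by unfold_locales (rule sch)
    show ?thesis using L.besov_sum_bound(1) iff by blast
  qed
  show "paraproduct_in_schatten p F b \<longleftrightarrow> b \<in> besov_space TYPE('d) p" using up(1) low by blast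
  show "b \<in> besov_space TYPE('d) p \<Longrightarrow> schatten_norm p T \<le> C * besov_norm CARD('d) p b" by (rule up(2))
  assume bB: "b \<in> besov_space TYPE('d) p"
    and first: "b 1 = 0\<^sub>m CARD('d) CARD('d) \<or> F (l2_embed 0 (1\<^sub>m 1)) 0 = 1\<^sub>m 1"
  interpret L: schatten_paraproduct p b F by unfold_locales (rule up(1)[OF bB])
  have "bt 1 \<le> first_const * L.schatten_sum"
    using first
  proof
    assume "b 1 = 0\<^sub>m CARD('d) CARD('d)"
    from L.first_term_zero[OF this] show ?thesis
      using mult_nonneg_nonneg[OF first_const_nonneg L.schatten_sum_nonneg] by simp
  qed (rule L.first_term_bound)
  then have "(\<Sum>k. bt (Suc k)) \<le> (first_const + tail_const) * L.schatten_sum"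
    using L.besov_sum_bound(2) by (simp add: distrib_right)
  then show "besov_norm CARD('d) p b \<le> C' * schatten_norm p T"
    unfolding schatten_norm_def besov_norm_def C'_def
    by (rule powr_inverse_bound[OF _ suminf_nonneg[OF L.besov_sum_bound(1) bt_nonneg] L.schatten_sum_nonneg
          add_nonneg_nonneg[OF first_const_nonneg tail_const_nonneg] p])
qed

lemma scalar_start_one: "scalar_start (l2_embed 0 (1\<^sub>m 1) :: 'd::finite l2M) 0 = 1\<^sub>m 1"
proof -
  have "Rep_l2M (l2_embed 0 (1\<^sub>m 1) :: 'd l2M) 1 = tensor_one CARD('d) (1\<^sub>m 1)"
    using Rep_l2_embed_ge[of "1\<^sub>m 1" 0 1, where 'd = 'd] by simp
  then show ?thesis using partial_trace_tensor_one[of "1\<^sub>m 1" 1 "CARD('d)"] by (simp add: scalar_start_def)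
qed

theorem theorem1p4:
  fixes p :: real
  assumes "CARD('d::finite) \<ge> 2" and "p > 0"
  shows "\<exists>C>0. \<exists>C'>0. \<forall>b\<in>martingales CARD('d).
    (paraproduct_in_schatten p (Rep_l2M :: 'd l2M \<Rightarrow> _) b \<longleftrightarrow> b \<in> besov_space TYPE('d) p) \<and>
    (b \<in> besov_space TYPE('d) p \<longrightarrow>
       schatten_norm p (paraproduct (Rep_l2M :: 'd l2M \<Rightarrow> _) b) \<le> C * besov_norm CARD('d) p b \<and>
       (b 1 = 0\<^sub>m CARD('d) CARD('d) \<longrightarrow>
        besov_norm CARD('d) p b \<le> C' * schatten_norm p (paraproduct (Rep_l2M :: 'd l2M \<Rightarrow> _) b))) \<and>
    (paraproduct_in_schatten p (scalar_start :: 'd l2M \<Rightarrow> _) b \<longleftrightarrow> b \<in> besov_space TYPE('d) p) \<and>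
    (b \<in> besov_space TYPE('d) p \<longrightarrow>
       schatten_norm p (paraproduct (scalar_start :: 'd l2M \<Rightarrow> _) b) \<le> C * besov_norm CARD('d) p b \<and>
       besov_norm CARD('d) p b \<le> C' * schatten_norm p (paraproduct (scalar_start :: 'd l2M \<Rightarrow> _) b))"
proof (rule exI, rule conjI[rotated], rule exI, rule conjI[rotated], rule ballI)
  fix b assume b: "b \<in> martingales CARD('d)"
  note R = paraproduct_schatten_besov[OF assms b start_map_Rep]
  note S = paraproduct_schatten_besov[OF assms b start_map_scalar_start]
  show "(paraproduct_in_schatten p (Rep_l2M :: 'd l2M \<Rightarrow> _) b \<longleftrightarrow> b \<in> besov_space TYPE('d) p) \<and>
    (b \<in> besov_space TYPE('d) p \<longrightarrow>
       schatten_norm p (paraproduct (Rep_l2M :: 'd l2M \<Rightarrow> _) b)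
         \<le> (besov_data.upper_const CARD('d) p powr (1 / p) + 1) * besov_norm CARD('d) p b \<and>
       (b 1 = 0\<^sub>m CARD('d) CARD('d) \<longrightarrow>
        besov_norm CARD('d) p b \<le> ((besov_data.first_const CARD('d) p + besov_data.tail_const CARD('d) p) powr (1 / p) + 1)
          * schatten_norm p (paraproduct (Rep_l2M :: 'd l2M \<Rightarrow> _) b))) \<and>
    (paraproduct_in_schatten p (scalar_start :: 'd l2M \<Rightarrow> _) b \<longleftrightarrow> b \<in> besov_space TYPE('d) p) \<and>
    (b \<in> besov_space TYPE('d) p \<longrightarrow>
       schatten_norm p (paraproduct (scalar_start :: 'd l2M \<Rightarrow> _) b)
         \<le> (besov_data.upper_const CARD('d) p powr (1 / p) + 1) * besov_norm CARD('d) p b \<and>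
       besov_norm CARD('d) p b \<le> ((besov_data.first_const CARD('d) p + besov_data.tail_const CARD('d) p) powr (1 / p) + 1)
         * schatten_norm p (paraproduct (scalar_start :: 'd l2M \<Rightarrow> _) b))"
    by (intro conjI impI R(1) S(1) R(2) S(2) R(3)[OF _ disjI1] S(3)[OF _ disjI2[OF scalar_start_one]])
qed (simp_all add: add_nonneg_pos)

end
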